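(* Let $s\in(0,1)$, $N>2s$, $1<p<\frac{N+2s}{N-2s}$. Let $a$ satisfy $a(x)\in(0,1]$ for all $x$, $\inf a>0$, $|\{a\neq1\}|>0$, $a(x)\to1$ as $|x|\to\infty$, and $1-a(x)\le\frac{C}{1+|x|^{\mu(N+2s)}}$ for all $x$, for some $C>0$ and $\mu>p+1+\frac{N}{N+2s}$. Let $r_1>0$, $d_1>0$ be constants such that for every nonnegative $f\in H^{-s}(\mathbb R^N)$, $f\not\equiv0$, with $\|f\|_{H^{-s}}\le d_1$, the functional $I_{a,f}$ is strictly convex on $B(r_1)=\{\|u\|_{H^s}<r_1\}$ and has a unique critical point $u_{locmin}(a,f;\cdot)$ in $B(r_1)$. Then there exists $d_5\in(0,d_1]$ such that if $f\in H^{-s}(\mathbb R^N)$ is nonnegative, $f\not\equiv0$ and $\|f\|_{H^{-s}}\le d_5$, then $J_{a,f}$ has at least two critical points in $$\{v\in\tilde\Sigma_+:\ J_{a,f}(v)<I_{a,f}(u_{locmin}(a,f;\cdot))+I_{1,0}(w^* )\}.$$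
   Context: $\|u\|_{H^s}^2=\int_{\mathbb R^N}|u|^2+\iint_{\mathbb R^{2N}}\frac{|u(x)-u(y)|^2}{|x-y|^{N+2s}}dx\,dy$; $\langle\cdot,\cdot\rangle$ is the $H^{-s}$–$H^s$ duality; $f$ nonnegative means $\langle f,u\rangle\ge0$ for all nonnegative $u$. For $b\in L^\infty$, $g\in H^{-s}$: $I_{b,g}(u)=\frac12\|u\|_{H^s}^2-\frac1{p+1}\int b(x)u_+^{p+1}dx-\langle g,u\rangle$. $\tilde\Sigma_+:=\{u\in H^s:\|u\|_{H^s}=1,\ u_+\not\equiv0\}$, a $C^1$ submanifold of the unit sphere of $H^s$, and $J_{a,f}(v):=\max_{t>0}I_{a,f}(tv)$ for $v\in\tilde\Sigma_+$; critical points of $J_{a,f}$ are taken on $\tilde\Sigma_+$ (derivative vanishing on tangent vectors $h$ with $\langle h,v\rangle_{H^s}=0$). $w^*$ is the unique (up to translation) positive ground state solution of $(-\Delta)^s w+w=w^p$ in $\mathbb R^N$, $w\in H^s$. *)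

theory Defs
  imports "HOL-Analysis.Analysis"
begin

type_synonym 'n fn = "real ^ 'n \<Rightarrow> real"


definition gag :: "real \<Rightarrow> ('n::finite) fn \<Rightarrow> ('n fn) \<Rightarrow> ((real^'n) \<times> (real^'n)) \<Rightarrow> real" where
  "gag s u v = (\<lambda>(x,y). (u x - u y) * (v x - v y) / norm (x - y) powr (real CARD('n) + 2 * s))"

text \<open>The fractional Sobolev space H^s(R^N) (as a set of representatives)\<close>
definition Hs :: "real \<Rightarrow> ('n::finite) fn set" where
  "Hs s = {u. u \<in> borel_measurable lborel \<and> integrable lborel (\<lambda>x. (u x)\<^sup>2) \<and>
              integrable (lborel \<Otimes>\<^sub>M lborel) (gag s u u)}"

definition Hs_norm :: "real \<Rightarrow> ('n::finite) fn \<Rightarrow> real" where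
  "Hs_norm s u = sqrt ((\<integral>x. (u x)\<^sup>2 \<partial>lborel) + (\<integral>z. gag s u u z \<partial>(lborel \<Otimes>\<^sub>M lborel)))"

text \<open>H^{-s}: bounded linear functionals on H^s; duality is application.\<close>
definition Hneg :: "real \<Rightarrow> (('n::finite) fn \<Rightarrow> real) set" where
  "Hneg s = {f. (\<forall>u\<in>Hs s. \<forall>v\<in>Hs s. f (\<lambda>x. u x + v x) = f u + f v) \<and>
               (\<forall>u\<in>Hs s. \<forall>c. f (\<lambda>x. c * u x) = c * f u) \<and>
               (\<exists>K. \<forall>u\<in>Hs s. \<bar>f u\<bar> \<le> K * Hs_norm s u)}"

definition Hneg_norm :: "real \<Rightarrow> (('n::finite) fn \<Rightarrow> real) \<Rightarrow> real" where
  "Hneg_norm s f = Sup {\<bar>f u\<bar> | u. u \<in> Hs s \<and> Hs_norm s u \<le> 1}"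

definition nonneg_dual :: "real \<Rightarrow> (('n::finite) fn \<Rightarrow> real) \<Rightarrow> bool" where
  "nonneg_dual s f \<longleftrightarrow> (\<forall>u\<in>Hs s. (AE x in lborel. u x \<ge> 0) \<longrightarrow> f u \<ge> 0)"

definition nonzero_dual :: "real \<Rightarrow> (('n::finite) fn \<Rightarrow> real) \<Rightarrow> bool" where
  "nonzero_dual s f \<longleftrightarrow> (\<exists>u\<in>Hs s. f u \<noteq> 0)"

definition Ifun :: "real \<Rightarrow> real \<Rightarrow> ('n::finite) fn \<Rightarrow> ('n fn \<Rightarrow> real) \<Rightarrow> 'n fn \<Rightarrow> real" where
  "Ifun s p b g u = Hs_norm s u ^ 2 / 2
     - (1 / (p + 1)) * (\<integral>x. b x * (max (u x) 0) powr (p + 1) \<partial>lborel) - g u"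

definition Hball :: "real \<Rightarrow> real \<Rightarrow> ('n::finite) fn set" where
  "Hball s r = {u \<in> Hs s. Hs_norm s u < r}"

definition crit_Hs :: "real \<Rightarrow> (('n::finite) fn \<Rightarrow> real) \<Rightarrow> 'n fn \<Rightarrow> bool" where
  "crit_Hs s F u \<longleftrightarrow> u \<in> Hs s \<and>
     (\<forall>e>0. \<exists>d>0. \<forall>h\<in>Hs s. Hs_norm s h < d \<longrightarrow>
         \<bar>F (\<lambda>x. u x + h x) - F u\<bar> \<le> e * Hs_norm s h)"

definition strictly_convex_on_Hs :: "real \<Rightarrow> ('n::finite) fn set \<Rightarrow> ('n fn \<Rightarrow> real) \<Rightarrow> bool" where
  "strictly_convex_on_Hs s A F \<longleftrightarrow>
     (\<forall>u\<in>A. \<forall>v\<in>A. \<not> (AE x in lborel. u x = v x) \<longrightarrow>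
        (\<forall>t. 0 < t \<and> t < 1 \<longrightarrow>
           F (\<lambda>x. t * u x + (1 - t) * v x) < t * F u + (1 - t) * F v))"

definition Sigma_plus :: "real \<Rightarrow> ('n::finite) fn set" where
  "Sigma_plus s = {v \<in> Hs s. Hs_norm s v = 1 \<and> \<not> (AE x in lborel. max (v x) 0 = 0)}"

definition Jfun :: "real \<Rightarrow> real \<Rightarrow> ('n::finite) fn \<Rightarrow> ('n fn \<Rightarrow> real) \<Rightarrow> 'n fn \<Rightarrow> real" where
  "Jfun s p a f v = (SUP t\<in>{0<..}. Ifun s p a f (\<lambda>x. t * v x))"

text \<open>Critical point of J on the manifold: the differential of J restricted
  to the manifold vanishes at v.\<close>
definition crit_Sigma :: "real \<Rightarrow> (('n::finite) fn \<Rightarrow> real) \<Rightarrow> 'n fn \<Rightarrow> bool" where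
  "crit_Sigma s F v \<longleftrightarrow> v \<in> Sigma_plus s \<and>
     (\<forall>e>0. \<exists>d>0. \<forall>w\<in>Sigma_plus s. Hs_norm s (\<lambda>x. w x - v x) < d \<longrightarrow>
         \<bar>F w - F v\<bar> \<le> e * Hs_norm s (\<lambda>x. w x - v x))"

text \<open>Positive ground state of (-\<Delta>)^s w + w = w^p: a positive critical point of
  I_{1,0} of least energy among nontrivial critical points.\<close>
definition ground_state :: "real \<Rightarrow> real \<Rightarrow> ('n::finite) fn \<Rightarrow> bool" where
  "ground_state s p w \<longleftrightarrow> w \<in> Hs s \<and> (\<forall>x. w x > 0) \<and>
     crit_Hs s (Ifun s p (\<lambda>_. 1) (\<lambda>_. 0)) w \<and>
     (\<forall>u::'n fn. crit_Hs s (Ifun s p (\<lambda>_. 1) (\<lambda>_. 0)) u \<and> \<not> (AE x in lborel. u x = 0) \<longrightarrow>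
        Ifun s p (\<lambda>_. 1) (\<lambda>_. 0) w \<le> Ifun s p (\<lambda>_. 1) (\<lambda>_. 0) u)"

end

theory Submission
 imports Defs "HOL-Library.Diagonal_Subsequence"
begin

text \<open>
  Below the level \<open>c = I f u + gs_energy\<close>, where \<open>u\<close> is the local minimiser and \<open>gs_energy\<close> the ground state energy,
  the functional \<open>J f\<close> satisfies the Palais-Smale condition, because a noncompact sequence loses at least one ground state.
  For large \<open>y\<close> the projection of \<open>u + w(\<cdot> - y)\<close> lies below this level: the interaction of \<open>u\<close> with the
  translated ground state \<open>w\<close> dominates the loss caused by \<open>a \<noteq> 1\<close>, since \<open>u\<close> decays no faster than
  \<open>(1 + |x|) powr - (N + 2 s)\<close> and \<open>w\<close> satisfies a Caccioppoli estimate with that weight.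
  Below the level the barycentre does not vanish. If there were only one critical point there, gradient descent
  would push the sphere of the projections with \<open>|y| = R\<close> into a small neighbourhood of it, and the barycentre
  would contract a sphere in the complement of the origin.
\<close>

abbreviation (input) seq_tendsto (infixr "--->" 60) where "X ---> l == (X \<longlonglongrightarrow> l)"

abbreviation escapes :: "(nat => 'a::real_normed_vector) => bool" where "escapes y \<equiv> filterlim (%n. norm (y n)) at_top sequentially"

abbreviation tail_le :: "(nat => nat => real) => real => bool" where
 "tail_le d e \<equiv> \<exists>n0. \<forall>n\<ge>n0. \<forall>m\<ge>n0. d n m <= e"

lemma nn_integral_lborel_shift:
 fixes c :: "'a::euclidean_space"
 assumes "f \<in> borel_measurable borel"
 shows "(\<integral>\<^sup>+x. f (x + c) \<partial>lborel) = (\<integral>\<^sup>+x. f x \<partial>lborel)"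
proof -
 have "(\<integral>\<^sup>+x. f x \<partial>lborel) = (\<integral>\<^sup>+x. f x \<partial>(distr lborel borel ((+) c)))"
  by (simp add: lborel_distr_plus)
 also have "... = (\<integral>\<^sup>+x. f (c + x) \<partial>lborel)"
  using assms by (subst nn_integral_distr) auto
 finally show ?thesis by (simp add: add.commute)
qed

lemma integral_lborel_shift:
 fixes c :: "'a::euclidean_space" and f :: "'a => 'b::{banach,second_countable_topology}"
 assumes "f \<in> borel_measurable borel"
 shows "(LINT x|lborel. f (x + c)) = (LINT x|lborel. f x)"
  and "integrable lborel (%x. f (x + c)) = integrable lborel f"
proof -
 have "(LINT x|lborel. f x) = (\<integral>x. f x \<partial>(distr lborel borel ((+) c)))"
  by (simp add: lborel_distr_plus)
 also have "... = (LINT x|lborel. f (c + x))"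
  using assms by (subst integral_distr) auto
 finally show "(LINT x|lborel. f (x + c)) = (LINT x|lborel. f x)" by (simp add: add.commute)
 have "integrable lborel f = integrable (distr lborel borel ((+) c)) f"
  by (simp add: lborel_distr_plus)
 also have "... = integrable lborel (%x. f (c + x))"
  using assms by (subst integrable_distr_eq) auto
 finally show "integrable lborel (%x. f (x + c)) = integrable lborel f" by (simp add: add.commute)
qed

lemma distr_shear:
 "distr (lborel \<Otimes>\<^sub>M lborel) (lborel \<Otimes>\<^sub>M lborel) (%z::'a \<times> 'a::euclidean_space. (fst z, fst z + snd z)) = lborel \<Otimes>\<^sub>M lborel"
  (is "?D = ?M")
proof (rule measure_eqI)
 fix X assume "X \<in> sets ?D"
 hence [measurable]: "X \<in> sets (borel \<Otimes>\<^sub>M borel)" by (simp cong: sets_pair_measure_cong)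
 have "emeasure ?D X = (\<integral>\<^sup>+z. indicator X z \<partial>?D)" using \<open>X \<in> sets ?D\<close> by simp
 also have "... = (\<integral>\<^sup>+z. indicator X (fst z, fst z + snd z) \<partial>?M)"
  by (subst nn_integral_distr) auto
 also have "... = (\<integral>\<^sup>+x. \<integral>\<^sup>+h. indicator X (x, x + h) \<partial>lborel \<partial>lborel)"
  by (subst lborel.nn_integral_fst[symmetric]) auto
 also have "... = (\<integral>\<^sup>+x. \<integral>\<^sup>+h. indicator X (x, h) \<partial>lborel \<partial>lborel)"
  using nn_integral_lborel_shift[of "%h. indicator X (_, h)"]
  by (auto simp: add.commute intro!: nn_integral_cong)
 also have "... = (\<integral>\<^sup>+z. indicator X z \<partial>?M)"
  by (subst lborel.nn_integral_fst[symmetric]) auto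
 also have "... = emeasure ?M X" using \<open>X \<in> sets ?D\<close> by simp
 finally show "emeasure ?D X = emeasure ?M X" .
qed simp

definition L2 :: "'a measure => ('a => real) => bool" where
 "L2 M f \<longleftrightarrow> f \<in> borel_measurable M & integrable M (%x. (f x)^2)"

lemma L2D: "L2 M f ==> f \<in> borel_measurable M" "L2 M f ==> integrable M (%x. (f x)^2)"
 by (auto simp: L2_def)

lemma L2_mono:
 assumes "L2 M g" "f \<in> borel_measurable M" "!!x. x \<in> space M ==> abs (f x) <= abs (g x)"
 shows "L2 M f"
 unfolding L2_def
proof
 show "integrable M (%x. (f x)^2)"
  using assms by (intro Bochner_Integration.integrable_bound[OF L2D(2)[OF assms(1)]])
   (auto intro!: AE_I2 simp: abs_le_square_iff)
qed fact

lemma L2_mult_integrable: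
 assumes "L2 M f" "L2 M g" shows "integrable M (%x. f x*g x)"
proof (rule Bochner_Integration.integrable_bound)
 show "integrable M (%x. (f x)^2 + (g x)^2)" using assms by (auto simp: L2_def)
 show "(%x. f x*g x) \<in> borel_measurable M" using assms by (auto simp: L2_def)
 have "abs (f x*g x) <= (f x)^2 + (g x)^2" for x
 proof -
  have "0 <= abs (f x)*abs (g x)" by simp
  moreover have "2*(abs (f x)*abs (g x)) <= (f x)^2 + (g x)^2"
   using sum_squares_bound[of "abs (f x)" "abs (g x)"] by (simp add: mult.assoc)
  ultimately show ?thesis by (simp only: abs_mult)
 qed
 thus "AE x in M. norm (f x*g x) <= norm ((f x)^2 + (g x)^2)" by auto
qed

lemma L2_scale: "L2 M f ==> L2 M (%x. c*f x)"
 by (auto simp: L2_def power_mult_distrib)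

lemma L2_add: assumes "L2 M f" "L2 M g" shows "L2 M (%x. f x + g x)"
 using assms L2_mult_integrable[OF assms]
 by (auto simp: L2_def power2_sum mult.assoc)

lemma L2_diff: assumes "L2 M f" "L2 M g" shows "L2 M (%x. f x - g x)"
 using L2_add[OF assms(1) L2_scale[OF assms(2), of "-1"]] by simp

lemma discriminant_le_0:
 fixes a b c :: real
 assumes "!!t. 0 <= a + 2*t*b + t^2*c" "c >= 0"
 shows "b^2 <= a*c"
proof (cases "c = 0")
 case True
 have "b = 0"
 proof (rule ccontr)
  assume "b ~= 0"
  thus False using assms(1)[of "- (a + 1)/(2*b)"] True by (simp add: field_simps)
 qed
 thus ?thesis using True by simp
next
 case False
 thus ?thesis using assms(1)[of "- b/c"] assms(2) by (simp add: field_simps power2_eq_square)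
qed

lemma L2_Cauchy_Schwarz:
 assumes "L2 M f" "L2 M g"
 shows "(LINT x|M. abs (f x*g x))^2 <= (LINT x|M. (f x)^2)*(LINT x|M. (g x)^2)"
proof (rule discriminant_le_0)
 fix t
 have "0 <= (LINT x|M. (abs (f x) + t*abs (g x))^2)" by simp
 also have "... = (LINT x|M. (f x)^2 + 2*t*abs (f x*g x) + t^2*(g x)^2)"
  by (simp add: power2_sum power_mult_distrib abs_mult mult_ac add_ac)
 also have "... = (LINT x|M. (f x)^2) + 2*t*(LINT x|M. abs (f x*g x)) + t^2*(LINT x|M. (g x)^2)"
  using assms by (simp add: L2D L2_mult_integrable)
 finally show "0 <= (LINT x|M. (f x)^2) + 2*t*(LINT x|M. abs (f x*g x)) + t^2*(LINT x|M. (g x)^2)" .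
qed simp

locale frac_sobolev =
 fixes s N2s :: real and n_type :: "'n::finite itself"
 assumes s_pos: "0 < s" and s_lt_1: "s < 1" and s_lt_N: "2 * s < real CARD('n)"
  and N2s_def: "N2s = real CARD('n) + 2 * s"
begin

abbreviation H :: "'n fn set" where "H \<equiv> Hs s"
abbreviation Hnorm :: "'n fn => real" where "Hnorm \<equiv> Hs_norm s"
abbreviation L :: "(real^'n) measure" where "L \<equiv> lborel"
abbreviation LL :: "((real^'n) \<times> (real^'n)) measure" where "LL \<equiv> lborel \<Otimes>\<^sub>M lborel"

definition dquot :: "'n fn => (real^'n) \<times> (real^'n) => real" where
 "dquot u z = (u (fst z) - u (snd z))/norm (fst z - snd z) powr (N2s/2)"

definition Hinner :: "'n fn => 'n fn => real" where
 "Hinner u v = (LINT x|L. u x * v x) + (LINT z|LL. dquot u z*dquot v z)"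

lemma N2s_pos: "N2s > 0" using s_pos by (simp add: N2s_def)

lemma gag_eq_dquot: "gag s u v z = dquot u z*dquot v z"
 by (cases z) (simp add: gag_def dquot_def powr_add[symmetric] flip: N2s_def)

lemma dquot_measurable[measurable]:
 assumes [measurable]: "u \<in> borel_measurable borel"
 shows "dquot u \<in> borel_measurable LL"
proof -
 have [measurable]: "fst \<in> LL \<rightarrow>\<^sub>M borel" "snd \<in> LL \<rightarrow>\<^sub>M borel"
  using measurable_fst[of L L] measurable_snd[of L L] by (simp_all add: measurable_lborel1)
 show ?thesis unfolding dquot_def by measurable
qed

lemma H_iff: "u \<in> H \<longleftrightarrow> L2 L u & L2 LL (dquot u)"
proof -
 have "gag s u u = (%z. (dquot u z)^2)" by (simp add: fun_eq_iff gag_eq_dquot power2_eq_square)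
 thus ?thesis
  unfolding Hs_def L2_def by (auto intro: dquot_measurable)
qed

lemma H_meas[measurable_dest]: "u \<in> H ==> u \<in> borel_measurable borel" by (auto simp: Hs_def)

lemma H_L2: "u \<in> H ==> L2 L u" and H_dquot_L2: "u \<in> H ==> L2 LL (dquot u)" by (auto simp: H_iff)

lemma dquot_add: "dquot (%x. u x + v x) z = dquot u z + dquot v z"
 and dquot_diff: "dquot (%x. u x - v x) z = dquot u z - dquot v z"
 and dquot_scale: "dquot (%x. c*u x) z = c*dquot u z"
 by (auto simp: dquot_def add_divide_distrib diff_divide_distrib algebra_simps)

lemma H_add: "u \<in> H ==> v \<in> H ==> (%x. u x + v x) \<in> H"
 by (auto simp: H_iff dquot_add[abs_def] intro!: L2_add)
lemma H_scale: "u \<in> H ==> (%x. c*u x) \<in> H"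
 by (auto simp: H_iff dquot_scale[abs_def] intro!: L2_scale)
lemma H_diff: "u \<in> H ==> v \<in> H ==> (%x. u x - v x) \<in> H"
 by (auto simp: H_iff dquot_diff[abs_def] intro!: L2_diff)
lemma H_zero: "(%x. 0) \<in> H" by (simp add: H_iff L2_def dquot_def)
lemma H_minus: "u \<in> H ==> (%x. - u x) \<in> H" using H_scale[of u "-1"] by simp

lemma Hinner_commute: "Hinner u v = Hinner v u" by (simp add: Hinner_def mult.commute)

lemma Hinner_add_left: "u \<in> H ==> v \<in> H ==> w \<in> H ==> Hinner (%x. u x + v x) w = Hinner u w + Hinner v w"
 unfolding Hinner_def dquot_add distrib_right
 by (simp add: Bochner_Integration.integral_add L2_mult_integrable H_L2 H_dquot_L2)
lemma Hinner_scale_left: "Hinner (%x. c*u x) w = c*Hinner u w"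
 unfolding Hinner_def dquot_scale mult.assoc by (simp add: distrib_left)
lemma Hinner_add_right: "u \<in> H ==> v \<in> H ==> w \<in> H ==> Hinner w (%x. u x + v x) = Hinner w u + Hinner w v"
 by (subst (1 2 3) Hinner_commute) (rule Hinner_add_left)
lemma Hinner_scale_right: "Hinner w (%x. c*u x) = c*Hinner w u"
 by (subst (1 2) Hinner_commute) (rule Hinner_scale_left)
lemma Hinner_diff_left: "u \<in> H ==> v \<in> H ==> w \<in> H ==> Hinner (%x. u x - v x) w = Hinner u w - Hinner v w"
 using Hinner_add_left[of u "%x. -1 * v x" w] Hinner_scale_left[of "-1" v w] H_scale[of v "-1"] by simp
lemma Hinner_diff_right: "u \<in> H ==> v \<in> H ==> w \<in> H ==> Hinner w (%x. u x - v x) = Hinner w u - Hinner w v"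
 by (subst (1 2 3) Hinner_commute) (rule Hinner_diff_left)

lemma Hinner_self_nonneg: "Hinner u u >= 0"
 unfolding Hinner_def by (intro add_nonneg_nonneg integral_nonneg_AE) auto

lemma Hnorm_def2: "Hnorm u = sqrt (Hinner u u)"
 by (simp add: Hs_norm_def Hinner_def gag_eq_dquot power2_eq_square)
lemma Hnorm_power2: "(Hnorm u)^2 = Hinner u u" by (simp add: Hnorm_def2 Hinner_self_nonneg)
lemma Hnorm_nonneg: "0 <= Hnorm u" by (simp add: Hnorm_def2 Hinner_self_nonneg)

abbreviation Hdist :: "'n fn => 'n fn => real" where "Hdist u v \<equiv> Hnorm (%x. u x - v x)"

lemma Hnorm_power2_eq: "(Hnorm u)^2 = (LINT x|L. (u x)^2) + (LINT z|LL. (dquot u z)^2)"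
 unfolding Hnorm_power2 Hinner_def by (simp add: power2_eq_square)

lemma Hnorm_scale: "Hnorm (%x. c*u x) = abs c*Hnorm u"
proof -
 have "Hinner (%x. c*u x) (%x. c*u x) = c^2*Hinner u u"
  by (simp add: Hinner_scale_left Hinner_scale_right power2_eq_square)
 thus ?thesis by (simp add: Hnorm_def2 real_sqrt_mult)
qed
lemma Hnorm_zero: "Hnorm (%x. 0) = 0" using Hnorm_scale[of 0 "%x. 0"] by simp
lemma Hnorm_minus: "Hnorm (%x. - u x) = Hnorm u" using Hnorm_scale[of "-1" u] by simp

lemma Hnorm_power2_add:
 assumes "u \<in> H" "v \<in> H"
 shows "(Hnorm (%x. u x + v x))^2 = (Hnorm u)^2 + 2*Hinner u v + (Hnorm v)^2"
 using assms by (simp add: Hnorm_power2 Hinner_add_left Hinner_add_right H_add Hinner_commute[of v u])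

lemma Hnorm_power2_diff:
 assumes "u \<in> H" "v \<in> H"
 shows "(Hdist u v)^2 = (Hnorm u)^2 - 2*Hinner u v + (Hnorm v)^2"
 using assms by (simp add: Hnorm_power2 Hinner_diff_left Hinner_diff_right H_diff Hinner_commute[of v u])

lemma Hinner_Cauchy_Schwarz:
 assumes "u \<in> H" "v \<in> H" shows "abs (Hinner u v) <= Hnorm u*Hnorm v"
proof -
 have "0 <= (Hnorm u)^2 + 2*t*Hinner u v + t^2*(Hnorm v)^2" for t
  using Hnorm_power2_add[OF assms(1) H_scale[OF assms(2), of t]] zero_le_power2[of "Hnorm (%x. u x + t * v x)"]
  by (simp add: Hinner_scale_right Hnorm_scale power_mult_distrib mult_ac)
 hence "(Hinner u v)^2 <= (Hnorm u)^2*(Hnorm v)^2" by (rule discriminant_le_0) simp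
 thus ?thesis
  by (metis abs_le_square_iff abs_mult abs_of_nonneg Hnorm_nonneg power_mult_distrib)
qed

lemma Hnorm_triangle:
 assumes "u \<in> H" "v \<in> H" shows "Hnorm (%x. u x + v x) <= Hnorm u + Hnorm v"
proof (rule power2_le_imp_le)
 show "(Hnorm (%x. u x + v x))^2 <= (Hnorm u + Hnorm v)^2"
  using Hinner_Cauchy_Schwarz[OF assms] by (simp add: Hnorm_power2_add[OF assms] power2_sum)
qed (simp add: Hnorm_nonneg)

lemma Hnorm_diff_triangle:
 assumes "u \<in> H" "v \<in> H" "w \<in> H"
 shows "Hdist u w <= Hdist u v + Hdist v w"
 using Hnorm_triangle[OF H_diff[OF assms(1,2)] H_diff[OF assms(2,3)]] by simp
lemma Hnorm_diff_commute: "Hdist u v = Hdist v u"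
 using Hnorm_minus[of "%x. u x - v x"] by simp
lemma Hnorm_diff_le: "u \<in> H ==> v \<in> H ==> Hdist u v <= Hnorm u + Hnorm v"
 using Hnorm_triangle[OF _ H_minus, of u v] by (simp add: Hnorm_minus)
lemma Hnorm_reverse_triangle:
 assumes "u \<in> H" "v \<in> H" shows "abs (Hnorm u - Hnorm v) <= Hdist u v"
 using Hnorm_triangle[OF H_diff[OF assms] assms(2)] Hnorm_triangle[OF H_diff[OF assms(2,1)] assms(1)]
 by (simp add: Hnorm_diff_commute[of u v])

lemma AE_pair:
 assumes "AE x in L. P x" shows "AE z in LL. P (fst z)" "AE z in LL. P (snd z)"
proof -
 obtain N where N: "{x \<in> space L. ~ P x} \<subseteq> N" "N \<in> sets L" "emeasure L N = 0"
  using assms by (rule AE_E)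
 have n: "N \<times> UNIV \<in> null_sets LL" "UNIV \<times> N \<in> null_sets LL"
  using N(2,3) lborel.emeasure_pair_measure_Times[of N L UNIV] lborel.emeasure_pair_measure_Times[of UNIV L N]
  by (auto simp: null_sets_def intro!: pair_measureI)
 show "AE z in LL. P (fst z)"
  using N(1) by (intro AE_I'[OF n(1)]) (auto simp: space_pair_measure)
 show "AE z in LL. P (snd z)"
  using N(1) by (intro AE_I'[OF n(2)]) (auto simp: space_pair_measure)
qed

lemma dquot_AE_cong: assumes "AE x in L. u x = v x" shows "AE z in LL. dquot u z = dquot v z"
 using AE_pair[OF assms] by eventually_elim (simp add: dquot_def)

lemma Hinner_AE_cong:
 assumes [measurable]: "u \<in> H" "u' \<in> borel_measurable borel" and ae: "AE x in L. u x = u' x" and [measurable]: "v \<in> H"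
 shows "Hinner u v = Hinner u' v"
proof -
 have "(LINT x|L. u x * v x) = (LINT x|L. u' x * v x)"
  using ae by (intro integral_cong_AE) auto
 moreover have "(LINT z|LL. dquot u z*dquot v z) = (LINT z|LL. dquot u' z*dquot v z)"
  using dquot_AE_cong[OF ae] by (intro integral_cong_AE) auto
 ultimately show ?thesis by (simp add: Hinner_def)
qed

lemma H_AE_cong:
 assumes u[measurable]: "u \<in> H" "u' \<in> borel_measurable borel" and ae: "AE x in L. u x = u' x"
 shows "u' \<in> H"
proof -
 have "integrable L (%x. (u' x)^2)"
  using ae by (intro integrable_cong_AE_imp[OF L2D(2)[OF H_L2[OF u(1)]]]) auto
 moreover have "integrable LL (%z. (dquot u' z)^2)"
  using dquot_AE_cong[OF ae] by (intro integrable_cong_AE_imp[OF L2D(2)[OF H_dquot_L2[OF u(1)]]]) auto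
 ultimately show ?thesis by (simp add: H_iff L2_def)
qed

lemma Hnorm_AE_cong:
 assumes "u \<in> H" "u' \<in> borel_measurable borel" "AE x in L. u x = u' x"
 shows "Hnorm u = Hnorm u'"
 using Hinner_AE_cong[OF assms assms(1)] Hinner_AE_cong[OF assms H_AE_cong[OF assms]]
 by (simp add: Hnorm_def2 Hinner_commute)

lemma L2_le_Hnorm: "(LINT x|L. (u x)^2) <= (Hnorm u)^2"
 by (simp add: Hnorm_power2_eq)

lemma Hnorm_eq_0_iff: assumes "u \<in> H" shows "Hnorm u = 0 \<longleftrightarrow> (AE x in L. u x = 0)"
proof
 assume "Hnorm u = 0"
 hence "(LINT x|L. (u x)^2) = 0" using L2_le_Hnorm[of u] by (simp add: antisym)
 thus "AE x in L. u x = 0"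
  using integral_nonneg_eq_0_iff_AE[OF L2D(2)[OF H_L2[OF assms]]] by simp
next
 assume "AE x in L. u x = 0"
 thus "Hnorm u = 0" using Hnorm_AE_cong[OF assms, of "%x. 0"] by (simp add: Hnorm_zero)
qed

lemma Hnorm_pos_iff: "u \<in> H ==> Hnorm u > 0 \<longleftrightarrow> ~ (AE x in L. u x = 0)"
 using Hnorm_eq_0_iff[of u] Hnorm_nonneg[of u] by (auto simp: less_le)

definition normalized :: "'n fn => 'n fn" where "normalized g = (%x. (1/Hnorm g)*g x)"

lemma H_normalized: "u \<in> H ==> normalized u \<in> H" unfolding normalized_def by (rule H_scale)
lemma Hnorm_normalized: "Hnorm u > 0 ==> Hnorm (normalized u) = 1" unfolding normalized_def Hnorm_scale by simp

lemma H_contraction: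
 assumes u[measurable]: "u \<in> H" "v \<in> borel_measurable borel"
  and contr: "!!x. abs (v x) <= abs (u x)" "!!x y. abs (v x - v y) <= abs (u x - u y)"
 shows "v \<in> H" "Hnorm v <= Hnorm u"
proof -
 have d: "abs (dquot v z) <= abs (dquot u z)" for z
  using contr(2) by (auto simp: dquot_def abs_divide intro!: divide_right_mono)
 show v: "v \<in> H"
  using contr by (auto simp: H_iff intro!: L2_mono[OF H_L2[OF u(1)]] L2_mono[OF H_dquot_L2[OF u(1)]] d)
 have "(Hnorm v)^2 <= (Hnorm u)^2"
  unfolding Hnorm_power2_eq
  using contr u v d by (intro add_mono integral_mono L2D(2) H_L2 H_dquot_L2) (auto simp: abs_le_square_iff)
 thus "Hnorm v <= Hnorm u" by (rule power2_le_imp_le[OF _ Hnorm_nonneg])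
qed

abbreviation pos_part :: "'n fn => 'n fn" where "pos_part u \<equiv> (%x. max (u x) 0)"

lemma H_pos_part: "u \<in> H ==> pos_part u \<in> H"
 using H_contraction[of u "pos_part u"] H_meas[of u] by (auto simp: max_def abs_if)

lemma Hinner_pos_part_ge:
 assumes "u \<in> H" shows "Hinner u (pos_part u) >= (Hnorm (pos_part u))^2"
proof -
 have "(a - b)*(max a 0 - max b 0) >= (max a 0 - max b 0)^2" for a b :: real
 proof -
  have "(a - b)*(max a 0 - max b 0) - (max a 0 - max b 0)^2
   = max a 0*(max b 0 - b) + max b 0*(max a 0 - a) + (a - max a 0)*max a 0 + (b - max b 0)*max b 0"
   by (simp add: power2_eq_square algebra_simps)
  moreover have "(c - max c 0)*max c 0 = 0" for c :: real by (simp add: max_def)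
  ultimately show ?thesis
   by (smt (verit) max.cobounded1 max.cobounded2 mult_nonneg_nonneg)
 qed
 hence "dquot u z*dquot (pos_part u) z >= (dquot (pos_part u) z)^2" for z
  by (auto simp: dquot_def power2_eq_square divide_right_mono)
 hence "(LINT z|LL. dquot u z*dquot (pos_part u) z) >= (LINT z|LL. (dquot (pos_part u) z)^2)"
  using assms by (intro integral_mono L2_mult_integrable L2D(2) H_dquot_L2 H_pos_part)
 moreover have "(LINT x|L. u x*pos_part u x) = (LINT x|L. (pos_part u x)^2)"
  by (intro Bochner_Integration.integral_cong) (auto simp: max_def power2_eq_square)
 ultimately show ?thesis by (simp add: Hinner_def Hnorm_power2_eq)
qed

lemma pair_shift:
 fixes g :: "(real^'n) \<times> (real^'n) => real"
 assumes [measurable]: "g \<in> borel_measurable LL"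
 shows "integrable LL (%z. g (fst z + c, snd z + c)) = integrable LL g"
  "(LINT z|LL. g (fst z + c, snd z + c)) = (LINT z|LL. g z)"
proof -
 have [measurable]: "(%z. (fst z + c, snd z + c)) \<in> LL \<rightarrow>\<^sub>M LL" by measurable
 have "LL = distr L borel ((+) c) \<Otimes>\<^sub>M distr L borel ((+) c)" by (simp only: lborel_distr_plus)
 also have "... = distr LL (borel \<Otimes>\<^sub>M borel) (%(x, y). (c + x, c + y))"
  by (rule pair_measure_distr) (simp_all add: lborel_distr_plus lborel.sigma_finite_measure_axioms)
 also have "... = distr LL LL (%z. (fst z + c, snd z + c))"
  by (intro distr_cong sets_pair_measure_cong) (auto simp: case_prod_unfold add.commute)
 finally have dist: "distr LL LL (%z. (fst z + c, snd z + c)) = LL" by (rule sym)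
 show "integrable LL (%z. g (fst z + c, snd z + c)) = integrable LL g"
  by (subst (2) dist[symmetric], subst integrable_distr_eq) auto
 show "(LINT z|LL. g (fst z + c, snd z + c)) = (LINT z|LL. g z)"
  by (subst (2) dist[symmetric], subst integral_distr) auto
qed

lemma dquot_shift: "dquot (%x. u (x + c)) z = dquot u (fst z + c, snd z + c)" by (simp add: dquot_def)

lemma H_shift:
 assumes u: "u \<in> H"
 shows "(%x. u (x + c)) \<in> H"
proof -
 note [measurable] = H_meas[OF u]
 show ?thesis
  unfolding H_iff L2_def dquot_shift
 using u pair_shift(1)[of "%z. (dquot u z)^2"] integral_lborel_shift(2)[of "%x. (u x)^2" c]
 by (auto simp: dquot_shift[abs_def] dest: H_L2 H_dquot_L2 L2D(2))
qed

lemma Hinner_shift: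
 assumes [measurable]: "u \<in> H" "v \<in> H"
 shows "Hinner (%x. u (x + c)) (%x. v (x + c)) = Hinner u v"
 unfolding Hinner_def dquot_shift
 using pair_shift(2)[of "%z. dquot u z*dquot v z"] integral_lborel_shift(1)[of "%x. u x * v x" c] by auto

lemma Hnorm_shift: "u \<in> H ==> Hnorm (%x. u (x + c)) = Hnorm u"
 by (simp add: Hnorm_def2 Hinner_shift)

lemma integral_LL_shear:
 fixes F :: "(real^'n) \<times> (real^'n) => real"
 assumes "integrable LL F"
 shows "integrable LL (%z. F (fst z, fst z + snd z))"
  "(LINT z|LL. F z) = (LINT z|LL. F (fst z, fst z + snd z))"
proof -
 have [measurable]: "(%z. (fst z, fst z + snd z)) \<in> LL \<rightarrow>\<^sub>M LL" "F \<in> borel_measurable LL" using assms by auto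
 have d: "distr LL LL (%z. (fst z, fst z + snd z)) = LL" by (rule distr_shear)
 show "integrable LL (%z. F (fst z, fst z + snd z))"
  using assms by (subst (asm) d[symmetric], subst (asm) integrable_distr_eq) auto
 show "(LINT z|LL. F z) = (LINT z|LL. F (fst z, fst z + snd z))"
  by (subst d[symmetric], subst integral_distr) auto
qed

end

lemma integrable_boundI:
 fixes f g :: "'a => real"
 assumes "integrable M g" "f \<in> borel_measurable M" "!!x. abs (f x) <= g x"
 shows "integrable M f"
proof (rule Bochner_Integration.integrable_bound[OF assms(1,2)])
 show "AE x in M. norm (f x) <= norm (g x)"
  by (intro AE_I2) (metis abs_ge_self assms(3) order_trans real_norm_def)
qed

lemma integral_suminf_bound:
 fixes f :: "'a => real" and g :: "nat => 'a => real"
 assumes f: "f \<in> borel_measurable M" "!!x. 0 <= f x"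
  and g: "!!k. integrable M (g k)" "!!k x. 0 <= g k x" "!!k. (LINT x|M. g k x) <= c k" "summable c"
  and le: "!!x. \<exists>k. f x <= g k x"
 shows "integrable M f" "(LINT x|M. f x) <= suminf c"
proof -
 have c_nonneg: "c k >= 0" for k using g(3)[of k] g(2)[of k] by (smt (verit) Bochner_Integration.integral_nonneg)
 have [measurable]: "g k \<in> borel_measurable M" for k using g(1) by auto
 have "(\<integral>\<^sup>+x. ennreal (f x) \<partial>M) <= (\<integral>\<^sup>+x. (\<Sum>k. ennreal (g k x)) \<partial>M)"
 proof (intro nn_integral_mono)
  fix x
  obtain k where "f x <= g k x" using le by blast
  hence "ennreal (f x) <= ennreal (g k x)" by (rule ennreal_leI)
  also have "... <= (\<Sum>k. ennreal (g k x))" by (metis ennreal_suminf_lessD not_le order_less_irrefl)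
  finally show "ennreal (f x) <= (\<Sum>k. ennreal (g k x))" .
 qed
 also have "... = (\<Sum>k. \<integral>\<^sup>+x. ennreal (g k x) \<partial>M)" by (intro nn_integral_suminf) auto
 also have "... <= (\<Sum>k. ennreal (c k))"
  using g by (intro suminf_le) (auto simp: nn_integral_eq_integral intro!: ennreal_leI)
 also have "... = ennreal (suminf c)" using c_nonneg g(4) by (simp add: suminf_ennreal2)
 finally have nn_le: "(\<integral>\<^sup>+x. ennreal (f x) \<partial>M) <= ennreal (suminf c)" .
 thus i: "integrable M f" using f by (intro integrableI_nonneg) (auto simp: le_less_trans)
 have "ennreal (LINT x|M. f x) <= ennreal (suminf c)" using nn_le i f by (simp add: nn_integral_eq_integral)
 thus "(LINT x|M. f x) <= suminf c" using c_nonneg g(4) by (simp add: ennreal_le_iff suminf_nonneg)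
qed

lemma ball_indicator_integrable: "integrable lborel (indicator (ball z r) :: 'a::euclidean_space => real)"
 using emeasure_bounded_finite[of "ball z r"] by (auto intro!: integrable_real_indicator simp: less_top)

lemma integrable_of_balls:
 fixes f :: "'a::euclidean_space => real" and r c :: "nat => real"
 assumes f: "f \<in> borel_measurable borel" "!!x. f x >= 0"
  and cov: "!!x. f x = 0 \<or> (\<exists>k. f x <= c k & norm x < r k)"
  and pos: "!!k. c k >= 0" "!!k. r k >= 0"
  and sm: "summable (%k. c k*r k ^ DIM('a))"
 shows "integrable lborel f"
proof (rule integral_suminf_bound(1))
 show "integrable lborel (%x. c k*indicator (ball (0::'a) (r k)) x)" for k
  by (intro integrable_mult_right ball_indicator_integrable)
 show "(LINT x|lborel. c k*indicator (ball (0::'a) (r k)) x) <= unit_ball_vol (real DIM('a))*(c k*r k ^ DIM('a))" for k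
  using content_ball[OF pos(2), of "0::'a" k] by simp
 show "\<exists>k. f x <= c k*indicator (ball 0 (r k)) x" for x using cov[of x] pos(1) by (auto simp: indicator_def)
qed (use f pos sm in \<open>auto intro: summable_mult\<close>)

lemma ex_power2_bracket:
 fixes x :: real assumes "x >= 1" shows "\<exists>k::nat. 2 ^ k <= x & x < 2 ^ (k + 1)"
proof -
 define k where "k = nat \<lfloor>log 2 x\<rfloor>"
 have "log 2 x >= 0" using assms by simp
 hence "real k <= log 2 x" "log 2 x < real k + 1" by (auto simp: k_def)
 hence "2 powr real k <= x" "x < 2 powr (real k + 1)"
  using assms by (auto simp: le_log_iff log_less_iff)
 thus ?thesis by (intro exI[of _ k]) (auto simp: powr_realpow powr_add)
qed

lemma integrable_one_plus_norm_powr: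
 assumes "a > real DIM('a)" shows "integrable lborel (%x::'a::euclidean_space. (1 + norm x) powr - a)"
proof (rule integrable_of_balls[where c="%k. (2 powr - a) ^ k" and r="%k. 2 ^ (k + 1)"])
 fix x :: 'a
 obtain k where k: "2 ^ k <= 1 + norm x" "1 + norm x < 2 ^ (k + 1)"
  using ex_power2_bracket[of "1 + norm x"] by auto
 have "(1 + norm x) powr - a <= (2 ^ k) powr - a" using k assms by (intro powr_mono2') auto
 also have "... = (2 powr - a) ^ k" by (simp add: powr_realpow[symmetric] powr_powr mult.commute)
 finally show "(1 + norm x) powr - a = 0 \<or> (\<exists>k. (1 + norm x) powr - a <= (2 powr - a) ^ k & norm x < 2 ^ (k + 1))"
  using k by (intro disjI2 exI[of _ k]) auto
next
 have "(2 powr - a) ^ k*(2 ^ (k + 1)) ^ DIM('a) = 2 ^ DIM('a)*(2 powr (real DIM('a) - a)) ^ k" for k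
  by (simp add: powr_realpow[symmetric] powr_powr powr_add[symmetric] algebra_simps)
 moreover have "summable (%k. 2 ^ DIM('a)*(2 powr (real DIM('a) - a)) ^ k)"
  using assms by (intro summable_mult summable_geometric) (simp add: powr_less_one)
 ultimately show "summable (%k. (2 powr - a) ^ k*(2 ^ (k + 1)) ^ DIM('a))" by (simp only:)
qed auto

lemma integrable_norm_powr_unit_ball:
 assumes "a > - real DIM('a)"
 shows "integrable lborel (%x::'a::euclidean_space. indicator (cball 0 1) x*norm x powr a)"
proof (rule integrable_of_balls[where c="%k. 2 powr abs a*(2 powr - a) ^ k" and r="%k. 2*(1/2) ^ k"])
 fix x :: 'a
 show "indicator (cball 0 1) x*norm x powr a = 0 \<or>
   (\<exists>k. indicator (cball 0 1) x*norm x powr a <= 2 powr abs a*(2 powr - a) ^ k & norm x < 2*(1/2) ^ k)"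
 proof (cases "norm x <= 1 & x ~= 0")
  case True
  obtain k where k: "2 ^ k <= 1/norm x" "1/norm x < 2 ^ (k + 1)"
   using ex_power2_bracket[of "1/norm x"] True by auto
  define y where "y = norm x*2 ^ k"
  have y: "1/2 <= y" "y <= 1" "y > 0" using k True by (auto simp: y_def field_simps)
  have "y powr a <= 2 powr abs a"
  proof (cases "a >= 0")
   case True
   thus ?thesis using y powr_le1[of a y] ge_one_powr_ge_zero[of 2 a] by simp
  next
   case False
   thus ?thesis using y powr_mono2'[of a "1/2" y] by (simp add: powr_divide powr_minus_divide)
  qed
  moreover have "norm x = y*(1/2) ^ k" by (simp add: y_def power_one_over)
  moreover from this have "norm x powr a = y powr a*(2 powr - a) ^ k"
   by (simp add: powr_mult powr_realpow[symmetric] powr_powr powr_divide powr_minus_divide mult.commute)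
  ultimately have "norm x powr a <= 2 powr abs a*(2 powr - a) ^ k" "norm x < 2*(1/2) ^ k"
   using y by (auto intro!: mult_right_mono)
  thus ?thesis using True by auto
 qed auto
next
 have "2 powr abs a*(2 powr - a) ^ k*(2*(1/2) ^ k) ^ DIM('a) = 2 powr abs a*2 ^ DIM('a)*(2 powr (- a - real DIM('a))) ^ k" for k
  by (simp add: power_mult_distrib powr_realpow[symmetric] powr_powr powr_divide powr_diff power_one_over powr_minus field_simps)
 moreover have "summable (%k. 2 powr abs a*2 ^ DIM('a)*(2 powr (- a - real DIM('a))) ^ k)"
  using assms by (intro summable_mult summable_geometric) (simp add: powr_less_one)
 ultimately show "summable (%k. 2 powr abs a*(2 powr - a) ^ k*(2*(1/2) ^ k) ^ DIM('a))" by (simp only:)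
 show "(%x::'a. indicator (cball 0 1) x*norm x powr a) \<in> borel_measurable borel"
  by (intro borel_measurable_times borel_measurable_indicator) auto
qed auto

lemma eventually_integral_le_split_bound:
 fixes h e :: "nat => 'a => real"
 assumes h: "!!n. h n \<in> borel_measurable M" "AE x in M. (%n. h n x) ---> 0"
  and e: "!!n. integrable M (e n)" "!!n x. 0 <= e n x" "!!n. (LINT x|M. e n x) <= C"
  and psi: "integrable M psi" "!!n x. abs (h n x) <= eps*e n x + psi x" and pos: "eps >= 0" "r > 0"
 shows "\<forall>\<^sub>F n in sequentially. (LINT x|M. abs (h n x)) < eps*C + r"
proof -
 define g where "g n x = max (abs (h n x) - eps*e n x) 0" for n x
 have [measurable]: "h n \<in> borel_measurable M" "e n \<in> borel_measurable M" "psi \<in> borel_measurable M" for n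
  using h(1) e(1) psi(1) by auto
 have [measurable]: "g n \<in> borel_measurable M" for n unfolding g_def by measurable
 have dom: "abs (g n x) <= abs (psi x)" for n x using psi(2)[of n x] by (auto simp: g_def max_def)
 have gi: "integrable M (g n)" for n
  using dom by (intro Bochner_Integration.integrable_bound[OF psi(1)]) auto
 have "(%n. LINT x|M. g n x) ---> (LINT x|M. 0)"
 proof (rule integral_dominated_convergence[where w="%x. abs (psi x)"])
  show "AE x in M. (%n. g n x) ---> 0"
   using h(2)
  proof eventually_elim
   case (elim x)
   have "0 <= g n x" "g n x <= abs (h n x)" for n
    using e(2)[of n x] pos(1) by (auto simp: g_def)
   thus ?case using tendsto_sandwich[of "%_. 0" "%n. g n x" sequentially "%n. abs (h n x)" 0] elim
    by (auto simp: tendsto_rabs_zero_iff)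
  qed
 qed (use psi(1) dom in auto)
 hence "\<forall>\<^sub>F n in sequentially. (LINT x|M. g n x) < r" using pos(2) by (intro order_tendstoD(2)) auto
 thus ?thesis
 proof eventually_elim
  case (elim n)
  have "(LINT x|M. abs (h n x)) <= (LINT x|M. eps*e n x + g n x)"
  proof (rule integral_mono')
   show "integrable M (%x. eps*e n x + g n x)" using e(1)[of n] gi[of n] by simp
  qed (use e(2) pos(1) in \<open>auto simp: g_def\<close>)
  also have "... = eps*(LINT x|M. e n x) + (LINT x|M. g n x)" using e(1)[of n] gi[of n] by simp
  finally show ?case using elim mult_left_mono[OF e(3)[of n] pos(1)] by linarith
 qed
qed

lemma dominated_convergence_split_bound:
 fixes h e :: "nat => 'a => real"
 assumes h: "!!n. h n \<in> borel_measurable M" "AE x in M. (%n. h n x) ---> 0"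
  and e: "!!n. integrable M (e n)" "!!n x. 0 <= e n x" "!!n. (LINT x|M. e n x) <= C"
  and b: "!!eps. eps > 0 ==> \<exists>psi. integrable M psi & (\<forall>n x. abs (h n x) <= eps*e n x + psi x)"
 shows "(%n. LINT x|M. h n x) ---> 0"
proof (rule tendsto_rabs_zero_cancel, rule LIMSEQ_I)
 fix r :: real assume r: "0 < r"
 have C: "C >= 0" using e(3)[of 0] Bochner_Integration.integral_nonneg[of M "e 0"] e(2) by fastforce
 define eps where "eps = r/(2*(C + 1))"
 have eps: "eps > 0" "eps*C < r/2" using r C by (auto simp: eps_def field_simps)
 obtain psi where "integrable M psi" "\<And>n x. abs (h n x) <= eps*e n x + psi x" using b[OF eps(1)] by auto
 from eventually_integral_le_split_bound[OF h e this less_imp_le[OF eps(1)], of "r/2"]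
 obtain n0 where n0: "!!n. n >= n0 ==> (LINT x|M. abs (h n x)) < eps*C + r/2"
  using r by (auto simp: eventually_sequentially)
 have "abs (LINT x|M. h n x) < r" if "n >= n0" for n
  using integral_abs_bound[of M "h n"] n0[OF that] eps(2) by linarith
 thus "\<exists>n0. \<forall>n\<ge>n0. norm (abs (LINT x|M. h n x) - 0) < r" by auto
qed

lemma L2_fatou:
 assumes "!!n. L2 M (f n)" "AE x in M. (%n. f n x) ---> g x" "g \<in> borel_measurable M"
  and "!!n. (LINT x|M. (f n x)^2) <= C"
 shows "L2 M g" "(LINT x|M. (g x)^2) <= C"
proof -
 have C: "C >= 0" using assms(4)[of 0] by (smt (verit) integral_nonneg_AE AE_I2 zero_le_power2)
 have [measurable]: "f n \<in> borel_measurable M" for n using assms(1) by (auto simp: L2_def)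
 note assms(3)[measurable]
 have "(\<integral>\<^sup>+x. ennreal ((g x)^2) \<partial>M) = (\<integral>\<^sup>+x. liminf (%n. ennreal ((f n x)^2)) \<partial>M)"
  using assms(2)
 proof (intro nn_integral_cong_AE, eventually_elim)
  case (elim x)
  hence "(%n. ennreal ((f n x)^2)) ---> ennreal ((g x)^2)" by (intro tendsto_ennrealI tendsto_power)
  thus ?case by (intro lim_imp_Liminf[symmetric]) auto
 qed
 also have "... <= liminf (%n. \<integral>\<^sup>+x. ennreal ((f n x)^2) \<partial>M)"
  by (intro nn_integral_liminf) auto
 also have "... <= ennreal C"
  using assms(1,4) by (intro Liminf_le always_eventually allI)
   (auto simp: nn_integral_eq_integral L2D intro!: ennreal_leI)
 finally have nn_le: "(\<integral>\<^sup>+x. ennreal ((g x)^2) \<partial>M) <= ennreal C" .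
 thus "L2 M g"
  unfolding L2_def using assms(3) by (auto intro!: integrableI_nonneg simp: le_less_trans)
 hence "ennreal (LINT x|M. (g x)^2) <= ennreal C"
  using nn_le by (simp add: nn_integral_eq_integral L2D)
 thus "(LINT x|M. (g x)^2) <= C" using C by (simp add: ennreal_le_iff)
qed

lemma weighted_AM_GM: "abs (x*y) <= eps*x^2 + y^2/eps" if "eps > 0" for x y eps :: real
proof -
 have "0 <= (eps*abs x - abs y)^2" "0 <= eps*(abs x*abs y)" using that by auto
 hence "eps*(abs x*abs y) <= eps^2*x^2 + y^2" by (simp add: power2_diff power_mult_distrib)
 thus ?thesis using that by (simp add: abs_mult field_simps power2_eq_square)
qed

lemma L2_diff_le:
 assumes "L2 M f" "L2 M g"
 shows "(LINT x|M. (f x - g x)^2) <= 2*(LINT x|M. (f x)^2) + 2*(LINT x|M. (g x)^2)"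
proof -
 have "(LINT x|M. (f x - g x)^2) <= (LINT x|M. 2*(f x)^2 + 2*(g x)^2)"
 proof (rule integral_mono)
  show "(f x - g x)^2 <= 2*(f x)^2 + 2*(g x)^2" for x
   using zero_le_power2[of "f x + g x"] by (simp add: power2_sum power2_diff)
 qed (use assms in \<open>auto intro!: L2D L2_diff integrable_mult_right Bochner_Integration.integrable_add\<close>)
 thus ?thesis using assms by (simp add: L2D)
qed

lemma L2_weak_limit:
 assumes f: "!!n. L2 M (f n)" "AE x in M. (%n. f n x) ---> g x" and g: "L2 M g" and v: "L2 M v"
  and C: "!!n. (LINT x|M. (f n x)^2) <= C"
 shows "(%n. LINT x|M. f n x * v x) ---> (LINT x|M. g x * v x)"
proof -
 note [measurable] = L2D(1)[OF f(1)] L2D(1)[OF g] L2D(1)[OF v]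
 have "(%n. LINT x|M. (f n x - g x) * v x) ---> 0"
 proof (rule dominated_convergence_split_bound[where e="%n x. (f n x - g x)^2" and C="2*C + 2*(LINT x|M. (g x)^2)"])
  show "AE x in M. (%n. (f n x - g x) * v x) ---> 0"
   using f(2) by eventually_elim (auto intro!: tendsto_mult_left_zero simp: LIM_zero_iff)
  show "integrable M (%x. (f n x - g x)^2)" for n using f(1) g by (intro L2D L2_diff)
  show "(LINT x|M. (f n x - g x)^2) <= 2*C + 2*(LINT x|M. (g x)^2)" for n
   using L2_diff_le[OF f(1)[of n] g] C[of n] by linarith
  show "\<exists>psi. integrable M psi & (\<forall>n x. abs ((f n x - g x) * v x) <= eps*(f n x - g x)^2 + psi x)" if "eps > 0" for eps
   using v weighted_AM_GM[OF that] by (intro exI[of _ "%x. (v x)^2/eps"]) (auto simp: L2D)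
 qed auto
 hence "(%n. (LINT x|M. f n x * v x) - (LINT x|M. g x * v x)) ---> 0"
  using f g v by (simp add: left_diff_distrib L2_mult_integrable)
 thus ?thesis by (simp add: LIM_zero_iff)
qed

lemma diagonal_convergent_subsequence:
 fixes X :: "'i::countable => nat => real"
 assumes X: "!!i. bounded (range (X i))"
 obtains r :: "nat => nat" where "strict_mono r" "!!i. convergent (%n. X i (r n))"
proof -
 interpret subseqs "%i r. convergent (%n. X (from_nat i) (r n))"
 proof
  fix i and r :: "nat => nat"
  have "bounded (range (%n. X (from_nat i) (r n)))" using X by (rule bounded_subset) auto
  then obtain l q where "strict_mono q" "((%n. X (from_nat i) (r n)) \<circ> q) ---> l"
   using bounded_imp_convergent_subsequence by metis
  thus "\<exists>q. strict_mono q & convergent (%n. X (from_nat i) ((r \<circ> q) n))"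
   by (intro exI[of _ q]) (auto simp: convergent_def comp_def)
 qed
 have "convergent (%n. X i (diagseq n))" for i
 proof -
  have "convergent (%n. X (from_nat (to_nat i)) ((diagseq \<circ> ((+) (Suc (to_nat i)))) n))"
  proof (rule diagseq_holds)
   fix j and q r :: "nat => nat"
   assume "strict_mono r" "convergent (%n. X (from_nat j) (q n))"
   thus "convergent (%n. X (from_nat j) ((q \<circ> r) n))"
    using convergent_subseq_convergent[of "%n. X (from_nat j) (q n)" r] by (simp add: comp_def)
  qed
  hence "convergent (%n. X i (diagseq (n + Suc (to_nat i))))" by (simp add: comp_def add.commute)
  thus ?thesis by (rule convergent_ignore_initial_segment[THEN iffD1])
 qed
 thus ?thesis using that subseq_diagseq by blast
qed

lemma AE_summable_of_L1_summable:
 fixes d :: "nat => 'a => real"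
 assumes d: "!!j. integrable M (d j)" "!!j. (LINT x|M. abs (d j x)) <= c j" and c: "summable c"
 shows "AE x in M. summable (%j. abs (d j x))"
proof -
 have [measurable]: "d j \<in> borel_measurable M" for j using d(1) by auto
 have c0: "c j >= 0" for j using order_trans[OF _ d(2)[of j]] by simp
 have "(\<integral>\<^sup>+x. (\<Sum>j. ennreal (abs (d j x))) \<partial>M) = (\<Sum>j. \<integral>\<^sup>+x. ennreal (abs (d j x)) \<partial>M)"
  by (intro nn_integral_suminf) measurable
 also have "... <= (\<Sum>j. ennreal (c j))"
  using d by (intro suminf_le) (auto simp: nn_integral_eq_integral intro!: ennreal_leI)
 also have "... < \<infinity>" using c c0 by (simp add: suminf_ennreal2)
 finally have "AE x in M. (\<Sum>j. ennreal (abs (d j x))) ~= \<infinity>"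
  by (intro nn_integral_noteq_infinite) auto
 thus ?thesis by eventually_elim (rule summable_suminf_not_top, auto)
qed

lemma L1_Cauchy_AE_convergent_subseq:
 fixes f :: "nat => 'a => real"
 assumes f: "!!n. integrable M (f n)" and cau: "!!e. e > 0 ==> tail_le (%n m. LINT x|M. abs (f n x - f m x)) e"
 shows "\<exists>r::nat => nat. strict_mono r & (AE x in M. convergent (%n. f (r n) x))"
proof -
 have "\<forall>j. tail_le (%n m. LINT x|M. abs (f n x - f m x)) ((1/2) ^ j)" by (intro allI cau) simp
 from choice[OF this] obtain N where
  N: "!!j n m. n >= N j ==> m >= N j ==> (LINT x|M. abs (f n x - f m x)) <= (1/2) ^ j" by auto
 define r where "r = rec_nat (N 0) (%j k. max (Suc k) (N (Suc j)))"
 have r: "r (Suc j) > r j" "r j >= N j" for j by (auto simp: r_def) (cases j; simp add: r_def)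
 have "AE x in M. summable (%j. abs (f (r (Suc j)) x - f (r j) x))"
 proof (rule AE_summable_of_L1_summable)
  show "(LINT x|M. abs (f (r (Suc j)) x - f (r j) x)) <= (1/2) ^ j" for j
   using r[of j] by (intro N) auto
 qed (use f in \<open>auto intro: summable_geometric\<close>)
 hence "AE x in M. convergent (%n. f (r n) x)"
 proof eventually_elim
  case (elim x)
  hence "convergent (%n. \<Sum>j<n. f (r (Suc j)) x - f (r j) x)"
   by (simp add: summable_rabs_cancel flip: summable_iff_convergent)
  hence "convergent (%n. (\<Sum>j<n. f (r (Suc j)) x - f (r j) x) + f (r 0) x)" by (simp add: convergent_add_const_right_iff)
  thus ?case by (simp add: sum_lessThan_telescope[of "%j. f (r j) x"])
 qed
 thus ?thesis using r(1) by (intro exI[of _ r]) (simp add: strict_mono_Suc_iff)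
qed

context frac_sobolev
begin

definition weight :: "real^'n => real" where "weight x = (1 + norm x) powr - N2s"

definition kernel :: "real^'n => real" where "kernel h = min ((norm h)^2) 1/norm h powr N2s"

lemma weight_meas[measurable]: "weight \<in> borel_measurable borel" unfolding weight_def by measurable

lemma weight_pos: "weight x > 0"
 using norm_ge_zero[of x] by (simp add: weight_def add_nonneg_eq_0_iff)
lemma weight_nonneg: "weight x >= 0" by (rule less_imp_le[OF weight_pos])
lemma weight_le_1: "weight x <= 1"
 using N2s_pos ge_one_powr_ge_zero[of "1 + norm x" N2s] by (simp add: weight_def powr_minus_divide divide_le_eq)

lemma weight_comparable:
 assumes "1 + norm x <= c*(1 + norm z)" shows "weight z <= c powr N2s*weight x"
proof -
 have c: "c > 0" using assms norm_ge_zero[of x] norm_ge_zero[of z] by (smt (verit) mult_nonpos_nonneg)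
 have "(c*(1 + norm z)) powr - N2s <= (1 + norm x) powr - N2s"
  using assms N2s_pos by (intro powr_mono2') (auto simp: add_pos_nonneg)
 hence "c powr N2s*(c powr - N2s*weight z) <= c powr N2s*weight x"
  unfolding weight_def powr_mult by (intro mult_left_mono) auto
 thus ?thesis using c by (simp add: mult.assoc[symmetric] powr_add[symmetric])
qed

lemma weight_shift: "weight z <= (1 + norm y) powr N2s*weight (z + y)"
proof (rule weight_comparable)
 have "0 <= norm y*norm z" "(1 + norm y)*(1 + norm z) = 1 + norm z + norm y + norm y*norm z" by (auto simp: algebra_simps)
 thus "1 + norm (z + y) <= (1 + norm y)*(1 + norm z)" using norm_triangle_ineq[of z y] by linarith
qed

lemma weight_integrable: "integrable L weight"
 unfolding weight_def by (rule integrable_one_plus_norm_powr) (use s_pos in \<open>simp add: N2s_def\<close>)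

lemma weight_mult_integrable:
 fixes g :: "'n fn"
 assumes "integrable L g" shows "integrable L (%x. weight x*g x)"
 by (rule Bochner_Integration.integrable_bound[OF assms])
  (use assms in \<open>auto simp: abs_mult weight_nonneg weight_le_1 intro!: mult_left_le_one_le\<close>)

lemma weight_L2:
 assumes "L2 L g"
 shows "integrable L (%x. weight x*(g x)^2)" "(LINT x|L. weight x*(g x)^2) <= (LINT x|L. (g x)^2)"
proof -
 show i: "integrable L (%x. weight x*(g x)^2)" using L2D(2)[OF assms] by (rule weight_mult_integrable)
 show "(LINT x|L. weight x*(g x)^2) <= (LINT x|L. (g x)^2)"
  using i L2D(2)[OF assms] by (intro integral_mono) (auto simp: weight_nonneg weight_le_1 mult_left_le_one_le)
qed

definition rweight :: "'n fn" where "rweight x = sqrt (weight x)"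

lemma rweight_power2: "(rweight x)^2 = weight x" by (simp add: rweight_def weight_nonneg)
lemma rweight_pos: "rweight x > 0" by (simp add: rweight_def weight_pos)
lemma rweight_le_1: "rweight x <= 1" by (simp add: rweight_def weight_le_1)
lemma rweight_meas[measurable]: "rweight \<in> borel_measurable borel" unfolding rweight_def by measurable

lemma abs_rweight_mult_le: "abs (rweight x*t) <= abs t"
 using rweight_pos[of x] rweight_le_1[of x] by (simp add: abs_mult mult_left_le_one_le)

lemma L2_rweight: "L2 L g ==> L2 L (%x. rweight x*g x)"
 by (rule L2_mono) (auto simp: abs_rweight_mult_le L2_def)

lemma inverse_norm_powr_le_weight:
 assumes "norm h >= 1" shows "1/norm h powr N2s <= 2 powr N2s*weight h"
proof -
 have "(1 + norm h) powr N2s <= (2*norm h) powr N2s" using assms N2s_pos by (intro powr_mono2) auto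
 moreover have "norm h powr N2s > 0" "(1 + norm h) powr N2s > 0" using assms by (auto simp: add_nonneg_eq_0_iff)
 ultimately show ?thesis by (simp add: weight_def powr_minus powr_mult field_simps)
qed

lemma kernel_nonneg: "kernel h >= 0" by (simp add: kernel_def)

lemma kernel_integrable: "integrable L kernel"
proof (rule integrable_boundI)
 show "integrable L (%h. indicator (cball 0 1) h*norm h powr (2 - N2s) + 2 powr N2s*weight h)"
  using integrable_norm_powr_unit_ball[of "2 - N2s", where 'a="real^'n"] weight_integrable s_lt_1 by (simp add: N2s_def)
 show "abs (kernel h) <= indicator (cball 0 1) h*norm h powr (2 - N2s) + 2 powr N2s*weight h" for h
 proof (cases "norm h <= 1")
  case True
  have "(norm h)^2/norm h powr N2s = norm h powr (2 - N2s)" by (cases "h = 0") (auto simp: powr_diff powr_numeral)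
  thus ?thesis using True by (simp add: kernel_def min_def power_le_one weight_nonneg)
 next
  case False
  have "kernel h <= 1/norm h powr N2s" unfolding kernel_def by (intro divide_right_mono) auto
  thus ?thesis using False inverse_norm_powr_le_weight[of h] kernel_nonneg[of h] by simp
 qed
qed (auto simp: kernel_def[abs_def])

subsection \<open>Averages over dyadic cubes\<close>

definition cube_index :: "nat => real^'n => int^'n" where "cube_index k x = (\<chi> i. \<lfloor>2 ^ k*x $ i\<rfloor>)"
definition cube :: "nat => int^'n => (real^'n) set" where "cube k z = {y. cube_index k y = z}"
definition cube_vol :: "nat => real" where "cube_vol k = (1/2 ^ k) ^ CARD('n)"
definition cube_avg :: "nat => 'n fn => int^'n => real" where
 "cube_avg k u z = (LINT y|L. indicator (cube k z) y*u y)/cube_vol k"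
definition dyadic_avg :: "nat => 'n fn => 'n fn" where "dyadic_avg k u x = cube_avg k u (cube_index k x)"

lemma cube_vol_pos: "cube_vol k > 0" by (simp add: cube_vol_def)

lemma cube_meas[measurable]: "cube k z \<in> sets borel"
proof -
 have "cube k z = (\<Inter>i\<in>UNIV. {y \<in> space borel. \<lfloor>2 ^ k*y $ i\<rfloor> = z $ i})"
  by (auto simp: cube_def cube_index_def vec_eq_iff)
 moreover have "{y \<in> space borel. \<lfloor>2 ^ k*(y::real^'n) $ i\<rfloor> = z $ i} \<in> sets borel" for i
  by measurable
 ultimately show ?thesis by (auto intro!: sets.finite_INT)
qed

lemma cube_emeasure: "emeasure L (cube k z) = ennreal (cube_vol k)"
proof -
 define l :: "real^'n" where "l = (\<chi> i. of_int (z $ i)/2 ^ k)"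
 define r :: "real^'n" where "r = (\<chi> i. (of_int (z $ i) + 1)/2 ^ k)"
 have ineq: "\<lfloor>2 ^ k*t\<rfloor> = m \<longleftrightarrow> of_int m/2 ^ k <= t & t < (of_int m + 1)/2 ^ k" for t :: real and m
  by (auto simp: floor_eq_iff field_simps)
 have sub: "box l r \<subseteq> cube k z" "cube k z \<subseteq> cbox l r"
  by (auto simp: mem_box_cart cube_def cube_index_def vec_eq_iff ineq l_def r_def less_imp_le)
 have le: "b \<in> Basis ==> l \<bullet> b <= r \<bullet> b" for b
  by (auto simp: Basis_vec_def l_def r_def inner_axis divide_right_mono)
 have "(\<Prod>b\<in>Basis. (r - l) \<bullet> b) = (\<Prod>b\<in>(Basis :: (real^'n) set). 1/2 ^ k)"
  by (intro prod.cong) (auto simp: Basis_vec_def l_def r_def inner_axis diff_divide_distrib[symmetric])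
 also have "... = cube_vol k" by (simp add: cube_vol_def)
 finally have "emeasure L (box l r) = cube_vol k" "emeasure L (cbox l r) = cube_vol k"
  using le by (simp_all add: emeasure_lborel_box emeasure_lborel_cbox)
 thus ?thesis
  using emeasure_mono[OF sub(1), of L] emeasure_mono[OF sub(2), of L] by (auto intro: antisym)
qed

lemma cube_integral: "integrable L (indicator (cube k z) :: _ => real)"
  "(LINT y|L. indicator (cube k z) y) = cube_vol k"
 using cube_vol_pos[of k] by (auto simp: measure_def cube_emeasure)

lemma norm_diff_in_cube: assumes "cube_index k x = cube_index k y" shows "norm (x - y) <= real CARD('n)/2 ^ k"
proof -
 have "abs (x $ i - y $ i) <= 1/2 ^ k" for i
 proof -
  have "\<lfloor>2 ^ k*x $ i\<rfloor> = \<lfloor>2 ^ k*y $ i\<rfloor>" using assms by (simp add: cube_index_def vec_eq_iff)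
  hence "abs (2 ^ k*x $ i - 2 ^ k*y $ i) <= 1" by linarith
  thus ?thesis by (simp add: field_simps abs_le_iff)
 qed
 hence "norm (x - y) <= (\<Sum>i\<in>(UNIV::'n set). 1/2 ^ k)"
  by (intro order_trans[OF norm_le_l1_cart] sum_mono) auto
 thus ?thesis by simp
qed

lemma indicator_power2: "(indicator A x :: real)^2 = indicator A x" by (simp add: indicator_def)

lemma L2_cube: "L2 L (indicator (cube k z))"
 using cube_integral(1)[of k z] by (auto simp: L2_def indicator_power2)

lemma cube_mult_integrable: "L2 L u ==> integrable L (%y. indicator (cube k z) y*u y)"
 by (rule L2_mult_integrable[OF L2_cube])

lemma cube_integral_power2_le:
 assumes "f \<in> borel_measurable borel" "integrable L (%y. indicator (cube k z) y*(f y)^2)"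
 shows "(LINT y|L. abs (indicator (cube k z) y*f y))^2 <= cube_vol k*(LINT y|L. indicator (cube k z) y*(f y)^2)"
proof -
 have f: "L2 L (%y. indicator (cube k z) y*f y)"
  using assms by (auto simp: L2_def power_mult_distrib indicator_power2)
 show ?thesis
  using L2_Cauchy_Schwarz[OF L2_cube[of k z] f] cube_integral(2)[of k z]
  by (simp add: power_mult_distrib indicator_power2 flip: mult.assoc power2_eq_square)
qed

lemma cube_avg_le_Hnorm:
 assumes u: "u \<in> H" "Hnorm u <= C" shows "abs (cube_avg k u z) <= C/sqrt (cube_vol k)"
proof -
 let ?Q = "indicator (cube k z) :: real^'n => real"
 note u2 = L2D[OF H_L2[OF u(1)]]
 note [measurable] = H_meas[OF u(1)]
 have i: "integrable L (%y. ?Q y*(u y)^2)" by (rule integrable_boundI[OF u2(2)]) (auto simp: indicator_def)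
 have "(LINT y|L. abs (?Q y*u y))^2 <= cube_vol k*(LINT y|L. ?Q y*(u y)^2)" by (rule cube_integral_power2_le[OF _ i]) measurable
 also have "(LINT y|L. ?Q y*(u y)^2) <= (LINT y|L. (u y)^2)" using i u2(2) by (intro integral_mono) (auto simp: indicator_def)
 also have "... <= (Hnorm u)^2" by (simp add: Hnorm_power2_eq)
 also have "... <= C^2" using u(2) Hnorm_nonneg by (rule power_mono)
 finally have "(LINT y|L. abs (?Q y*u y))^2 <= (sqrt (cube_vol k)*C)^2"
  using cube_vol_pos[of k] by (simp add: power_mult_distrib mult_left_mono)
 hence "(LINT y|L. abs (?Q y*u y)) <= sqrt (cube_vol k)*C"
  by (rule power2_le_imp_le) (use u(2) Hnorm_nonneg[of u] cube_vol_pos[of k] in simp)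
 hence "abs (LINT y|L. ?Q y*u y) <= sqrt (cube_vol k)*C"
  by (rule order_trans[OF integral_abs_bound])
 hence "abs (cube_avg k u z) <= sqrt (cube_vol k)/cube_vol k*C"
  using cube_vol_pos[of k] by (simp add: cube_avg_def abs_divide divide_right_mono)
 thus ?thesis using cube_vol_pos[of k] by (simp add: sqrt_divide_self_eq inverse_eq_divide)
qed

lemma cube_avg_diff: "L2 L u ==> L2 L v ==> cube_avg k (%x. u x - v x) z = cube_avg k u z - cube_avg k v z"
 by (simp add: cube_avg_def right_diff_distrib cube_mult_integrable diff_divide_distrib)

lemma cube_avg_bound:
 assumes "L2 L u" "integrable L (%x. abs (u x) powr r)" "(LINT x|L. abs (u x) powr r) <= C" "C > 0" "r >= 1"
 shows "abs (cube_avg k u z) <= 2*(C/cube_vol k) powr (1/r)"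
proof -
 define lev where "lev = (C/cube_vol k) powr (1/r)"
 have lev: "lev > 0" "lev powr r = C/cube_vol k" using assms cube_vol_pos[of k] by (auto simp: lev_def powr_powr)
 have pt: "abs t <= lev + abs t powr r/lev powr (r - 1)" for t
 proof (cases "abs t <= lev")
  case False
  have "abs t*lev powr (r - 1) <= abs t*abs t powr (r - 1)"
   using False lev assms by (intro mult_left_mono powr_mono2) auto
  also have "... = abs t powr r" using False lev by (simp add: powr_mult_base)
  finally have "abs t <= abs t powr r/lev powr (r - 1)" using lev by (simp add: field_simps)
  thus ?thesis using lev by simp
 qed (use lev in \<open>auto intro: add_increasing2\<close>)
 have "abs (LINT y|L. indicator (cube k z) y*u y) <= (LINT y|L. abs (indicator (cube k z) y*u y))"
  by (rule integral_abs_bound)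
 also have "... <= (LINT y|L. lev*indicator (cube k z) y + abs (u y) powr r/lev powr (r - 1))"
 proof (intro integral_mono integrable_abs cube_mult_integrable assms(1))
  show "integrable L (%y. lev*indicator (cube k z) y + abs (u y) powr r/lev powr (r - 1))"
   using assms(2) cube_integral(1)[of k z] by auto
 qed (use pt lev in \<open>auto simp: indicator_def intro!: add_nonneg_nonneg\<close>)
 also have "... = lev * cube_vol k + (LINT y|L. abs (u y) powr r)/lev powr (r - 1)"
  using assms cube_integral[of k z] by simp
 also have "... <= lev * cube_vol k + C/lev powr (r - 1)"
  using assms lev by (intro add_left_mono divide_right_mono) auto
 also have "C/lev powr (r - 1) = lev * cube_vol k"
  using lev cube_vol_pos[of k] by (simp add: powr_diff field_simps)
 finally have "abs (LINT y|L. indicator (cube k z) y*u y) <= 2*lev * cube_vol k" by simp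
 thus ?thesis using cube_vol_pos[of k] by (simp add: cube_avg_def lev_def field_simps abs_divide)
qed

lemma cube_index_meas[measurable]: "cube_index k \<in> borel \<rightarrow>\<^sub>M count_space UNIV"
 by (rule measurable_count_space_eq_countable[THEN iffD2])
  (use cube_meas[of k] in \<open>auto simp: cube_def vimage_def\<close>)

lemma dyadic_avg_meas[measurable]: "dyadic_avg k u \<in> borel_measurable borel"
 unfolding dyadic_avg_def by measurable

definition avg_rate :: "nat => real" where
 "avg_rate k = real CARD('n) powr N2s*(2 powr (- 2 * s)) ^ k"

lemma avg_rate_nonneg: "avg_rate k >= 0" by (simp add: avg_rate_def)

lemma avg_rate_tendsto: "avg_rate ---> 0"
 unfolding avg_rate_def using s_pos
 by (intro tendsto_mult_right_zero LIMSEQ_power_zero) (simp add: powr_less_one)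

lemma avg_rate_eq: "(real CARD('n)/2 ^ k) powr N2s/cube_vol k = avg_rate k"
 unfolding avg_rate_def cube_vol_def
 by (simp add: powr_divide powr_realpow[symmetric] powr_powr N2s_def powr_minus powr_add field_simps)

lemma power2_diff_le_dquot:
 assumes "y \<in> cube k (cube_index k x)"
 shows "(u x - u y)^2 <= (real CARD('n)/2 ^ k) powr N2s*(dquot u (x, y))^2"
proof (cases "x = y")
 case False
 hence n: "0 < norm (x - y)" "norm (x - y) <= real CARD('n)/2 ^ k"
  using norm_diff_in_cube[of k x y] assms by (auto simp: cube_def)
 have "(u x - u y)^2 = norm (x - y) powr N2s*(dquot u (x, y))^2"
  using n(1) by (simp add: dquot_def power_divide power2_eq_square[of "_ powr _"] powr_add[symmetric])
 also have "... <= (real CARD('n)/2 ^ k) powr N2s*(dquot u (x, y))^2"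
  using n N2s_pos by (intro mult_right_mono powr_mono2) auto
 finally show ?thesis .
qed simp

lemma dyadic_avg_error_pointwise:
 assumes u: "u \<in> H" and i: "integrable L (%y. (dquot u (x, y))^2)"
 shows "(u x - dyadic_avg k u x)^2 <= avg_rate k*(LINT y|L. (dquot u (x, y))^2)"
proof -
 let ?Q = "indicator (cube k (cube_index k x)) :: real^'n => real" and ?c = "(real CARD('n)/2 ^ k) powr N2s"
 note [measurable] = H_meas[OF u]
 have bound: "?Q y*(u x - u y)^2 <= ?c*(dquot u (x, y))^2" for y
  using power2_diff_le_dquot[of y k x u] by (simp add: indicator_def)
 have Qi: "integrable L (%y. ?Q y*(u x - u y)^2)"
  by (rule Bochner_Integration.integrable_bound[OF integrable_mult_right[OF i, of ?c]]) (use bound in \<open>auto simp: abs_mult\<close>)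
 define D where "D = u x - dyadic_avg k u x"
 have "D*cube_vol k = (LINT y|L. ?Q y*(u x - u y))"
  using cube_integral[of k] cube_mult_integrable[OF H_L2[OF u]] cube_vol_pos[of k]
  by (simp add: D_def dyadic_avg_def cube_avg_def right_diff_distrib left_diff_distrib)
 hence "abs (D*cube_vol k) <= (LINT y|L. abs (?Q y*(u x - u y)))" by (simp add: integral_abs_bound del: abs_mult)
 hence "(D*cube_vol k)^2 <= (LINT y|L. abs (?Q y*(u x - u y)))^2" by (metis abs_ge_zero power2_abs power_mono)
 also have "... <= cube_vol k*(LINT y|L. ?Q y*(u x - u y)^2)"
  by (rule cube_integral_power2_le[OF _ Qi]) measurable
 finally have "D^2*cube_vol k <= (LINT y|L. ?Q y*(u x - u y)^2)"
  using cube_vol_pos[of k] by (simp add: power_mult_distrib power2_eq_square[of "cube_vol k"])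
 also have "... <= (LINT y|L. ?c*(dquot u (x, y))^2)" using Qi i bound by (intro integral_mono) auto
 finally show ?thesis
  using cube_vol_pos[of k] by (simp add: D_def field_simps flip: avg_rate_eq)
qed

lemma dyadic_avg_L2:
 assumes u: "u \<in> H"
 shows "L2 L (%x. u x - dyadic_avg k u x)" "(LINT x|L. (u x - dyadic_avg k u x)^2) <= avg_rate k*(Hnorm u)^2"
proof -
 note [measurable] = H_meas[OF u]
 define E where "E x = (LINT y|L. (dquot u (x, y))^2)" for x
 have int: "integrable LL (%z. (dquot u z)^2)" using u by (auto intro: L2D H_dquot_L2)
 have E: "integrable L E" "(LINT x|L. E x) = (LINT z|LL. (dquot u z)^2)"
  unfolding E_def using lborel_pair.integrable_fst'[OF int] lborel_pair.integral_fst'[OF int] by auto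
 have le: "AE x in L. (u x - dyadic_avg k u x)^2 <= avg_rate k*E x"
  using lborel_pair.AE_integrable_fst'[OF int] by eventually_elim (simp add: E_def dyadic_avg_error_pointwise[OF u])
 have i: "integrable L (%x. (u x - dyadic_avg k u x)^2)"
  using le by (intro Bochner_Integration.integrable_bound[OF integrable_mult_right[OF E(1), of "avg_rate k"]]) (auto elim: AE_mp)
 thus "L2 L (%x. u x - dyadic_avg k u x)" by (simp add: L2_def)
 have "(LINT x|L. (u x - dyadic_avg k u x)^2) <= (LINT x|L. avg_rate k*E x)" using i E(1) le by (intro integral_mono_AE) auto
 also have "... <= avg_rate k*(Hnorm u)^2" using avg_rate_nonneg by (simp add: E(2) Hnorm_power2_eq mult_left_mono)
 finally show "(LINT x|L. (u x - dyadic_avg k u x)^2) <= avg_rate k*(Hnorm u)^2" .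
qed

end

lemma power2_le_of_far:
 fixes t m l :: real
 assumes "abs m <= l" "abs t > 2*l" shows "t^2 <= 4*(t - m)^2"
proof -
 have "abs t <= abs (2*(t - m))" using assms by (simp add: abs_mult)
 hence "t^2 <= (2*(t - m))^2" by (simp only: abs_le_square_iff)
 thus ?thesis unfolding power_mult_distrib by simp
qed

lemma powr_le_power2_of_levels:
 fixes t q :: real and m lev :: "nat => real"
 assumes q: "q >= 2" and m: "!!k. abs (m k) <= lev k" and ex: "\<exists>k. abs t <= 2*lev k"
 shows "abs t powr q <= (2*lev 0) powr (q - 2)*t^2 \<or> (\<exists>i. abs t powr q <= 4*(2*lev (Suc i)) powr (q - 2)*(t - m i)^2)"
proof -
 define j where "j = (LEAST j. abs t <= 2*lev j)"
 have j: "abs t <= 2*lev j" unfolding j_def using ex by (rule LeastI_ex)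
 have sq: "abs t powr q = abs t powr (q - 2)*t^2"
  using powr_add[of "abs t" "q - 2" 2] by (cases "t = 0") (auto simp: powr_numeral)
 have low_power: "abs t powr (q - 2) <= (2*lev j) powr (q - 2)" using j q by (intro powr_mono2) auto
 show ?thesis
 proof (cases j)
  case 0
  thus ?thesis using low_power by (intro disjI1) (auto simp: sq intro: mult_right_mono)
 next
  case (Suc i)
  hence "abs t > 2*lev i" using not_less_Least[of i "%j. abs t <= 2*lev j"] by (auto simp: j_def)
  hence "t^2 <= 4*(t - m i)^2" by (rule power2_le_of_far[OF m])
  hence "abs t powr q <= (2*lev (Suc i)) powr (q - 2)*(4*(t - m i)^2)"
   unfolding sq using low_power Suc by (intro mult_mono) auto
  thus ?thesis by (intro disjI2 exI[of _ i]) (simp add: mult_ac)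
 qed
qed

context frac_sobolev
begin

subsection \<open>Subcritical Sobolev embedding\<close>

definition embedded :: "real => real => bool" where
 "embedded q C \<longleftrightarrow> (\<forall>u\<in>H. Hnorm u <= 1 --> integrable L (%x. abs (u x) powr q) & (LINT x|L. abs (u x) powr q) <= C)"

lemma dquot_le_Hnorm: "(LINT z|LL. (dquot u z)^2) <= (Hnorm u)^2"
 by (simp add: Hnorm_power2_eq)

lemma embedded_of_avg_levels:
 assumes q: "q >= 2" and lev: "!!t::real. \<exists>k. t <= 2*lev k"
  and av: "!!u k x. u \<in> H ==> Hnorm u <= 1 ==> abs (dyadic_avg k u x) <= lev k"
  and sum: "summable (%k. 4*(2*lev (Suc k)) powr (q - 2)*avg_rate k)"
 shows "\<exists>C. embedded q C"
proof -
 define c where "c k = (case k of 0 => (2*lev 0) powr (q - 2) | Suc j => 4*(2*lev (Suc j)) powr (q - 2)*avg_rate j)" for k :: nat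
 have c: "summable c" using sum by (subst summable_Suc_iff[symmetric]) (simp add: c_def)
 have "embedded q (suminf c)"
  unfolding embedded_def
 proof (intro ballI impI)
  fix u assume u: "u \<in> H" "Hnorm u <= 1"
  note [measurable] = H_meas[OF u(1)]
  have unit: "(Hnorm u)^2 <= 1" using u Hnorm_nonneg[of u] by (simp add: power_le_one)
  define g where "g k x = (case k of 0 => (2*lev 0) powr (q - 2)*(u x)^2
    | Suc j => 4*(2*lev (Suc j)) powr (q - 2)*(u x - dyadic_avg j u x)^2)" for k :: nat and x
  have int: "integrable L (g k)" for k
   using H_L2[OF u(1)] dyadic_avg_L2(1)[OF u(1)] by (cases k) (auto simp: g_def[abs_def] intro: L2D)
  have nonneg: "0 <= g k x" for k x by (cases k) (auto simp: g_def)
  have g_le: "(LINT x|L. g k x) <= c k" for k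
  proof (cases k)
   case 0
   thus ?thesis using L2_le_Hnorm[of u] unit mult_left_mono[of "LINT x|L. (u x)^2" 1 "(2*lev 0) powr (q - 2)"]
    by (simp add: g_def c_def)
  next
   case (Suc j)
   have "(LINT x|L. (u x - dyadic_avg j u x)^2) <= avg_rate j"
    using dyadic_avg_L2(2)[OF u(1), of j] mult_left_mono[OF unit avg_rate_nonneg[of j]] by simp
   thus ?thesis using Suc by (simp add: g_def c_def mult_left_mono)
  qed
  have ex: "\<exists>k. abs (u x) powr q <= g k x" for x
   using powr_le_power2_of_levels[OF q, where m="%k. dyadic_avg k u x" and lev=lev and t="u x", OF av[OF u] lev]
  proof (elim disjE exE)
   assume "abs (u x) powr q <= (2*lev 0) powr (q - 2)*(u x)^2"
   thus ?thesis by (intro exI[of _ 0]) (simp add: g_def)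
  next
   fix i assume "abs (u x) powr q <= 4*(2*lev (Suc i)) powr (q - 2)*(u x - dyadic_avg i u x)^2"
   thus ?thesis by (intro exI[of _ "Suc i"]) (simp add: g_def)
  qed
  have "(%x. abs (u x) powr q) \<in> borel_measurable L" by measurable
  from integral_suminf_bound[OF this powr_ge_zero int nonneg g_le c ex]
  show "integrable L (%x. abs (u x) powr q) & (LINT x|L. abs (u x) powr q) <= suminf c" by blast
 qed
 thus ?thesis ..
qed

lemma embedded_improve:
 assumes emb: "embedded r C" and r: "r >= 2" and q: "2 <= q" "q < 2 + 2 * s * r/real CARD('n)"
 shows "\<exists>C'. embedded q C'"
proof (rule embedded_of_avg_levels[OF q(1)])
 define C1 where "C1 = max C 1"
 define A where "A = 2*C1 powr (1/r)"
 define rho where "rho = 2 powr (real CARD('n)/r)"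
 have C1: "C1 > 0" "C <= C1" by (auto simp: C1_def)
 have A: "A > 0" and rho: "rho > 1" using C1 r by (simp_all add: A_def rho_def)
 let ?lev = "%k. A*rho ^ k"
 show "\<exists>k. t <= 2*?lev k" for t
 proof -
  obtain k where "t/(2*A) < rho ^ k" using real_arch_pow[OF rho] by blast
  thus ?thesis using A by (intro exI[of _ k]) (auto simp: field_simps)
 qed
 show "abs (dyadic_avg k u x) <= ?lev k" if u: "u \<in> H" "Hnorm u <= 1" for u k x
 proof -
  have "integrable L (%x. abs (u x) powr r)" "(LINT x|L. abs (u x) powr r) <= C1"
   using emb u C1 by (force simp: embedded_def)+
  hence "abs (dyadic_avg k u x) <= 2*(C1/cube_vol k) powr (1/r)"
   unfolding dyadic_avg_def using H_L2[OF u(1)] C1(1) r by (intro cube_avg_bound) auto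
  also have "... = ?lev k"
   using C1 by (simp add: A_def rho_def cube_vol_def powr_mult power_one_over divide_inverse power_inverse power_mult[symmetric]
     powr_powr powr_realpow[symmetric] mult_ac)
  finally show ?thesis .
 qed
 have "4*(2*?lev (Suc k)) powr (q - 2)*avg_rate k
  = 4*(2*A*rho) powr (q - 2)*real CARD('n) powr N2s*(rho powr (q - 2)*2 powr (- 2 * s)) ^ k" for k
  using A rho by (simp add: avg_rate_def powr_mult power_mult_distrib powr_realpow[symmetric] powr_powr mult_ac)
 moreover have "rho powr (q - 2)*2 powr (- 2 * s) = 2 powr (real CARD('n)/r*(q - 2) + - 2 * s)"
  unfolding rho_def powr_powr powr_add ..
 moreover have "real CARD('n)/r*(q - 2) + - 2 * s < 0" using q r by (simp add: field_simps)
 ultimately show "summable (%k. 4*(2*?lev (Suc k)) powr (q - 2)*avg_rate k)"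
  by (simp only:) (intro summable_mult summable_geometric, simp add: powr_less_one)
qed

abbreviation critical_exponent :: "'n itself => real" where "critical_exponent _ \<equiv> 2*real CARD('n)/(real CARD('n) - 2 * s)"

lemma embedded_2: "embedded 2 1"
 unfolding embedded_def
proof (intro ballI impI)
 fix u assume u: "u \<in> H" "Hnorm u <= 1"
 have e: "abs (u x) powr 2 = (u x)^2" for x by (simp add: powr_numeral)
 have "(LINT x|L. (u x)^2) <= 1" using L2_le_Hnorm[of u] power_le_one[OF Hnorm_nonneg u(2), of 2] by linarith
 thus "integrable L (%x. abs (u x) powr 2) & (LINT x|L. abs (u x) powr 2) <= 1"
  using L2D(2)[OF H_L2[OF u(1)]] by (simp add: e)
qed

lemma embedded_subcritical:
 assumes q: "2 <= q" "q < critical_exponent TYPE('n)"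
 shows "\<exists>C. embedded q C"
proof (rule ccontr)
 assume no: "\<nexists>C. embedded q C"
 define N where "N = real CARD('n)"
 have N: "0 < 2 * s" "2 * s < N" using s_pos s_lt_N by (auto simp: N_def)
 define S where "S = {r. 2 <= r & r <= q & (\<exists>C. embedded r C)}"
 define R where "R = Sup S"
 have S2: "2 \<in> S" and bdd: "bdd_above S" using embedded_2 q by (auto simp: S_def bdd_above_def)
 have R: "2 <= R" "R <= q"
  unfolding R_def using cSup_upper[OF S2 bdd] S2 by (auto simp: S_def intro!: cSup_least)
 define gap where "gap = (2 + 2 * s*(R/N) - R)/2"
 have "q*(N - 2 * s) < 2*N" using N q by (simp add: N_def field_simps)
 moreover have "R*(N - 2 * s) <= q*(N - 2 * s)" using R N by (intro mult_right_mono) auto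
 ultimately have gap: "gap > 0" using N by (simp add: gap_def field_simps)
 obtain r where r: "r \<in> S" "R - gap < r"
  using less_cSupD[of S "R - gap"] S2 gap unfolding R_def[symmetric] by auto
 have "r <= R" unfolding R_def using r(1) bdd by (rule cSup_upper)
 have "2 * s/N*(R - r) <= 1*(R - r)" using N \<open>r <= R\<close> by (intro mult_right_mono) auto
 hence "2 * s*(R/N) - 2 * s * r/N < gap" using r(2) by (simp add: right_diff_distrib)
 moreover have "R + gap = 2 + 2 * s*(R/N) - gap" by (simp add: gap_def field_simps)
 moreover define t where "t = min q (R + gap)"
 ultimately have "t < 2 + 2 * s * r/N" by linarith
 moreover have t2: "2 <= t" using q R gap by (auto simp: t_def)
 moreover obtain C where "embedded r C" "2 <= r" using r by (auto simp: S_def)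
 ultimately obtain C' where C': "embedded t C'" using embedded_improve[of r C t] by (auto simp: N_def)
 hence "t \<in> S" using t2 by (auto simp: S_def t_def)
 hence "t <= R" unfolding R_def using bdd by (rule cSup_upper)
 hence "t = q" using gap by (auto simp: t_def min_def split: if_splits)
 thus False using C' no by auto
qed

definition sobolev :: "real => real => bool" where
 "sobolev q C \<longleftrightarrow> C > 0 & (\<forall>u\<in>H. integrable L (%x. abs (u x) powr q) & (LINT x|L. abs (u x) powr q) <= C*Hnorm u powr q)"

lemma sobolev_inequality:
 assumes q: "2 <= q" "q < critical_exponent TYPE('n)"
 shows "\<exists>C. sobolev q C"
proof -
 obtain C0 where C0: "embedded q C0" using embedded_subcritical[OF q] by blast
 define C where "C = max C0 1"
 have C: "C > 0" "C0 <= C" by (auto simp: C_def)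
 have "integrable L (%x. abs (u x) powr q) & (LINT x|L. abs (u x) powr q) <= C*Hnorm u powr q" if u: "u \<in> H" for u
 proof (cases "Hnorm u > 0")
  case False
  hence ae: "AE x in L. abs (u x) powr q = 0" using Hnorm_pos_iff[OF u] by auto
  note [measurable] = H_meas[OF u]
  have "integrable L (%x. abs (u x) powr q)"
   using ae by (intro integrable_cong_AE_imp[OF integrable_zero]) auto
  moreover have "(LINT x|L. abs (u x) powr q) = 0" using ae by (rule integral_eq_zero_AE)
  ultimately show ?thesis using C by simp
 next
  case h: True
  let ?v = "%x. abs (u x) powr q/Hnorm u powr q"
  have e: "(%x. abs (normalized u x) powr q) = ?v"
   using h by (simp add: normalized_def abs_mult powr_divide fun_eq_iff)
  have i: "integrable L ?v" "(LINT x|L. ?v x) <= C0"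
   using C0[unfolded embedded_def, rule_format, OF H_normalized[OF u] eq_refl[OF Hnorm_normalized[OF h]]] unfolding e by auto
  from integrable_mult_right[OF i(1), of "Hnorm u powr q"]
  have "integrable L (%x. abs (u x) powr q)" using h by simp
  moreover have "(LINT x|L. abs (u x) powr q) <= C*Hnorm u powr q"
   using order_trans[OF i(2) C(2)] h by (simp add: field_simps)
  ultimately show ?thesis ..
 qed
 thus ?thesis using C(1) unfolding sobolev_def by blast
qed

subsection \<open>Compactness of bounded sequences\<close>

lemma dyadic_avg_weighted_limit:
 assumes v: "!!n. v n \<in> H" "!!n. Hnorm (v n) <= C" and conv: "!!z. convergent (%n. cube_avg k (v n) z)"
 obtains l where "l \<in> borel_measurable borel" "!!x. abs (l x) <= C/sqrt (cube_vol k)"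
  "(%n. LINT x|L. weight x*(dyadic_avg k (v n) x - l x)^2) ---> 0"
proof
 define K where "K = C/sqrt (cube_vol k)"
 define l where "l x = lim (%n. dyadic_avg k (v n) x)" for x
 have l: "(%n. dyadic_avg k (v n) x) ---> l x" for x
  using conv by (simp add: dyadic_avg_def l_def convergent_LIMSEQ_iff)
 show [measurable]: "l \<in> borel_measurable borel"
  by (rule borel_measurable_LIMSEQ_real[OF l]) auto
 have K: "abs (dyadic_avg k (v n) x) <= K" for n x
  unfolding dyadic_avg_def K_def by (rule cube_avg_le_Hnorm[OF v])
 show lK: "abs (l x) <= C/sqrt (cube_vol k)" for x
  using LIMSEQ_le_const2[OF tendsto_rabs[OF l]] K unfolding K_def by blast
 have "(%n. LINT x|L. weight x*(dyadic_avg k (v n) x - l x)^2) ---> (LINT x|L. 0)"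
 proof (rule integral_dominated_convergence[where w="%x. weight x*(2*K)^2"])
  show "AE x in L. (%n. weight x*(dyadic_avg k (v n) x - l x)^2) ---> 0"
   using l by (auto intro!: AE_I2 tendsto_eq_intros)
  have "abs (dyadic_avg k (v n) x - l x) <= abs (2*K)" for n x using K[of n x] lK[of x] unfolding K_def by linarith
  hence "(dyadic_avg k (v n) x - l x)^2 <= (2*K)^2" for n x by (simp only: abs_le_square_iff)
  thus "AE x in L. norm (weight x*(dyadic_avg k (v n) x - l x)^2) <= weight x*(2*K)^2" for n
   by (simp add: abs_mult weight_nonneg mult_left_mono)
 qed (use weight_integrable in auto)
 thus "(%n. LINT x|L. weight x*(dyadic_avg k (v n) x - l x)^2) ---> 0" by simp
qed

lemma weighted_distance_le_averages:
 assumes v: "v \<in> H" "Hnorm v <= C" and w: "w \<in> H" "Hnorm w <= C"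
  and l[measurable]: "l \<in> borel_measurable borel" and b: "!!x. abs (l x) <= B"
 shows "(LINT x|L. weight x*(v x - w x)^2) <= 4*(LINT x|L. weight x*(dyadic_avg k v x - l x)^2)
   + 4*(LINT x|L. weight x*(dyadic_avg k w x - l x)^2) + 8*(avg_rate k*C^2)"
proof -
 let ?d = "%v x. v x - dyadic_avg k v x" and ?l = "%v x. dyadic_avg k v x - l x"
 have C: "(Hnorm g)^2 <= C^2" if "Hnorm g <= C" for g using that Hnorm_nonneg by (intro power_mono)
 have d: "integrable L (%x. weight x*(?d g x)^2)" "(LINT x|L. weight x*(?d g x)^2) <= avg_rate k*C^2" if "g \<in> H" "Hnorm g <= C" for g
  using weight_L2[OF dyadic_avg_L2(1)[OF that(1)]] dyadic_avg_L2(2)[OF that(1), of k] mult_left_mono[OF C[OF that(2)] avg_rate_nonneg[of k]]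
  by (blast, fastforce intro: order_trans)
 have il: "integrable L (%x. weight x*(?l g x)^2)" if g: "g \<in> H" for g
 proof (rule integrable_boundI)
  show "integrable L (%x. weight x*(Hnorm g/sqrt (cube_vol k) + B)^2)" using weight_integrable by simp
  have "abs (?l g x) <= abs (Hnorm g/sqrt (cube_vol k) + B)" for x
   using cube_avg_le_Hnorm[OF g order_refl, of k "cube_index k x"] b[of x] unfolding dyadic_avg_def by linarith
  hence "(?l g x)^2 <= (Hnorm g/sqrt (cube_vol k) + B)^2" for x by (simp only: abs_le_square_iff)
  thus "abs (weight x*(?l g x)^2) <= weight x*(Hnorm g/sqrt (cube_vol k) + B)^2" for x
   by (simp add: abs_mult weight_nonneg mult_left_mono)
 qed measurable
 have power2_sum4_le: "(a + b - c - e)^2 <= 4*a^2 + 4*b^2 + 4*c^2 + 4*e^2" for a b c e :: real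
 proof -
  have "4*a^2 + 4*b^2 + 4*c^2 + 4*e^2 - (a + b - c - e)^2 = (a - b)^2 + (a + c)^2 + (a + e)^2 + (b + c)^2 + (b + e)^2 + (c - e)^2"
   by (simp add: power2_eq_square algebra_simps)
  thus ?thesis by (smt (verit) zero_le_power2)
 qed
 have "(v x - w x)^2 <= 4*(?d v x)^2 + 4*(?l v x)^2 + 4*(?l w x)^2 + 4*(?d w x)^2" for x
  using power2_sum4_le[of "?d v x" "?l v x" "?l w x" "?d w x"] by (simp add: algebra_simps)
 from mult_left_mono[OF this weight_nonneg]
 have "(LINT x|L. weight x*(v x - w x)^2) <= (LINT x|L. 4*(weight x*(?d v x)^2) + 4*(weight x*(?l v x)^2) + 4*(weight x*(?l w x)^2) + 4*(weight x*(?d w x)^2))"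
  using d(1)[OF v] d(1)[OF w] il v w weight_L2(1)[OF L2_diff[OF H_L2[OF v(1)] H_L2[OF w(1)]]]
  by (intro integral_mono Bochner_Integration.integrable_add integrable_mult_right) (auto simp: algebra_simps)
 also have "... = 4*(LINT x|L. weight x*(?d v x)^2) + 4*(LINT x|L. weight x*(?l v x)^2) + 4*(LINT x|L. weight x*(?l w x)^2) + 4*(LINT x|L. weight x*(?d w x)^2)"
  using d(1)[OF v] d(1)[OF w] il v w by simp
 finally show ?thesis using d(2)[OF v] d(2)[OF w] by linarith
qed

lemma weighted_Cauchy_of_averages:
 assumes v: "!!n. v n \<in> H" "!!n. Hnorm (v n) <= C" and conv: "!!k z. convergent (%n. cube_avg k (v n) z)" and e: "e > 0"
 shows "tail_le (%n m. LINT x|L. weight x*(v n x - v m x)^2) e"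
proof -
 have "(%k. avg_rate k*C^2) ---> 0" using avg_rate_tendsto by (rule tendsto_mult_left_zero)
 hence "\<forall>\<^sub>F k in sequentially. avg_rate k*C^2 < e/16" using e by (intro order_tendstoD(2)) auto
 then obtain k where k: "avg_rate k*C^2 < e/16" by (auto simp: eventually_sequentially)
 obtain l where l: "l \<in> borel_measurable borel" "!!x. abs (l x) <= C/sqrt (cube_vol k)"
  and lim: "(%n. LINT x|L. weight x*(dyadic_avg k (v n) x - l x)^2) ---> 0"
  by (rule dyadic_avg_weighted_limit[OF v conv, of k]) blast
 from order_tendstoD(2)[OF lim, of "e/16"] e
 obtain n0 where n0: "!!n. n >= n0 ==> (LINT x|L. weight x*(dyadic_avg k (v n) x - l x)^2) < e/16"
  by (auto simp: eventually_sequentially)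
 have "(LINT x|L. weight x*(v n x - v m x)^2) <= e" if "n >= n0" "m >= n0" for n m
  using weighted_distance_le_averages[OF v v l, of n m k] n0[OF that(1)] n0[OF that(2)] k by linarith
 thus ?thesis by blast
qed

lemma weighted_L1_Cauchy_of_L2:
 assumes v: "!!n. L2 L (v n)" and cau: "!!e. e > 0 ==> tail_le (%n m. LINT x|L. weight x*(v n x - v m x)^2) e" and e: "e > 0"
 shows "tail_le (%n m. LINT x|L. abs (weight x * v n x - weight x * v m x)) e"
proof -
 define M where "M = (LINT x|L. weight x)"
 have M: "M >= 0" by (simp add: M_def weight_nonneg)
 define t where "t = e/(2*(M + 1))"
 have t: "t > 0" "t*M <= e/2" using e M by (auto simp: t_def field_simps)
 obtain n0 where n0: "!!n m. n >= n0 ==> m >= n0 ==> (LINT x|L. weight x*(v n x - v m x)^2) <= t*(e/2)"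
  using cau[of "t*(e/2)"] t e by auto
 have "(LINT x|L. abs (weight x * v n x - weight x * v m x)) <= e" if "n >= n0" "m >= n0" for n m
 proof -
  note i = weight_L2(1)[OF L2_diff[OF v[of n] v[of m]]]
  have "abs (weight x * v n x - weight x * v m x) <= t*weight x + (1/t)*(weight x*(v n x - v m x)^2)" for x
  proof -
   have "weight x*abs (v n x - v m x) <= weight x*(t + (v n x - v m x)^2/t)"
    using weighted_AM_GM[OF t(1), of 1 "v n x - v m x"] by (intro mult_left_mono weight_nonneg) simp
   thus ?thesis by (simp add: abs_mult weight_nonneg distrib_left mult.commute[of t] flip: right_diff_distrib)
  qed
  hence "(LINT x|L. abs (weight x * v n x - weight x * v m x)) <= (LINT x|L. t*weight x + (1/t)*(weight x*(v n x - v m x)^2))"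
   by (rule integral_mono'[rotated]) (use i weight_integrable t in \<open>simp_all add: weight_nonneg\<close>)
  also have "... = t*M + (1/t)*(LINT x|L. weight x*(v n x - v m x)^2)" using i weight_integrable by (simp add: M_def)
  also have "... <= e/2 + (1/t)*(t*(e/2))" using t n0[OF that] by (intro add_mono mult_left_mono) auto
  finally show ?thesis using t by simp
 qed
 thus ?thesis by blast
qed

lemma bounded_seq_AE_subseq:
 assumes u: "!!n. u n \<in> H" "!!n. Hnorm (u n) <= C"
 obtains r v where "strict_mono (r :: nat => nat)" "v \<in> borel_measurable borel" "AE x in L. (%n. u (r n) x) ---> v x"
  "!!e. e > 0 ==> tail_le (%n m. LINT x|L. weight x*(u (r n) x - u (r m) x)^2) e"
proof -
 have "bounded (range (%n. cube_avg (fst i) (u n) (snd i)))" for i :: "nat \<times> (int^'n)"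
   unfolding bounded_iff by (intro exI[of _ "C/sqrt (cube_vol (fst i))"]) (auto intro: cube_avg_le_Hnorm[OF u])
 then obtain d where d: "strict_mono (d :: nat => nat)" "!!i. convergent (%n. cube_avg (fst i) (u (d n)) (snd i))"
  using diagonal_convergent_subsequence[of "%i n. cube_avg (fst i) (u n) (snd i)"] by blast
 have "convergent (%n. cube_avg k (u (d n)) z)" for k z using d(2)[of "(k, z)"] by simp
 note cau = weighted_Cauchy_of_averages[of "%n. u (d n)", OF u this]
 have "integrable L (%x. weight x*u (d n) x)" for n
 proof (rule integrable_boundI)
  show "integrable L (%x. weight x + weight x*(u (d n) x)^2)"
   using weight_integrable weight_L2(1)[OF H_L2[OF u(1)]] by simp
  show "abs (weight x*u (d n) x) <= weight x + weight x*(u (d n) x)^2" for x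
   using mult_left_mono[OF weighted_AM_GM[of 1 1 "u (d n) x"] weight_nonneg[of x]] by (simp add: abs_mult weight_nonneg distrib_left)
 qed (use H_meas[OF u(1)] in measurable)
 from L1_Cauchy_AE_convergent_subseq[OF this weighted_L1_Cauchy_of_L2[OF H_L2[OF u(1)] cau]]
 obtain g where g: "strict_mono g" "AE x in L. convergent (%n. weight x*u (d (g n)) x)" by blast
 show thesis
 proof
  show "strict_mono (d \<circ> g)" using d(1) g(1) by (rule strict_mono_o)
  note [measurable] = H_meas[OF u(1)]
  show "(%x. lim (%n. u (d (g n)) x)) \<in> borel_measurable borel" by measurable
  show "AE x in L. (%n. u ((d \<circ> g) n) x) ---> lim (%n. u (d (g n)) x)"
   using g(2)
  proof eventually_elim
   case (elim x)
   hence "convergent (%n. u (d (g n)) x)" using weight_pos[of x] by (simp add: convergent_mult_const_iff)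
   thus ?case by (simp add: convergent_LIMSEQ_iff)
  qed
  fix e :: real assume "e > 0"
  then obtain n0 where n0: "!!n m. n >= n0 ==> m >= n0 ==> (LINT x|L. weight x*(u (d n) x - u (d m) x)^2) <= e" using cau by blast
  have "n0 <= g n" if "n0 <= n" for n using seq_suble[OF g(1), of n] that by linarith
  thus "tail_le (%n m. LINT x|L. weight x*(u ((d \<circ> g) n) x - u ((d \<circ> g) m) x)^2) e"
   using n0 by (intro exI[of _ n0]) simp
 qed
qed

lemma weak_limit:
 assumes "!!n. u n \<in> H" "!!n. Hnorm (u n) <= C" "v \<in> borel_measurable borel" "AE x in L. (%n. u n x) ---> v x"
 shows "v \<in> H" "g \<in> H ==> (%n. Hinner (u n) g) ---> Hinner v g" "Hnorm v <= C"
proof -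
 have C: "C >= 0" using assms(2)[of 0] Hnorm_nonneg[of "u 0"] by linarith
 have sq: "(Hnorm (u n))^2 <= C^2" for n using assms(2)[of n] Hnorm_nonneg by (intro power_mono) auto
 have b: "(LINT x|L. (u n x)^2) <= C^2" "(LINT z|LL. (dquot (u n) z)^2) <= C^2" for n
  using sq[of n] L2_le_Hnorm[of "u n"] dquot_le_Hnorm[of "u n"] by auto
 have ae: "AE z in LL. (%n. dquot (u n) z) ---> dquot v z"
  using AE_pair[OF assms(4)]
 proof eventually_elim
  case (elim z)
  have "(%n. (u n (fst z) - u n (snd z))/norm (fst z - snd z) powr (N2s/2)) ---> (v (fst z) - v (snd z))/norm (fst z - snd z) powr (N2s/2)"
   using elim unfolding divide_inverse by (intro tendsto_intros)
  thus ?case by (simp add: dquot_def)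
 qed
 have s1: "L2 L v" using L2_fatou(1)[OF H_L2[OF assms(1)] assms(4) _ b(1)] assms(3) by simp
 have s2: "L2 LL (dquot v)" using L2_fatou(1)[OF H_dquot_L2[OF assms(1)] ae _ b(2)] assms(3) by simp
 show vH: "v \<in> H" using s1 s2 by (simp add: H_iff)
 show w: "(%n. Hinner (u n) g) ---> Hinner v g" if "g \<in> H" for g
  unfolding Hinner_def
  using L2_weak_limit[OF H_L2[OF assms(1)] assms(4) s1 H_L2[OF that] b(1)]
   L2_weak_limit[OF H_dquot_L2[OF assms(1)] ae s2 H_dquot_L2[OF that] b(2)] by (rule tendsto_add)
 have "(Hnorm v)^2 <= C*Hnorm v"
  unfolding Hnorm_power2
 proof (rule LIMSEQ_le_const2[OF w[OF vH]], intro exI allI impI)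
  fix n show "Hinner (u n) v <= C*Hnorm v"
   using Hinner_Cauchy_Schwarz[OF assms(1) vH, of n] mult_right_mono[OF assms(2)[of n] Hnorm_nonneg[of v]] by linarith
 qed
 thus "Hnorm v <= C" using Hnorm_nonneg[of v] C by (cases "Hnorm v = 0") (auto simp: power2_eq_square)
qed

lemma weighted_L2_limit:
 assumes u: "!!n. L2 L (u n)" and v: "L2 L v" and ae: "AE x in L. (%n. u n x) ---> v x"
  and cau: "!!e. e > 0 ==> tail_le (%n m. LINT x|L. weight x*(u n x - u m x)^2) e"
 shows "(%n. LINT x|L. weight x*(u n x - v x)^2) ---> 0"
proof (rule LIMSEQ_I)
 fix r :: real assume r: "r > 0"
 then obtain n0 where n0: "!!n m. n >= n0 ==> m >= n0 ==> (LINT x|L. weight x*(u n x - u m x)^2) <= r/2"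
  using cau[of "r/2"] by auto
 have bound: "(LINT x|L. weight x*(u n x - v x)^2) <= r/2" if n: "n >= n0" for n
 proof -
  have "(LINT x|L. (rweight x*(u n x - v x))^2) <= r/2"
  proof (rule L2_fatou(2)[where f="%m x. rweight x*(u n x - u (m + n0) x)"])
   show "AE x in L. (%m. rweight x*(u n x - u (m + n0) x)) ---> rweight x*(u n x - v x)"
    using ae by eventually_elim (intro tendsto_intros LIMSEQ_ignore_initial_segment)
   show "(LINT x|L. (rweight x*(u n x - u (m + n0) x))^2) <= r/2" for m
    using n0[OF n, of "m + n0"] by (simp add: power_mult_distrib rweight_power2)
  qed (use L2_rweight L2_diff u v L2D(1) in blast)+
  thus ?thesis by (simp add: power_mult_distrib rweight_power2)
 qed
 have "0 <= (LINT x|L. weight x*(u n x - v x)^2)" for n by (simp add: weight_nonneg)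
 hence "norm ((LINT x|L. weight x*(u n x - v x)^2) - 0) < r" if "n >= n0" for n
  using bound[OF that] r by simp
 thus "\<exists>n0. \<forall>n\<ge>n0. norm ((LINT x|L. weight x*(u n x - v x)^2) - 0) < r" by blast
qed

lemma rellich:
 assumes u: "!!n. u n \<in> H" "!!n. Hnorm (u n) <= C"
 obtains r v where "strict_mono (r :: nat => nat)" "v \<in> H" "Hnorm v <= C" "AE x in L. (%n. u (r n) x) ---> v x"
  "(%n. LINT x|L. weight x*(u (r n) x - v x)^2) ---> 0" "!!g. g \<in> H ==> (%n. Hinner (u (r n)) g) ---> Hinner v g"
proof -
 obtain r v where r: "strict_mono r" "v \<in> borel_measurable borel" "AE x in L. (%n. u (r n) x) ---> v x"
  and cau: "!!e. e > 0 ==> tail_le (%n m. LINT x|L. weight x*(u (r n) x - u (r m) x)^2) e"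
  by (rule bounded_seq_AE_subseq[of u C, OF u]) blast
 note w = weak_limit[of "%n. u (r n)", OF u(1) u(2) r(2,3)]
 show thesis
  by (rule that[OF r(1) w(1) w(3) r(3) weighted_L2_limit[OF H_L2[OF u(1)] H_L2[OF w(1)] r(3) cau] w(2)])
qed

lemma H_complete:
 assumes u: "!!n. u n \<in> H" and cau: "!!e. e > 0 ==> tail_le (%n m. Hdist (u n) (u m)) e"
 obtains v where "v \<in> H" "(%n. Hdist (u n) v) ---> 0"
proof -
 obtain n0 where n0: "!!n. n >= n0 ==> Hdist (u n) (u n0) <= 1" using cau[of 1] by auto
 define C where "C = 1 + Hnorm (u n0)"
 have b: "Hnorm (u (n + n0)) <= C" for n
  using n0[of "n + n0"] Hnorm_triangle[OF H_diff[OF u[of "n + n0"] u[of n0]] u[of n0]] by (simp add: C_def)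
 obtain phi v where phi: "strict_mono phi" "v \<in> H" "AE x in L. (%n. u (phi n + n0) x) ---> v x"
  by (rule rellich[of "%n. u (n + n0)" C]) (use u b in auto)
 have "(%n. Hdist (u n) v) ---> 0"
 proof (rule LIMSEQ_I)
  fix r :: real assume r: "r > 0"
  then obtain n1 where n1: "!!n m. n >= n1 ==> m >= n1 ==> Hdist (u n) (u m) <= r/2"
   using cau[of "r/2"] by auto
  have "Hdist (u n) v <= r/2" if n: "n >= n1" for n
  proof (rule weak_limit(3)[where u="%m x. u n x - u (phi (m + n1) + n0) x"])
   show "Hnorm (%x. u n x - u (phi (m + n1) + n0) x) <= r/2" for m
    using n1[OF n, of "phi (m + n1) + n0"] seq_suble[OF phi(1), of "m + n1"] by linarith
   show "AE x in L. (%m. u n x - u (phi (m + n1) + n0) x) ---> u n x - v x"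
    using phi(3)
   proof eventually_elim
    case (elim x)
    thus ?case using LIMSEQ_ignore_initial_segment[OF elim, of n1] by (intro tendsto_intros)
   qed
  qed (use H_diff[OF u phi(2)] H_diff[OF u u] H_meas in auto)
  thus "\<exists>n1. \<forall>n\<ge>n1. norm (Hdist (u n) v - 0) < r"
  proof (intro exI[of _ n1] allI impI)
   fix n assume "n >= n1"
   show "norm (Hdist (u n) v - 0) < r"
    using \<open>!!n. n >= n1 ==> _ <= r / 2\<close>[OF \<open>n >= n1\<close>] r Hnorm_nonneg[of "%x. u n x - v x"] by simp
  qed
 qed
 thus ?thesis using that phi(2) by blast
qed

end

lemma powr_diff_le:
 fixes x y r :: real
 assumes "r >= 1" "x >= 0" "y >= 0"
 shows "abs (x powr r - y powr r) <= r*(x + y) powr (r - 1)*abs (x - y)"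
proof -
 have ordered: "y powr r - x powr r <= r*(x + y) powr (r - 1)*(y - x)" if "0 <= x" "x < y" for x y :: real
 proof (cases "x = 0")
  case True
  thus ?thesis using that assms mult_right_mono[of 1 r "y powr r"] powr_add[of y "r - 1" 1] by (simp add: mult.assoc)
 next
  case False
  hence "0 < x" using that by simp
  obtain z where z: "x < z" "z < y" "y powr r - x powr r = (y - x)*(r*z powr (r - 1))"
  proof -
   have "((%x. x powr r) has_real_derivative r*t powr (r - 1)) (at t)" if "x <= t" for t
    using that \<open>0 < x\<close> by (auto intro!: derivative_eq_intros)
   thus ?thesis using that MVT2[of x y "%x. x powr r" "%x. r*x powr (r - 1)"] \<open>x < y\<close> by metis
  qed
  have "z powr (r - 1) <= (x + y) powr (r - 1)" using z \<open>0 < x\<close> assms by (intro powr_mono2) auto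
  hence "(y - x)*(r*z powr (r - 1)) <= (y - x)*(r*(x + y) powr (r - 1))"
   using that assms by (intro mult_left_mono) auto
  thus ?thesis using z by (simp add: mult_ac)
 qed
 have m: "a <= b ==> a powr r <= b powr r" if "0 <= a" for a b using that assms by (intro powr_mono2) auto
 consider "x = y" | "x < y" | "y < x" by linarith
 thus ?thesis
  using ordered[of x y] ordered[of y x] m[of x y] m[of y x] assms by cases (auto simp: add.commute)
qed

lemma pos_powr_diff_le:
 fixes x y r :: real
 assumes "r >= 1"
 shows "abs (max x 0 powr r - max y 0 powr r) <= r*(abs x + abs y) powr (r - 1)*abs (x - y)"
proof -
 have "abs (max x 0 powr r - max y 0 powr r) <= r*(max x 0 + max y 0) powr (r - 1)*abs (max x 0 - max y 0)"
  using assms by (intro powr_diff_le) auto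
 also have "... <= r*(abs x + abs y) powr (r - 1)*abs (x - y)"
  using assms by (intro mult_mono powr_mono2 mult_nonneg_nonneg add_mono) (auto simp: max_def)
 finally show ?thesis .
qed

lemma DERIV_pos_powr:
 fixes x p :: real
 assumes "p > 1"
 shows "((%x. max x 0 powr (p + 1)) has_real_derivative (p + 1)*max x 0 powr p) (at x)"
proof -
 consider "x > 0" | "x < 0" | "x = 0" by linarith
 thus ?thesis
 proof cases
  case 1
  have "((%x. x powr (p + 1)) has_real_derivative (p + 1)*x powr p) (at x)"
   using 1 by (auto intro!: derivative_eq_intros)
  hence "((%x. max x 0 powr (p + 1)) has_real_derivative (p + 1)*x powr p) (at x)"
   by (rule has_field_derivative_transform_within_open[of _ _ _ "{0<..}"]) (use 1 in auto)
  thus ?thesis using 1 by simp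
 next
  case 2
  have "((%x. max x 0 powr (p + 1)) has_real_derivative 0) (at x)"
   by (rule has_field_derivative_transform_within_open[of "%x. 0" _ _ "{..<0}"]) (use 2 in auto)
  thus ?thesis using 2 by simp
 next
  case 3
  have "((%h. max h 0 powr (p + 1)/h) \<longlongrightarrow> 0) (at 0)"
  proof (rule tendsto_0_le[where K=1])
   show "((%h. abs h powr p) \<longlongrightarrow> 0) (at (0::real))"
    using assms by (intro tendsto_eq_intros tendsto_zero_powrI) auto
   have "norm (max h 0 powr (p + 1)/h) <= norm (abs h powr p)*1" for h :: real
    by (cases "h > 0") (auto simp: max_def powr_add)
   thus "\<forall>\<^sub>F h in at 0. norm (max h 0 powr (p + 1)/h) <= norm (abs h powr p)*1" by simp
  qed
  thus ?thesis using 3 by (simp add: has_field_derivative_iff)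
 qed
qed

lemma MVT_abs:
 fixes f f' :: "real => real"
 assumes "!!x. (f has_real_derivative f' x) (at x)"
 obtains z where "abs (z - t) <= abs h" "f (t + h) - f t = h*f' z"
proof -
 consider "h = 0" | "h > 0" | "h < 0" by linarith
 thus ?thesis
 proof cases
  case 2
  obtain z where "t < z" "z < t + h" "f (t + h) - f t = (t + h - t)*f' z"
   using MVT2[of t "t + h" f f'] 2 assms by auto
  thus ?thesis by (intro that[of z]) auto
 next
  case 3
  obtain z where "t + h < z" "z < t" "f t - f (t + h) = (t - (t + h))*f' z"
   using MVT2[of "t + h" t f f'] 3 assms by auto
  thus ?thesis by (intro that[of z]) auto
 qed (use that[of t] in auto)
qed

lemma pos_powr_taylor:
 fixes t h p :: real
 assumes "p > 1"
 shows "abs (max (t + h) 0 powr (p + 1) - max t 0 powr (p + 1) - (p + 1)*max t 0 powr p*h)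
   <= (p + 1)*p*2 powr (p - 1)*(abs t + abs h) powr (p - 1)*h^2"
proof -
 let ?F = "%x. max x 0 powr (p + 1)" and ?F' = "%x. (p + 1)*max x 0 powr p"
 obtain z where z: "abs (z - t) <= abs h" "?F (t + h) - ?F t = h*?F' z"
  by (rule MVT_abs[OF DERIV_pos_powr[OF assms]])
 have "?F (t + h) - ?F t - (p + 1)*max t 0 powr p*h = (p + 1)*(max z 0 powr p - max t 0 powr p)*h"
  using z(2) by (simp add: algebra_simps)
 hence "abs (?F (t + h) - ?F t - (p + 1)*max t 0 powr p*h) = (p + 1)*abs (max z 0 powr p - max t 0 powr p)*abs h"
  using assms by (simp add: abs_mult)
 also have "... <= (p + 1)*(p*(abs z + abs t) powr (p - 1)*abs (z - t))*abs h"
  using assms pos_powr_diff_le[of p z t] by (intro mult_right_mono mult_left_mono) auto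
 also have "... <= (p + 1)*(p*(2*(abs t + abs h)) powr (p - 1)*abs h)*abs h"
  using assms z(1) by (intro mult_right_mono mult_left_mono mult_mono powr_mono2 mult_nonneg_nonneg) auto
 also have "... = (p + 1)*p*2 powr (p - 1)*(abs t + abs h) powr (p - 1)*(abs h*abs h)"
  unfolding powr_mult by (simp only: mult.assoc)
 finally show ?thesis by (simp add: power2_eq_square)
qed

lemma powr_mult_split:
 fixes x y p eps :: real
 assumes "p > 0" "eps > 0" "x >= 0" "y >= 0"
 shows "x powr p*y <= eps*x powr (p + 1) + (1/eps) powr p*y powr (p + 1)"
proof (cases "y <= eps*x")
 case True
 have "x powr p*y <= x powr p*(eps*x)" using True by (intro mult_left_mono) auto
 also have "... = eps*x powr (p + 1)" using assms by (cases "x = 0") (auto simp: powr_add)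
 finally show ?thesis by (simp add: add_increasing2)
next
 case False
 hence "x <= 1/eps*y" using assms by (simp add: field_simps)
 hence "x powr p <= (1/eps) powr p*y powr p"
  using assms powr_mono2[of p x "1/eps*y"] by (simp only: powr_mult)
 hence "x powr p*y <= (1/eps) powr p*y powr p*y" using assms by (intro mult_right_mono) auto
 also have "... = (1/eps) powr p*y powr (p + 1)" using assms by (cases "y = 0") (auto simp: powr_add)
 finally show ?thesis using assms by (simp add: add_increasing)
qed

lemma powr_add_le:
 fixes x y r :: real assumes "x >= 0" "y >= 0" "r >= 0"
 shows "(x + y) powr r <= 2 powr r*(x powr r + y powr r)"
proof -
 have "(x + y) powr r <= (2*max x y) powr r" using assms by (intro powr_mono2) auto
 also have "... = 2 powr r*max x y powr r" using assms by (simp add: powr_mult)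
 also have "max x y powr r <= x powr r + y powr r" by (simp add: max_def)
 finally show ?thesis by simp
qed

lemma powr_interpolation:
 fixes t q r r0 eps :: real
 assumes "t >= 0" "r < q" "r0 <= r" "eps > 0"
 shows "t powr r <= eps*t powr q + (1/eps) powr ((r - r0)/(q - r))*t powr r0"
proof (cases "t powr (q - r) >= 1/eps")
 case True
 have "t powr r*1 <= t powr r*(eps*t powr (q - r))"
  using True assms by (intro mult_left_mono) (auto simp: field_simps)
 also have "... = eps*t powr q" by (simp add: powr_add[symmetric])
 finally show ?thesis by (simp add: add_increasing2)
next
 case False
 have "t powr r = t powr (r - r0)*t powr r0" by (simp add: powr_add[symmetric])
 also have "t powr (r - r0) <= (1/eps) powr ((r - r0)/(q - r))"
 proof (cases "t = 0")
  case False
  have "t powr (r - r0) = (t powr (q - r)) powr ((r - r0)/(q - r))" using assms by (simp add: powr_powr)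
  also have "... <= (1/eps) powr ((r - r0)/(q - r))"
   using assms \<open>~ 1/eps <= t powr (q - r)\<close> by (intro powr_mono2) auto
  finally show ?thesis .
 qed simp
 finally show ?thesis using assms by (simp add: add_increasing mult_right_mono)
qed

lemma tendsto_pos_powr:
 fixes X :: "nat => real"
 assumes "X ---> l" "r > 0" shows "(%n. max (X n) 0 powr r) ---> max l 0 powr r"
 using assms by (intro tendsto_powr2 tendsto_intros) auto

lemma powr_Suc_eq_mult_power2:
 fixes x p :: real shows "x >= 0 ==> x powr (p + 1) = x powr (p - 1)*x^2"
 using powr_add[of x "p - 1" 2] by (cases "x = 0") (auto simp: powr_numeral add.commute)

lemma powr_eq_power2_powr:
 fixes x r :: real shows "x >= 0 ==> x powr r = (x^2) powr (r/2)"
 using powr_powr[of x 2 "r/2"] by (cases "x = 0") (auto simp: powr_numeral)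

text \<open>The pointwise estimate behind the Brezis-Lieb lemma.\<close>
lemma pos_powr_add_bound:
 fixes p eps :: real
 assumes p: "p > 1" and eps: "eps > 0"
 obtains M where "!!A D. abs (max (A + D) 0 powr (p + 1) - max D 0 powr (p + 1) - max A 0 powr (p + 1))
  <= eps*abs D powr (p + 1) + M*abs A powr (p + 1)"
proof
 fix A D :: real
 let ?F = "%t. max t 0 powr (p + 1) :: real"
 define K where "K = 2 powr (p + 1)*2 powr (p + 1)"
 define eta where "eta = eps/((p + 1)*K)"
 have K: "K > 0" by (simp add: K_def)
 have eta: "eta > 0" "(p + 1)*(eta*K) = eps" using eps K p by (auto simp: eta_def)
 have "abs (?F (A + D) - ?F D) <= (p + 1)*(abs (A + D) + abs D) powr p*abs A"
  using pos_powr_diff_le[of "p + 1" "A + D" D] p by simp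
 also have "... <= (p + 1)*((2*(abs A + abs D)) powr p*abs A)"
  unfolding mult.assoc using p by (intro mult_left_mono mult_right_mono powr_mono2) auto
 also have "... <= (p + 1)*(eta*(2*(abs A + abs D)) powr (p + 1) + (1/eta) powr p*abs A powr (p + 1))"
  using p eta by (intro mult_left_mono powr_mult_split) auto
 also have "(2*(abs A + abs D)) powr (p + 1) <= K*(abs A powr (p + 1) + abs D powr (p + 1))"
  unfolding powr_mult K_def mult.assoc using powr_add_le[of "abs A" "abs D" "p + 1"] p by (intro mult_left_mono) auto
 finally have "abs (?F (A + D) - ?F D)
  <= (p + 1)*(eta*(K*(abs A powr (p + 1) + abs D powr (p + 1))) + (1/eta) powr p*abs A powr (p + 1))"
  using p eta by (simp add: mult_left_mono)
 also have "... = eps*abs D powr (p + 1) + (eps + (p + 1)*(1/eta) powr p)*abs A powr (p + 1)"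
  unfolding eta(2)[symmetric] by (simp add: algebra_simps)
 finally have "abs (?F (A + D) - ?F D) <= eps*abs D powr (p + 1) + (eps + (p + 1)*(1/eta) powr p)*abs A powr (p + 1)" .
 moreover have "?F A <= abs A powr (p + 1)" using p by (intro powr_mono2) auto
 moreover have "abs (?F (A + D) - ?F D - ?F A) <= abs (?F (A + D) - ?F D) + ?F A"
  using abs_triangle_ineq4[of "?F (A + D) - ?F D" "?F A"] by simp
 ultimately show "abs (?F (A + D) - ?F D - ?F A)
  <= eps*abs D powr (p + 1) + (eps + (p + 1)*(1/(eps/((p + 1)*(2 powr (p + 1)*2 powr (p + 1))))) powr p + 1)*abs A powr (p + 1)"
  by (simp add: distrib_right eta_def K_def)
qed

locale nonlinear = frac_sobolev s N2s n_type for s N2s and n_type :: "'n::finite itself" +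
 fixes p :: real
 assumes p_gt_1: "1 < p" and p_sub: "p < (real CARD('n) + 2 * s)/(real CARD('n) - 2 * s)"
begin

lemma p1_less_critical_exponent: "p + 1 < critical_exponent TYPE('n)"
 using p_sub s_lt_N by (simp add: field_simps)

definition C_sob :: real where "C_sob = (SOME C. sobolev (p + 1) C)"

lemma sobolev_C_sob: "sobolev (p + 1) C_sob"
 unfolding C_sob_def by (rule someI_ex[OF sobolev_inequality]) (use p1_less_critical_exponent p_gt_1 in simp_all)

lemma sobolev_above_p1:
 obtains q K where "p + 1 < q" "K > 0" "!!u. u \<in> H ==> integrable L (%x. abs (u x) powr q)"
  "!!u. u \<in> H ==> (LINT x|L. abs (u x) powr q) <= K*Hnorm u powr q"
proof -
 define q where "q = (p + 1 + critical_exponent TYPE('n))/2"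
 have q: "p + 1 < q" "q < critical_exponent TYPE('n)" "2 <= q" using p1_less_critical_exponent p_gt_1 by (auto simp: q_def)
 obtain K where "sobolev q K" using sobolev_inequality[OF q(3,2)] by blast
 thus ?thesis using that[OF q(1), of K] by (simp add: sobolev_def)
qed

lemma C_sob_pos: "C_sob > 0" using sobolev_C_sob by (simp add: sobolev_def)
lemma powr_p1_integrable: "u \<in> H ==> integrable L (%x. abs (u x) powr (p + 1))" using sobolev_C_sob by (simp add: sobolev_def)
lemma powr_p1_le: "u \<in> H ==> (LINT x|L. abs (u x) powr (p + 1)) <= C_sob*Hnorm u powr (p + 1)" using sobolev_C_sob by (simp add: sobolev_def)

lemma powr_triple_product_le:
 fixes a b c :: real
 assumes "a >= 0" "b >= 0" "c >= 0" "alpha >= 0" "beta >= 0" "gamma >= 0" "alpha + beta + gamma = p + 1"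
 shows "a powr alpha*b powr beta * c powr gamma <= a powr (p + 1) + b powr (p + 1) + c powr (p + 1)"
proof -
 define m where "m = max a (max b c)"
 have m: "a <= m" "b <= m" "c <= m" "m >= 0" using assms by (auto simp: m_def)
 have "a powr alpha*b powr beta * c powr gamma <= m powr alpha*m powr beta*m powr gamma"
  using assms m by (intro mult_mono powr_mono2) auto
 also have "... = m powr (p + 1)" by (simp add: powr_add[symmetric] assms(7))
 also have "... <= a powr (p + 1) + b powr (p + 1) + c powr (p + 1)"
  by (auto simp: m_def max_def add_increasing add_increasing2)
 finally show ?thesis .
qed

lemma triple_product_le:
 assumes H: "u \<in> H" "v \<in> H" "w \<in> H" and e: "alpha > 0" "beta > 0" "gamma > 0" "alpha + beta + gamma = p + 1"
 shows "integrable L (%x. abs (u x) powr alpha*abs (v x) powr beta*abs (w x) powr gamma)" (is "integrable L ?f")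
  "(LINT x|L. abs (u x) powr alpha*abs (v x) powr beta*abs (w x) powr gamma) <= 3*C_sob*(Hnorm u powr alpha*Hnorm v powr beta*Hnorm w powr gamma)"
proof -
 note [measurable] = H_meas[OF H(1)] H_meas[OF H(2)] H_meas[OF H(3)]
 let ?s = "%u v w x. abs (u x) powr (p + 1) + abs (v x) powr (p + 1) + abs (w x) powr (p + 1) :: real"
 have s: "integrable L (?s u v w)" if "u \<in> H" "v \<in> H" "w \<in> H" for u v w
  using that by (intro Bochner_Integration.integrable_add powr_p1_integrable)
 show i: "integrable L ?f"
 proof (rule integrable_boundI[OF s[OF H]])
  show "abs (?f x) <= ?s u v w x" for x
   using powr_triple_product_le[of "abs (u x)" "abs (v x)" "abs (w x)" alpha beta gamma] e by (simp add: abs_mult)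
 qed measurable
 show "(LINT x|L. ?f x) <= 3*C_sob*(Hnorm u powr alpha*Hnorm v powr beta*Hnorm w powr gamma)"
 proof (cases "Hnorm u > 0 & Hnorm v > 0 & Hnorm w > 0")
  case False
  hence "AE x in L. ?f x = 0" using H Hnorm_pos_iff by auto
  hence "(LINT x|L. ?f x) = 0" by (rule integral_eq_zero_AE)
  thus ?thesis using C_sob_pos by simp
 next
  case True
  define A where "A = Hnorm u powr alpha*Hnorm v powr beta*Hnorm w powr gamma"
  let ?u = "normalized u" and ?v = "normalized v" and ?w = "normalized w"
  have A: "A > 0" using True by (simp add: A_def)
  note N = H_normalized[OF H(1)] H_normalized[OF H(2)] H_normalized[OF H(3)]
  have n: "(LINT x|L. abs (normalized g x) powr (p + 1)) <= C_sob" if "g \<in> H" "Hnorm g > 0" for g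
   using powr_p1_le[OF H_normalized[OF that(1)]] Hnorm_normalized[OF that(2)] by simp
  have "abs (?u x) powr alpha*abs (?v x) powr beta*abs (?w x) powr gamma = ?f x/A" for x
   using True by (simp add: A_def normalized_def abs_mult powr_divide)
  hence "?f x/A <= ?s ?u ?v ?w x" for x
   using powr_triple_product_le[of "abs (?u x)" "abs (?v x)" "abs (?w x)" alpha beta gamma] e by simp
  hence "(LINT x|L. ?f x/A) <= (LINT x|L. ?s ?u ?v ?w x)" using i by (intro integral_mono s N) auto
  also have "... = (LINT x|L. abs (?u x) powr (p + 1)) + (LINT x|L. abs (?v x) powr (p + 1)) + (LINT x|L. abs (?w x) powr (p + 1))"
   using N by (simp add: powr_p1_integrable)
  also have "... <= C_sob + C_sob + C_sob" using H True by (intro add_mono n) auto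
  finally have "(LINT x|L. ?f x) <= 3*C_sob*A" using A by (simp add: field_simps)
  thus ?thesis by (simp only: A_def)
 qed
qed

lemma product_le:
 assumes "u \<in> H" "v \<in> H" "alpha > 0" "beta > 0" "alpha + beta = p + 1"
 shows "integrable L (%x. abs (u x) powr alpha*abs (v x) powr beta)"
  "(LINT x|L. abs (u x) powr alpha*abs (v x) powr beta) <= 3*C_sob*(Hnorm u powr alpha*Hnorm v powr beta)"
 using triple_product_le[OF assms(1,2,2,3), of "beta/2" "beta/2"] assms
 by (simp_all add: mult.assoc flip: powr_add)

definition coefficient :: "'n fn => bool" where
 "coefficient b \<longleftrightarrow> b \<in> borel_measurable borel & (\<forall>x. 0 <= b x & b x <= 1)"

lemma coefficientD: "coefficient b ==> b \<in> borel_measurable borel" "coefficient b ==> 0 <= b x" "coefficient b ==> b x <= 1"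
 by (auto simp: coefficient_def)
lemma coefficient_one: "coefficient (%_. 1)" by (simp add: coefficient_def)

definition Bint :: "'n fn => 'n fn => real" where "Bint b u = (LINT x|L. b x*max (u x) 0 powr (p + 1))"
definition Bform :: "'n fn => 'n fn => 'n fn => real" where "Bform b u h = (LINT x|L. b x*max (u x) 0 powr p*h x)"

lemma Ifun_eq: "Ifun s p b g u = (Hnorm u)^2/2 - Bint b u/(p + 1) - g u"
 by (simp add: Ifun_def Bint_def)

lemma coefficient_mult_le: assumes "coefficient b" "abs t <= r" shows "abs (b x*t) <= r"
 using coefficientD(2,3)[OF assms(1), of x] assms(2) mult_left_le_one_le[of "abs t" "b x"] by (simp add: abs_mult)

lemma pos_powr_le: "r >= 0 ==> max t 0 powr r <= abs t powr r" for t r :: real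
 by (intro powr_mono2) (auto simp: max_def)

lemma Bint_integrable: assumes "coefficient b" "u \<in> H" shows "integrable L (%x. b x*max (u x) 0 powr (p + 1))"
proof (rule integrable_boundI[OF powr_p1_integrable[OF assms(2)]])
 have [measurable]: "u \<in> borel_measurable borel" "b \<in> borel_measurable borel" using assms H_meas coefficientD by auto
 show "(%x. b x*max (u x) 0 powr (p + 1)) \<in> borel_measurable L" by measurable
 show "abs (b x*max (u x) 0 powr (p + 1)) <= abs (u x) powr (p + 1)" for x
  using p_gt_1 pos_powr_le[of "p + 1" "u x"] by (intro coefficient_mult_le[OF assms(1)]) auto
qed

lemma Bint_nonneg: "coefficient b ==> Bint b u >= 0"
 unfolding Bint_def by (simp add: coefficientD)

lemma Bint_mono: assumes "coefficient b" "coefficient c" "u \<in> H" "!!x. b x <= c x" shows "Bint b u <= Bint c u"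
 unfolding Bint_def using assms Bint_integrable by (intro integral_mono mult_right_mono) auto

lemma Bint_le_powr_p1: assumes "coefficient b" "u \<in> H" shows "Bint b u <= (LINT x|L. abs (u x) powr (p + 1))"
 unfolding Bint_def
proof (intro integral_mono Bint_integrable powr_p1_integrable assms)
 show "b x*max (u x) 0 powr (p + 1) <= abs (u x) powr (p + 1)" for x
  using p_gt_1 pos_powr_le[of "p + 1" "u x"] coefficient_mult_le[OF assms(1), of "max (u x) 0 powr (p + 1)" _ x] by (smt (verit) powr_ge_zero)
qed

lemma Bint_le: assumes "coefficient b" "u \<in> H" shows "Bint b u <= C_sob*Hnorm u powr (p + 1)"
 using Bint_le_powr_p1[OF assms] powr_p1_le[OF assms(2)] by linarith

lemma pos_part_scale: "t >= 0 ==> max (t*r) 0 = t*max r (0::real)"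
 by (simp add: max_mult_distrib_left)

lemma Bint_scale: assumes "t >= 0" shows "Bint b (%x. t*u x) = t powr (p + 1)*Bint b u"
proof -
 have "b x*max (t*u x) 0 powr (p + 1) = t powr (p + 1)*(b x*max (u x) 0 powr (p + 1))" for x
  unfolding pos_part_scale[OF assms] using assms by (simp add: powr_mult)
 hence "Bint b (%x. t*u x) = (LINT x|L. t powr (p + 1)*(b x*max (u x) 0 powr (p + 1)))" by (simp only: Bint_def)
 thus ?thesis by (simp add: Bint_def)
qed

lemma Bform_integrable: assumes "coefficient b" "u \<in> H" "h \<in> H" shows "integrable L (%x. b x*max (u x) 0 powr p*h x)"
proof (rule integrable_boundI[OF product_le(1)[OF assms(2,3), of p 1]])
 have [measurable]: "u \<in> borel_measurable borel" "b \<in> borel_measurable borel" "h \<in> borel_measurable borel" using assms H_meas coefficientD by auto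
 show "(%x. b x*max (u x) 0 powr p*h x) \<in> borel_measurable L" by measurable
 show "abs (b x*max (u x) 0 powr p*h x) <= abs (u x) powr p*abs (h x) powr 1" for x
  using p_gt_1 pos_powr_le[of p "u x"] unfolding mult.assoc
  by (intro coefficient_mult_le[OF assms(1)]) (auto simp: abs_mult intro!: mult_right_mono)
qed (use p_gt_1 in auto)

lemma Bform_bound: assumes "coefficient b" "u \<in> H" "h \<in> H" shows "abs (Bform b u h) <= 3*C_sob*(Hnorm u powr p*Hnorm h)"
proof -
 have "abs (Bform b u h) <= (LINT x|L. abs (b x*max (u x) 0 powr p*h x))" unfolding Bform_def by (rule integral_abs_bound)
 also have "... <= (LINT x|L. abs (u x) powr p*abs (h x) powr 1)"
 proof (intro integral_mono integrable_abs Bform_integrable assms product_le(1))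
  show "abs (b x*max (u x) 0 powr p*h x) <= abs (u x) powr p*abs (h x) powr 1" for x
   using p_gt_1 pos_powr_le[of p "u x"] unfolding mult.assoc
   by (intro coefficient_mult_le[OF assms(1)]) (auto simp: abs_mult intro!: mult_right_mono)
 qed (use p_gt_1 in auto)
 also have "... <= 3*C_sob*(Hnorm u powr p*Hnorm h powr 1)" using product_le(2)[OF assms(2,3), of p 1] p_gt_1 by simp
 finally show ?thesis by (simp add: Hnorm_nonneg)
qed

lemma Bform_add: assumes "coefficient b" "u \<in> H" "h \<in> H" "k \<in> H" shows "Bform b u (%x. h x + k x) = Bform b u h + Bform b u k"
 using Bform_integrable[OF assms(1,2,3)] Bform_integrable[OF assms(1,2,4)] by (simp add: Bform_def distrib_left)
lemma Bform_scale: "Bform b u (%x. c*h x) = c*Bform b u h"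
proof -
 have "b x*max (u x) 0 powr p*(c*h x) = c*(b x*max (u x) 0 powr p*h x)" for x by simp
 hence "Bform b u (%x. c*h x) = (LINT x|L. c*(b x*max (u x) 0 powr p*h x))" by (simp only: Bform_def)
 thus ?thesis by (simp add: Bform_def)
qed

lemma Bform_scale_left: assumes "t >= 0" shows "Bform b (%x. t*u x) h = t powr p*Bform b u h"
proof -
 have "b x*max (t*u x) 0 powr p*h x = t powr p*(b x*max (u x) 0 powr p*h x)" for x
  unfolding pos_part_scale[OF assms] using assms by (simp add: powr_mult)
 hence "Bform b (%x. t*u x) h = (LINT x|L. t powr p*(b x*max (u x) 0 powr p*h x))" by (simp only: Bform_def)
 thus ?thesis by (simp add: Bform_def)
qed

lemma Bform_self: "Bform b u u = Bint b u"
proof -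
 have "max t 0 powr p*t = max t 0 powr (p + 1)" for t :: real by (auto simp: max_def powr_add)
 thus ?thesis by (simp add: Bform_def Bint_def mult.assoc)
qed

lemma abs_H: "u \<in> H ==> (%x. abs (u x)) \<in> H" and Hnorm_abs: "u \<in> H ==> Hnorm (%x. abs (u x)) <= Hnorm u"
 using H_contraction[of u "%x. abs (u x)"] H_meas[of u] by (auto simp: abs_triangle_ineq3)

lemma abs_sum_H:
 assumes "u \<in> H" "v \<in> H"
 shows "(%x. abs (u x) + abs (v x)) \<in> H" "Hnorm (%x. abs (u x) + abs (v x)) <= Hnorm u + Hnorm v"
 using H_add[OF abs_H[OF assms(1)] abs_H[OF assms(2)]] Hnorm_triangle[OF abs_H[OF assms(1)] abs_H[OF assms(2)]]
  Hnorm_abs[OF assms(1)] Hnorm_abs[OF assms(2)] by auto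

lemma Bform_lipschitz:
 assumes "coefficient b" "u \<in> H" "v \<in> H" "h \<in> H"
 shows "abs (Bform b u h - Bform b v h) <= 3*p*C_sob*(Hnorm u + Hnorm v) powr (p - 1)*Hdist u v * Hnorm h"
proof -
 let ?f = "%x. abs (abs (u x) + abs (v x)) powr (p - 1)*abs (u x - v x) powr 1*abs (h x) powr 1"
 note t = triple_product_le[OF abs_sum_H(1)[OF assms(2,3)] H_diff[OF assms(2,3)] assms(4), of "p - 1" 1 1]
 have i: "integrable L ?f" using t(1) p_gt_1 by simp
 have "abs (Bform b u h - Bform b v h) = abs (LINT x|L. b x*max (u x) 0 powr p*h x - b x*max (v x) 0 powr p*h x)"
  unfolding Bform_def using Bform_integrable assms by (subst Bochner_Integration.integral_diff) auto
 also have "... <= (LINT x|L. abs (b x*max (u x) 0 powr p*h x - b x*max (v x) 0 powr p*h x))" by (rule integral_abs_bound)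
 also have "... <= (LINT x|L. p*?f x)"
 proof (intro integral_mono integrable_abs Bochner_Integration.integrable_diff Bform_integrable assms integrable_mult_right i)
  fix x
  have e: "b x*max (u x) 0 powr p*h x - b x*max (v x) 0 powr p*h x = b x*((max (u x) 0 powr p - max (v x) 0 powr p)*h x)"
   by (simp add: algebra_simps)
  show "abs (b x*max (u x) 0 powr p*h x - b x*max (v x) 0 powr p*h x) <= p*?f x"
   unfolding e using mult_right_mono[OF pos_powr_diff_le[of p "u x" "v x"], of "abs (h x)"] p_gt_1
   by (intro coefficient_mult_le[OF assms(1)]) (simp add: abs_mult mult_ac)
 qed
 also have "... = p*(LINT x|L. ?f x)" by simp
 also have "... <= p*(3*C_sob*(Hnorm (%x. abs (u x) + abs (v x)) powr (p - 1)*Hdist u v powr 1*Hnorm h powr 1))"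
  using t(2) p_gt_1 by (intro mult_left_mono) auto
 also have "... <= p*(3*C_sob*((Hnorm u + Hnorm v) powr (p - 1)*Hdist u v powr 1*Hnorm h powr 1))"
  using abs_sum_H(2)[OF assms(2,3)] p_gt_1 C_sob_pos Hnorm_nonneg
  by (intro mult_left_mono mult_right_mono powr_mono2) (auto intro!: mult_nonneg_nonneg)
 finally show ?thesis by (simp add: Hnorm_nonneg mult_ac)
qed

definition C_taylor :: real where "C_taylor = 3*(p + 1)*p*2 powr (p - 1)*C_sob"

lemma C_taylor_pos: "C_taylor > 0" using p_gt_1 C_sob_pos by (simp add: C_taylor_def)

lemma Bint_taylor:
 assumes "coefficient b" "u \<in> H" "h \<in> H"
 shows "abs (Bint b (%x. u x + h x) - Bint b u - (p + 1)*Bform b u h) <= C_taylor*(Hnorm u + Hnorm h) powr (p - 1)*(Hnorm h)^2"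
proof -
 let ?f = "%x. abs (abs (u x) + abs (h x)) powr (p - 1)*abs (h x) powr 2"
 note t = product_le[OF abs_sum_H(1)[OF assms(2,3)] assms(3), of "p - 1" 2]
 have i: "integrable L ?f" using t(1) p_gt_1 by simp
 let ?g = "%x. b x*max (u x + h x) 0 powr (p + 1) - b x*max (u x) 0 powr (p + 1) - (p + 1)*(b x*max (u x) 0 powr p*h x)"
 have gi: "integrable L ?g"
  using Bint_integrable[OF assms(1) H_add[OF assms(2,3)]] Bint_integrable[OF assms(1,2)] Bform_integrable[OF assms] by simp
 have "Bint b (%x. u x + h x) - Bint b u - (p + 1)*Bform b u h = (LINT x|L. ?g x)"
  unfolding Bint_def Bform_def
  using Bint_integrable[OF assms(1) H_add[OF assms(2,3)]] Bint_integrable[OF assms(1,2)] Bform_integrable[OF assms] by simp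
 hence "abs (Bint b (%x. u x + h x) - Bint b u - (p + 1)*Bform b u h) <= (LINT x|L. abs (?g x))" by (simp add: integral_abs_bound)
 also have "... <= (LINT x|L. (p + 1)*p*2 powr (p - 1)*?f x)"
 proof (intro integral_mono integrable_abs gi integrable_mult_right i)
  fix x
  have e: "?g x = b x*(max (u x + h x) 0 powr (p + 1) - max (u x) 0 powr (p + 1) - (p + 1)*max (u x) 0 powr p*h x)"
   by (simp add: algebra_simps)
  show "abs (?g x) <= (p + 1)*p*2 powr (p - 1)*?f x"
   unfolding e using pos_powr_taylor[OF p_gt_1, of "u x" "h x"]
   by (intro coefficient_mult_le[OF assms(1)]) (simp add: mult_ac powr_numeral)
 qed
 also have "... = (p + 1)*p*2 powr (p - 1)*(LINT x|L. ?f x)" by simp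
 also have "... <= (p + 1)*p*2 powr (p - 1)*(3*C_sob*(Hnorm (%x. abs (u x) + abs (h x)) powr (p - 1)*Hnorm h powr 2))"
  using t(2) p_gt_1 by (intro mult_left_mono) auto
 also have "... <= (p + 1)*p*2 powr (p - 1)*(3*C_sob*((Hnorm u + Hnorm h) powr (p - 1)*Hnorm h powr 2))"
  using abs_sum_H(2)[OF assms(2,3)] p_gt_1 C_sob_pos Hnorm_nonneg
  by (intro mult_left_mono mult_right_mono powr_mono2) (auto intro!: mult_nonneg_nonneg)
 also have "... = C_taylor*(Hnorm u + Hnorm h) powr (p - 1)*(Hnorm h)^2"
  by (simp add: C_taylor_def Hnorm_nonneg powr_numeral algebra_simps)
 finally show ?thesis .
qed

lemma Bint_AE_cong: assumes "u \<in> borel_measurable borel" "v \<in> borel_measurable borel" "coefficient b" "AE x in L. u x = v x" shows "Bint b u = Bint b v"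
 unfolding Bint_def using assms coefficientD(1)[OF assms(3)] by (intro integral_cong_AE) auto

lemma Bint_shift: "u \<in> H ==> Bint (%_. 1) (%x. u (x + c)) = Bint (%_. 1) u"
 using H_meas[of u] integral_lborel_shift(1)[of "%x. max (u x) 0 powr (p + 1)" c] by (simp add: Bint_def)

lemma powr_p1_sum_le:
 assumes "u \<in> H" "v \<in> H" "Hnorm u <= C" "Hnorm v <= C"
 shows "(LINT x|L. abs (u x) powr (p + 1) + abs (v x) powr (p + 1)) <= 2*C_sob*C powr (p + 1)"
proof -
 have "Hnorm u powr (p + 1) <= C powr (p + 1)" "Hnorm v powr (p + 1) <= C powr (p + 1)"
  using assms p_gt_1 by (auto intro!: powr_mono2 Hnorm_nonneg)
 hence "C_sob*Hnorm u powr (p + 1) <= C_sob*C powr (p + 1)" "C_sob*Hnorm v powr (p + 1) <= C_sob*C powr (p + 1)"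
  using C_sob_pos by auto
 thus ?thesis using powr_p1_le[OF assms(1)] powr_p1_le[OF assms(2)] powr_p1_integrable[OF assms(1)] powr_p1_integrable[OF assms(2)] by simp
qed

lemma brezis_lieb:
 assumes b: "coefficient b" and u: "!!n. u n \<in> H" "!!n. Hnorm (u n) <= C" and v: "v \<in> H" and ae: "AE x in L. (%n. u n x) ---> v x"
 shows "(%n. Bint b (u n) - Bint b (%x. u n x - v x)) ---> Bint b v"
proof -
 note [measurable] = H_meas[OF u(1)] H_meas[OF v] coefficientD(1)[OF b]
 have d: "(%x. u n x - v x) \<in> H" "Hdist (u n) v <= C + Hnorm v" for n
  using H_diff[OF u(1) v] Hnorm_diff_le[OF u(1) v, of n] u(2)[of n] by auto
 let ?F = "%t. max t 0 powr (p + 1) :: real"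
 let ?h = "%n x. b x*(?F (v x + (u n x - v x)) - ?F (u n x - v x) - ?F (v x))"
 have "(%n. LINT x|L. ?h n x) ---> 0"
 proof (rule dominated_convergence_split_bound[where e="%n x. abs (u n x - v x) powr (p + 1)" and C="C_sob*(C + Hnorm v) powr (p + 1)"])
  show "AE x in L. (%n. ?h n x) ---> 0"
   using ae
  proof eventually_elim
   case (elim x)
   have c: "isCont ?F t" for t using DERIV_isCont[OF DERIV_pos_powr[OF p_gt_1]] .
   have "(%n. u n x - v x) ---> 0" using elim by (simp add: LIM_zero_iff)
   from isCont_tendsto_compose[OF c this] isCont_tendsto_compose[OF c elim]
   have "(%n. b x*(?F (u n x) - ?F (u n x - v x) - ?F (v x))) ---> b x*(?F (v x) - ?F 0 - ?F (v x))"
    by (intro tendsto_mult tendsto_diff tendsto_const)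
   thus ?case by simp
  qed
  show "(LINT x|L. abs (u n x - v x) powr (p + 1)) <= C_sob*(C + Hnorm v) powr (p + 1)" for n
   using d(2) p_gt_1 C_sob_pos by (intro order_trans[OF powr_p1_le[OF d(1)]] mult_left_mono powr_mono2 Hnorm_nonneg) auto
  fix eps :: real assume "eps > 0"
  then obtain M where M: "!!A D. abs (?F (A + D) - ?F D - ?F A) <= eps*abs D powr (p + 1) + M*abs A powr (p + 1)"
   using pos_powr_add_bound[OF p_gt_1] by blast
  have "abs (?h n x) <= eps*abs (u n x - v x) powr (p + 1) + M*abs (v x) powr (p + 1)" for n x
   by (rule coefficient_mult_le[OF b M])
  thus "\<exists>psi. integrable L psi & (\<forall>n x. abs (?h n x) <= eps*abs (u n x - v x) powr (p + 1) + psi x)"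
   using powr_p1_integrable[OF v] by (intro exI[of _ "%x. M*abs (v x) powr (p + 1)"] conjI allI) simp_all
 qed (use powr_p1_integrable[OF d(1)] in auto)
 moreover have "(LINT x|L. ?h n x) = Bint b (u n) - Bint b (%x. u n x - v x) - Bint b v" for n
  unfolding Bint_def right_diff_distrib
  using Bint_integrable[OF b u(1), of n] Bint_integrable[OF b d(1), of n] Bint_integrable[OF b v] by simp
 ultimately show ?thesis by (simp add: LIM_zero_iff)
qed

lemma Bform_weak_limit:
 assumes b: "coefficient b" and u: "!!n. u n \<in> H" "!!n. Hnorm (u n) <= C" and v: "v \<in> H" and ae: "AE x in L. (%n. u n x) ---> v x" and g: "g \<in> H"
 shows "(%n. Bform b (u n) g) ---> Bform b v g"
proof -
 note [measurable] = H_meas[OF u(1)] H_meas[OF v] H_meas[OF g] coefficientD(1)[OF b]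
 let ?h = "%n x. b x*((max (u n x) 0 powr p - max (v x) 0 powr p)*g x)"
 let ?e = "%n x. abs (u n x) powr (p + 1) + abs (v x) powr (p + 1)"
 have "(%n. LINT x|L. ?h n x) ---> 0"
 proof (rule dominated_convergence_split_bound[where e="?e" and C="2*C_sob*(max C (Hnorm v)) powr (p + 1)"])
  show "AE x in L. (%n. ?h n x) ---> 0"
   using ae
  proof eventually_elim
   case (elim x)
   hence "(%n. ?h n x) ---> b x*((max (v x) 0 powr p - max (v x) 0 powr p)*g x)"
    using p_gt_1 by (intro tendsto_mult tendsto_diff tendsto_const tendsto_pos_powr) auto
   thus ?case by simp
  qed
  show "(LINT x|L. ?e n x) <= 2*C_sob*(max C (Hnorm v)) powr (p + 1)" for n
   using u(2)[of n] by (intro powr_p1_sum_le u(1) v) auto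
  fix eps :: real assume eps: "eps > 0"
  have "abs (?h n x) <= eps*?e n x + 2*(1/eps) powr p*abs (g x) powr (p + 1)" for n x
  proof (rule coefficient_mult_le[OF b])
   have "abs ((max (u n x) 0 powr p - max (v x) 0 powr p)*g x) <= (abs (u n x) powr p + abs (v x) powr p)*abs (g x)"
    using pos_powr_le[of p "u n x"] pos_powr_le[of p "v x"] p_gt_1
    unfolding abs_mult by (intro mult_right_mono) (smt (verit) powr_ge_zero, simp)
   thus "abs ((max (u n x) 0 powr p - max (v x) 0 powr p)*g x) <= eps*?e n x + 2*(1/eps) powr p*abs (g x) powr (p + 1)"
    using powr_mult_split[of p eps "abs (u n x)" "abs (g x)"] powr_mult_split[of p eps "abs (v x)" "abs (g x)"] p_gt_1 eps
    by (simp add: algebra_simps)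
  qed
  thus "\<exists>psi. integrable L psi & (\<forall>n x. abs (?h n x) <= eps*?e n x + psi x)"
   using powr_p1_integrable[OF g] by (intro exI[of _ "%x. 2*(1/eps) powr p*abs (g x) powr (p + 1)"]) auto
 qed (use powr_p1_integrable u(1) v in auto)
 moreover have "(LINT x|L. ?h n x) = Bform b (u n) g - Bform b v g" for n
  unfolding Bform_def using Bform_integrable[OF b u(1) g, of n] Bform_integrable[OF b v g]
  by (simp add: algebra_simps)
 ultimately show ?thesis by (simp add: LIM_zero_iff)
qed

lemma coefficient_defect_vanishes:
 assumes b: "coefficient b" "integrable L (%x. 1 - b x)" and z: "!!n. z n \<in> H" "!!n. Hnorm (z n) <= C" and ae: "AE x in L. (%n. z n x) ---> 0"
 shows "(%n. Bint (%_. 1) (z n) - Bint b (z n)) ---> 0"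
proof -
 note [measurable] = H_meas[OF z(1)] coefficientD(1)[OF b(1)]
 have b01: "0 <= 1 - b x" "1 - b x <= 1" for x using coefficientD[OF b(1)] by auto
 obtain q K where q: "p + 1 < q" and K: "K > 0" "!!u. u \<in> H ==> integrable L (%x. abs (u x) powr q)"
  "!!u. u \<in> H ==> (LINT x|L. abs (u x) powr q) <= K*Hnorm u powr q" by (rule sobolev_above_p1) blast
 let ?h = "%n x. (1 - b x)*max (z n x) 0 powr (p + 1)"
 have "(%n. LINT x|L. ?h n x) ---> 0"
 proof (rule dominated_convergence_split_bound[where e="%n x. abs (z n x) powr q" and C="K*C powr q"])
  show "AE x in L. (%n. ?h n x) ---> 0"
   using ae
  proof eventually_elim
   case (elim x)
   thus ?case using tendsto_mult_right_zero[of "%n. max (z n x) 0 powr (p + 1)"] tendsto_pos_powr[OF elim, of "p + 1"] p_gt_1 by simp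
  qed
  show "(LINT x|L. abs (z n x) powr q) <= K*C powr q" for n
   using z(2) q p_gt_1 K(1) by (intro order_trans[OF K(3)[OF z(1)]] mult_left_mono powr_mono2 Hnorm_nonneg) auto
  fix eps :: real assume eps: "eps > 0"
  define M where "M = (1/eps) powr ((p + 1)/(q - (p + 1)))"
  have "abs (?h n x) <= eps*abs (z n x) powr q + M*(1 - b x)" for n x
  proof -
   have "abs (?h n x) <= (1 - b x)*abs (z n x) powr (p + 1)"
    using b01 pos_powr_le[of "p + 1" "z n x"] p_gt_1 by (simp add: abs_mult mult_left_mono)
   also have "abs (z n x) powr (p + 1) <= eps*abs (z n x) powr q + M*abs (z n x) powr 0"
    using powr_interpolation[of "abs (z n x)" "p + 1" q 0 eps] q eps p_gt_1 by (simp add: M_def)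
   also have "... <= eps*abs (z n x) powr q + M" by (simp add: M_def)
   also have "(1 - b x)*(eps*abs (z n x) powr q + M) <= eps*abs (z n x) powr q + M*(1 - b x)"
    using mult_right_mono[OF b01(2)[of x], of "eps*abs (z n x) powr q"] eps by (simp add: algebra_simps)
   finally show ?thesis using b01(1)[of x] by (simp add: mult_left_mono)
  qed
  thus "\<exists>psi. integrable L psi & (\<forall>n x. abs (?h n x) <= eps*abs (z n x) powr q + psi x)"
   using b(2) by (intro exI[of _ "%x. M*(1 - b x)"]) auto
 qed (use K(2) z(1) in auto)
 moreover have "(LINT x|L. ?h n x) = Bint (%_. 1) (z n) - Bint b (z n)" for n
  unfolding Bint_def left_diff_distrib
  using Bint_integrable[OF coefficient_one z(1), of n] Bint_integrable[OF b(1) z(1), of n] by simp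
 ultimately show ?thesis by simp
qed

end

lemma bernoulli_powr:
 fixes x p :: real assumes "p >= 1" "x >= 0"
 shows "x powr p >= 1 + p*(x - 1)"
proof (cases "x = 0")
 case False
 have "(x powr p) powr (1/p)*1 powr (1 - 1/p) <= 1/p*x powr p + (1 - 1/p)*1"
  using assms False by (intro Youngs_inequality_0) auto
 hence "p*x <= p*(x powr p/p + (1 - 1/p))" using assms by (intro mult_left_mono) (auto simp: powr_powr)
 also have "... = x powr p + p - 1" using assms by (simp add: field_simps)
 finally show ?thesis by (simp add: algebra_simps)
qed (use assms in auto)

definition fibre :: "real => real => real => real => real" where
 "fibre p B phi t = t^2/2 - t powr (p + 1)*B/(p + 1) - t*phi"

lemma fibre_deriv:
 assumes "x > 0" "p > 1"
 shows "(fibre p B phi has_real_derivative (x - B*x powr p - phi)) (at x)"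
proof -
 have "((%t. t^2/2 - t powr (p + 1)*B/(p + 1) - t*phi) has_real_derivative
  (2*x/2 - (p + 1)*x powr p*B/(p + 1) - phi)) (at x)"
  using assms by (auto intro!: derivative_eq_intros)
 moreover have "(p + 1)*x powr p*B/(p + 1) = B*x powr p" using assms by simp
 ultimately show ?thesis unfolding fibre_def[abs_def] by simp
qed

lemma fibre_neg_at_top:
 assumes p: "p > 1" and B: "B > 0"
 obtains T where "T >= 1" "!!t. t >= T ==> fibre p B phi t < 0"
proof
 let ?m = "(p + 1)*(1 + abs phi)/B"
 show "max 1 (?m powr (1/(p - 1))) >= 1" by simp
 fix t assume t: "t >= max 1 (?m powr (1/(p - 1)))"
 have m: "?m >= 0" using p B by simp
 have "(?m powr (1/(p - 1))) powr (p - 1) <= t powr (p - 1)" using t p by (intro powr_mono2) auto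
 hence "?m <= t powr (p - 1)" using p m B by (simp add: powr_powr)
 hence "1 + abs phi <= t powr (p - 1)*B/(p + 1)" using B p by (simp add: field_simps)
 hence "(1 + abs phi)*t^2 <= t powr (p - 1)*B/(p + 1)*t^2" by (rule mult_right_mono) simp
 also have "... = t powr (p + 1)*B/(p + 1)" using t by (simp add: powr_Suc_eq_mult_power2)
 finally have "t^2 + abs phi*t^2 <= t powr (p + 1)*B/(p + 1)" by (simp add: algebra_simps)
 moreover have "- (t*phi) <= abs phi*t^2"
  using t mult_right_mono[of t "t^2" "abs phi"] self_le_power[of t 2] abs_ge_minus_self[of "t*phi"] by (simp add: abs_mult mult.commute)
 moreover have "t^2 > 0" using t by simp
 ultimately show "fibre p B phi t < 0" unfolding fibre_def by linarith
qed

lemma fibre_max_exists: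
 assumes p: "p > 1" and B: "B > 0" and t1: "t1 > 0" "fibre p B phi t1 > 0"
 shows "\<exists>t>0. \<forall>r>0. fibre p B phi r <= fibre p B phi t"
proof -
 obtain T where T: "T >= 1" "!!t. t >= T ==> fibre p B phi t < 0" using fibre_neg_at_top[OF p B] by blast
 have "continuous_on {0..T} (fibre p B phi)"
  unfolding fibre_def using p by (intro continuous_intros continuous_on_powr') auto
 then obtain t where t: "t \<in> {0..T}" "!!r. r \<in> {0..T} ==> fibre p B phi r <= fibre p B phi t"
  using continuous_attains_sup[OF compact_Icc, of 0 T "fibre p B phi"] T(1) by force
 have pos: "fibre p B phi t > 0" using t(2)[of t1] t1 T(2)[of t1] by force
 hence "t > 0" using t(1) by (cases "t = 0") (auto simp: fibre_def)
 moreover have "fibre p B phi r <= fibre p B phi t" if "r > 0" for r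
  using t(2)[of r] T(2)[of r] pos that by (cases "r <= T") auto
 ultimately show ?thesis by blast
qed

lemma fibre_max_critical:
 assumes "p > 1" "t > 0" "!!r. r > 0 ==> fibre p B phi r <= fibre p B phi t"
 shows "t - B*t powr p = phi"
 using DERIV_local_max[OF fibre_deriv[OF assms(2,1)] assms(2)] assms(2,3) by fastforce

lemma fibre_at_critical:
 assumes "p > 1" "t > 0" "t - B*t powr p = phi"
 shows "fibre p B phi t = (p - 1)/(2*(p + 1))*t^2 - p/(p + 1)*t*phi"
proof -
 have "t powr (p + 1)*B = t*(B*t powr p)" using assms(2) by (simp add: powr_add mult_ac)
 also have "B*t powr p = t - phi" using assms(3) by simp
 finally have q: "t powr (p + 1)*B = t*(t - phi)" .
 show ?thesis unfolding fibre_def q using assms(1) by (simp add: divide_simps power2_eq_square) (simp add: algebra_simps)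
qed

context nonlinear
begin

abbreviation Hdual :: "('n fn => real) set" where "Hdual \<equiv> Hneg s"
abbreviation dual_norm :: "('n fn => real) => real" where "dual_norm \<equiv> Hneg_norm s"

lemma dual_add: "f \<in> Hdual ==> u \<in> H ==> v \<in> H ==> f (%x. u x + v x) = f u + f v"
 and dual_scale: "f \<in> Hdual ==> u \<in> H ==> f (%x. c*u x) = c*f u"
 by (auto simp: Hneg_def)

lemma dual_diff: "f \<in> Hdual ==> u \<in> H ==> v \<in> H ==> f (%x. u x - v x) = f u - f v"
 using dual_add[of f u "%x. -1 * v x"] dual_scale[of f v "-1"] H_scale[of v "-1"] by simp

lemma zero_dual: "(%_. 0) \<in> Hdual" by (auto simp: Hneg_def intro!: exI[of _ 0])

lemma bdd_above_dual: assumes "f \<in> Hdual" shows "bdd_above {abs (f u) |u. u \<in> H & Hnorm u <= 1}"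
proof -
 obtain K where K: "!!u. u \<in> H ==> abs (f u) <= K*Hnorm u" using assms unfolding Hneg_def by blast
 have "abs (f u) <= abs K" if "u \<in> H" "Hnorm u <= 1" for u
 proof -
  have "K*Hnorm u <= abs K*1" using that Hnorm_nonneg[of u] by (intro mult_mono) auto
  thus ?thesis using K[OF that(1)] by simp
 qed
 thus ?thesis by (auto intro!: bdd_aboveI[of _ "abs K"])
qed

lemma dual_norm_nonneg: assumes "f \<in> Hdual" shows "dual_norm f >= 0"
 unfolding Hneg_norm_def
 using H_zero Hnorm_zero by (intro cSup_upper2[OF _ abs_ge_zero bdd_above_dual[OF assms]] CollectI exI[of _ "%x. 0"]) auto

lemma dual_bound: assumes f: "f \<in> Hdual" and u: "u \<in> H" shows "abs (f u) <= dual_norm f*Hnorm u"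
proof (cases "Hnorm u = 0")
 case True
 thus ?thesis using f u unfolding Hneg_def by force
next
 case False
 hence h: "Hnorm u > 0" using Hnorm_nonneg[of u] by linarith
 have "abs (f (normalized u)) <= dual_norm f"
  unfolding Hneg_norm_def using H_normalized[OF u] Hnorm_normalized[OF h]
  by (intro cSup_upper[OF _ bdd_above_dual[OF f]] CollectI exI[of _ "normalized u"]) auto
 hence "abs (f u)/Hnorm u <= dual_norm f" using h dual_scale[OF f u, of "1/Hnorm u"] by (simp add: normalized_def)
 thus ?thesis using h by (simp add: field_simps)
qed

lemma dual_AE_cong:
 assumes "f \<in> Hdual" "u \<in> H" "v \<in> H" "AE x in L. u x = v x" shows "f u = f v"
proof -
 have "Hdist u v = 0" using assms by (subst Hnorm_eq_0_iff) (auto intro: H_diff)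
 thus ?thesis using dual_bound[OF assms(1) H_diff[OF assms(2,3)]] dual_diff[OF assms(1-3)] by simp
qed

definition I_deriv :: "'n fn => ('n fn => real) => 'n fn => 'n fn => real" where
 "I_deriv b f u h = Hinner u h - Bform b u h - f h"

definition taylor_const :: "real => real" where "taylor_const M = 1/2 + C_taylor/(p + 1)*M powr (p - 1)"
definition deriv_lip :: "real => real" where "deriv_lip M = 1 + 3*p*C_sob*M powr (p - 1)"

lemma taylor_const_mono: "0 <= M ==> M <= M' ==> taylor_const M <= taylor_const M'" and taylor_const_pos: "taylor_const M > 0"
 using C_taylor_pos p_gt_1 by (auto simp: taylor_const_def add_pos_nonneg intro!: mult_left_mono divide_right_mono powr_mono2)
lemma deriv_lip_mono: "0 <= M ==> M <= M' ==> deriv_lip M <= deriv_lip M'" and deriv_lip_pos: "deriv_lip M > 0"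
 using C_sob_pos p_gt_1 by (auto simp: deriv_lip_def add_pos_nonneg intro!: mult_left_mono powr_mono2)

lemma I_deriv_add: "coefficient b ==> f \<in> Hdual ==> u \<in> H ==> h \<in> H ==> k \<in> H ==> I_deriv b f u (%x. h x + k x) = I_deriv b f u h + I_deriv b f u k"
 by (simp add: I_deriv_def Hinner_add_right Bform_add dual_add)
lemma I_deriv_scale: "f \<in> Hdual ==> h \<in> H ==> I_deriv b f u (%x. c*h x) = c*I_deriv b f u h"
 by (simp add: I_deriv_def Hinner_scale_right Bform_scale dual_scale right_diff_distrib)

lemma I_taylor:
 assumes "coefficient b" "f \<in> Hdual" "u \<in> H" "h \<in> H"
 shows "abs (Ifun s p b f (%x. u x + h x) - Ifun s p b f u - I_deriv b f u h) <= taylor_const (Hnorm u + Hnorm h)*(Hnorm h)^2"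
proof -
 define E where "E = Bint b (%x. u x + h x) - Bint b u - (p + 1)*Bform b u h"
 have E: "abs (E/(p + 1)) <= C_taylor/(p + 1)*(Hnorm u + Hnorm h) powr (p - 1)*(Hnorm h)^2"
  using Bint_taylor[OF assms(1,3,4)] p_gt_1 by (simp add: E_def abs_divide divide_right_mono)
 have "Ifun s p b f (%x. u x + h x) - Ifun s p b f u - I_deriv b f u h = (Hnorm h)^2/2 - E/(p + 1)"
 proof -
  have q: "(p + 1)*Bform b u h/(p + 1) = Bform b u h" using p_gt_1 by simp
  have "E/(p + 1) = Bint b (%x. u x + h x)/(p + 1) - Bint b u/(p + 1) - Bform b u h"
   unfolding E_def diff_divide_distrib q ..
  thus ?thesis by (simp add: Ifun_eq I_deriv_def Hnorm_power2_add assms dual_add add_divide_distrib)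
 qed
 hence "abs (Ifun s p b f (%x. u x + h x) - Ifun s p b f u - I_deriv b f u h) <= (Hnorm h)^2/2 + abs (E/(p + 1))"
  using abs_triangle_ineq4[of "(Hnorm h)^2/2" "E/(p + 1)"] by simp
 also have "... <= (Hnorm h)^2/2 + C_taylor/(p + 1)*(Hnorm u + Hnorm h) powr (p - 1)*(Hnorm h)^2" using E by simp
 finally show ?thesis by (simp add: taylor_const_def algebra_simps)
qed

lemma I_deriv_lipschitz:
 assumes "coefficient b" "f \<in> Hdual" "u \<in> H" "v \<in> H" "h \<in> H"
 shows "abs (I_deriv b f u h - I_deriv b f v h) <= deriv_lip (Hnorm u + Hnorm v)*Hdist u v * Hnorm h"
proof -
 have "I_deriv b f u h - I_deriv b f v h = Hinner (%x. u x - v x) h - (Bform b u h - Bform b v h)"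
  using assms by (simp add: I_deriv_def Hinner_diff_left)
 hence "abs (I_deriv b f u h - I_deriv b f v h) <= Hdist u v * Hnorm h + 3*p*C_sob*(Hnorm u + Hnorm v) powr (p - 1)*Hdist u v * Hnorm h"
  using Hinner_Cauchy_Schwarz[OF H_diff[OF assms(3,4)] assms(5)] Bform_lipschitz[OF assms(1,3,4,5)] by linarith
 thus ?thesis by (simp add: deriv_lip_def algebra_simps)
qed

lemma I_deriv_bound:
 assumes "coefficient b" "f \<in> Hdual" "u \<in> H" "Hnorm u <= T" "h \<in> H"
 shows "abs (I_deriv b f u h) <= (T + 3*C_sob*T powr p + dual_norm f)*Hnorm h"
proof -
 have "abs (Hinner u h) <= T*Hnorm h"
  using order_trans[OF Hinner_Cauchy_Schwarz[OF assms(3,5)] mult_right_mono[OF assms(4) Hnorm_nonneg]] .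
 moreover have "3*C_sob*(Hnorm u powr p*Hnorm h) <= 3*C_sob*(T powr p*Hnorm h)"
  using C_sob_pos assms(4) p_gt_1 Hnorm_nonneg by (intro mult_left_mono mult_right_mono powr_mono2) auto
 hence "abs (Bform b u h) <= 3*C_sob*(T powr p*Hnorm h)" using Bform_bound[OF assms(1,3,5)] by linarith
 ultimately show ?thesis using dual_bound[OF assms(2,5)] unfolding I_deriv_def by (simp add: algebra_simps abs_le_iff)
qed

lemma crit_HsI:
 assumes b: "coefficient b" and f: "f \<in> Hdual" and u: "u \<in> H" and z: "!!h. h \<in> H ==> I_deriv b f u h = 0"
 shows "crit_Hs s (Ifun s p b f) u"
 unfolding crit_Hs_def
proof (intro conjI allI impI u)
 fix e :: real assume e: "e > 0"
 define R where "R = taylor_const (Hnorm u + 1)"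
 have R: "R > 0" by (simp add: R_def taylor_const_pos)
 show "\<exists>d>0. \<forall>h\<in>H. Hnorm h < d --> abs (Ifun s p b f (%x. u x + h x) - Ifun s p b f u) <= e*Hnorm h"
 proof (intro exI[of _ "min 1 (e/R)"] conjI ballI impI)
  fix h assume h: "h \<in> H" "Hnorm h < min 1 (e/R)"
  have "abs (Ifun s p b f (%x. u x + h x) - Ifun s p b f u) <= taylor_const (Hnorm u + Hnorm h)*(Hnorm h)^2"
   using I_taylor[OF b f u h(1)] z[OF h(1)] by simp
  also have "... <= R*(Hnorm h)^2" unfolding R_def using h Hnorm_nonneg[of u] Hnorm_nonneg[of h] by (intro mult_right_mono taylor_const_mono) auto
  also have "... = (R*Hnorm h)*Hnorm h" by (simp add: power2_eq_square)
  also have "... <= e*Hnorm h" using h R Hnorm_nonneg[of h] by (intro mult_right_mono) (auto simp: field_simps)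
  finally show "abs (Ifun s p b f (%x. u x + h x) - Ifun s p b f u) <= e*Hnorm h" .
 qed (use e R in auto)
qed

lemma crit_Hs_I_deriv_le:
 assumes b: "coefficient b" and f: "f \<in> Hdual" and c: "crit_Hs s (Ifun s p b f) u" and h: "h \<in> H" and e: "e > 0"
 shows "abs (I_deriv b f u h) <= 2*e*Hnorm h"
proof -
 have u: "u \<in> H" using c by (simp add: crit_Hs_def)
 obtain d where d: "d > 0" "!!k. k \<in> H ==> Hnorm k < d ==> abs (Ifun s p b f (%x. u x + k x) - Ifun s p b f u) <= e*Hnorm k"
  using c e unfolding crit_Hs_def by metis
 define R where "R = taylor_const (Hnorm u + 1)"
 have R: "R > 0" by (simp add: R_def taylor_const_pos)
 define m where "m = min d (min 1 (e/R))"
 define t where "t = m/(Hnorm h + 1)"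
 have m: "0 < m" "m <= d" "m <= 1" "m <= e/R" using d(1) e R by (auto simp: m_def)
 have t: "t > 0" using m Hnorm_nonneg[of h] by (simp add: t_def)
 define k where "k = (%x. t*h x)"
 have k: "k \<in> H" "Hnorm k = t*Hnorm h" using t H_scale[OF h] by (auto simp: k_def Hnorm_scale)
 have km: "Hnorm k < m" using m(1) Hnorm_nonneg[of h] by (simp add: k t_def field_simps)
 have "taylor_const (Hnorm u + Hnorm k)*(Hnorm k)^2 <= R*(Hnorm k)^2"
  unfolding R_def using km m(3) Hnorm_nonneg[of u] Hnorm_nonneg[of k] by (intro mult_right_mono taylor_const_mono) auto
 also have "... = (R*Hnorm k)*Hnorm k" by (simp add: power2_eq_square)
 also have "R*Hnorm k <= R*(e/R)" using km m(4) R by (intro mult_left_mono) auto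
 hence "(R*Hnorm k)*Hnorm k <= e*Hnorm k" using R Hnorm_nonneg by (intro mult_right_mono) auto
 finally have "abs (I_deriv b f u k) <= 2*e*Hnorm k"
  using I_taylor[OF b f u k(1)] d(2)[OF k(1)] km m(2) by (simp add: abs_le_iff)
 hence "t*abs (I_deriv b f u h) <= t*(2*e*Hnorm h)" using t I_deriv_scale[OF f h, of b u t] by (simp add: k_def Hnorm_scale abs_mult mult_ac)
 thus ?thesis using t by simp
qed

lemma crit_Hs_iff:
 assumes "coefficient b" "f \<in> Hdual"
 shows "crit_Hs s (Ifun s p b f) u \<longleftrightarrow> u \<in> H & (\<forall>h\<in>H. I_deriv b f u h = 0)"
proof (intro iffI conjI ballI)
 assume c: "crit_Hs s (Ifun s p b f) u"
 thus "u \<in> H" by (simp add: crit_Hs_def)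
 fix h assume h: "h \<in> H"
 have "abs (I_deriv b f u h) <= 0 + e" if "e > 0" for e
 proof -
  have "abs (I_deriv b f u h) <= 2*(e/(2*(Hnorm h + 1)))*Hnorm h"
   using that Hnorm_nonneg[of h] by (intro crit_Hs_I_deriv_le[OF assms c h]) auto
  also have "... <= e" using that Hnorm_nonneg[of h] by (simp add: field_simps)
  finally show ?thesis by simp
 qed
 thus "I_deriv b f u h = 0" using field_le_epsilon[of "abs (I_deriv b f u h)" 0] by simp
qed (use assms crit_HsI in auto)

definition Bint_lip :: real where "Bint_lip = (p + 1)*(3*C_sob) + C_taylor*3 powr (p - 1)*2"

lemma Bint_lip_pos: "Bint_lip > 0" using p_gt_1 C_sob_pos C_taylor_pos by (simp add: Bint_lip_def add_pos_pos)

lemma Bint_lipschitz: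
 assumes b: "coefficient b" and v: "v \<in> H" "Hnorm v = 1" and w: "w \<in> H" "Hnorm w = 1"
 shows "abs (Bint b w - Bint b v) <= Bint_lip*Hdist w v"
proof -
 define d where "d = Hdist w v"
 have d: "0 <= d" "d <= 2" using Hnorm_nonneg Hnorm_diff_le[OF w(1) v(1)] by (auto simp: d_def w v)
 note k = H_diff[OF w(1) v(1)]
 have "abs (Bint b w - Bint b v - (p + 1)*Bform b v (%x. w x - v x)) <= C_taylor*(1 + d) powr (p - 1)*d^2"
  using Bint_taylor[OF b v(1) k] by (simp add: d_def v)
 also have "... <= C_taylor*3 powr (p - 1)*(2*d)"
  using C_taylor_pos d p_gt_1 by (intro mult_mono powr_mono2) (auto simp: power2_eq_square mult_right_mono)
 finally have "abs (Bint b w - Bint b v) <= abs ((p + 1)*Bform b v (%x. w x - v x)) + C_taylor*3 powr (p - 1)*(2*d)" by linarith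
 moreover have "(p + 1)*abs (Bform b v (%x. w x - v x)) <= (p + 1)*(3*C_sob*d)"
  using Bform_bound[OF b v(1) k] p_gt_1 by (intro mult_left_mono) (auto simp: d_def v)
 moreover have "abs ((p + 1)*Bform b v (%x. w x - v x)) = (p + 1)*abs (Bform b v (%x. w x - v x))" using p_gt_1 by (simp add: abs_mult)
 moreover have "Bint_lip*d = (p + 1)*(3*C_sob*d) + C_taylor*3 powr (p - 1)*(2*d)" by (simp add: Bint_lip_def algebra_simps)
 ultimately show ?thesis unfolding d_def[symmetric] by linarith
qed

lemma Hdist_tendsto:
 assumes "!!n. v n \<in> H" "w \<in> H" "(%n. Hdist (v n) w) ---> 0"
 shows "(%n. Hnorm (v n)) ---> Hnorm w" "coefficient b ==> (%n. Bint b (v n)) ---> Bint b w" "f \<in> Hdual ==> (%n. f (v n)) ---> f w"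
proof -
 show h: "(%n. Hnorm (v n)) ---> Hnorm w"
  by (rule LIM_zero_cancel, rule tendsto_0_le[OF assms(3), of _ 1]) (auto intro!: always_eventually simp: Hnorm_nonneg Hnorm_reverse_triangle assms)
 show "(%n. f (v n)) ---> f w" if "f \<in> Hdual"
 proof (rule LIM_zero_cancel, rule tendsto_0_le[OF assms(3), of _ "dual_norm f"], intro always_eventually allI)
  show "norm (f (v n) - f w) <= norm (Hdist (v n) w)*dual_norm f" for n
   using dual_bound[OF that H_diff[OF assms(1,2)], of n] dual_diff[OF that assms(1,2), of n] by (simp add: Hnorm_nonneg mult.commute)
 qed
 show "(%n. Bint b (v n)) ---> Bint b w" if b: "coefficient b"
 proof -
  let ?h = "%n x. v n x - w x"
  have t: "abs (Bint b (v n) - Bint b w - (p + 1)*Bform b w (?h n)) <= C_taylor*(Hnorm w + Hnorm (?h n)) powr (p - 1)*(Hnorm (?h n))^2" for n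
   using Bint_taylor[OF b assms(2) H_diff[OF assms(1,2)], of n] by simp
  have "(%n. Bform b w (?h n)) ---> 0"
   by (rule tendsto_0_le[OF assms(3), of _ "3*C_sob*Hnorm w powr p"], intro always_eventually allI)
    (use Bform_bound[OF b assms(2) H_diff[OF assms(1,2)]] in \<open>simp add: Hnorm_nonneg mult_ac\<close>)
  moreover have "(%n. C_taylor*(Hnorm w + Hnorm (?h n)) powr (p - 1)*(Hnorm (?h n))^2) ---> C_taylor*(Hnorm w + 0) powr (p - 1)*0^2"
   using assms(3) p_gt_1 Hnorm_nonneg by (intro tendsto_intros tendsto_powr2) (auto intro!: always_eventually)
  hence g0: "(%n. C_taylor*(Hnorm w + Hnorm (?h n)) powr (p - 1)*(Hnorm (?h n))^2) ---> 0" by simp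
  have "(%n. Bint b (v n) - Bint b w - (p + 1)*Bform b w (?h n)) ---> 0"
   by (rule Lim_null_comparison[OF _ g0]) (use t in \<open>simp add: always_eventually\<close>)
  ultimately have "(%n. (Bint b (v n) - Bint b w - (p + 1)*Bform b w (?h n)) + (p + 1)*Bform b w (?h n)) ---> 0 + (p + 1)*0"
   by (intro tendsto_intros)
  thus ?thesis by (simp add: LIM_zero_iff)
 qed
qed

definition kappa :: real where "kappa = (p - 1)/(2*(p + 1))"
lemma kappa_pos: "kappa > 0" and kappa_le: "kappa <= 1/2" using p_gt_1 by (auto simp: kappa_def field_simps)

end

locale potential = nonlinear s N2s n_type p for s N2s and n_type :: "'n::finite itself" and p +
 fixes a :: "real^'n => real"
 assumes a_coef: "coefficient a" and a_low: "\<exists>c>0. \<forall>x. c <= a x"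
  and a_dec: "\<exists>C. \<forall>x. 1 - a x <= C * weight x powr ((p + 1)/2)"
  and a_ne1: "~ (AE x in lborel. a x = 1)"
begin

abbreviation Sigma :: "'n fn set" where "Sigma \<equiv> Sigma_plus s"
abbreviation I :: "('n fn => real) => 'n fn => real" where "I f \<equiv> Ifun s p a f"
abbreviation J :: "('n fn => real) => 'n fn => real" where "J f \<equiv> Jfun s p a f"
abbreviation stationary :: "('n fn => real) => 'n fn => bool" where "stationary f u \<equiv> \<forall>h\<in>H. I_deriv a f u h = 0"

lemma one_minus_a_integrable: "integrable L (%x. 1 - a x)"
proof -
 obtain C where C: "!!x. 1 - a x <= C * weight x powr ((p + 1)/2)" using a_dec by blast
 show ?thesis
 proof (rule integrable_boundI[OF integrable_mult_right[OF weight_integrable, of "abs C"]])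
  show "abs (1 - a x) <= abs C * weight x" for x
  proof -
   have "weight x powr ((p + 1)/2) <= weight x powr 1" using p_gt_1 weight_pos[of x] weight_le_1[of x] by (intro powr_mono') auto
   hence "C * weight x powr ((p + 1)/2) <= abs C * weight x" using weight_pos[of x] by (intro mult_mono) auto
   thus ?thesis using C[of x] coefficientD(3)[OF a_coef, of x] by simp
  qed
 qed (use coefficientD(1)[OF a_coef] in measurable)
qed

definition tmax_min :: real where "tmax_min = C_sob powr (- 1/(p - 1))/2"
definition dual_max :: real where "dual_max = kappa*tmax_min"
definition small_dual :: "('n fn => real) => bool" where "small_dual f \<longleftrightarrow> f \<in> Hdual & dual_norm f <= dual_max"

lemma tmax_min_pos: "tmax_min > 0" and dual_max_pos: "dual_max > 0"
 using C_sob_pos p_gt_1 kappa_pos by (auto simp: tmax_min_def dual_max_def)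

lemma small_dualD: "small_dual f ==> f \<in> Hdual" "small_dual f ==> dual_norm f <= dual_max"
 by (auto simp: small_dual_def)

lemma Sigma_plusD: "v \<in> Sigma ==> v \<in> H" "v \<in> Sigma ==> Hnorm v = 1" by (auto simp: Sigma_plus_def)

lemma small_dual_le: "small_dual f ==> v \<in> Sigma ==> abs (f v) <= dual_max"
 using dual_bound[of f v] Sigma_plusD[of v] small_dualD[of f] by simp

lemma Bint_pos_iff: assumes "v \<in> H" shows "Bint a v > 0 \<longleftrightarrow> ~ (AE x in L. max (v x) 0 = 0)"
proof -
 have "Bint a v = 0 \<longleftrightarrow> (AE x in L. a x*max (v x) 0 powr (p + 1) = 0)"
  unfolding Bint_def using Bint_integrable[OF a_coef assms] coefficientD(2)[OF a_coef]
  by (intro integral_nonneg_eq_0_iff_AE) auto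
 also have "... \<longleftrightarrow> (AE x in L. max (v x) 0 = 0)"
 proof -
  have "a x ~= 0" for x using a_low by (metis not_le order_less_irrefl)
  thus ?thesis by simp
 qed
 finally show ?thesis using Bint_nonneg[OF a_coef, of v] by linarith
qed

lemma Sigma_plus_iff: "v \<in> Sigma \<longleftrightarrow> v \<in> H & Hnorm v = 1 & Bint a v > 0"
 using Bint_pos_iff by (auto simp: Sigma_plus_def)

lemma Bint_Sigma_plus: assumes "v \<in> Sigma" shows "Bint a v > 0" "Bint a v <= C_sob"
 using assms Bint_le[OF a_coef, of v] by (auto simp: Sigma_plus_iff)

lemma I_eq_fibre: assumes "v \<in> Sigma" "f \<in> Hdual" "t >= 0" shows "I f (%x. t * v x) = fibre p (Bint a v) (f v) t"
 using assms Sigma_plusD[OF assms(1)] by (simp add: Ifun_eq Hnorm_scale Bint_scale dual_scale fibre_def power_mult_distrib)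

lemma fibre_at_natural:
 assumes "B > 0" shows "fibre p B phi (B powr (- 1/(p - 1))) = kappa*(B powr (- 1/(p - 1)))^2 - B powr (- 1/(p - 1))*phi"
proof -
 let ?t = "B powr (- 1/(p - 1))"
 have "?t powr (p - 1) = B powr (- 1)" using p_gt_1 by (subst powr_powr) simp
 hence "?t powr (p - 1)*B = 1" using assms by (simp add: powr_minus)
 moreover have "?t powr (p + 1) = ?t powr (p - 1)*?t^2"
  using powr_add[of ?t "p - 1" 2] assms by (simp add: powr_numeral add.commute)
 ultimately have "?t powr (p + 1)*B = ?t^2" by (simp add: mult_ac)
 thus ?thesis unfolding fibre_def using p_gt_1 by (simp add: kappa_def field_simps)
qed

definition tmax :: "('n fn => real) => 'n fn => real" where
 "tmax f v = (SOME t. t > 0 & (\<forall>r>0. fibre p (Bint a v) (f v) r <= fibre p (Bint a v) (f v) t))"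

lemma tmax_max:
 assumes f: "small_dual f" and v: "v \<in> Sigma"
 shows "tmax f v > 0" "r > 0 ==> fibre p (Bint a v) (f v) r <= fibre p (Bint a v) (f v) (tmax f v)"
  "kappa*(2*tmax_min^2) <= fibre p (Bint a v) (f v) (tmax f v)"
proof -
 note B = Bint_Sigma_plus[OF v]
 let ?t = "Bint a v powr (- 1/(p - 1))"
 have t: "2*tmax_min <= ?t" using powr_mono2'[of "- 1/(p - 1)" "Bint a v" C_sob] B p_gt_1 by (simp add: tmax_min_def)
 have "f v <= kappa*tmax_min" using small_dual_le[OF f v] by (simp add: dual_max_def abs_le_iff)
 hence "(2*tmax_min)*(kappa*(2*tmax_min) - kappa*tmax_min) <= ?t*(kappa*?t - f v)"
  using t tmax_min_pos kappa_pos by (intro mult_mono diff_mono mult_left_mono) auto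
 hence nat: "kappa*(2*tmax_min^2) <= fibre p (Bint a v) (f v) ?t"
  using fibre_at_natural[OF B(1), of "f v"] by (simp add: power2_eq_square algebra_simps)
 moreover have "kappa*(2*tmax_min^2) > 0" using kappa_pos tmax_min_pos by simp
 ultimately have "\<exists>t>0. \<forall>r>0. fibre p (Bint a v) (f v) r <= fibre p (Bint a v) (f v) t"
  using B(1) by (intro fibre_max_exists[OF p_gt_1 B(1), of ?t]) auto
 hence *: "tmax f v > 0 & (\<forall>r>0. fibre p (Bint a v) (f v) r <= fibre p (Bint a v) (f v) (tmax f v))"
  unfolding tmax_def by (rule someI_ex)
 thus "tmax f v > 0" "r > 0 ==> fibre p (Bint a v) (f v) r <= fibre p (Bint a v) (f v) (tmax f v)" by auto
 have "?t > 0" using B(1) by simp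
 thus "kappa*(2*tmax_min^2) <= fibre p (Bint a v) (f v) (tmax f v)" using nat * by (meson order_trans)
qed

lemma tmax_critical: assumes "small_dual f" "v \<in> Sigma" shows "tmax f v - Bint a v * tmax f v powr p = f v"
 using fibre_max_critical[OF p_gt_1 tmax_max(1,2)[OF assms]] .

lemma J_eq:
 assumes "small_dual f" "v \<in> Sigma"
 shows "J f v = I f (%x. tmax f v * v x)" "J f v = fibre p (Bint a v) (f v) (tmax f v)"
  "r > 0 ==> I f (%x. r * v x) <= J f v" "J f v > 0"
  "J f v = kappa*(tmax f v)^2 - p/(p + 1)*tmax f v * f v"
proof -
 note f = small_dualD(1)[OF assms(1)] and t = tmax_max[OF assms]
 have "J f v = (SUP r\<in>{0<..}. fibre p (Bint a v) (f v) r)"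
  unfolding Jfun_def using I_eq_fibre[OF assms(2) f] by (intro SUP_cong) auto
 also have "... = fibre p (Bint a v) (f v) (tmax f v)"
  using t(1,2) by (intro cSup_eq_maximum) auto
 finally show J: "J f v = fibre p (Bint a v) (f v) (tmax f v)" .
 thus "J f v = I f (%x. tmax f v * v x)" using I_eq_fibre[OF assms(2) f] t by auto
 show "J f v > 0" unfolding J using t(3) kappa_pos tmax_min_pos by (smt (verit) mult_pos_pos zero_less_power)
 show "r > 0 ==> I f (%x. r * v x) <= J f v" using J I_eq_fibre[OF assms(2) f] t(2) by auto
 show "J f v = kappa*(tmax f v)^2 - p/(p + 1)*tmax f v * f v"
  unfolding J kappa_def by (rule fibre_at_critical[OF p_gt_1 t(1) tmax_critical[OF assms]])
qed

lemma tmax_ge: assumes "small_dual f" "v \<in> Sigma" shows "tmax f v >= tmax_min"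
proof (rule ccontr)
 define t where "t = tmax f v"
 assume "~ ?thesis"
 hence t: "0 < t" "t < tmax_min" using tmax_max(1)[OF assms] by (auto simp: t_def)
 have "p/(p + 1)*t*(- f v) <= p/(p + 1)*t*dual_max" using small_dual_le[OF assms] t p_gt_1 by (intro mult_left_mono) auto
 also have "... <= 1*tmax_min*dual_max" using t p_gt_1 dual_max_pos by (intro mult_mono) auto
 finally have "J f v <= kappa*t^2 + kappa*tmax_min^2" using J_eq(5)[OF assms] by (simp add: t_def dual_max_def power2_eq_square mult_ac)
 moreover have "kappa*t^2 < kappa*tmax_min^2" using t kappa_pos by (intro mult_strict_left_mono power_strict_mono) auto
 ultimately show False using tmax_max(3)[OF assms] J_eq(2)[OF assms] by simp
qed

lemma small_dual_le_tmax: assumes "small_dual f" "v \<in> Sigma" shows "abs (f v) <= kappa*tmax f v"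
 using order_trans[OF small_dual_le[OF assms, unfolded dual_max_def] mult_left_mono[OF tmax_ge[OF assms] less_imp_le[OF kappa_pos]]] .

lemma Bint_tmax_powr:
 assumes "small_dual f" "v \<in> Sigma"
 shows "1/2 <= Bint a v * tmax f v powr (p - 1)" "Bint a v * tmax f v powr (p - 1) <= 3/2"
proof -
 define t where "t = tmax f v"
 have t: "t > 0" using tmax_max(1)[OF assms] by (simp add: t_def)
 have "abs (f v) <= kappa*t" using small_dual_le_tmax[OF assms] by (simp add: t_def)
 also have "... <= 1/2*t" using t kappa_le by (intro mult_right_mono) auto
 finally have "abs (f v) <= t/2" by simp
 moreover have "t*(Bint a v * t powr (p - 1)) = Bint a v * t powr p" using powr_mult_base[of t "p - 1"] t by simp
 ultimately have "t*(1/2) <= t*(Bint a v * t powr (p - 1))" "t*(Bint a v * t powr (p - 1)) <= t*(3/2)"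
  using tmax_critical[OF assms] unfolding t_def[symmetric] by linarith+
 thus "1/2 <= Bint a v * tmax f v powr (p - 1)" "Bint a v * tmax f v powr (p - 1) <= 3/2"
  using t unfolding t_def[symmetric] by (simp_all only: mult_le_cancel_left_pos)
qed

definition tmax_bound :: "real => real" where "tmax_bound c = max 1 ((abs c + dual_max)/kappa)"

lemma tmax_le: assumes "small_dual f" "v \<in> Sigma" "J f v <= c" shows "tmax f v <= tmax_bound c"
proof (cases "tmax f v <= 1")
 case False
 define t where "t = tmax f v"
 have t: "t > 1" using False by (simp add: t_def)
 have "p/(p + 1)*t * f v <= p/(p + 1)*t*dual_max" using small_dual_le[OF assms(1,2)] t p_gt_1 by (intro mult_left_mono) auto
 also have "... <= 1*t*dual_max" using t p_gt_1 dual_max_pos by (intro mult_right_mono) auto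
 finally have "kappa*t^2 <= c + t*dual_max" using J_eq(5)[OF assms(1,2)] assms(3) by (simp add: t_def)
 also have "... <= (abs c + dual_max)*t" using t mult_left_mono[of 1 t "abs c"] by (simp add: algebra_simps)
 finally have "kappa*t <= abs c + dual_max" using t by (simp add: power2_eq_square)
 hence "t <= (abs c + dual_max)/kappa" using kappa_pos by (simp add: field_simps)
 thus ?thesis by (simp add: t_def tmax_bound_def)
qed (simp add: tmax_bound_def)

definition Sigma_radius :: "real => real" where "Sigma_radius T = 1/(4*Bint_lip*T powr (p - 1))"

lemma Sigma_radius_pos: "T > 0 ==> Sigma_radius T > 0" using Bint_lip_pos by (simp add: Sigma_radius_def)

lemma near_Sigma:
 assumes f: "small_dual f" and v: "v \<in> Sigma" "tmax f v <= T" and w: "w \<in> H" "Hnorm w = 1" "Hdist w v <= Sigma_radius T"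
 shows "w \<in> Sigma" "tmax f w <= 6 powr (1/(p - 1))*T"
proof -
 define B where "B = Bint a v"
 define tp where "tp = tmax f v powr (p - 1)"
 have T: "0 < tmax f v" "0 < T" using tmax_max(1)[OF f v(1)] v(2) by auto
 have B: "B > 0" "1/2 <= B*tp" "B*tp <= 3/2" using Bint_Sigma_plus(1)[OF v(1)] Bint_tmax_powr[OF f v(1)] by (auto simp: B_def tp_def)
 have tp: "0 < tp" "tp <= T powr (p - 1)" using T v(2) p_gt_1 by (auto simp: tp_def intro!: powr_mono2)
 have "B*tp <= B*T powr (p - 1)" using B(1) tp(2) by (intro mult_left_mono) auto
 hence "1/2 <= B*T powr (p - 1)" using B(2) by linarith
 hence "1/(4*T powr (p - 1)) <= B/2" using T(2) by (simp add: field_simps)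
 moreover have "Bint_lip*Hdist w v <= 1/(4*T powr (p - 1))"
  using mult_left_mono[OF w(3), of Bint_lip] Bint_lip_pos by (simp add: Sigma_radius_def)
 ultimately have Bw: "B/2 <= Bint a w" using Bint_lipschitz[OF a_coef Sigma_plusD[OF v(1)] w(1,2)] by (simp add: B_def abs_le_iff)
 thus wS: "w \<in> Sigma" using B(1) w by (simp add: Sigma_plus_iff)
 define r where "r = tmax f w"
 have r: "r > 0" using tmax_max(1)[OF f wS] by (simp add: r_def)
 have "B/2*r powr (p - 1) <= Bint a w*r powr (p - 1)" using Bw by (intro mult_right_mono) auto
 also have "... <= 3*(B*tp)" using Bint_tmax_powr(2)[OF f wS] B(2) by (simp add: r_def)
 finally have "r powr (p - 1) <= 6*tp" using B(1) by (simp add: field_simps)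
 hence "r powr (p - 1) <= 6*T powr (p - 1)" using tp(2) by simp
 hence "(r powr (p - 1)) powr (1/(p - 1)) <= (6*T powr (p - 1)) powr (1/(p - 1))" using p_gt_1 by (intro powr_mono2) auto
 thus "tmax f w <= 6 powr (1/(p - 1))*T" using r T p_gt_1 by (simp add: r_def powr_mult powr_powr)
qed

lemma tmax_one_sided:
 assumes f: "small_dual f" and v: "v \<in> Sigma" and w: "w \<in> Sigma" and le: "tmax f v <= tmax f w"
 shows "(p - 1)/2*(tmax f w - tmax f v) <= abs (f w - f v) + abs (Bint a w - Bint a v)*tmax f w powr p"
proof -
 define t where "t = tmax f v"
 define r where "r = tmax f w"
 have t: "t > 0" and tr: "t <= r" using tmax_max(1)[OF f v] le by (auto simp: t_def r_def)
 have Bt: "Bint a v * t powr p = t - f v" and Br: "Bint a w * r powr p = r - f w"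
  using tmax_critical[OF f v] tmax_critical[OF f w] by (auto simp: t_def r_def)
 have "f v <= kappa*t" using small_dual_le_tmax[OF f v] by (simp add: t_def abs_le_iff)
 hence fv: "(1 - kappa)*t <= t - f v" by (simp add: algebra_simps)
 have tf: "t - f v >= 0" using order_trans[OF mult_nonneg_nonneg fv] kappa_le t by simp
 have "p*(1 - kappa) <= p*((t - f v)/t)" using fv t p_gt_1 by (intro mult_left_mono) (auto simp: field_simps)
 moreover have "(p + 1)/2 <= p*(1 - kappa)" using p_gt_1 by (simp add: kappa_def field_simps)
 ultimately have "(p + 1)/2 <= p*((t - f v)/t)" by linarith
 hence "(p + 1)/2*(r - t) <= p*((t - f v)/t)*(r - t)" using tr by (intro mult_right_mono) auto
 hence "(t - f v) + (p + 1)/2*(r - t) <= (t - f v) + p*((t - f v)/t)*(r - t)" by simp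
 also have "... = (t - f v)*(1 + p*(r/t - 1))" using t by (simp add: field_simps)
 also have "... <= (t - f v)*(r/t) powr p" using t tr p_gt_1 tf by (intro mult_left_mono bernoulli_powr) auto
 also have "... = Bint a v * (t powr p*(r/t) powr p)" unfolding Bt[symmetric] by simp
 also have "t powr p*(r/t) powr p = r powr p" using t tr by (simp add: powr_divide)
 finally have "(t - f v) + (p + 1)/2*(r - t) <= Bint a v * r powr p" .
 moreover have "(Bint a v - Bint a w)*r powr p <= abs (Bint a w - Bint a v)*r powr p" by (intro mult_right_mono) auto
 ultimately have "(t - f v) + (p + 1)/2*(r - t) <= (r - f w) + abs (Bint a w - Bint a v)*r powr p" using Br by (simp add: left_diff_distrib)
 moreover have "(p + 1)/2*(r - t) = (p - 1)/2*(r - t) + (r - t)" by (simp add: field_simps)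
 ultimately show ?thesis unfolding t_def[symmetric] r_def[symmetric] by linarith
qed

definition tmax_lip :: "real => real" where "tmax_lip T = 2/(p - 1)*(dual_max + Bint_lip*T powr p)"

lemma tmax_lip_pos: "tmax_lip T > 0" using p_gt_1 dual_max_pos Bint_lip_pos by (simp add: tmax_lip_def add_pos_nonneg)

lemma tmax_lipschitz:
 assumes f: "small_dual f" and v: "v \<in> Sigma" "tmax f v <= T" and w: "w \<in> Sigma" "tmax f w <= T"
 shows "abs (tmax f w - tmax f v) <= tmax_lip T*Hdist w v"
proof -
 have ordered: "(p - 1)/2*(tmax f w - tmax f v) <= (dual_max + Bint_lip*T powr p)*Hdist w v"
  if v: "v \<in> Sigma" and w: "w \<in> Sigma" "tmax f w <= T" and le: "tmax f v <= tmax f w" for v w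
 proof -
  note vH = Sigma_plusD[OF v] and wH = Sigma_plusD[OF w(1)]
  have "abs (f w - f v) <= dual_max*Hdist w v"
   using dual_bound[OF small_dualD(1)[OF f] H_diff[OF wH(1) vH(1)]] dual_diff[OF small_dualD(1)[OF f] wH(1) vH(1)]
    mult_right_mono[OF small_dualD(2)[OF f] Hnorm_nonneg, of "%x. w x - v x"] by simp
  moreover have "abs (Bint a w - Bint a v)*tmax f w powr p <= (Bint_lip*Hdist w v)*T powr p"
   using Bint_lipschitz[OF a_coef vH wH] w(2) tmax_max(1)[OF f w(1)] p_gt_1 Hnorm_nonneg Bint_lip_pos by (intro mult_mono powr_mono2) auto
  ultimately show ?thesis using tmax_one_sided[OF f v w(1) le] by (simp add: algebra_simps)
 qed
 have "(p - 1)/2*abs (tmax f w - tmax f v) <= (dual_max + Bint_lip*T powr p)*Hdist w v"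
  using ordered[OF v(1) w] ordered[OF w(1) v] Hnorm_diff_commute[of w v] by (cases "tmax f v <= tmax f w") auto
 thus ?thesis using p_gt_1 by (simp add: tmax_lip_def field_simps)
qed

lemma tmax_tendsto:
 assumes f: "small_dual f" and v: "!!n. v n \<in> Sigma" and w: "w \<in> Sigma" and lim: "(%n. Hdist (v n) w) ---> 0"
 shows "(%n. tmax f (v n)) ---> tmax f w" "(%n. J f (v n)) ---> J f w"
proof -
 define T where "T = 6 powr (1/(p - 1))*tmax f w"
 have w0: "tmax f w > 0" by (rule tmax_max(1)[OF f w])
 have "1 <= (6::real) powr (1/(p - 1))" using p_gt_1 by (intro ge_one_powr_ge_zero) auto
 hence wT: "tmax f w <= T" using w0 by (simp add: T_def)
 have "\<forall>\<^sub>F n in sequentially. Hdist (v n) w < Sigma_radius (tmax f w)"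
  using order_tendstoD(2)[OF lim Sigma_radius_pos[OF w0]] .
 hence "\<forall>\<^sub>F n in sequentially. norm (tmax f (v n) - tmax f w) <= norm (Hdist (v n) w)*tmax_lip T"
 proof eventually_elim
  case (elim n)
  have "tmax f (v n) <= T"
   unfolding T_def using near_Sigma(2)[OF f w order_refl Sigma_plusD[OF v]] elim by simp
  thus ?case using tmax_lipschitz[OF f w wT v, of n] Hnorm_nonneg by (simp add: mult.commute)
 qed
 thus t: "(%n. tmax f (v n)) ---> tmax f w" by (rule LIM_zero_cancel[OF tendsto_0_le[OF lim]])
 show "(%n. J f (v n)) ---> J f w"
  unfolding J_eq(5)[OF f v] J_eq(5)[OF f w]
  using t Hdist_tendsto(3)[OF Sigma_plusD(1)[OF v] Sigma_plusD(1)[OF w] lim small_dualD(1)[OF f]] by (intro tendsto_intros)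
qed

abbreviation nehari :: "('n fn => real) => 'n fn => 'n fn" where "nehari f v \<equiv> (%x. tmax f v * v x)"

lemma H_nehari: "v \<in> Sigma ==> nehari f v \<in> H" using Sigma_plusD(1) by (rule H_scale)

lemma Hnorm_nehari: "small_dual f ==> v \<in> Sigma ==> Hnorm (nehari f v) = tmax f v"
 using Sigma_plusD(2)[of v] tmax_max(1)[of f v] by (simp add: Hnorm_scale)

definition J_deriv :: "('n fn => real) => 'n fn => 'n fn => real" where
 "J_deriv f v h = tmax f v * I_deriv a f (nehari f v) h"

lemma I_deriv_nehari_self: assumes "small_dual f" "v \<in> Sigma" shows "I_deriv a f (nehari f v) v = 0"
proof -
 let ?t = "tmax f v"
 have t: "?t > 0" by (rule tmax_max(1)[OF assms])
 have "?t*Bform a (nehari f v) v = Bform a (nehari f v) (nehari f v)" by (simp add: Bform_scale)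
 also have "... = ?t powr (p + 1)*Bint a v" using t by (simp add: Bform_self Bint_scale)
 also have "... = ?t*(?t powr p*Bint a v)" using t by (simp add: powr_add)
 finally have "Bform a (nehari f v) v = ?t powr p*Bint a v" using t by simp
 moreover have "Hinner (nehari f v) v = ?t" using Sigma_plusD[OF assms(2)] Hnorm_power2[of v] by (simp add: Hinner_scale_left)
 ultimately show ?thesis using tmax_critical[OF assms] by (simp add: I_deriv_def mult.commute)
qed

lemma I_taylor_ray:
 assumes f: "f \<in> Hdual" and v: "v \<in> Sigma" and w: "w \<in> Sigma" and t: "0 < t" "t <= T"
 shows "abs (I f (%x. t*w x) - I f (%x. t * v x) - t*I_deriv a f (%x. t * v x) (%x. w x - v x)) <= taylor_const (3*T)*T^2*(Hdist w v)^2"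
proof -
 note vH = Sigma_plusD[OF v] and wH = Sigma_plusD[OF w]
 define h where "h = (%x. w x - v x)"
 have h: "h \<in> H" "Hnorm h <= 2" "Hnorm h >= 0" using H_diff[OF wH(1) vH(1)] Hnorm_diff_le[OF wH(1) vH(1)] vH wH Hnorm_nonneg by (auto simp: h_def)
 have e: "(%x. t * v x + t*h x) = (%x. t*w x)" by (simp add: h_def algebra_simps)
 have "abs (I f (%x. t*w x) - I f (%x. t * v x) - I_deriv a f (%x. t * v x) (%x. t*h x)) <= taylor_const (t + t*Hnorm h)*(t*Hnorm h)^2"
  using I_taylor[OF a_coef f H_scale[OF vH(1)] H_scale[OF h(1)], of t t] t unfolding e by (simp add: Hnorm_scale vH)
 also have "... <= taylor_const (3*T)*(T*Hnorm h)^2"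
 proof (intro mult_mono taylor_const_mono power_mono)
  have "t*Hnorm h <= T*2" using t h by (intro mult_mono) auto
  thus "t + t*Hnorm h <= 3*T" using t by simp
 qed (use t h(3) taylor_const_pos[of "3*T"] in \<open>auto simp: less_imp_le intro: mult_right_mono\<close>)
 finally show ?thesis unfolding I_deriv_scale[OF f h(1)] by (simp add: h_def power_mult_distrib mult_ac)
qed

lemma I_deriv_ray_diff:
 assumes f: "small_dual f" and v: "v \<in> Sigma" and t: "0 < t" "t <= T" and r: "0 < r" "r <= T" and h: "h \<in> H"
 shows "abs (t*I_deriv a f (%x. t * v x) h - r*I_deriv a f (%x. r * v x) h)
  <= abs (t - r)*((T + 3*C_sob*T powr p + dual_max + T*deriv_lip (2*T))*Hnorm h)"
proof -
 note fH = small_dualD(1)[OF f] and vH = Sigma_plusD[OF v]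
 let ?A = "I_deriv a f (%x. t * v x) h" and ?B = "I_deriv a f (%x. r * v x) h"
 have d: "Hdist (%x. t * v x) (%x. r * v x) = abs (t - r)" using Hnorm_scale[of "t - r" v] vH by (simp add: left_diff_distrib)
 have "abs (?A - ?B) <= deriv_lip (t + r)*abs (t - r)*Hnorm h"
  using I_deriv_lipschitz[OF a_coef fH H_scale[OF vH(1)] H_scale[OF vH(1)] h, of t r] d t r by (simp add: Hnorm_scale vH)
 also have "... <= deriv_lip (2*T)*abs (t - r)*Hnorm h" using t r Hnorm_nonneg by (intro mult_right_mono deriv_lip_mono) auto
 finally have AB: "t*abs (?A - ?B) <= T*(deriv_lip (2*T)*abs (t - r)*Hnorm h)" using t by (intro mult_mono) auto
 have "abs ?B <= (T + 3*C_sob*T powr p + dual_norm f)*Hnorm h"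
  using r by (intro I_deriv_bound[OF a_coef fH H_scale[OF vH(1)] _ h]) (simp add: Hnorm_scale vH)
 also have "... <= (T + 3*C_sob*T powr p + dual_max)*Hnorm h" using small_dualD(2)[OF f] Hnorm_nonneg by (intro mult_right_mono) auto
 finally have B: "abs (t - r)*abs ?B <= abs (t - r)*((T + 3*C_sob*T powr p + dual_max)*Hnorm h)" by (intro mult_left_mono) auto
 have "t*?A - r*?B = t*(?A - ?B) + (t - r)*?B" by (simp add: algebra_simps)
 hence "abs (t*?A - r*?B) <= t*abs (?A - ?B) + abs (t - r)*abs ?B" using t abs_triangle_ineq[of "t*(?A - ?B)" "(t - r)*?B"] by (simp add: abs_mult)
 thus ?thesis using AB B by (simp add: algebra_simps)
qed

definition J_taylor_const :: "real => real" where
 "J_taylor_const T = tmax_lip T*(T + 3*C_sob*T powr p + dual_max + T*deriv_lip (2*T)) + taylor_const (3*T)*T^2"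

lemma J_taylor_const_pos: "T > 0 ==> J_taylor_const T > 0"
 using tmax_lip_pos[of T] C_sob_pos dual_max_pos deriv_lip_pos[of "2*T"] taylor_const_pos[of "3*T"]
 by (simp add: J_taylor_const_def add_pos_pos)

text \<open>An envelope argument: \<open>J f w\<close> is attained at \<open>tmax f w\<close>, while \<open>J f v\<close> dominates
  the value at that same parameter, and conversely.\<close>
lemma J_taylor:
 assumes f: "small_dual f" and v: "v \<in> Sigma" "tmax f v <= T" and w: "w \<in> Sigma" "tmax f w <= T"
 shows "abs (J f w - J f v - J_deriv f v (%x. w x - v x)) <= J_taylor_const T*(Hdist w v)^2"
proof -
 define t where "t = tmax f w"
 define r where "r = tmax f v"
 define d where "d = Hdist w v"
 define h where "h = (%x. w x - v x)"
 define K where "K = T + 3*C_sob*T powr p + dual_max + T*deriv_lip (2*T)"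
 note fH = small_dualD(1)[OF f]
 have h: "h \<in> H" "Hnorm h = d" using H_diff[OF Sigma_plusD(1)[OF w(1)] Sigma_plusD(1)[OF v(1)]] by (auto simp: h_def d_def)
 have t: "0 < t" "t <= T" and r: "0 < r" "r <= T" using v w tmax_max(1)[OF f] by (auto simp: t_def r_def)
 have K: "K >= 0" using r C_sob_pos dual_max_pos deriv_lip_pos[of "2*T"] by (simp add: K_def)
 have "abs (t - r)*(K*d) <= tmax_lip T*d*(K*d)"
  using tmax_lipschitz[OF f v w] K Hnorm_nonneg by (intro mult_right_mono) (auto simp: t_def r_def d_def)
 hence tr: "t*I_deriv a f (%x. t * v x) h <= J_deriv f v h + tmax_lip T*K*d^2"
  using I_deriv_ray_diff[OF f v(1) t r h(1), folded K_def] by (simp add: J_deriv_def r_def h abs_le_iff power2_eq_square mult_ac)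
 have "J f w - J f v <= I f (%x. t*w x) - I f (%x. t * v x)"
  using J_eq(1)[OF f w(1)] J_eq(3)[OF f v(1) t(1)] by (simp add: t_def)
 hence up: "J f w - J f v <= t*I_deriv a f (%x. t * v x) h + taylor_const (3*T)*T^2*d^2"
  using I_taylor_ray[OF fH v(1) w(1) t] unfolding h_def d_def by linarith
 have "I f (%x. r*w x) - I f (%x. r * v x) <= J f w - J f v"
  using J_eq(1)[OF f v(1)] J_eq(3)[OF f w(1) r(1)] by (simp add: r_def)
 hence lo: "J_deriv f v h - taylor_const (3*T)*T^2*d^2 <= J f w - J f v"
  using I_taylor_ray[OF fH v(1) w(1) r] unfolding J_deriv_def r_def[symmetric] h_def d_def by linarith
 have C: "J_taylor_const T*d^2 = tmax_lip T*K*d^2 + taylor_const (3*T)*T^2*d^2" by (simp add: J_taylor_const_def K_def distrib_right)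
 have "0 <= tmax_lip T*K*d^2" using K tmax_lip_pos[of T] by simp
 thus ?thesis using tr up lo C unfolding h_def[symmetric] h(2) by (intro abs_leI) linarith+
qed

lemma J_taylor_near:
 assumes f: "small_dual f" and v: "v \<in> Sigma" "tmax f v <= T" and w: "w \<in> H" "Hnorm w = 1" "Hdist w v <= Sigma_radius T"
 shows "w \<in> Sigma" "abs (J f w - J f v - J_deriv f v (%x. w x - v x)) <= J_taylor_const (6 powr (1/(p - 1))*T)*(Hdist w v)^2"
proof -
 show wS: "w \<in> Sigma" by (rule near_Sigma(1)[OF assms])
 have "1 <= (6::real) powr (1/(p - 1))" using p_gt_1 by (intro ge_one_powr_ge_zero) auto
 hence "1*T <= 6 powr (1/(p - 1))*T" using v tmax_max(1)[OF f v(1)] by (intro mult_right_mono) auto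
 thus "abs (J f w - J f v - J_deriv f v (%x. w x - v x)) <= J_taylor_const (6 powr (1/(p - 1))*T)*(Hdist w v)^2"
  using v(2) by (intro J_taylor[OF f v(1) _ wS near_Sigma(2)[OF assms]]) auto
qed

lemma crit_SigmaI:
 assumes f: "small_dual f" and v: "v \<in> Sigma" and z: "!!h. h \<in> H ==> I_deriv a f (nehari f v) h = 0"
 shows "crit_Sigma s (J f) v"
 unfolding crit_Sigma_def
proof (intro conjI allI impI v)
 fix e :: real assume e: "e > 0"
 define T where "T = tmax f v"
 define C where "C = J_taylor_const (6 powr (1/(p - 1))*T)"
 have T: "T > 0" "C > 0" using tmax_max(1)[OF f v] by (auto simp: T_def C_def intro!: J_taylor_const_pos)
 show "\<exists>d>0. \<forall>w\<in>Sigma. Hdist w v < d --> abs (J f w - J f v) <= e*Hdist w v"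
 proof (intro exI[of _ "min (Sigma_radius T) (e/C)"] conjI ballI impI)
  fix w assume w: "w \<in> Sigma" "Hdist w v < min (Sigma_radius T) (e/C)"
  have "J_deriv f v (%x. w x - v x) = 0" using z[OF H_diff] Sigma_plusD(1) v w(1) by (simp add: J_deriv_def)
  hence "abs (J f w - J f v) <= C*(Hdist w v)^2"
   using J_taylor_near(2)[OF f v _ Sigma_plusD[OF w(1)], of T] w(2) by (simp add: T_def C_def)
  also have "... = (C*Hdist w v)*Hdist w v" by (simp add: power2_eq_square)
  also have "... <= e*Hdist w v" using w(2) T Hnorm_nonneg by (intro mult_right_mono) (auto simp: field_simps)
  finally show "abs (J f w - J f v) <= e*Hdist w v" .
 qed (use e T Sigma_radius_pos in auto)
qed

end

context frac_sobolev
begin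

subsection \<open>A lower bound for nonnegative supersolutions\<close>

lemma H_of_differences:
 assumes g: "L2 L g" and b: "!!h. (\<integral>\<^sup>+x. ennreal ((g x - g (x + h))^2) \<partial>L) <= ennreal (C*min ((norm h)^2) 1)" and "C >= 0"
 shows "g \<in> H"
proof -
 have [measurable]: "g \<in> borel_measurable borel" using g by (simp add: L2_def)
 have [measurable]: "dquot g \<in> borel_measurable LL" by (rule dquot_measurable) simp
 have m: "(%z. (fst z, fst z + snd z)) \<in> LL \<rightarrow>\<^sub>M LL" by measurable
 have d: "distr LL LL (%z. (fst z, fst z + snd z)) = LL" using distr_shear[where 'a="real^'n"] by (simp add: case_prod_unfold)
 have e: "(dquot g (x, x + h))^2 = (g x - g (x + h))^2*(1/norm h powr N2s)" for x h
  by (simp add: dquot_def power_divide power2_eq_square[of "_ powr _"] powr_add[symmetric])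
 have "(\<integral>\<^sup>+z. ennreal ((dquot g z)^2) \<partial>LL) = (\<integral>\<^sup>+z. ennreal ((dquot g (fst z, fst z + snd z))^2) \<partial>LL)"
  by (subst d[symmetric], subst nn_integral_distr[OF m]) auto
 also have "... = (\<integral>\<^sup>+h. \<integral>\<^sup>+x. ennreal ((dquot g (x, x + h))^2) \<partial>L \<partial>L)"
 proof -
  have [measurable]: "(%z. ennreal ((dquot g (fst z, fst z + snd z))^2)) \<in> borel_measurable LL"
   using measurable_compose[OF m, of "%z. ennreal ((dquot g z)^2)"] by simp
  show ?thesis
   by (subst lborel_pair.nn_integral_snd[symmetric]) auto
 qed
 also have "... = (\<integral>\<^sup>+h. (\<integral>\<^sup>+x. ennreal ((g x - g (x + h))^2) \<partial>L)*ennreal (1/norm h powr N2s) \<partial>L)"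
  unfolding e by (intro nn_integral_cong, subst nn_integral_multc[symmetric]) (auto simp: ennreal_mult' simp del: times_divide_eq_right intro!: nn_integral_cong)
 also have "... <= (\<integral>\<^sup>+h. ennreal (C*min ((norm h)^2) 1)*ennreal (1/norm h powr N2s) \<partial>L)"
  by (intro nn_integral_mono mult_right_mono b) auto
 also have "... = (\<integral>\<^sup>+h. ennreal (C*(kernel h)) \<partial>L)"
  using \<open>C >= 0\<close> by (intro nn_integral_cong) (simp add: ennreal_mult[symmetric] kernel_def)
 also have "... < \<infinity>"
  using \<open>C >= 0\<close> integrable_mult_right[OF kernel_integrable, of C] by (subst nn_integral_eq_integral) (auto simp: kernel_nonneg)
 finally have "integrable LL (%z. (dquot g z)^2)" by (intro integrableI_nonneg) auto
 thus ?thesis using g by (simp add: H_iff L2_def)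
qed

definition bump :: "'n fn" where "bump x = max (1 - (norm x)^2) 0"

lemma bump_bounds: "0 <= bump x" "bump x <= 1" "norm x >= 1 ==> bump x = 0"
 by (auto simp: bump_def max_def)

lemma bump_meas[measurable]: "bump \<in> borel_measurable borel" unfolding bump_def by measurable

lemma bump_second_difference: "2*bump x - bump (x + h) - bump (x - h) <= 2*min ((norm h)^2) 1"
proof -
 define m :: "real^'n => real" where "m z = max 1 ((norm z)^2)" for z
 have e: "bump z = m z - (norm z)^2" for z by (simp add: bump_def m_def max_def)
 have m: "1 <= m z" "(norm z)^2 <= m z" "m z = 1 \<or> m z = (norm z)^2" for z by (auto simp: m_def max_def)
 have par: "(norm (x + h))^2 + (norm (x - h))^2 = 2*(norm x)^2 + 2*(norm h)^2"
  unfolding power2_norm_eq_inner by (simp add: algebra_simps inner_commute)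
 have "2*m x <= m (x + h) + m (x - h)"
  using m(3)[of x] m(1,2)[of "x + h"] m(1,2)[of "x - h"] par zero_le_power2[of "norm h"] by (elim disjE) linarith+
 hence "2*bump x - bump (x + h) - bump (x - h) <= 2*(norm h)^2" unfolding e using par by (smt (verit))
 moreover have "2*bump x - bump (x + h) - bump (x - h) <= 2" using bump_bounds(1)[of "x + h"] bump_bounds(1)[of "x - h"] bump_bounds(2)[of x] by linarith
 ultimately show ?thesis by (simp add: min_def)
qed

lemma bump_lipschitz: "abs (bump x - bump y) <= 2*norm (x - y)"
proof -
 let ?m = "%z. min (norm z) 1"
 have b: "bump z = 1 - (?m z)^2" for z
  using power_le_one[of "norm z" 2] one_le_power[of "norm z" 2] by (cases "norm z <= 1") (auto simp: bump_def)
 have "bump x - bump y = (?m y - ?m x)*(?m y + ?m x)" unfolding b by (simp add: power2_eq_square algebra_simps)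
 moreover have "?m y + ?m x >= 0" by simp
 ultimately have "abs (bump x - bump y) = abs (?m y - ?m x)*(?m y + ?m x)" by (simp only: abs_mult abs_of_nonneg)
 also have "... <= norm (x - y)*2" using norm_triangle_ineq3[of y x] by (intro mult_mono) (auto simp: norm_minus_commute)
 finally show ?thesis by simp
qed

lemma bump_integrable: "integrable L bump" "L2 L bump"
proof -
 have fin: "integrable L (indicator (ball 0 1) :: _ => real)" by (rule ball_indicator_integrable)
 show b: "integrable L bump"
  by (rule integrable_boundI[OF fin]) (use bump_bounds in \<open>auto simp: indicator_def not_le less_imp_le\<close>)
 have "(bump x)^2 <= bump x" for x using bump_bounds[of x] by (simp add: power2_eq_square mult_left_le_one_le)
 hence "integrable L (%x. (bump x)^2)" by (intro integrable_boundI[OF b]) auto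
 thus "L2 L bump" by (simp add: L2_def)
qed

lemma bump_difference_power2_le:
 "(bump x - bump (x + h))^2 <= 4*min ((norm h)^2) 1*(indicator (ball 0 1) x + indicator (ball 0 1) (x + h))"
proof (cases "norm x < 1 \<or> norm (x + h) < 1")
 case False thus ?thesis using bump_bounds(3)[of x] bump_bounds(3)[of "x + h"] by simp
next
 case True
 have "(bump x - bump (x + h))^2 <= (2*norm h)^2"
  using bump_lipschitz[of x "x + h"] by (subst abs_le_square_iff[symmetric]) simp
 moreover have "abs (bump x - bump (x + h)) <= 1" using bump_bounds[of x] bump_bounds[of "x + h"] by (simp add: abs_le_iff)
 hence "(bump x - bump (x + h))^2 <= 1" by (simp add: abs_square_le_1)
 ultimately have "(bump x - bump (x + h))^2 <= 4*min ((norm h)^2) 1*1" by (simp add: min_def power_mult_distrib)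
 also have "... <= 4*min ((norm h)^2) 1*(indicator (ball 0 1) x + indicator (ball 0 1) (x + h))"
  using True by (intro mult_left_mono) (auto simp: indicator_def)
 finally show ?thesis .
qed

lemma bump_H: "bump \<in> H"
proof -
 let ?i = "indicator (ball 0 1) :: real^'n => real"
 define V where "V = (LINT x|L. ?i x)"
 have V: "V >= 0" by (simp add: V_def)
 have i: "integrable L (%x. ?i (x + h))" "(LINT x|L. ?i (x + h)) = V" for h
  using integral_lborel_shift[of ?i h] ball_indicator_integrable[of "0 :: real^'n" 1] by (auto simp: V_def)
 show ?thesis
 proof (rule H_of_differences[OF bump_integrable(2), of "8*V"])
  fix h :: "real^'n"
  have "(\<integral>\<^sup>+x. ennreal ((bump x - bump (x + h))^2) \<partial>L) <= (\<integral>\<^sup>+x. ennreal (4*min ((norm h)^2) 1*(?i x + ?i (x + h))) \<partial>L)"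
   by (intro nn_integral_mono ennreal_leI bump_difference_power2_le)
  also have "... = ennreal (LINT x|L. 4*min ((norm h)^2) 1*(?i x + ?i (x + h)))"
   using i[of 0] i[of h] by (intro nn_integral_eq_integral integrable_mult_right Bochner_Integration.integrable_add) auto
  also have "(LINT x|L. 4*min ((norm h)^2) 1*(?i x + ?i (x + h))) = 8*V*min ((norm h)^2) 1"
   using i[of 0] i[of h] by (simp add: integral_mult_right_zero)
  finally show "(\<integral>\<^sup>+x. ennreal ((bump x - bump (x + h))^2) \<partial>L) <= ennreal (8*V*min ((norm h)^2) 1)" .
 qed (simp add: V)
qed

lemma integral_difference_product:
 assumes b: "L2 L b" and g: "L2 L g"
 shows "(LINT x|L. (b x - b (x + h))*(g x - g (x + h))) = (LINT x|L. (2*b x - b (x + h) - b (x - h))*g x)"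
proof -
 have [measurable]: "b \<in> borel_measurable borel" "g \<in> borel_measurable borel" using b g by (auto simp: L2_def)
 have shift: "L2 L (%x. f (x + c))" if "L2 L f" for f :: "'n fn" and c
  using that integral_lborel_shift(2)[of "%x. (f x)^2" c] by (auto simp: L2_def)
 note s = b g shift[OF b, of h] shift[OF g, of h] shift[OF b, of "- h", simplified]
 have s1: "(LINT x|L. b (x + h)*g (x + h)) = (LINT x|L. b x*g x)" by (rule integral_lborel_shift(1)[of "%x. b x*g x"]) measurable
 have s2: "(LINT x|L. b x*g (x + h)) = (LINT x|L. b (x - h)*g x)"
  using integral_lborel_shift(1)[of "%x. b (x - h)*g x" h] by simp
 have "(LINT x|L. (b x - b (x + h))*(g x - g (x + h)))
   = (LINT x|L. b x*g x - b x*g (x + h) - b (x + h)*g x + b (x + h)*g (x + h))" by (simp add: algebra_simps)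
 also have "... = (LINT x|L. b x*g x) - (LINT x|L. b x*g (x + h)) - (LINT x|L. b (x + h)*g x) + (LINT x|L. b (x + h)*g (x + h))"
  using s by (simp add: L2_mult_integrable)
 also have "... = (LINT x|L. 2*(b x*g x) - b (x + h)*g x - b (x - h)*g x)"
  unfolding s1 s2 using s by (simp add: L2_mult_integrable)
 finally show ?thesis by (simp add: left_diff_distrib mult.assoc)
qed

lemma dquot_integral_differences:
 assumes u: "u \<in> H" and v: "v \<in> H"
 shows "integrable L (%h. (LINT x|L. (u x - u (x + h))*(v x - v (x + h)))/norm h powr N2s)"
  "(LINT z|LL. dquot u z*dquot v z) = (LINT h|L. (LINT x|L. (u x - u (x + h))*(v x - v (x + h)))/norm h powr N2s)"
proof -
 have e: "dquot u (x, x + h)*dquot v (x, x + h) = (u x - u (x + h))*(v x - v (x + h))/norm h powr N2s" for x h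
  by (simp add: dquot_def powr_add[symmetric])
 have i: "integrable LL (%z. dquot u z*dquot v z)" by (intro L2_mult_integrable H_dquot_L2 u v)
 note sh = integral_LL_shear[OF i, unfolded e]
 show "integrable L (%h. (LINT x|L. (u x - u (x + h))*(v x - v (x + h)))/norm h powr N2s)"
  "(LINT z|LL. dquot u z*dquot v z) = (LINT h|L. (LINT x|L. (u x - u (x + h))*(v x - v (x + h)))/norm h powr N2s)"
  using lborel_pair.integrable_snd[of "%x h. (u x - u (x + h))*(v x - v (x + h))/norm h powr N2s"]
   lborel_pair.integral_snd[of "%x h. (u x - u (x + h))*(v x - v (x + h))/norm h powr N2s"] sh
  by (simp_all add: case_prod_unfold)
qed

lemma Hinner_le_of_second_difference:
 assumes b: "b \<in> H" "!!x. b x <= M" "!!x h. 2*b x - b (x + h) - b (x - h) <= C*min ((norm h)^2) 1"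
  and g: "g \<in> H" "!!x. g x >= 0" "integrable L g"
 shows "Hinner b g <= (M + C*(LINT h|L. kernel h))*(LINT x|L. g x)"
proof -
 define G where "G = (LINT x|L. g x)"
 have sb: "L2 L b" "L2 L g" "L2 L (%x. b (x + h))" "L2 L (%x. b (x - h))" for h
  using H_L2 b(1) g(1) H_shift[OF b(1), of h] H_shift[OF b(1), of "- h"] by auto
 have inner: "(LINT x|L. (b x - b (x + h))*(g x - g (x + h)))/norm h powr N2s <= C*kernel h*G" for h
 proof -
  have "(LINT x|L. (b x - b (x + h))*(g x - g (x + h))) = (LINT x|L. (2*b x - b (x + h) - b (x - h))*g x)"
   by (rule integral_difference_product[OF sb(1,2)])
  also have "... <= (LINT x|L. C*min ((norm h)^2) 1*g x)"
   using sb g by (intro integral_mono mult_right_mono b(3)) (simp_all add: left_diff_distrib mult.assoc L2_mult_integrable)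
  also have "... = C*min ((norm h)^2) 1*G" by (simp add: G_def)
  finally show ?thesis by (simp add: kernel_def divide_right_mono)
 qed
 have "(LINT z|LL. dquot b z*dquot g z) <= (LINT h|L. C*kernel h*G)"
  unfolding dquot_integral_differences(2)[OF b(1) g(1)]
  by (intro integral_mono dquot_integral_differences(1)[OF b(1) g(1)] integrable_mult_left integrable_mult_right kernel_integrable inner)
 also have "... = C*(LINT h|L. kernel h)*G" by simp
 finally have "(LINT z|LL. dquot b z*dquot g z) <= C*(LINT h|L. kernel h)*G" .
 moreover have "(LINT x|L. b x*g x) <= (LINT x|L. M*g x)"
  using sb(1,2) g(2,3) b(2) by (intro integral_mono mult_right_mono) (auto intro: L2_mult_integrable)
 ultimately show ?thesis by (simp add: Hinner_def G_def[symmetric] distrib_right)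
qed

definition C_bump :: real where "C_bump = 1 + 2*(LINT h|L. kernel h)"

lemma C_bump_pos: "C_bump > 0"
 unfolding C_bump_def using kernel_nonneg by (simp add: add_pos_nonneg)

lemma H_bump: "(%x. bump (x - c)) \<in> H" using H_shift[OF bump_H, of "- c"] by simp

lemma Hinner_bump_le:
 assumes "g \<in> H" "!!x. g x >= 0" "integrable L g"
 shows "Hinner (%x. bump (x - c)) g <= C_bump*(LINT x|L. g x)"
 unfolding C_bump_def
proof (rule Hinner_le_of_second_difference[OF H_bump bump_bounds(2) _ assms])
 show "2*bump (x - c) - bump (x + h - c) - bump (x - h - c) <= 2*min ((norm h)^2) 1" for x h
  using bump_second_difference[of "x - c" h] by (simp add: algebra_simps)
qed

text \<open>The nonlocal form sees the positive part of \<open>g\<close> interact with the negative part far away.\<close>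
lemma dquot_pos_part_ge:
 assumes "y \<in> B ==> g x > 0 ==> c <= norm (x - y) powr - N2s" "c >= 0"
 shows "c*(max (g x) 0*(indicator B y*max (- g y) 0)) <= dquot g (x, y)*dquot (pos_part g) (x, y)"
proof -
 let ?P = "max (g x) 0*(indicator B y*max (- g y) 0)" and ?n = "norm (x - y) powr N2s"
 have "(s - t)*(max s 0 - max t 0) = (max s 0 - max t 0)^2 + max s 0*max (- t) 0 + max t 0*max (- s) 0" for s t :: real
  by (auto simp: max_def power2_eq_square algebra_simps)
 hence "max (g x) 0*max (- g y) 0 <= (g x - g y)*(max (g x) 0 - max (g y) 0)" by simp
 moreover have P: "0 <= ?P" "?P <= max (g x) 0*max (- g y) 0" by (auto intro: mult_left_mono mult_right_mono simp: indicator_def)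
 ultimately have "?P/?n <= (g x - g y)*(max (g x) 0 - max (g y) 0)/?n" by (intro divide_right_mono) auto
 moreover have "c*?P <= ?P/?n"
 proof (cases "y \<in> B & g x > 0")
  case True
  thus ?thesis using mult_right_mono[OF assms(1) P(1)] by (simp add: powr_minus_divide)
 qed auto
 ultimately show ?thesis by (simp add: dquot_def powr_add[symmetric])
qed

lemma Hinner_pos_part_ge_interaction:
 assumes g: "g \<in> H" "integrable L (pos_part g)" and B: "B \<in> sets borel"
  and c: "c >= 0" "!!x y. y \<in> B ==> g x > 0 ==> c <= norm (x - y) powr - N2s"
 shows "(LINT x|L. (max (g x) 0)^2) + c*((LINT y|L. indicator B y*max (- g y) 0)*(LINT x|L. max (g x) 0)) <= Hinner g (pos_part g)"
proof -
 note [measurable] = H_meas[OF g(1)] B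
 define F where "F z = c*(max (g (fst z)) 0*(indicator B (snd z)*max (- g (snd z)) 0))" for z :: "(real^'n) \<times> (real^'n)"
 have le: "F z <= dquot g z*dquot (pos_part g) z" for z
  using dquot_pos_part_ge[of "snd z" B g "fst z" c] c by (simp add: F_def)
 have i0: "integrable LL (%z. dquot g z*dquot (pos_part g) z)" by (intro L2_mult_integrable H_dquot_L2 H_pos_part g)
 have iF: "integrable LL F"
 proof (rule integrable_boundI[OF i0])
  have [measurable]: "fst \<in> LL \<rightarrow>\<^sub>M borel" "snd \<in> LL \<rightarrow>\<^sub>M borel"
   using measurable_fst[of L L] measurable_snd[of L L] by (simp_all add: measurable_lborel1)
  have m1: "(%z. indicator B (snd z)*max (- g (snd z)) 0) \<in> borel_measurable LL"
   using measurable_compose[OF \<open>snd \<in> LL \<rightarrow>\<^sub>M borel\<close>, of "%y. indicator B y*max (- g y) 0"] by simp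
  have m2: "(%z. max (g (fst z)) 0) \<in> borel_measurable LL"
   by (rule measurable_compose[OF \<open>fst \<in> LL \<rightarrow>\<^sub>M borel\<close>]) measurable
  show "F \<in> borel_measurable LL"
   unfolding F_def by (rule borel_measurable_times[OF borel_measurable_const borel_measurable_times[OF m2 m1]])
  show "abs (F z) <= dquot g z*dquot (pos_part g) z" for z using le[of z] c(1) by (simp add: F_def abs_mult)
 qed
 have "c*((LINT y|L. indicator B y*max (- g y) 0)*(LINT x|L. max (g x) 0)) = (LINT x|L. LINT y|L. F (x, y))"
  by (simp add: F_def mult.commute)
 also have "... = (LINT z|LL. F z)" by (rule lborel_pair.integral_fst'[OF iF])
 also have "... <= (LINT z|LL. dquot g z*dquot (pos_part g) z)" by (intro integral_mono i0 iF le)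
 moreover have "g x*max (g x) 0 = (max (g x) 0)^2" for x by (simp add: max_def power2_eq_square)
 ultimately show ?thesis by (simp add: Hinner_def)
qed

lemma inverse_norm_powr_ge_weight:
 assumes "norm (x - x0) < 1" "norm (y - z0) < 1" "norm (x0 - z0) >= 2"
 shows "(2 + norm z0) powr - N2s * weight x0 <= norm (x - y) powr - N2s"
proof -
 have "norm (x0 - z0) <= norm (x0 - x) + norm (x - y) + norm (y - z0)"
  using norm_triangle_ineq[of "x0 - x" "x - y"] norm_triangle_ineq[of "x0 - x + (x - y)" "y - z0"] by simp
 hence xy: "norm (x - y) > 0" using assms norm_minus_commute[of x0 x] by linarith
 have "norm (x - y) <= norm (x - x0) + norm x0 + norm z0 + norm (z0 - y)"
  using norm_triangle_ineq[of "x - x0" "x0 - y"] norm_triangle_ineq4[of x0 z0] norm_triangle_ineq[of "x0 - z0" "z0 - y"] by simp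
 also have "... <= 2 + 2*norm x0 + norm z0 + norm z0*norm x0"
  using assms(1,2) norm_minus_commute[of z0 y] mult_nonneg_nonneg[OF norm_ge_zero[of z0] norm_ge_zero[of x0]] norm_ge_zero[of x0] by linarith
 also have "... = (2 + norm z0)*(1 + norm x0)" by (simp add: algebra_simps)
 finally have "((2 + norm z0)*(1 + norm x0)) powr - N2s <= norm (x - y) powr - N2s"
  using xy N2s_pos by (intro powr_mono2') auto
 thus ?thesis by (simp add: weight_def powr_mult)
qed

definition ball_mass :: "'n fn => real^'n => real" where
 "ball_mass u z = (LINT y|L. indicator (ball z 1) y*u y)"

lemma ball_mass_integrable: "u \<in> H ==> integrable L (%y. indicator (ball z 1) y*u y)"
 by (rule L2_mult_integrable[OF _ H_L2]) (use ball_indicator_integrable[of z 1] in \<open>auto simp: L2_def indicator_power2\<close>)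

lemma ball_mass_nonneg: "(!!x. u x >= 0) ==> ball_mass u z >= 0"
 unfolding ball_mass_def by simp

lemma ball_mass_eq_0_iff:
 assumes "u \<in> H" "!!x. u x >= 0"
 shows "ball_mass u z = 0 \<longleftrightarrow> (AE x in L. x \<in> ball z 1 --> u x = 0)"
proof -
 have "ball_mass u z = 0 \<longleftrightarrow> (AE x in L. indicator (ball z 1) x*u x = 0)"
  unfolding ball_mass_def using assms(2) by (intro integral_nonneg_eq_0_iff_AE ball_mass_integrable assms(1)) auto
 also have "... \<longleftrightarrow> (AE x in L. x \<in> ball z 1 --> u x = 0)" by (intro AE_cong) (auto simp: indicator_def)
 finally show ?thesis .
qed

lemma countable_dense: obtains D :: "(real^'n) set" where "countable D" "!!x r. r > 0 ==> \<exists>d\<in>D. norm (d - x) < r"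
proof -
 obtain D :: "(real^'n) set" where D: "countable D" "!!X. open X ==> X ~= {} ==> \<exists>d\<in>D. d \<in> X"
  by (rule countable_dense_setE) blast
 have "\<exists>d\<in>D. norm (d - x) < r" if "r > 0" for x r using D(2)[of "ball x r"] that by (auto simp: dist_norm norm_minus_commute)
 thus thesis using that D(1) by blast
qed

lemma ball_mass_pos_exists:
 assumes u: "u \<in> H" "!!x. u x >= 0" "Hnorm u > 0"
 obtains z where "ball_mass u z > 0"
proof (rule ccontr)
 assume n: "~ thesis"
 obtain D :: "(real^'n) set" where D: "countable D" "!!x r. r > 0 ==> \<exists>d\<in>D. norm (d - x) < r" by (rule countable_dense) blast
 have "ball_mass u z = 0" for z
 proof (rule antisym)
  show "ball_mass u z <= 0" using n that[of z] by (meson not_le)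
 qed (rule ball_mass_nonneg[OF u(2)])
 hence "AE x in L. \<forall>z\<in>D. x \<in> ball z 1 --> u x = 0" using D(1) ball_mass_eq_0_iff[OF u(1,2)] by (subst AE_ball_countable) auto
 hence "AE x in L. u x = 0"
 proof eventually_elim
  case (elim x)
  obtain d where "d \<in> D" "norm (d - x) < 1" using D(2)[of 1 x] by auto
  thus ?case using elim by (auto simp: dist_norm)
 qed
 thus False using Hnorm_eq_0_iff[OF u(1)] u(3) by simp
qed

lemma supersolution_bump:
 assumes u: "u \<in> H" "!!x. u x >= 0" and ss: "!!phi. phi \<in> H ==> (!!x. phi x >= 0) ==> Hinner u phi >= 0"
  and far: "norm (x0 - z0) >= 2"
 shows "AE x in L. (2 + norm z0) powr - N2s * ball_mass u z0/C_bump * weight x0*bump (x - x0) <= u x"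
proof -
 define c where "c = (2 + norm z0) powr - N2s * weight x0"
 define eps where "eps = c*ball_mass u z0/C_bump"
 have c: "c >= 0" using weight_pos[of x0] by (simp add: c_def)
 have eps: "eps >= 0" "eps*C_bump = c*ball_mass u z0" using c ball_mass_nonneg[of u z0] u(2) C_bump_pos by (auto simp: eps_def)
 define b where "b x = bump (x - x0)" for x
 define g where "g x = eps*b x - u x" for x
 have bH: "b \<in> H" unfolding b_def[abs_def] by (rule H_bump)
 have gH: "g \<in> H" unfolding g_def[abs_def] by (intro H_diff H_scale bH u)
 note phi = H_pos_part[OF gH]
 note [measurable] = H_meas[OF gH]
 have g_out: "g x <= 0" if "norm (x - x0) >= 1" for x using bump_bounds(3)[OF that] u(2)[of x] by (simp add: g_def b_def)
 have b_int: "integrable L b" unfolding b_def using integral_lborel_shift(2)[of bump "- x0"] bump_integrable(1) by simp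
 have "max (g x) 0 <= eps*b x" for x using eps(1) u(2)[of x] bump_bounds(1)[of "x - x0"] by (simp add: g_def b_def)
 hence phi_int: "integrable L (pos_part g)" by (intro integrable_boundI[OF integrable_mult_right[OF b_int, of eps]]) auto
 have "indicator (ball z0 1) y*max (- g y) 0 = indicator (ball z0 1) y*u y" for y
 proof (cases "y \<in> ball z0 1")
  case True
  hence "norm (y - x0) >= 1" using far norm_triangle_ineq[of "x0 - y" "y - z0"] by (simp add: dist_norm norm_minus_commute)
  thus ?thesis using bump_bounds(3)[of "y - x0"] u(2)[of y] by (simp add: g_def b_def)
 qed simp
 hence mass: "ball_mass u z0 = (LINT y|L. indicator (ball z0 1) y*max (- g y) 0)" by (simp only: ball_mass_def)
 have cxy: "c <= norm (x - y) powr - N2s" if "y \<in> ball z0 1" "g x > 0" for x y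
  unfolding c_def using that g_out[of x] by (intro inverse_norm_powr_ge_weight far) (auto simp: dist_norm norm_minus_commute not_le[symmetric])
 have "(LINT x|L. (max (g x) 0)^2) + c*(ball_mass u z0*(LINT x|L. max (g x) 0)) <= Hinner g (pos_part g)"
  unfolding mass by (rule Hinner_pos_part_ge_interaction[OF gH phi_int _ c cxy]) auto
 also have "Hinner g (pos_part g) = eps*Hinner b (pos_part g) - Hinner u (pos_part g)"
  using Hinner_diff_left[OF H_scale[OF bH, of eps] u(1) phi] by (simp add: g_def[abs_def] Hinner_scale_left)
 also have "... <= eps*(C_bump*(LINT x|L. max (g x) 0)) - 0"
  using Hinner_bump_le[OF phi _ phi_int, of x0] eps(1) ss[OF phi] by (intro diff_mono mult_left_mono) (auto simp: b_def[abs_def])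
 finally have "(LINT x|L. (max (g x) 0)^2) <= 0" using eps(2) by (simp add: mult.assoc[symmetric])
 hence "(LINT x|L. (max (g x) 0)^2) = 0" by (simp add: antisym)
 hence "AE x in L. max (g x) 0 = 0" using integral_nonneg_eq_0_iff_AE[OF L2D(2)[OF H_L2[OF phi]]] by simp
 thus ?thesis by eventually_elim (auto simp: g_def eps_def c_def b_def max_def mult_ac split: if_splits)
qed

definition far_const :: "'n fn => real^'n => real" where
 "far_const u z = (2 + norm z) powr - N2s * ball_mass u z/C_bump*((3/4)*(3/2) powr - N2s)"

lemma far_const_pos: assumes "ball_mass u z > 0" shows "far_const u z > 0"
proof -
 have "2 + norm z > 0" using norm_ge_zero[of z] by linarith
 thus ?thesis using assms C_bump_pos by (simp add: far_const_def)
qed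

lemma supersolution_far_bound:
 assumes u: "u \<in> H" "!!x. u x >= 0" and ss: "!!phi. phi \<in> H ==> (!!x. phi x >= 0) ==> Hinner u phi >= 0"
 shows "AE x in L. norm (x - z) >= 3 --> far_const u z * weight x <= u x"
proof -
 define k where "k = (2 + norm z) powr - N2s * ball_mass u z/C_bump"
 have k: "k >= 0" using ball_mass_nonneg[of u z] u(2) C_bump_pos by (simp add: k_def)
 obtain D :: "(real^'n) set" where D: "countable D" "!!x r. r > 0 ==> \<exists>d\<in>D. norm (d - x) < r" by (rule countable_dense) blast
 have "AE x in L. \<forall>x0\<in>D. norm (x0 - z) >= 2 --> k * weight x0*bump (x - x0) <= u x"
  using D(1) supersolution_bump[OF u ss] by (subst AE_ball_countable) (auto simp: k_def)
 thus ?thesis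
 proof (eventually_elim, intro impI)
  fix x assume elim: "\<forall>x0\<in>D. norm (x0 - z) >= 2 --> k * weight x0*bump (x - x0) <= u x" and x: "norm (x - z) >= 3"
  obtain x0 where x0: "x0 \<in> D" "norm (x0 - x) < 1/2" using D(2)[of "1/2" x] by auto
  have "norm (x0 - z) >= 2" using x x0 norm_triangle_ineq[of "x - x0" "x0 - z"] by (simp add: norm_minus_commute)
  hence ux: "k*(weight x0*bump (x - x0)) <= u x" using elim x0 by (simp add: mult.assoc)
  have "(norm (x - x0))^2 <= (1/2)^2" using x0 by (intro power_mono) (auto simp: norm_minus_commute)
  hence b: "bump (x - x0) >= 3/4" by (simp add: bump_def power2_eq_square)
  have "norm x0 < norm x + 1/2" using x0(2) norm_triangle_ineq2[of x0 x] by linarith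
  moreover have "0 <= norm x" by simp
  ultimately have "1 + norm x0 <= (3/2)*(1 + norm x)" by argo
  hence "weight x <= (3/2) powr N2s * weight x0" by (rule weight_comparable)
  hence "(3/2) powr - N2s * weight x <= weight x0" by (simp add: powr_minus_divide field_simps)
  hence "k*(((3/2) powr - N2s * weight x)*(3/4)) <= k*(weight x0*bump (x - x0))"
   using b k weight_pos[of x] weight_pos[of x0] by (intro mult_left_mono mult_mono) auto
  thus "far_const u z * weight x <= u x" using ux by (simp add: far_const_def k_def mult_ac)
 qed
qed

lemma supersolution_lower_bound:
 assumes u: "u \<in> H" "!!x. u x >= 0" "Hnorm u > 0" and ss: "!!phi. phi \<in> H ==> (!!x. phi x >= 0) ==> Hinner u phi >= 0"
 obtains eps where "eps > 0" "AE x in L. u x >= eps * weight x"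
proof -
 have near: "AE x in L. norm (x - z) >= 3 --> far_const u z * weight x <= u x" for z
  by (rule supersolution_far_bound[OF u(1,2)]) (rule ss)
 obtain z where z: "ball_mass u z > 0" by (rule ball_mass_pos_exists[OF u]) blast
 obtain e :: "real^'n" where e: "norm e = 1" using vector_choose_size[of 1] by auto
 define z' where "z' = z + 6 *\<^sub>R e"
 have zz: "norm (z' - z) = 6" using e by (simp add: z'_def)
 have "~ (AE x in L. x \<in> ball z' 1 --> u x = 0)"
 proof
  assume "AE x in L. x \<in> ball z' 1 --> u x = 0"
  hence "AE x in L. x \<notin> ball z' 1" using near[of z]
  proof eventually_elim
   case (elim x)
   have "far_const u z * weight x > 0" using far_const_pos[OF z] weight_pos[of x] by simp
   moreover have "norm (x - z) >= 3" if "x \<in> ball z' 1" using that zz norm_triangle_ineq[of "z' - x" "x - z"] by (simp add: dist_norm)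
   ultimately show ?case using elim by auto
  qed
  hence "emeasure L (ball z' 1) = 0" using AE_iff_null_sets[of "ball z' 1" L] by (auto simp: null_sets_def)
  thus False using unit_ball_vol_pos[of "real CARD('n)"] by (simp add: emeasure_ball)
 qed
 hence z': "ball_mass u z' > 0" using ball_mass_eq_0_iff[OF u(1,2), of z'] ball_mass_nonneg[of u z'] u(2) by fastforce
 define eps where "eps = min (far_const u z) (far_const u z')"
 have "AE x in L. eps * weight x <= u x"
  using near[of z] near[of z']
 proof eventually_elim
  case (elim x)
  have "norm (x - z) >= 3 \<or> norm (x - z') >= 3" using zz norm_triangle_ineq[of "x - z" "z' - x"] by (simp add: norm_minus_commute) linarith
  moreover have "eps * weight x <= far_const u z * weight x" "eps * weight x <= far_const u z' * weight x"
   using weight_pos[of x] by (auto simp: eps_def intro!: mult_right_mono less_imp_le)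
  ultimately show ?case using elim by linarith
 qed
 moreover have "eps > 0" using far_const_pos z z' by (simp add: eps_def)
 ultimately show thesis using that by blast
qed

end

lemma split_powr_strict:
 fixes theta r :: real assumes "0 < theta" "theta < 1" "r > 1" shows "theta powr r + (1 - theta) powr r < 1"
proof -
 have "x powr r < x" if "0 < x" "x < 1" for x :: real
  using powr_less_mono'[of x 1 r] that assms by simp
 from this[of theta] this[of "1 - theta"] show ?thesis using assms by simp
qed

lemma DERIV_quadratic_remainder:
 fixes f :: "real => real"
 assumes "!!t. abs t <= 1 ==> abs (f t - f 0 - t*D) <= K*t^2"
 shows "(f has_real_derivative D) (at 0)"
proof -
 have "((%t. (f t - f 0)/(t - 0) - D) \<longlongrightarrow> 0) (at 0)"
 proof (rule Lim_null_comparison)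
  show "((%t. K*abs t) \<longlongrightarrow> 0) (at 0)" by (intro tendsto_mult_right_zero tendsto_rabs_zero tendsto_ident_at)
  have "\<forall>\<^sub>F t in at 0. t \<in> {-1<..<1} & t ~= (0::real)" by (intro eventually_conj eventually_at_in_open') (auto simp: eventually_at_filter)
  thus "\<forall>\<^sub>F t in at 0. norm ((f t - f 0)/(t - 0) - D) <= K*abs t"
  proof eventually_elim
   case (elim t)
   have "(f t - f 0)/(t - 0) - D = (f t - f 0 - t*D)/t" using elim by (simp add: field_simps)
   moreover have "abs (f t - f 0 - t*D)/abs t <= K*t^2/abs t" using elim by (intro divide_right_mono assms) auto
   ultimately have "norm ((f t - f 0)/(t - 0) - D) <= K*t^2/abs t" by simp
   also have "... = K*(abs t*abs t)/abs t" by (simp only: abs_mult_self_eq power2_eq_square)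
   also have "... = K*abs t" using elim by (simp del: abs_mult_self_eq)
   finally show ?case .
  qed
 qed
 thus ?thesis by (simp add: has_field_derivative_iff LIM_zero_iff)
qed

context frac_sobolev
begin

definition core_mass :: "'n fn => real" where "core_mass u = (LINT x|L. weight x*(u x)^2)"

lemma core_mass_integrable: "u \<in> H ==> integrable L (%x. weight x*(u x)^2)"
 by (rule weight_L2(1)[OF H_L2])

lemma core_mass_ge_average:
 assumes u: "u \<in> H" and M: "M >= 0" "M < abs (dyadic_avg k u x)"
 shows "(1 + real CARD('n)) powr - N2s*(M^2 * cube_vol k) <= core_mass (%y. u (y + x))"
proof -
 note [measurable] = H_meas[OF u]
 let ?Q = "indicator (cube k (cube_index k x)) :: real^'n => real" and ?c = "(1 + real CARD('n)) powr - N2s"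
 define E where "E = (LINT y|L. ?Q y*(u y)^2)"
 have Q: "integrable L (%y. ?Q y*(u y)^2)" by (rule integrable_boundI[OF L2D(2)[OF H_L2[OF u]]]) (auto simp: indicator_def)
 have v: "cube_vol k > 0" by (rule cube_vol_pos)
 have "M * cube_vol k < abs (LINT y|L. ?Q y*u y)" using M v by (simp add: dyadic_avg_def cube_avg_def abs_divide field_simps)
 also have "... <= (LINT y|L. abs (?Q y*u y))" by (rule integral_abs_bound)
 finally have "(M * cube_vol k)^2 <= (LINT y|L. abs (?Q y*u y))^2" using M(1) v by (intro power_mono) auto
 also have "... <= cube_vol k*E" unfolding E_def by (rule cube_integral_power2_le[OF _ Q]) measurable
 finally have "cube_vol k*(M^2 * cube_vol k) <= cube_vol k*E" by (simp add: power2_eq_square mult_ac)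
 hence "?c*(M^2 * cube_vol k) <= ?c*E" using v by (intro mult_left_mono) auto
 also have "... = (LINT y|L. ?c*(?Q y*(u y)^2))" by (simp add: E_def)
 also have "... <= (LINT y|L. weight (y - x)*(u y)^2)"
 proof (intro integral_mono integrable_mult_right Q)
  show "integrable L (%y. weight (y - x)*(u y)^2)"
   using weight_mult_integrable by (intro integrable_boundI[OF L2D(2)[OF H_L2[OF u]]]) (auto simp: abs_mult weight_nonneg weight_le_1 intro!: mult_left_le_one_le)
  show "?c*(?Q y*(u y)^2) <= weight (y - x)*(u y)^2" for y
  proof (cases "y \<in> cube k (cube_index k x)")
   case True
   hence "norm (y - x) <= real CARD('n)/2 ^ k" using norm_diff_in_cube[of k y x] by (simp add: cube_def)
   also have "... <= real CARD('n)" by (simp add: field_simps)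
   finally have "?c <= weight (y - x)"
    unfolding weight_def using N2s_pos by (intro powr_mono2') (auto simp: add_pos_nonneg)
   thus ?thesis using True by (auto intro: mult_right_mono)
  qed (simp add: weight_nonneg)
 qed
 also have "... = core_mass (%y. u (y + x))"
  unfolding core_mass_def using integral_lborel_shift(1)[of "%y. weight (y - x)*(u y)^2" x] by simp
 finally show ?thesis .
qed

lemma core_mass_shift_le:
 assumes u: "u \<in> H" and y: "norm y <= R"
 shows "core_mass (%z. u (z + y)) <= (1 + R) powr N2s*core_mass u"
proof -
 note [measurable] = H_meas[OF u]
 have i: "integrable L (%z. weight (z + y)*(u (z + y))^2)"
  using core_mass_integrable[OF u] by (subst integral_lborel_shift(2)[of "%z. weight z*(u z)^2"]) auto
 have w: "weight z <= (1 + R) powr N2s*weight (z + y)" for z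
 proof -
  have "(1 + norm y) powr N2s*weight (z + y) <= (1 + R) powr N2s*weight (z + y)"
   using y N2s_pos weight_nonneg by (intro mult_right_mono powr_mono2) auto
  thus ?thesis using weight_shift[of z y] by linarith
 qed
 have "core_mass (%z. u (z + y)) <= (LINT z|L. (1 + R) powr N2s*(weight (z + y)*(u (z + y))^2))"
  unfolding core_mass_def using mult_right_mono[OF w]
  by (intro integral_mono core_mass_integrable H_shift u integrable_mult_right i) (simp add: mult.assoc)
 also have "... = (1 + R) powr N2s*core_mass u"
  using integral_lborel_shift(1)[of "%z. weight z*(u z)^2" y] by (simp add: core_mass_def)
 finally show ?thesis .
qed

lemma L2_pos: assumes "v \<in> H" "Hnorm v > 0" shows "(LINT x|L. (v x)^2) > 0"
proof -
 have "(LINT x|L. (v x)^2) ~= 0"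
  using integral_nonneg_eq_0_iff_AE[OF L2D(2)[OF H_L2[OF assms(1)]]] Hnorm_eq_0_iff[OF assms(1)] assms(2) by auto
 moreover have "(LINT x|L. (v x)^2) >= 0" by simp
 ultimately show ?thesis by linarith
qed

end

lemma powr_le_split_by_mean:
 fixes t m M p q eps e :: real
 assumes p: "1 < p" "p + 1 < q" and eps: "eps > 0" and M: "(2*M) powr (p - 1) = e" and m: "abs m <= M"
 shows "abs t powr (p + 1) <= e*t^2 + (eps*abs t powr q + 4*(1/eps) powr ((p - 1)/(q - p - 1))*(t - m)^2)"
proof (cases "abs t <= 2*M")
 case True
 have "abs t powr (p + 1) = abs t powr (p - 1)*t^2" by (simp add: powr_Suc_eq_mult_power2)
 also have "... <= e*t^2" unfolding M[symmetric] using True p by (intro mult_right_mono powr_mono2) auto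
 finally show ?thesis using eps by (simp add: add_increasing2)
next
 case False
 define C where "C = (1/eps) powr ((p - 1)/(q - p - 1))"
 have "C*t^2 <= C*(4*(t - m)^2)" using power2_le_of_far[OF m] False by (intro mult_left_mono) (auto simp: C_def)
 moreover have "abs t powr (p + 1) <= eps*abs t powr q + C*t^2"
  using powr_interpolation[of "abs t" "p + 1" q 2 eps] p eps by (simp add: C_def powr_numeral algebra_simps)
 moreover have "0 <= e*t^2" by (simp add: M[symmetric])
 ultimately show ?thesis unfolding C_def[symmetric] by linarith
qed

context nonlinear
begin

text \<open>If all dyadic averages are at most \<open>M\<close> in modulus, then \<open>u\<close> is small or far from its average,
  and both regions contribute little to the \<open>L\<^sup>p\<^sup>+\<^sup>1\<close> norm.\<close>
lemma powr_p1_small_of_averages: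
 assumes e: "e > 0"
 obtains k M where "M > 0"
  "!!u. u \<in> H ==> Hnorm u <= 1 ==> (!!x. abs (dyadic_avg k u x) <= M) ==> (LINT x|L. abs (u x) powr (p + 1)) < e"
proof -
 obtain q K where q: "p + 1 < q" and K: "K > 0" "!!u. u \<in> H ==> integrable L (%x. abs (u x) powr q)"
  "!!u. u \<in> H ==> (LINT x|L. abs (u x) powr q) <= K*Hnorm u powr q" by (rule sobolev_above_p1) blast
 define eps where "eps = e/(4*K)"
 define C where "C = (1/eps) powr ((p - 1)/(q - p - 1))"
 have eps: "eps > 0" "eps*K = e/4" and C: "C >= 0" using e K(1) by (auto simp: eps_def C_def)
 have "(%k. 4*C*avg_rate k) ---> 0" by (rule tendsto_mult_right_zero[OF avg_rate_tendsto])
 hence "\<forall>\<^sub>F k in sequentially. 4*C*avg_rate k < e/4" using e by (intro order_tendstoD(2)) auto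
 then obtain k where k: "4*C*avg_rate k < e/4" by (auto simp: eventually_sequentially)
 define M where "M = (e/4) powr (1/(p - 1))/2"
 have M: "M > 0" "(2*M) powr (p - 1) = e/4" using e p_gt_1 by (auto simp: M_def powr_powr)
 show thesis
 proof (rule that[OF M(1), of k])
  fix u assume u: "u \<in> H" "Hnorm u <= 1" and av: "!!x. abs (dyadic_avg k u x) <= M"
  have h1: "(Hnorm u)^2 <= 1" "Hnorm u powr q <= 1" using u(2) Hnorm_nonneg[of u] q p_gt_1 by (auto intro: power_le_one powr_le1)
  note i = L2D(2)[OF H_L2[OF u(1)]] K(2)[OF u(1)] L2D(2)[OF dyadic_avg_L2(1)[OF u(1)]]
  have "(LINT x|L. abs (u x) powr (p + 1)) <= (LINT x|L. e/4*(u x)^2 + (eps*abs (u x) powr q + 4*C*(u x - dyadic_avg k u x)^2))"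
   using powr_le_split_by_mean[OF p_gt_1 q eps(1) M(2) av, folded C_def] i powr_p1_integrable[OF u(1)] by (intro integral_mono) auto
  also have "... = e/4*(LINT x|L. (u x)^2) + (eps*(LINT x|L. abs (u x) powr q) + 4*C*(LINT x|L. (u x - dyadic_avg k u x)^2))"
   using i by simp
  also have "... <= e/4*1 + (eps*K + 4*C*avg_rate k)"
  proof (intro add_mono mult_left_mono)
   show "(LINT x|L. (u x)^2) <= 1" using L2_le_Hnorm[of u] h1(1) by linarith
   show "(LINT x|L. abs (u x) powr q) <= K" using K(3)[OF u(1)] mult_left_mono[OF h1(2), of K] K(1) by linarith
   show "(LINT x|L. (u x - dyadic_avg k u x)^2) <= avg_rate k"
    using dyadic_avg_L2(2)[OF u(1), of k] mult_left_mono[OF h1(1) avg_rate_nonneg[of k]] by linarith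
  qed (use e eps C in auto)
  finally show "(LINT x|L. abs (u x) powr (p + 1)) < e" using eps k e by simp
 qed
qed

lemma nonvanishing:
 assumes "beta > 0"
 obtains delta where "delta > 0"
  "!!u. u \<in> H ==> Hnorm u <= 1 ==> (LINT x|L. abs (u x) powr (p + 1)) >= beta ==> \<exists>x. delta <= core_mass (%y. u (y + x))"
proof -
 obtain k M where M: "M > 0"
  "!!u. u \<in> H ==> Hnorm u <= 1 ==> (!!x. abs (dyadic_avg k u x) <= M) ==> (LINT x|L. abs (u x) powr (p + 1)) < beta"
  by (rule powr_p1_small_of_averages[OF assms]) blast
 show thesis
 proof (rule that)
  show "(1 + real CARD('n)) powr - N2s*(M^2 * cube_vol k) > 0" using M(1) cube_vol_pos[of k] by simp
  fix u assume u: "u \<in> H" "Hnorm u <= 1" "(LINT x|L. abs (u x) powr (p + 1)) >= beta"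
  obtain x where "M < abs (dyadic_avg k u x)" using M(2)[OF u(1,2)] u(3) by (meson not_le)
  thus "\<exists>x. (1 + real CARD('n)) powr - N2s*(M^2 * cube_vol k) <= core_mass (%y. u (y + x))"
   using core_mass_ge_average[OF u(1)] M(1) by (meson less_imp_le)
 qed
qed

lemma Bint_has_derivative:
 assumes b: "coefficient b" and u: "u \<in> H" and h: "h \<in> H"
 shows "((%t. Bint b (%x. u x + t*h x)) has_real_derivative (p + 1)*Bform b u h) (at 0)"
proof (rule DERIV_quadratic_remainder)
 fix t :: real assume t: "abs t <= 1"
 have "abs (Bint b (%x. u x + t*h x) - Bint b u - (p + 1)*(t*Bform b u h)) <= C_taylor*(Hnorm u + abs t*Hnorm h) powr (p - 1)*(abs t*Hnorm h)^2"
  using Bint_taylor[OF b u H_scale[OF h, of t]] by (simp add: Hnorm_scale Bform_scale)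
 also have "... <= C_taylor*(Hnorm u + Hnorm h) powr (p - 1)*(abs t*Hnorm h)^2"
  using t p_gt_1 C_taylor_pos Hnorm_nonneg[of u] Hnorm_nonneg[of h]
  by (intro mult_right_mono mult_left_mono powr_mono2) (auto intro: mult_left_le_one_le)
 finally show "abs (Bint b (%x. u x + t*h x) - Bint b (%x. u x + 0*h x) - t*((p + 1)*Bform b u h))
   <= (C_taylor*(Hnorm u + Hnorm h) powr (p - 1)*(Hnorm h)^2)*t^2"
  by (simp add: power_mult_distrib mult_ac)
qed

end

locale setting = potential s N2s n_type p a for s N2s and n_type :: "'n::finite itself" and p a +
 fixes gs :: "real^'n => real"
 assumes gs: "ground_state s p gs"
begin

abbreviation one :: "'n fn" where "one \<equiv> %_. 1"
abbreviation gs_energy :: real where "gs_energy \<equiv> Ifun s p one (%_. 0) gs"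

definition Bmax :: real where "Bmax = (SUP u\<in>{u\<in>H. Hnorm u = 1}. Bint one u)"

lemma gs_H: "gs \<in> H" and gs_pos: "gs x > 0" and gs_crit: "h \<in> H ==> I_deriv one (%_. 0) gs h = 0"
 using gs crit_Hs_iff[OF coefficient_one zero_dual] by (auto simp: ground_state_def)

lemma L_not_null: "~ (AE x in L. False)"
 by (subst AE_iff_measurable[OF _ refl]) (auto simp: emeasure_lborel_UNIV)

lemma Hnorm_gs_pos: "Hnorm gs > 0"
proof -
 have "~ (AE x in L. gs x = 0)"
 proof
  assume "AE x in L. gs x = 0"
  hence "AE x in L. False" by eventually_elim (metis gs_pos order_less_irrefl)
  thus False using L_not_null by simp
 qed
 thus ?thesis using Hnorm_eq_0_iff[OF gs_H] Hnorm_nonneg[of gs] by linarith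
qed

lemma Bmax_bdd: "bdd_above (Bint one ` {u\<in>H. Hnorm u = 1})"
 using Bint_le[OF coefficient_one] by (intro bdd_aboveI[of _ C_sob]) fastforce

lemma Bint_one_le_Bmax: assumes "u \<in> H" shows "Bint one u <= Bmax*Hnorm u powr (p + 1)"
proof (cases "Hnorm u = 0")
 case True
 thus ?thesis using Bint_le[OF coefficient_one assms] p_gt_1 by simp
next
 case False
 hence h: "Hnorm u > 0" using Hnorm_nonneg[of u] by linarith
 have "Bint one (normalized u) <= Bmax"
  unfolding Bmax_def using H_normalized[OF assms] Hnorm_normalized[OF h] by (intro cSUP_upper[OF _ Bmax_bdd]) auto
 hence "(1/Hnorm u) powr (p + 1)*Bint one u <= Bmax" using h Bint_scale[of "1/Hnorm u" one u] by (simp add: normalized_def)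
 thus ?thesis using h by (simp add: powr_divide field_simps)
qed

lemma Bint_one_le_Bmax_power2: "u \<in> H ==> Bint one u <= Bmax*((Hnorm u)^2) powr ((p + 1)/2)"
 using Bint_one_le_Bmax[of u] powr_eq_power2_powr[OF Hnorm_nonneg, of u "p + 1"] by simp

lemma Bint_one_gs: "Bint one gs = (Hnorm gs)^2"
 using gs_crit[OF gs_H] by (simp add: I_deriv_def Bform_self Hnorm_power2)

lemma Bmax_pos: "Bmax > 0"
proof -
 have "0 < (Hnorm gs)^2" using Hnorm_gs_pos by simp
 also have "... <= Bmax*Hnorm gs powr (p + 1)" using Bint_one_le_Bmax[OF gs_H] Bint_one_gs by simp
 finally show ?thesis using Hnorm_gs_pos by (simp add: zero_less_mult_iff)
qed

lemma Bint_a_le_one: "u \<in> H ==> Bint a u <= Bint one u"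
 using coefficientD[OF a_coef] by (intro Bint_mono a_coef coefficient_one) auto

text \<open>By Brezis--Lieb the mass splits between the limit and the remainder; strict convexity
  of \<open>t powr ((p + 1)/2)\<close> lets a maximizing sequence keep all of it in the limit.\<close>
lemma maximizing_limit_norm:
 assumes u: "!!n. u n \<in> H" "!!n. Hnorm (u n) = 1" and B: "(%n. Bint one (u n)) ---> Bmax"
  and v: "v \<in> H" "0 < Hnorm v" "Hnorm v <= 1" "AE x in L. (%n. u n x) ---> v x" "(%n. Hinner (u n) v) ---> Hinner v v"
 shows "Hnorm v = 1" "(%n. Hdist (u n) v) ---> 0"
proof -
 define theta where "theta = (Hnorm v)^2"
 define r where "r = (p + 1)/2"
 have r: "r > 1" using p_gt_1 by (simp add: r_def)
 have theta: "0 < theta" "theta <= 1" using v by (auto simp: theta_def power_le_one)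
 let ?z = "%n x. u n x - v x"
 have zH: "?z n \<in> H" for n using H_diff u(1) v(1) .
 have "(%n. (Hnorm (u n))^2 - 2*Hinner (u n) v + (Hnorm v)^2) ---> 1 - 2*Hinner v v + (Hnorm v)^2"
  unfolding u(2) using v(5) by (intro tendsto_eq_intros) auto
 hence z2: "(%n. (Hnorm (?z n))^2) ---> 1 - theta"
  by (simp add: Hnorm_power2_diff[OF u(1) v(1)] theta_def flip: Hnorm_power2)
 have "(%n. Bint one (u n) - Bint one (?z n)) ---> Bint one v"
  by (rule brezis_lieb[OF coefficient_one, where C=1]) (use u v in auto)
 from tendsto_diff[OF B this] have Bz: "(%n. Bint one (?z n)) ---> Bmax - Bint one v" by simp
 have "(%n. Bmax*((Hnorm (?z n))^2) powr r) ---> Bmax*(1 - theta) powr r"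
  using z2 r by (intro tendsto_intros tendsto_powr2) (auto intro!: always_eventually)
 hence "Bmax - Bint one v <= Bmax*(1 - theta) powr r"
  by (rule LIMSEQ_le[OF Bz]) (use Bint_one_le_Bmax_power2[OF zH] in \<open>auto simp: r_def\<close>)
 moreover have "Bint one v <= Bmax*theta powr r" using Bint_one_le_Bmax_power2[OF v(1)] by (simp add: theta_def r_def)
 ultimately have "Bmax*1 <= Bmax*(theta powr r + (1 - theta) powr r)" by (simp add: algebra_simps)
 hence "1 <= theta powr r + (1 - theta) powr r" using Bmax_pos by simp
 hence theta1: "theta = 1" using split_powr_strict[of theta r] theta r by fastforce
 thus "Hnorm v = 1" using Hnorm_nonneg[of v] by (simp add: theta_def power2_eq_1_iff)
 have "(%n. sqrt ((Hnorm (?z n))^2)) ---> sqrt 0" using z2 theta1 by (intro tendsto_real_sqrt) simp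
 thus "(%n. Hdist (u n) v) ---> 0" by (simp add: Hnorm_nonneg)
qed

lemma maximizing_compact:
 assumes u: "!!n. u n \<in> H" "!!n. Hnorm (u n) = 1" and B: "(%n. Bint one (u n)) ---> Bmax"
  and delta: "delta > 0" "!!n. core_mass (u n) >= delta"
 obtains phi v where "strict_mono (phi :: nat => nat)" "v \<in> H" "Hnorm v = 1" "Bint one v = Bmax" "(%n. Hdist (u (phi n)) v) ---> 0"
proof -
 obtain phi v where phi: "strict_mono phi" "v \<in> H" "Hnorm v <= 1" "AE x in L. (%n. u (phi n) x) ---> v x"
  "(%n. LINT x|L. weight x*(u (phi n) x - v x)^2) ---> 0" "!!g. g \<in> H ==> (%n. Hinner (u (phi n)) g) ---> Hinner v g"
  by (rule rellich[of u 1]) (use u in auto)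
 have v0: "Hnorm v > 0"
 proof (rule ccontr)
  assume "~ ?thesis"
  hence "AE x in L. v x = 0" using Hnorm_eq_0_iff[OF phi(2)] Hnorm_nonneg[of v] by auto
  hence "(LINT x|L. weight x*(u (phi n) x - v x)^2) = core_mass (u (phi n))" for n
   unfolding core_mass_def using H_meas[OF u(1)] H_meas[OF phi(2)] by (intro integral_cong_AE) auto
  thus False using LIMSEQ_le_const[OF phi(5), of delta] delta by fastforce
 qed
 have Bphi: "(%n. Bint one (u (phi n))) ---> Bmax" using LIMSEQ_subseq_LIMSEQ[OF B phi(1)] by (simp add: comp_def)
 note lim = maximizing_limit_norm[of "%n. u (phi n)" v, OF u Bphi phi(2) v0 phi(3,4) phi(6)[OF phi(2)]]
 have "Bint one v = Bmax" by (rule LIMSEQ_unique[OF Hdist_tendsto(2)[OF u(1) phi(2) lim(2) coefficient_one] Bphi])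
 thus ?thesis using that[OF phi(1,2) lim(1) _ lim(2)] by blast
qed

definition max_level :: "nat => real" where "max_level n = Bmax*(1 - inverse (real (Suc n))/2)"

lemma max_level: "max_level n < Bmax" "Bmax/2 <= max_level n" "max_level ---> Bmax"
proof -
 have "inverse (real (Suc n)) <= 1" by (simp add: inverse_eq_divide)
 hence "Bmax*(1/2) <= max_level n" unfolding max_level_def using Bmax_pos by (intro mult_left_mono) auto
 thus "Bmax/2 <= max_level n" by simp
 have "max_level n < Bmax*1" unfolding max_level_def using Bmax_pos by (intro mult_strict_left_mono) auto
 thus "max_level n < Bmax" by simp
 have "max_level ---> Bmax*(1 - 0/2)" unfolding max_level_def[abs_def] by (intro tendsto_intros LIMSEQ_inverse_real_of_nat) auto
 thus "max_level ---> Bmax" by simp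
qed

lemma maximizing_translates:
 assumes v: "!!n. v n \<in> H" "!!n. Hnorm (v n) = 1" "!!n. max_level n <= Bint one (v n)"
 obtains y delta where "delta > 0" "!!n. core_mass (%z. v n (z + y n)) >= delta"
proof -
 obtain delta where delta: "delta > 0"
  "!!u. u \<in> H ==> Hnorm u <= 1 ==> (LINT x|L. abs (u x) powr (p + 1)) >= Bmax/2 ==> \<exists>x. delta <= core_mass (%y. u (y + x))"
  by (rule nonvanishing[of "Bmax/2"]) (use Bmax_pos in auto)
 have "Bmax/2 <= (LINT x|L. abs (v n x) powr (p + 1))" for n
  using max_level(2)[of n] v(3)[of n] Bint_le_powr_p1[OF coefficient_one v(1), of n] by linarith
 hence "\<exists>x. delta <= core_mass (%y. v n (y + x))" for n using delta(2)[OF v(1)] v(2)[of n] by simp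
 then obtain y where "!!n. core_mass (%z. v n (z + y n)) >= delta" by metis
 thus ?thesis using that delta(1) by blast
qed

lemma maximizing_tendsto:
 assumes "!!n. v n \<in> H" "!!n. Hnorm (v n) = 1" "!!n. max_level n <= X n" "!!n. X n <= Bint one (v n)"
 shows "X ---> Bmax"
proof (rule tendsto_sandwich[OF always_eventually always_eventually max_level(3) tendsto_const])
 show "\<forall>n. X n <= Bmax"
 proof
  fix n show "X n <= Bmax" using Bint_one_le_Bmax[OF assms(1)[of n]] assms(2)[of n] assms(4)[of n] by simp
 qed
qed (use assms(3) in auto)

lemma maximizer_exists: obtains v where "v \<in> H" "Hnorm v = 1" "Bint one v = Bmax"
proof -
 have ne: "{u\<in>H. Hnorm u = 1} ~= {}" using H_normalized[OF gs_H] Hnorm_normalized[OF Hnorm_gs_pos] by blast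
 have "\<exists>u. u \<in> H & Hnorm u = 1 & max_level n < Bint one u" for n
  using less_cSUP_iff[OF ne Bmax_bdd, of "max_level n"] max_level(1)[of n] unfolding Bmax_def[symmetric] by auto
 then obtain u where u: "!!n. u n \<in> H" "!!n. Hnorm (u n) = 1" and lev: "!!n. max_level n < Bint one (u n)" by metis
 note lev = less_imp_le[OF lev]
 obtain y delta where y: "delta > 0" "!!n. core_mass (%z. u n (z + y n)) >= delta"
  by (rule maximizing_translates[OF u lev]) blast
 show ?thesis
  by (rule maximizing_compact[of "%n z. u n (z + y n)" delta])
   (use u y that maximizing_tendsto[OF u lev order_refl] in \<open>auto simp: H_shift Hnorm_shift Bint_shift\<close>)
qed

lemma maximizer_EL: assumes v: "v \<in> H" "Hnorm v = 1" "Bint one v = Bmax" and h: "h \<in> H" shows "Bmax*Hinner v h = Bform one v h"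
proof -
 define b c where "b = Hinner v h" and "c = (Hnorm h)^2"
 define F where "F t = Bmax*(1 + 2*t*b + t^2 * c) powr ((p + 1)/2) - Bint one (%x. v x + t*h x)" for t
 have "(Hnorm (%x. v x + t*h x))^2 = 1 + 2*t*b + t^2 * c" for t
  using Hnorm_power2_add[OF v(1) H_scale[OF h], of t] v(2) by (simp add: b_def c_def Hinner_scale_right Hnorm_scale power_mult_distrib mult_ac)
 hence F0: "F t >= 0" for t
  using Bint_one_le_Bmax_power2[OF H_add[OF v(1) H_scale[OF h, of t]]] by (simp add: F_def)
 have "((%t. Bmax*(1 + 2*t*b + t^2 * c) powr ((p + 1)/2)) has_real_derivative Bmax*((p + 1)/2*(2*b))) (at 0)"
  by (auto intro!: derivative_eq_intros)
 hence D: "(F has_real_derivative Bmax*((p + 1)/2*(2*b)) - (p + 1)*Bform one v h) (at 0)"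
  unfolding F_def by (intro DERIV_diff Bint_has_derivative coefficient_one v h)
 have "F 0 = 0" using v(3) by (simp add: F_def)
 hence "Bmax*((p + 1)/2*(2*b)) - (p + 1)*Bform one v h = 0"
  using F0 by (intro DERIV_local_min[OF D, of 1]) auto
 hence "(p + 1)*(Bmax*b - Bform one v h) = 0" by (simp add: algebra_simps)
 thus ?thesis using p_gt_1 by (simp add: b_def)
qed

definition gs_norm :: real where "gs_norm = Bmax powr (- 1/(p - 1))"
lemma gs_norm_pos: "gs_norm > 0" using Bmax_pos by (simp add: gs_norm_def)
lemma gs_norm_powr: "gs_norm powr (p - 1)*Bmax = 1"
proof -
 have "gs_norm powr (p - 1) = Bmax powr (- 1)" unfolding gs_norm_def using p_gt_1 by (subst powr_powr) simp
 thus ?thesis using Bmax_pos by (simp add: powr_minus)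
qed

lemma gs_energy_kappa: "gs_energy = kappa*(Hnorm gs)^2"
 using p_gt_1 by (simp add: Ifun_eq Bint_one_gs kappa_def field_simps)

lemma Hnorm_ge_gs_norm: assumes "u \<in> H" "Hnorm u > 0" "(Hnorm u)^2 <= Bint one u" shows "gs_norm <= Hnorm u"
proof -
 have "(Hnorm u)^2 <= (Bmax*Hnorm u powr (p - 1))*(Hnorm u)^2"
  using assms(3) Bint_one_le_Bmax[OF assms(1)] by (simp add: powr_Suc_eq_mult_power2 Hnorm_nonneg)
 hence "1 <= Bmax*Hnorm u powr (p - 1)" using assms(2) by simp
 hence "Bmax*gs_norm powr (p - 1) <= Bmax*Hnorm u powr (p - 1)" using gs_norm_powr by (simp add: mult.commute)
 hence "gs_norm powr (p - 1) <= Hnorm u powr (p - 1)" using Bmax_pos by simp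
 thus ?thesis using powr_less_mono2[of "p - 1" "Hnorm u" gs_norm] p_gt_1 assms(2) by (metis not_le diff_gt_0_iff_gt less_imp_le)
qed

lemma scaled_maximizer:
 assumes v: "v \<in> H" "Hnorm v = 1" "Bint one v = Bmax"
 shows "crit_Hs s (Ifun s p one (%_. 0)) (%x. gs_norm * v x)" "Ifun s p one (%_. 0) (%x. gs_norm * v x) = kappa*gs_norm^2"
proof -
 let ?u = "%x. gs_norm * v x"
 have t: "gs_norm >= 0" using gs_norm_pos by simp
 have "I_deriv one (%_. 0) ?u h = 0" if "h \<in> H" for h
 proof -
  have "gs_norm powr p = gs_norm*gs_norm powr (p - 1)" using powr_mult_base[OF t, of "p - 1"] by simp
  hence "Bform one ?u h = gs_norm*(gs_norm powr (p - 1)*Bmax)*Hinner v h"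
   unfolding Bform_scale_left[OF t] maximizer_EL[OF v that, symmetric] by (simp only: mult.assoc)
  hence "Bform one ?u h = gs_norm*Hinner v h" unfolding gs_norm_powr by simp
  thus ?thesis by (simp only: I_deriv_def Hinner_scale_left)
 qed
 thus "crit_Hs s (Ifun s p one (%_. 0)) ?u" by (intro crit_HsI coefficient_one zero_dual H_scale v(1))
 have "Bint one ?u = (gs_norm powr (p - 1)*Bmax)*gs_norm^2"
  using Bint_scale[OF t, of one v] v(3) powr_Suc_eq_mult_power2[OF t, of p] by simp
 hence "Bint one ?u = gs_norm^2" unfolding gs_norm_powr by simp
 moreover have "Hnorm ?u = gs_norm" using v(2) t by (simp add: Hnorm_scale)
 ultimately show "Ifun s p one (%_. 0) ?u = kappa*gs_norm^2"
  using p_gt_1 by (simp add: Ifun_eq kappa_def field_simps)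
qed

lemma gs_energy_eq: "gs_energy = kappa*gs_norm^2"
proof (rule antisym)
 have "gs_norm <= Hnorm gs" by (rule Hnorm_ge_gs_norm[OF gs_H Hnorm_gs_pos]) (simp add: Bint_one_gs)
 thus "kappa*gs_norm^2 <= gs_energy" unfolding gs_energy_kappa using kappa_pos gs_norm_pos by (intro mult_left_mono power_mono) auto
 obtain v where v: "v \<in> H" "Hnorm v = 1" "Bint one v = Bmax" by (rule maximizer_exists)
 have "~ (AE x in L. gs_norm * v x = 0)" using Hnorm_eq_0_iff[OF v(1)] v(2) gs_norm_pos by simp
 hence "gs_energy <= Ifun s p one (%_. 0) (%x. gs_norm * v x)" using gs scaled_maximizer(1)[OF v] unfolding ground_state_def by blast
 thus "gs_energy <= kappa*gs_norm^2" by (simp only: scaled_maximizer(2)[OF v])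
qed

lemma Hnorm_gs: "Hnorm gs = gs_norm"
 using gs_energy_eq gs_energy_kappa kappa_pos gs_norm_pos Hnorm_gs_pos by (simp add: power2_eq_iff)

lemma maximizer_nonneg: assumes "v \<in> H" "Hnorm v = 1" "Bint one v = Bmax" shows "AE x in L. v x = max (v x) 0"
proof -
 note P = H_pos_part[OF assms(1)]
 have "Bint one (pos_part v) = Bint one v" by (simp add: Bint_def)
 hence "1 <= Hnorm (pos_part v) powr (p + 1)" using Bint_one_le_Bmax[OF P] assms Bmax_pos by simp
 moreover have "Hnorm (pos_part v) powr (p + 1) < 1 powr (p + 1)" if "Hnorm (pos_part v) < 1"
  using that p_gt_1 Hnorm_nonneg by (intro powr_less_mono2) auto
 ultimately have ge: "1 <= Hnorm (pos_part v)" by fastforce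
 have "(Hdist v (pos_part v))^2 = 1 - 2*Hinner v (pos_part v) + (Hnorm (pos_part v))^2"
  using Hnorm_power2_diff[OF assms(1) P] assms by simp
 also have "... <= 1 - (Hnorm (pos_part v))^2" using Hinner_pos_part_ge[OF assms(1)] by simp
 also have "... <= 0" using ge by (simp add: one_le_power)
 finally have "Hdist v (pos_part v) = 0" by simp
 thus ?thesis using Hnorm_eq_0_iff[OF H_diff[OF assms(1) P]] by (auto elim: AE_mp)
qed

lemma maximizer_positive: assumes "v \<in> H" "Hnorm v = 1" "Bint one v = Bmax" shows "AE x in L. v x > 0"
proof -
 have m: "pos_part v \<in> H" "AE x in L. v x = pos_part v x" using H_pos_part[OF assms(1)] maximizer_nonneg[OF assms] by auto
 have h: "Hnorm (pos_part v) = 1" using Hnorm_AE_cong[OF assms(1) H_meas[OF m(1)] m(2)] assms(2) by simp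
 have "Hinner (pos_part v) phi >= 0" if phi: "phi \<in> H" "!!x. phi x >= 0" for phi
 proof -
  have "Bmax*Hinner (pos_part v) phi = Bmax*Hinner v phi" using Hinner_AE_cong[OF assms(1) H_meas[OF m(1)] m(2) phi(1)] by simp
  also have "... = Bform one v phi" by (rule maximizer_EL[OF assms phi(1)])
  also have "... >= 0" unfolding Bform_def using phi(2) by simp
  finally show ?thesis using Bmax_pos by (simp add: zero_le_mult_iff)
 qed
 note ss = this
 obtain eps where eps: "eps > 0" "AE x in L. pos_part v x >= eps * weight x"
  by (rule supersolution_lower_bound[OF m(1)]) (use h ss in auto)
 from eps(2) show ?thesis
 proof eventually_elim
  case (elim x)
  have "eps * weight x > 0" using eps(1) weight_pos by simp
  thus ?case using elim by (simp add: max_def split: if_splits)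
 qed
qed

lemma Bint_a_less_Bmax: assumes "v \<in> H" "Hnorm v = 1" shows "Bint a v < Bmax"
proof (rule ccontr)
 assume "~ ?thesis"
 hence eq: "Bint one v = Bmax" "Bint a v = Bint one v" using Bint_a_le_one[OF assms(1)] Bint_one_le_Bmax[OF assms(1)] assms(2) by auto
 have i: "integrable L (%x. one x*max (v x) 0 powr (p + 1))" "integrable L (%x. a x*max (v x) 0 powr (p + 1))"
  using Bint_integrable[OF coefficient_one assms(1)] Bint_integrable[OF a_coef assms(1)] by auto
 have "(LINT x|L. one x*max (v x) 0 powr (p + 1) - a x*max (v x) 0 powr (p + 1)) = 0"
  using eq(2) i by (simp add: Bint_def)
 moreover have "0 <= one x*max (v x) 0 powr (p + 1) - a x*max (v x) 0 powr (p + 1)" for x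
  using coefficientD(3)[OF a_coef, of x] by (simp add: mult_left_le_one_le coefficientD(2)[OF a_coef])
 ultimately have "AE x in L. one x*max (v x) 0 powr (p + 1) - a x*max (v x) 0 powr (p + 1) = 0"
  using i by (subst (asm) integral_nonneg_eq_0_iff_AE) auto
 hence "AE x in L. a x = 1"
  using maximizer_positive[OF assms eq(1)] by eventually_elim (auto simp: max_def split: if_splits)
 thus False using a_ne1 by simp
qed

subsection \<open>Barycentres\<close>

definition direction :: "real^'n => real^'n" where "direction x = x /\<^sub>R (1 + norm x)"

lemma direction_meas[measurable]: "direction \<in> borel_measurable borel" unfolding direction_def by measurable

definition barycentre :: "'n fn => real^'n" where
 "barycentre v = (LINT x|L. (v x)^2 *\<^sub>R direction x)"

lemma norm_direction_le_1: "norm (direction x) <= 1"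
 using norm_ge_zero[of x] by (simp add: direction_def inverse_eq_divide divide_le_eq not_less)

lemma barycentre_integrable: assumes "v \<in> H" shows "integrable L (%x. (v x)^2 *\<^sub>R direction x)"
proof (rule Bochner_Integration.integrable_bound[OF L2D(2)[OF H_L2[OF assms]]])
 have [measurable]: "v \<in> borel_measurable borel" using assms H_meas by auto
 show "(%x. (v x)^2 *\<^sub>R direction x) \<in> borel_measurable L" by measurable
 show "AE x in L. norm ((v x)^2 *\<^sub>R direction x) <= norm ((v x)^2)"
  by (intro AE_I2) (simp add: mult_left_le norm_direction_le_1)
qed

lemma integral_power2_diff_le:
 assumes "v \<in> H" "w \<in> H"
 shows "integrable L (%x. abs ((v x)^2 - (w x)^2))"
  "(LINT x|L. abs ((v x)^2 - (w x)^2)) <= Hdist v w*(Hnorm v + Hnorm w)"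
proof -
 show "integrable L (%x. abs ((v x)^2 - (w x)^2))" using L2D(2)[OF H_L2[OF assms(1)]] L2D(2)[OF H_L2[OF assms(2)]] by auto
 note d = H_diff[OF assms] and t = H_add[OF assms]
 have "(v x)^2 - (w x)^2 = (v x - w x)*(v x + w x)" for x by (simp add: power2_eq_square algebra_simps)
 hence "(LINT x|L. abs ((v x)^2 - (w x)^2))^2 <= (LINT x|L. (v x - w x)^2)*(LINT x|L. (v x + w x)^2)"
  using L2_Cauchy_Schwarz[OF H_L2[OF d] H_L2[OF t]] by simp
 also have "... <= (Hdist v w)^2*(Hnorm v + Hnorm w)^2"
  using L2_le_Hnorm[of "%x. v x - w x"] L2_le_Hnorm[of "%x. v x + w x"] power_mono[OF Hnorm_triangle[OF assms] Hnorm_nonneg, of 2]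
  by (intro mult_mono) auto
 finally show "(LINT x|L. abs ((v x)^2 - (w x)^2)) <= Hdist v w*(Hnorm v + Hnorm w)"
  unfolding power_mult_distrib[symmetric] by (rule power2_le_imp_le) (simp add: Hnorm_nonneg)
qed

lemma barycentre_lipschitz:
 assumes "v \<in> H" "w \<in> H" shows "norm (barycentre v - barycentre w) <= Hdist v w*(Hnorm v + Hnorm w)"
proof -
 have "barycentre v - barycentre w = (LINT x|L. ((v x)^2 - (w x)^2) *\<^sub>R direction x)"
  unfolding barycentre_def using barycentre_integrable assms by (simp add: scaleR_left_diff_distrib)
 also have "norm ... <= (LINT x|L. norm (((v x)^2 - (w x)^2) *\<^sub>R direction x))" by (rule integral_norm_bound)
 also have "... <= (LINT x|L. abs ((v x)^2 - (w x)^2))"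
 proof (intro integral_mono' integral_power2_diff_le assms)
  show "norm (((v x)^2 - (w x)^2) *\<^sub>R direction x) <= abs ((v x)^2 - (w x)^2)" for x
   unfolding norm_scaleR real_norm_def[symmetric] using norm_direction_le_1[of x] by (simp add: mult_left_le)
 qed auto
 finally show ?thesis using integral_power2_diff_le(2)[OF assms] by linarith
qed

lemma direction_tendsto:
 fixes x :: "real^'n" and y :: "nat => real^'n"
 assumes "escapes y"
 shows "(%n. direction (x + y n) \<bullet> (y n /\<^sub>R norm (y n))) ---> 1"
proof -
 have inv: "(%n. inverse (norm (y n))) ---> 0" using tendsto_inverse_0_at_top[OF assms] .
 have ev: "\<forall>\<^sub>F n in sequentially. norm (y n) > 2*norm x + 1" using assms by (auto simp: filterlim_at_top_dense)
 have "\<forall>\<^sub>F n in sequentially. norm (direction (x + y n) \<bullet> (y n /\<^sub>R norm (y n)) - 1) <= 4*(1 + 2*norm x)*inverse (norm (y n))"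
  using ev
 proof eventually_elim
  case (elim n)
  define r where "r = norm (y n)"
  define q where "q = 1 + norm (x + y n)"
  define e where "e = y n /\<^sub>R r"
  have r: "r > 2*norm x + 1" "r > 0" using elim norm_ge_zero[of x] unfolding r_def by linarith+
  have ne: "norm e = 1" using r by (simp add: e_def r_def)
  have ye: "y n \<bullet> e = r" using r by (simp add: e_def r_def dot_square_norm power2_eq_square)
  have q1: "r - norm x <= q" "q <= 1 + norm x + r" unfolding q_def r_def using norm_triangle_ineq[of x "y n"] norm_triangle_ineq2[of "y n" "- x"] by (auto simp: add.commute)
  have q0: "q >= r/2" "q > 0" using q1(1) r by linarith+
  have xe: "abs (x \<bullet> e) <= norm x" using Cauchy_Schwarz_ineq2[of x e] ne by simp
  have "((x + y n) /\<^sub>R q) \<bullet> e - 1 = (x \<bullet> e + r - q)/q" using q0 ye by (simp add: inner_add_left field_simps)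
  moreover have "abs (x \<bullet> e + r - q) <= 1 + 2*norm x" using xe q1 by linarith
  ultimately have "abs (((x + y n) /\<^sub>R q) \<bullet> e - 1) <= (1 + 2*norm x)/q" using q0 by (simp add: abs_divide divide_right_mono)
  also have "... <= (1 + 2*norm x)/(r/2)" using q0 r by (intro divide_left_mono) auto
  also have "... <= 4*(1 + 2*norm x)*inverse r" using r by (simp add: field_simps)
  finally show ?case by (simp add: q_def e_def r_def direction_def)
 qed
 moreover have "(%n. 4*(1 + 2*norm x)*inverse (norm (y n))) ---> 0" using tendsto_mult_right_zero[OF inv] .
 ultimately have "(%n. direction (x + y n) \<bullet> (y n /\<^sub>R norm (y n)) - 1) ---> 0" by (rule Lim_null_comparison)
 thus ?thesis by (simp add: LIM_zero_iff)
qed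

lemma barycentre_shift_inner:
 assumes v: "v \<in> H"
 shows "barycentre (%x. v (x - y)) \<bullet> e = (LINT x|L. (v x)^2*(direction (x + y) \<bullet> e))"
proof -
 note [measurable] = H_meas[OF v]
 have sh: "(%x. v (x - y)) \<in> H" using H_shift[OF v, of "- y"] by simp
 have "barycentre (%x. v (x - y)) \<bullet> e = (LINT x|L. (v (x - y))^2*(direction x \<bullet> e))"
  unfolding barycentre_def using barycentre_integrable[OF sh] by (subst integral_inner_left[symmetric]) auto
 also have "... = (LINT x|L. (v (x + y - y))^2*(direction (x + y) \<bullet> e))"
  by (rule integral_lborel_shift(1)[symmetric, where f="%x. (v (x - y))^2*(direction x \<bullet> e)"]) measurable
 finally show ?thesis by simp
qed

lemma barycentre_shift_tendsto:
 assumes v: "v \<in> H" and y: "escapes y"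
 shows "(%n. barycentre (%x. v (x - y n)) \<bullet> (y n /\<^sub>R norm (y n))) ---> (LINT x|L. (v x)^2)"
proof -
 note [measurable] = H_meas[OF v]
 let ?rho = "%n x. direction (x + y n) \<bullet> (y n /\<^sub>R norm (y n))"
 have rho: "abs (?rho n x) <= 1" for n x
 proof -
  have "abs (?rho n x) <= norm (direction (x + y n))*norm (y n /\<^sub>R norm (y n))" by (rule Cauchy_Schwarz_ineq2)
  also have "... <= 1*1" using norm_direction_le_1[of "x + y n"] by (intro mult_mono) (auto simp: inverse_eq_divide)
  finally show ?thesis by simp
 qed
 have "(%n. LINT x|L. (v x)^2*?rho n x) ---> (LINT x|L. (v x)^2*1)"
 proof (rule integral_dominated_convergence[where w="%x. (v x)^2"])
  show "AE x in L. (%n. (v x)^2*?rho n x) ---> (v x)^2*1" by (intro AE_I2 tendsto_mult tendsto_const direction_tendsto y)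
  show "AE x in L. norm ((v x)^2*?rho n x) <= (v x)^2" for n using rho by (auto simp: abs_mult intro!: AE_I2 mult_left_le)
 qed (use L2D(2)[OF H_L2[OF v]] in auto)
 thus ?thesis unfolding barycentre_shift_inner[OF v] by (simp only: mult_1_right)
qed

lemma barycentre_far:
 assumes u: "!!n. u n \<in> H" and v: "v \<in> H" and lim: "(%n. Hdist (u n) v) ---> 0"
  and y: "escapes y"
 shows "(%n. barycentre (%x. u n (x - y n)) \<bullet> (y n /\<^sub>R norm (y n))) ---> (LINT x|L. (v x)^2)"
proof -
 let ?b = "%w n. barycentre (%x. w (x - y n)) \<bullet> (y n /\<^sub>R norm (y n))"
 have sh: "(%x. w (x - c)) \<in> H" "Hnorm (%x. w (x - c)) = Hnorm w" if "w \<in> H" for w c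
  using H_shift[OF that, of "- c"] Hnorm_shift[OF that, of "- c"] by auto
 have bound: "norm (?b (u n) n - ?b v n) <= Hdist (u n) v * (Hnorm (u n) + Hnorm v)" for n
 proof -
  have "norm (?b (u n) n - ?b v n) <= norm (barycentre (%x. u n (x - y n)) - barycentre (%x. v (x - y n)))*norm (y n /\<^sub>R norm (y n))"
   unfolding inner_diff_left[symmetric] real_norm_def by (rule Cauchy_Schwarz_ineq2)
  also have "... <= norm (barycentre (%x. u n (x - y n)) - barycentre (%x. v (x - y n)))*1" by (intro mult_left_mono) (auto simp: inverse_eq_divide)
  also have "... <= Hdist (u n) v * (Hnorm (u n) + Hnorm v)"
   using barycentre_lipschitz[OF sh(1)[OF u] sh(1)[OF v], of n "y n" "y n"] sh(2)[OF H_diff[OF u v]] sh(2)[OF u] sh(2)[OF v] by (simp only: mult_1_right)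
  finally show ?thesis .
 qed
 have "(%n. Hdist (u n) v * (Hnorm (u n) + Hnorm v)) ---> 0*(Hnorm v + Hnorm v)"
  by (intro tendsto_intros lim Hdist_tendsto(1)[OF u v lim])
 hence "(%n. Hdist (u n) v * (Hnorm (u n) + Hnorm v)) ---> 0" by simp
 from Lim_null_comparison[OF always_eventually[OF allI[OF bound]] this] have "(%n. ?b (u n) n - ?b v n) ---> 0" .
 from tendsto_add[OF this barycentre_shift_tendsto[OF v y]] show ?thesis by (simp only: diff_add_cancel add_0)
qed

lemma Bint_a_not_maximizing:
 assumes u: "!!n. u n \<in> H" "!!n. Hnorm (u n) = 1" and B: "(%n. Bint one (u n)) ---> Bmax" "(%n. Bint a (u n)) ---> Bmax"
  and delta: "delta > 0" "!!n. core_mass (u n) >= delta"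
 shows False
proof -
 obtain phi w where w: "strict_mono phi" "w \<in> H" "Hnorm w = 1" "(%n. Hdist (u (phi n)) w) ---> 0"
  by (rule maximizing_compact[OF u B(1) delta]) blast
 have "(%n. Bint a (u (phi n))) ---> Bmax" using LIMSEQ_subseq_LIMSEQ[OF B(2) w(1)] by (simp add: comp_def)
 with Hdist_tendsto(2)[OF u(1) w(2,4) a_coef] have "Bint a w = Bmax" by (rule LIMSEQ_unique)
 thus False using Bint_a_less_Bmax[OF w(2,3)] by simp
qed

lemma escaping_barycentre:
 assumes v: "!!n. v n \<in> H" "!!n. Hnorm (v n) = 1" and B: "(%n. Bint one (v n)) ---> Bmax"
  and y: "escapes y" and delta: "delta > 0" "!!n. core_mass (%z. v n (z + y n)) >= delta"
 shows "\<exists>n. barycentre (v n) ~= 0"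
proof (rule ccontr)
 assume "~ ?thesis"
 hence b0: "barycentre (v n) = 0" for n by simp
 obtain phi w where w: "strict_mono phi" "w \<in> H" "Hnorm w = 1" "(%n. Hnorm (%x. v (phi n) (x + y (phi n)) - w x)) ---> 0"
  by (rule maximizing_compact[of "%n z. v n (z + y n)" delta]) (use v B delta in \<open>auto simp: H_shift Hnorm_shift Bint_shift\<close>)
 have "(%n. barycentre (%x. v (phi n) (x - y (phi n) + y (phi n))) \<bullet> (y (phi n) /\<^sub>R norm (y (phi n)))) ---> (LINT x|L. (w x)^2)"
  by (rule barycentre_far[OF _ w(2) w(4) filterlim_compose[OF y filterlim_subseq[OF w(1)]]]) (simp add: H_shift v)
 hence "(LINT x|L. (w x)^2) = 0" by (simp add: b0 LIMSEQ_const_iff)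
 thus False using L2_pos[OF w(2)] w(3) by simp
qed

lemma not_at_top_subseq:
 fixes X :: "nat => real" assumes "~ filterlim X at_top sequentially"
 obtains sigma R where "strict_mono (sigma :: nat => nat)" "!!n. X (sigma n) < R"
proof -
 obtain R where "\<exists>\<^sub>F n in sequentially. X n < R" using assms by (auto simp: filterlim_at_top not_eventually not_le)
 hence "infinite {n. X n < R}" by (auto simp: frequently_sequentially infinite_nat_iff_unbounded_le)
 then obtain sigma :: "nat => nat" where sigma: "strict_mono sigma" "\<forall>n. sigma n \<in> {n. X n < R}" using infinite_enumerate by blast
 show ?thesis by (rule that[of sigma R]) (use sigma in auto)
qed

lemma barycentre_nonzero: obtains nu where "nu > 0" "!!v. v \<in> Sigma ==> Bint a v > Bmax - nu ==> barycentre v ~= 0"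
proof (rule ccontr)
 assume no: "~ thesis"
 have "\<exists>v. v \<in> Sigma & max_level n < Bint a v & barycentre v = 0" for n
  using no that[of "Bmax - max_level n"] max_level(1)[of n] by fastforce
 then obtain v where v: "!!n. v n \<in> Sigma" and lev: "!!n. max_level n < Bint a (v n)" and b0: "!!n. barycentre (v n) = 0" by metis
 note vH = Sigma_plusD[OF v]
 note lev1 = order_trans[OF less_imp_le[OF lev] Bint_a_le_one[OF vH(1)]]
 have B1: "(%n. Bint one (v n)) ---> Bmax" by (rule maximizing_tendsto[OF vH lev1 order_refl])
 have Ba: "(%n. Bint a (v n)) ---> Bmax" by (rule maximizing_tendsto[OF vH less_imp_le[OF lev] Bint_a_le_one[OF vH(1)]])
 obtain y delta where y: "delta > 0" "!!n. core_mass (%z. v n (z + y n)) >= delta"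
  by (rule maximizing_translates[OF vH lev1]) blast
 have "~ escapes y" using escaping_barycentre[OF vH B1 _ y] b0 by blast
 then obtain sigma R where sigma: "strict_mono (sigma :: nat => nat)" "!!n. norm (y (sigma n)) < R" using not_at_top_subseq by blast
 have R: "1 + R > 0" using sigma(2)[of 0] norm_ge_zero[of "y (sigma 0)"] by linarith
 have "delta/(1 + R) powr N2s <= core_mass (v (sigma n))" for n
  using order_trans[OF y(2) core_mass_shift_le[OF vH(1) less_imp_le[OF sigma(2)]]] R by (simp add: divide_le_eq mult.commute)
 moreover have "(%n. Bint one (v (sigma n))) ---> Bmax" "(%n. Bint a (v (sigma n))) ---> Bmax"
  using LIMSEQ_subseq_LIMSEQ[OF B1 sigma(1)] LIMSEQ_subseq_LIMSEQ[OF Ba sigma(1)] by (simp_all add: comp_def)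
 ultimately show False
  using y(1) R by (intro Bint_a_not_maximizing[of "%n. v (sigma n)" "delta/(1 + R) powr N2s"] vH) auto
qed

end

lemma powr_taylor2_lower:
 fixes t p :: real assumes "p > 1" "t >= 0"
 shows "(1 + t) powr (p + 1) >= 1 + (p + 1)*t + p*(p + 1)/2*t^2"
proof -
 have D: "((%x. (1 + x) powr (p + 1) - 1 - (p + 1)*x - p*(p + 1)/2*x^2) has_real_derivative ((p + 1)*((1 + x) powr p - 1 - p*x))) (at x)"
  if "x >= 0" for x
  using that by (auto intro!: derivative_eq_intros simp: algebra_simps)
 have "(%x. (1 + x) powr (p + 1) - 1 - (p + 1)*x - p*(p + 1)/2*x^2) 0 <= (%x. (1 + x) powr (p + 1) - 1 - (p + 1)*x - p*(p + 1)/2*x^2) t"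
 proof (rule DERIV_nonneg_imp_nondecreasing[OF assms(2), where f="%x. (1 + x) powr (p + 1) - 1 - (p + 1)*x - p*(p + 1)/2*x^2"])
  fix x :: real assume x: "0 <= x" "x <= t"
  have "(1 + x) powr p - 1 - p*x >= 0" using bernoulli_powr[of p "1 + x"] assms x by simp
  thus "\<exists>y. ((%x. (1 + x) powr (p + 1) - 1 - (p + 1)*x - p*(p + 1)/2*x^2) has_real_derivative y) (at x) & 0 <= y"
   using D[OF x(1)] assms by (intro exI[of _ "(p + 1)*((1 + x) powr p - 1 - p*x)"]) auto
 qed
 thus ?thesis by simp
qed

definition excess :: "real => real => real => real" where
 "excess p A B = (A + B) powr (p + 1) - A powr (p + 1) - B powr (p + 1) - (p + 1)*A powr p*B"

lemma excess_scale:
 assumes "l > 0" "A >= 0" "B >= 0" shows "excess p (l*A) (l*B) = l powr (p + 1)*excess p A B"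
proof -
 have "(l*A + l*B) powr (p + 1) = l powr (p + 1)*(A + B) powr (p + 1)" by (simp add: powr_mult flip: distrib_left)
 moreover have "(l*A) powr p*(l*B) = l powr (p + 1)*(A powr p*B)" using assms by (simp add: powr_mult powr_add)
 ultimately show ?thesis by (simp add: excess_def powr_mult mult.assoc right_diff_distrib)
qed

lemma excess_one_ge:
 fixes p t :: real assumes p: "p > 1" and t: "0 <= t" "t <= 1"
 shows "(p*(p + 1)/2 - 1)*t^2 <= excess p 1 t"
proof -
 have "t powr (p + 1) <= t powr 2" using t p by (intro powr_mono') auto
 hence "t powr (p + 1) <= t^2" using t by (simp add: powr_numeral)
 thus ?thesis using powr_taylor2_lower[OF p t(1)] by (simp add: excess_def algebra_simps)
qed

definition excess_const :: "real => real" where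
 "excess_const p = min ((p*(p + 1)/2 - 1)/2) ((p + 1)*(1 - (1/2) powr (p - 1)))"

lemma excess_const_pos: assumes p: "p > 1" shows "excess_const p > 0"
proof -
 have "1*2 < p*(p + 1)" using p by (intro mult_strict_mono) auto
 moreover have "(1/2::real) powr (p - 1) < 1" using p powr_less_mono2[of "p - 1" "1/2" 1] by simp
 ultimately show ?thesis using p by (simp add: excess_const_def)
qed

lemma excess_to_one_ge:
 fixes p t :: real assumes p: "p > 1" and t: "0 <= t" "t <= 1"
 shows "excess_const p*t <= excess p t 1"
proof -
 define k where "k = p*(p + 1)/2 - 1"
 define e where "e = (p + 1)*(1 - (1/2) powr (p - 1))"
 have c: "excess_const p <= k/2" "excess_const p <= e" unfolding excess_const_def k_def e_def by (rule min.cobounded1 min.cobounded2)+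
 hence k: "k > 0" using excess_const_pos[OF p] by linarith
 have G: "excess p t 1 = excess p 1 t + (p + 1)*(t - t powr p)" by (simp add: excess_def algebra_simps)
 have tp: "t powr p = t*t powr (p - 1)" using t powr_add[of t 1 "p - 1"] by (cases "t = 0") auto
 have low: "k*t^2 <= excess p 1 t" unfolding k_def by (rule excess_one_ge[OF p t])
 show ?thesis
 proof (cases "t <= 1/2")
  case True
  have "t powr (p - 1) <= (1/2) powr (p - 1)" using True t p by (intro powr_mono2) auto
  hence "t*(1 - (1/2) powr (p - 1)) <= t*(1 - t powr (p - 1))" using t by (intro mult_left_mono) auto
  hence "(p + 1)*(t*(1 - (1/2) powr (p - 1))) <= (p + 1)*(t - t powr p)" using p by (intro mult_left_mono) (auto simp: tp algebra_simps)
  hence "e*t <= (p + 1)*(t - t powr p)" by (simp add: e_def mult_ac)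
  moreover have "excess_const p*t <= e*t" using c t by (intro mult_right_mono) auto
  moreover have "0 <= k*t^2" using k by simp
  ultimately show ?thesis using low unfolding G by linarith
 next
  case False
  have "excess_const p*t <= k/2*t" using c t by (intro mult_right_mono) auto
  also have "... <= k*t^2" using False k t mult_left_mono[of "1/2" t "k*t"] by (simp add: power2_eq_square mult_ac)
  finally have "excess_const p*t <= k*t^2" .
  moreover have "0 <= (p + 1)*(t - t powr p)"
   using t p powr_le1[of "p - 1" t] mult_left_mono[of "t powr (p - 1)" 1 t] by (simp add: tp)
  ultimately show ?thesis using low unfolding G by linarith
 qed
qed

lemma excess_lower:
 fixes p :: real assumes p: "p > 1"
 shows "0 <= A ==> A <= B ==> excess_const p*(A*B powr p) <= excess p A B"
  "0 <= B ==> B <= A ==> excess_const p*(A powr (p - 1)*B^2) <= excess p A B"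
proof -
 show "excess_const p*(A*B powr p) <= excess p A B" if AB: "0 <= A" "A <= B"
 proof (cases "B = 0")
  case False
  hence B: "B > 0" "A/B <= 1" using AB by auto
  have "excess_const p*(A/B) <= excess p (A/B) 1" using AB B by (intro excess_to_one_ge p) auto
  hence "B powr (p + 1)*(excess_const p*(A/B)) <= B powr (p + 1)*excess p (A/B) 1" by (intro mult_left_mono) auto
  also have "... = excess p A B" using excess_scale[of B "A/B" 1 p] AB B by simp
  finally show ?thesis using B by (simp add: powr_add mult_ac)
 qed (use AB p in \<open>simp add: excess_def\<close>)
 show "excess_const p*(A powr (p - 1)*B^2) <= excess p A B" if AB: "0 <= B" "B <= A"
 proof (cases "A = 0")
  case False
  hence A: "A > 0" "B/A <= 1" using AB by auto
  define k where "k = p*(p + 1)/2 - 1"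
  have "excess_const p <= k/2" unfolding excess_const_def k_def by (rule min.cobounded1)
  hence "excess_const p <= k" using excess_const_pos[OF p] by linarith
  hence "excess_const p*(B/A)^2 <= k*(B/A)^2" by (intro mult_right_mono) auto
  also have "... <= excess p 1 (B/A)" using AB A unfolding k_def by (intro excess_one_ge p) auto
  finally have "A powr (p + 1)*(excess_const p*(B/A)^2) <= A powr (p + 1)*excess p 1 (B/A)" by (intro mult_left_mono) auto
  also have "... = excess p A B" using excess_scale[of A 1 "B/A" p] AB A by simp
  finally show ?thesis using A by (simp add: powr_Suc_eq_mult_power2 power_divide mult_ac)
 qed (use AB p in \<open>simp add: excess_def\<close>)
qed

lemma excess_nonneg: assumes p: "p > 1" and "A >= 0" "B >= 0" shows "excess p A B >= 0"
proof -
 have c: "0 <= excess_const p*(A*B powr p)" "0 <= excess_const p*(A powr (p - 1)*B^2)" using excess_const_pos[OF p] assms by auto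
 show ?thesis
 proof (cases "A <= B")
  case True
  thus ?thesis by (rule order_trans[OF c(1) excess_lower(1)[OF p assms(2)]])
 next
  case False
  thus ?thesis using order_trans[OF c(2) excess_lower(2)[OF p assms(3)]] by simp
 qed
qed

lemma excess_mono: assumes p: "p > 1" and "0 <= A'" "A' <= A" "0 <= B" shows "excess p A' B <= excess p A B"
proof (cases "A' = A \<or> A' = 0")
 case True
 thus ?thesis using excess_nonneg[OF p, of A B] assms by (auto simp: excess_def)
next
 case False
 hence A: "0 < A'" "A' <= A" using assms by auto
 show ?thesis
 proof (rule DERIV_nonneg_imp_nondecreasing[OF A(2)])
  fix x assume x: "A' <= x" "x <= A"
  hence xp: "x > 0" using A by simp
  have "(1 + B/x) powr p >= 1 + p*(B/x)" using bernoulli_powr[of p "1 + B/x"] xp assms by simp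
  hence "x powr p*(1 + B/x) powr p >= x powr p*(1 + p*(B/x))" by (intro mult_left_mono) auto
  moreover have "x powr p*(1 + B/x) powr p = (x + B) powr p" using xp assms by (simp add: powr_mult[symmetric] distrib_left)
  moreover have "x powr p/x = x powr (p - 1)" using xp by (simp add: powr_diff)
  hence "x powr p*(1 + p*(B/x)) = x powr p + p*x powr (p - 1)*B" by (simp add: distrib_left flip: \<open>x powr p / x = x powr (p - 1)\<close>)
  ultimately have "(p + 1)*((x + B) powr p - x powr p - p*x powr (p - 1)*B) >= 0" using p by (intro mult_nonneg_nonneg) auto
  moreover have "(((%A. excess p A B) has_real_derivative ((p + 1)*((x + B) powr p - x powr p - p*x powr (p - 1)*B))) (at x))"
   unfolding excess_def using xp assms
   by (auto intro!: derivative_eq_intros simp: algebra_simps)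
  ultimately show "\<exists>y. ((%A. excess p A B) has_real_derivative y) (at x) & 0 <= y" by blast
 qed
qed

lemma excess_ge_scaled_min:
 assumes p: "p > 1" and l: "0 < l" "l <= 1" and A: "0 < A" and B: "0 < B"
 shows "excess_const p*(l*min (A*B powr p) (B powr (p + 1))) <= excess p (l*A) B"
proof (cases "l*A <= B")
 case True
 have "excess_const p*(l*min (A*B powr p) (B powr (p + 1))) <= excess_const p*(l*(A*B powr p))"
  using excess_const_pos[OF p] l by (intro mult_left_mono) auto
 also have "... = excess_const p*((l*A)*B powr p)" by (simp add: mult_ac)
 also have "... <= excess p (l*A) B" using True l A by (intro excess_lower(1)[OF p]) auto
 finally show ?thesis .
next
 case False
 have "excess_const p*(l*min (A*B powr p) (B powr (p + 1))) <= excess_const p*(1*B powr (p + 1))"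
  using excess_const_pos[OF p] l A by (intro mult_left_mono mult_mono) auto
 also have "... = excess_const p*(B powr (p - 1)*B^2)" using B by (simp add: powr_Suc_eq_mult_power2)
 also have "... <= excess_const p*((l*A) powr (p - 1)*B^2)"
  using False B p excess_const_pos[OF p] by (intro mult_left_mono mult_right_mono powr_mono2) auto
 also have "... <= excess p (l*A) B" using False B by (intro excess_lower(2)[OF p]) auto
 finally show ?thesis .
qed

lemma excess_ge_low:
 assumes p: "p > 1" and eps: "eps > 0" and l: "0 < l" "l <= 1" and B: "0 < B" "B <= 1"
 shows "excess_const p*(min eps (eps powr (p - 1))*(l*B powr (max 2 p))) <= excess p (eps*l) B"
proof -
 define m where "m = min eps (eps powr (p - 1))"
 define A where "A = eps*l"
 have m: "0 < m" "m <= eps" "m <= eps powr (p - 1)" using eps by (auto simp: m_def)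
 have A: "A > 0" using eps l by (simp add: A_def)
 have "excess_const p*(m*(l*B powr (max 2 p))) <= excess p A B"
 proof (cases "A <= B")
  case True
  have "m*(l*B powr (max 2 p)) <= eps*(l*B powr p)"
   using m l B eps by (intro mult_mono mult_left_mono powr_mono') auto
  also have "... = A*B powr p" by (simp add: A_def)
  finally have "excess_const p*(m*(l*B powr (max 2 p))) <= excess_const p*(A*B powr p)" using excess_const_pos[OF p] by (intro mult_left_mono) auto
  thus ?thesis using excess_lower(1)[OF p, of A B] True A by simp
 next
  case False
  have "m*(l*B powr (max 2 p)) <= A powr (p - 1)*B^2"
  proof (cases "p <= 2")
   case True
   have "l powr 1 <= l powr (p - 1)" using True l p by (intro powr_mono') auto
   hence "m*(l*B powr 2) <= eps powr (p - 1)*(l powr (p - 1)*B powr 2)" using m l eps by (intro mult_mono mult_right_mono) auto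
   moreover have "max 2 p = 2" using True by simp
   ultimately show ?thesis using B eps l by (simp add: A_def powr_mult powr_numeral mult.assoc)
  next
   case p2: False
   have "B powr p = B powr (p - 2)*B^2" using powr_add[of B "p - 2" 2] B by (simp add: powr_numeral)
   also have "... <= A powr (p - 2)*B^2" using False B p2 by (intro mult_right_mono powr_mono2) auto
   finally have "m*(l*B powr p) <= eps*(l*(A powr (p - 2)*B^2))" using m l eps by (intro mult_mono mult_left_mono) auto
   also have "... = (A powr 1*A powr (p - 2))*B^2" using A by (simp add: A_def)
   also have "... = A powr (p - 1)*B^2" by (simp only: powr_add[symmetric]) simp
   finally show ?thesis using p2 by (simp add: max_def)
  qed
  hence "excess_const p*(m*(l*B powr (max 2 p))) <= excess_const p*(A powr (p - 1)*B^2)" using excess_const_pos[OF p] by (intro mult_left_mono) auto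
  thus ?thesis using excess_lower(2)[OF p, of B A] False B by simp
 qed
 thus ?thesis by (simp add: m_def A_def)
qed

lemma mult_powr_Suc_le_half:
 fixes G q X :: real
 assumes G: "G >= 0" and q: "q > 0" and X: "0 < X" "X <= (1/(2*(G + 1))) powr (1/q)"
 shows "G*X powr (q + 1) <= X/2"
proof -
 have "X powr q <= ((1/(2*(G + 1))) powr (1/q)) powr q" using X q by (intro powr_mono2) auto
 also have "... = 1/(2*(G + 1))" using q G by (simp add: powr_powr)
 finally have "G*X powr q <= G*(1/(2*(G + 1)))" using G by (intro mult_left_mono) auto
 also have "... <= 1/2" using G by (simp add: field_simps)
 finally have "G*X powr q*X <= 1/2*X" using X by (intro mult_right_mono) auto
 thus ?thesis using X by (simp add: powr_add)
qed

lemma powr_minus_lipschitz: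
 fixes m r s t :: real
 assumes m: "m > 0" and r: "r > 0" "r <= s" "r <= t"
 shows "abs (s powr - m - t powr - m) <= m*r powr (- m - 1)*abs (s - t)"
 unfolding real_norm_def[symmetric]
proof (rule field_differentiable_bound[where S="{r..}" and f'="%x. - m*x powr (- m - 1)"])
 fix x assume x: "x \<in> {r..}"
 show "((%x. x powr - m) has_field_derivative - m*x powr (- m - 1)) (at x within {r..})"
  using x r by (auto intro!: derivative_eq_intros)
 have "x powr (- m - 1) <= r powr (- m - 1)" using x r m by (intro powr_mono2') auto
 thus "norm (- m*x powr (- m - 1)) <= m*r powr (- m - 1)" using m by (simp add: abs_mult)
qed (use r in auto)

context frac_sobolev
begin

subsection \<open>Weighted energy estimate for the ground state\<close>

lemma rweight_eq: "rweight x = (1 + norm x) powr (- (N2s/2))"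
 unfolding rweight_def weight_def by (rule real_sqrt_unique) (simp_all add: power2_eq_square powr_add[symmetric])

lemma rweight_diff_near: assumes "norm h <= 1" shows "(rweight x - rweight (x + h))^2 <= (N2s*2 powr (N2s/2 + 1))^2 * weight x*(norm h)^2"
proof -
 define m where "m = N2s/2"
 define A B where "A = 1 + norm x" and "B = 1 + norm (x + h)"
 have m: "m > 0" using N2s_pos by (simp add: m_def)
 have AB: "A >= 1" "B >= 1" "abs (A - B) <= norm h"
  unfolding A_def B_def using norm_triangle_ineq3[of x "x + h"] by auto
 hence "A/2 <= B" using assms by (simp add: abs_le_iff)
 note AB = AB(1,3) this
 have "(A/2) powr (- m - 1) = 2 powr (m + 1)*A powr (- m - 1)"
  using AB powr_minus_divide[of 2 "m + 1"] by (simp add: powr_divide)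
 also have "... <= 2 powr (m + 1)*A powr - m" using AB by (intro mult_left_mono powr_mono) auto
 finally have A2: "(A/2) powr (- m - 1) <= 2 powr (m + 1)*rweight x" by (simp add: rweight_eq A_def m_def)
 have "rweight x = A powr - m" "rweight (x + h) = B powr - m" by (simp_all add: rweight_eq A_def B_def m_def)
 hence "abs (rweight x - rweight (x + h)) <= m*(A/2) powr (- m - 1)*abs (A - B)"
  using powr_minus_lipschitz[OF m, of "A/2" A B] AB by simp
 also have "... <= m*(2 powr (m + 1)*rweight x)*norm h" using A2 AB m rweight_pos[of x] by (intro mult_mono mult_left_mono mult_nonneg_nonneg) auto
 also have "... <= N2s*2 powr (m + 1)*rweight x*norm h" using N2s_pos rweight_pos[of x] by (simp add: m_def mult_right_mono)
 finally have "(abs (rweight x - rweight (x + h)))^2 <= (N2s*2 powr (m + 1)*rweight x*norm h)^2" by (intro power_mono) auto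
 thus ?thesis by (simp add: power_mult_distrib rweight_power2 m_def mult_ac)
qed

lemma weight_convolution: "weight (x + h) * weight h <= 2 powr N2s * weight x*(weight (x + h) + weight h)"
proof -
 have n: "norm x <= norm (x + h) + norm h" using norm_triangle_ineq4[of "x + h" h] by simp
 have w: "0 <= 2 powr N2s * weight x * weight h" "0 <= 2 powr N2s * weight x * weight (x + h)" by (auto simp: weight_nonneg)
 show ?thesis
 proof (cases "norm h <= norm (x + h)")
  case True
  have "weight (x + h) * weight h <= (2 powr N2s * weight x) * weight h" using n True by (intro mult_right_mono weight_comparable weight_nonneg) auto
  thus ?thesis using w by (simp add: distrib_left)
 next
  case False
  have "weight h * weight (x + h) <= (2 powr N2s * weight x) * weight (x + h)" using n False by (intro mult_right_mono weight_comparable weight_nonneg) auto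
  thus ?thesis using w by (simp add: distrib_left mult.commute[of "weight h"])
 qed
qed

definition energy_majorant :: "real^'n => real^'n => real" where
 "energy_majorant x h = (N2s*2 powr (N2s/2 + 1))^2 * weight x*kernel h + 2 powr N2s*2 * weight x * weight h
  + 2*2 powr N2s*(2 powr N2s * weight x*(weight (x + h) + weight h))"

lemma rweight_dquot_le: "(dquot rweight (x, x + h))^2 <= energy_majorant x h"
proof -
 define K where "K = (N2s*2 powr (N2s/2 + 1))^2"
 have e: "(dquot rweight (x, x + h))^2 = (rweight x - rweight (x + h))^2/norm h powr N2s"
  by (simp add: dquot_def power_divide power2_eq_square[of "_ powr _"] powr_add[symmetric])
 have nonneg: "0 <= 2 powr N2s*2 * weight x * weight h" "0 <= 2*2 powr N2s*(2 powr N2s * weight x*(weight (x + h) + weight h))"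
  "0 <= K * weight x*kernel h"
  by (auto simp: K_def weight_nonneg kernel_nonneg)
 show ?thesis
 proof (cases "norm h <= 1")
  case True
  have "(rweight x - rweight (x + h))^2/norm h powr N2s <= K * weight x*(norm h)^2/norm h powr N2s"
   unfolding K_def by (intro divide_right_mono rweight_diff_near True) auto
  also have "... = K * weight x*kernel h" using True by (simp add: kernel_def min_def power_le_one)
  finally show ?thesis unfolding e energy_majorant_def K_def[symmetric] using nonneg by linarith
 next
  case False
  have "(rweight x - rweight (x + h))^2 <= 2 * weight x + 2 * weight (x + h)"
   using zero_le_power2[of "rweight x + rweight (x + h)"] by (simp add: power2_sum power2_diff rweight_power2)
  hence "(rweight x - rweight (x + h))^2*(1/norm h powr N2s) <= (2 * weight x + 2 * weight (x + h))*(2 powr N2s * weight h)"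
   using inverse_norm_powr_le_weight[of h] False weight_pos[of x] weight_pos[of "x + h"] by (intro mult_mono) auto
  also have "... = 2 powr N2s*2 * weight x * weight h + 2*2 powr N2s*(weight (x + h) * weight h)" by (simp add: algebra_simps)
  also have "... <= 2 powr N2s*2 * weight x * weight h + 2*2 powr N2s*(2 powr N2s * weight x*(weight (x + h) + weight h))"
   using weight_convolution[of x h] by (intro add_left_mono mult_left_mono) auto
  finally show ?thesis unfolding e energy_majorant_def K_def[symmetric] using nonneg by simp
 qed
qed

definition C_energy :: real where
 "C_energy = (N2s*2 powr (N2s/2 + 1))^2*(LINT h|L. kernel h) + 2 powr N2s*2*(LINT h|L. weight h) + 4*2 powr N2s*2 powr N2s*(LINT h|L. weight h)"

lemma C_energy_nonneg: "C_energy >= 0"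
 by (simp add: C_energy_def weight_nonneg kernel_nonneg)

lemma energy_majorant_integral: "integrable L (energy_majorant x)" "(LINT h|L. energy_majorant x h) = C_energy * weight x"
proof -
 have oi: "integrable L (%h. weight (x + h))" "(LINT h|L. weight (x + h)) = (LINT h|L. weight h)"
  using integral_lborel_shift[of weight x] weight_integrable by (auto simp: add.commute)
 have em: "energy_majorant x = (%h. (N2s*2 powr (N2s/2 + 1))^2 * weight x*kernel h + 2 powr N2s*2 * weight x * weight h
  + 2*2 powr N2s*(2 powr N2s * weight x*(weight (x + h) + weight h)))" by (simp add: energy_majorant_def fun_eq_iff)
 show "integrable L (energy_majorant x)"
  unfolding em by (intro Bochner_Integration.integrable_add integrable_mult_right kernel_integrable weight_integrable oi)
 have "(LINT h|L. energy_majorant x h) = (N2s*2 powr (N2s/2 + 1))^2 * weight x*(LINT h|L. kernel h) + 2 powr N2s*2 * weight x*(LINT h|L. weight h)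
  + 2*2 powr N2s*(2 powr N2s * weight x*((LINT h|L. weight (x + h)) + (LINT h|L. weight h)))"
  unfolding em
  by (subst Bochner_Integration.integral_add; (intro Bochner_Integration.integrable_add integrable_mult_right kernel_integrable weight_integrable oi)?)+
    (simp only: integral_mult_right_zero Bochner_Integration.integral_add[OF oi(1) weight_integrable])
 thus "(LINT h|L. energy_majorant x h) = C_energy * weight x" unfolding C_energy_def oi by (simp add: algebra_simps)
qed

lemma rweight_energy: "(\<integral>\<^sup>+y. ennreal ((dquot rweight (x, y))^2) \<partial>L) <= ennreal (C_energy * weight x)"
proof -
 have "(\<integral>\<^sup>+y. ennreal ((dquot rweight (x, y))^2) \<partial>L) = (\<integral>\<^sup>+h. ennreal ((dquot rweight (x, h + x))^2) \<partial>L)"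
  by (rule nn_integral_lborel_shift[symmetric, where f="%y. ennreal ((dquot rweight (x, y))^2)"]) (simp add: dquot_def)
 also have "... <= (\<integral>\<^sup>+h. ennreal (energy_majorant x h) \<partial>L)" using rweight_dquot_le[of x] by (intro nn_integral_mono ennreal_leI) (simp add: add.commute[of _ x])
 also have "... = ennreal (LINT h|L. energy_majorant x h)"
  using energy_majorant_integral(1) by (intro nn_integral_eq_integral AE_I2 order_trans[OF zero_le_power2 rweight_dquot_le])
 finally show ?thesis unfolding energy_majorant_integral(2) .
qed

lemma rweight_dquot_mult:
 assumes w: "w \<in> H"
 shows "integrable LL (%z. (w (fst z))^2*(dquot rweight z)^2)" "(LINT z|LL. (w (fst z))^2*(dquot rweight z)^2) <= C_energy*core_mass w"
proof -
 note [measurable] = H_meas[OF w]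
 have [measurable]: "dquot rweight \<in> borel_measurable LL" "fst \<in> LL \<rightarrow>\<^sub>M borel"
  using measurable_fst[of L L] by (auto simp: measurable_lborel1 intro!: dquot_measurable)
 have "(\<integral>\<^sup>+z. ennreal ((w (fst z))^2*(dquot rweight z)^2) \<partial>LL) = (\<integral>\<^sup>+x. \<integral>\<^sup>+y. ennreal ((w x)^2)*ennreal ((dquot rweight (x, y))^2) \<partial>L \<partial>L)"
  by (subst lborel.nn_integral_fst[symmetric]) (auto simp: ennreal_mult)
 also have "... = (\<integral>\<^sup>+x. ennreal ((w x)^2)*(\<integral>\<^sup>+y. ennreal ((dquot rweight (x, y))^2) \<partial>L) \<partial>L)"
  by (intro nn_integral_cong nn_integral_cmult) (simp add: dquot_def)
 also have "... <= (\<integral>\<^sup>+x. ennreal ((w x)^2)*ennreal (C_energy * weight x) \<partial>L)" by (intro nn_integral_mono mult_left_mono rweight_energy) auto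
 also have "... = (\<integral>\<^sup>+x. ennreal (C_energy*(weight x*(w x)^2)) \<partial>L)"
  using C_energy_nonneg by (intro nn_integral_cong) (simp add: ennreal_mult[symmetric] weight_nonneg mult_ac)
 also have "... = ennreal (C_energy*core_mass w)"
  unfolding core_mass_def using core_mass_integrable[OF w] C_energy_nonneg by (subst nn_integral_eq_integral) (auto simp: weight_nonneg)
 finally have nn_le: "(\<integral>\<^sup>+z. ennreal ((w (fst z))^2*(dquot rweight z)^2) \<partial>LL) <= ennreal (C_energy*core_mass w)" .
 thus i: "integrable LL (%z. (w (fst z))^2*(dquot rweight z)^2)"
  by (intro integrableI_nonneg) (auto simp: le_less_trans)
 have "0 <= core_mass w" by (simp add: core_mass_def weight_nonneg)
 moreover have "ennreal (LINT z|LL. (w (fst z))^2*(dquot rweight z)^2) <= ennreal (C_energy*core_mass w)"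
  using nn_le i by (simp add: nn_integral_eq_integral)
 ultimately show "(LINT z|LL. (w (fst z))^2*(dquot rweight z)^2) <= C_energy*core_mass w"
  using C_energy_nonneg by (simp add: ennreal_le_iff)
qed

lemma rweight_mult_H_of_L2:
 assumes g: "g \<in> H" and i: "L2 LL (%z. g (fst z)*dquot rweight z)"
 shows "(%x. rweight x*g x) \<in> H"
proof -
 note [measurable] = H_meas[OF g]
 have ab: "L2 LL (%z. abs (F z))" if "L2 LL F" for F using that borel_measurable_abs[of F LL] by (auto simp: L2_def)
 have "L2 LL (dquot (%x. rweight x*g x))"
 proof (rule L2_mono[OF L2_add[OF ab[OF H_dquot_L2[OF g]] ab[OF i]]])
  show "dquot (%x. rweight x*g x) \<in> borel_measurable LL" by (rule dquot_measurable) measurable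
  fix z
  have "dquot (%x. rweight x*g x) z = rweight (snd z)*dquot g z + g (fst z)*dquot rweight z" by (simp add: dquot_def add_divide_distrib[symmetric] algebra_simps)
  also have "abs (...) <= abs (rweight (snd z)*dquot g z) + abs (g (fst z)*dquot rweight z)" by (rule abs_triangle_ineq)
  also have "... <= abs (abs (dquot g z) + abs (g (fst z)*dquot rweight z))" using abs_rweight_mult_le[of "snd z" "dquot g z"] by simp
  finally show "abs (dquot (%x. rweight x*g x) z) <= abs (abs (dquot g z) + abs (g (fst z)*dquot rweight z))" .
 qed
 thus ?thesis using L2_rweight[OF H_L2[OF g]] by (simp add: H_iff)
qed

lemma rweight_mult_H: "w \<in> H ==> (%x. rweight x*w x) \<in> H"
 and weight_mult_H: "w \<in> H ==> (%x. weight x*w x) \<in> H"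
proof -
 assume w: "w \<in> H"
 note [measurable] = H_meas[OF w]
 have [measurable]: "dquot rweight \<in> borel_measurable LL" "fst \<in> LL \<rightarrow>\<^sub>M borel"
  using measurable_fst[of L L] by (auto simp: measurable_lborel1 intro!: dquot_measurable)
 have i: "L2 LL (%z. w (fst z)*dquot rweight z)" using rweight_dquot_mult(1)[OF w] by (simp add: L2_def power_mult_distrib)
 show r: "(%x. rweight x*w x) \<in> H" by (rule rweight_mult_H_of_L2[OF w i])
 have "L2 LL (%z. rweight (fst z)*w (fst z)*dquot rweight z)"
  using abs_rweight_mult_le by (intro L2_mono[OF i]) (auto simp: mult.assoc)
 from rweight_mult_H_of_L2[OF r this] show "(%x. weight x*w x) \<in> H" by (simp add: power2_eq_square mult.assoc flip: rweight_power2)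
qed

lemma dquot_power2_swap:
 assumes i: "integrable LL (%z. F (fst z)*(dquot g z)^2)"
 shows "integrable LL (%z. F (snd z)*(dquot g z)^2)" "(LINT z|LL. F (snd z)*(dquot g z)^2) = (LINT z|LL. F (fst z)*(dquot g z)^2)"
proof -
 have s: "(dquot g (y, x))^2 = (dquot g (x, y))^2" for x y
  by (simp add: dquot_def norm_minus_commute[of y x] power_divide power2_commute[of "g y" "g x"])
 have e: "(%(x, y). (%z. F (fst z)*(dquot g z)^2) (y, x)) = (%z. F (snd z)*(dquot g z)^2)"
  by (rule ext, clarify, simp only: split fst_conv snd_conv, subst s, rule refl)
 show "integrable LL (%z. F (snd z)*(dquot g z)^2)" using lborel_pair.integrable_product_swap[OF i] unfolding e .
 show "(LINT z|LL. F (snd z)*(dquot g z)^2) = (LINT z|LL. F (fst z)*(dquot g z)^2)"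
  using lborel_pair.integral_product_swap[of "%z. F (fst z)*(dquot g z)^2"] borel_measurable_integrable[OF i] unfolding e by simp
qed

lemma dquot_rweight_mult_power2_le:
 "(dquot (%x. rweight x*w x) z)^2 <= dquot w z*dquot (%x. weight x*w x) z
  + ((1/2)*((w (fst z))^2*(dquot rweight z)^2) + (1/2)*((w (snd z))^2*(dquot rweight z)^2))"
proof -
 obtain x y where z: "z = (x, y)" by fastforce
 let ?n = "norm (x - y) powr (N2s/2)*norm (x - y) powr (N2s/2)"
 have id: "(rweight x*w x - rweight y*w y)^2 = (w x - w y)*(weight x*w x - weight y*w y) + w x*w y*(rweight x - rweight y)^2"
  by (simp add: power2_eq_square algebra_simps flip: rweight_power2)
 have "w x*w y <= (1/2)*(w x)^2 + (1/2)*(w y)^2" using zero_le_power2[of "w x - w y"] by (simp add: power2_diff)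
 hence "w x*w y*(rweight x - rweight y)^2 <= ((1/2)*(w x)^2 + (1/2)*(w y)^2)*(rweight x - rweight y)^2" by (rule mult_right_mono) simp
 hence "(rweight x*w x - rweight y*w y)^2/?n <= ((w x - w y)*(weight x*w x - weight y*w y) + ((1/2)*(w x)^2 + (1/2)*(w y)^2)*(rweight x - rweight y)^2)/?n"
  unfolding id by (intro divide_right_mono) auto
 moreover have "dquot w z*dquot (%x. weight x*w x) z = (w x - w y)*(weight x*w x - weight y*w y)/?n" by (simp add: z dquot_def)
 moreover have "(dquot rweight z)^2 = (rweight x - rweight y)^2/?n" "(dquot (%x. rweight x*w x) z)^2 = (rweight x*w x - rweight y*w y)^2/?n"
  by (simp_all add: z dquot_def power_divide power2_eq_square[of "_ powr _"])
 ultimately show ?thesis by (simp add: z add_divide_distrib distrib_right)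
qed

lemma caccioppoli:
 assumes w: "w \<in> H"
 shows "(Hnorm (%x. rweight x*w x))^2 <= Hinner w (%x. weight x*w x) + C_energy*core_mass w"
proof -
 let ?E = "%x. rweight x*w x" and ?O = "%x. weight x*w x" and ?F = "%z. (w (fst z))^2*(dquot rweight z)^2"
 have i: "integrable LL (%z. dquot w z*dquot ?O z)" by (intro L2_mult_integrable H_dquot_L2 w weight_mult_H)
 note f = rweight_dquot_mult[OF w] and s = dquot_power2_swap[OF rweight_dquot_mult(1)[OF w]]
 have "(LINT z|LL. (dquot ?E z)^2) <= (LINT z|LL. dquot w z*dquot ?O z + ((1/2)*?F z + (1/2)*((w (snd z))^2*(dquot rweight z)^2)))"
  using i f(1) s(1) by (intro integral_mono L2D H_dquot_L2 rweight_mult_H w dquot_rweight_mult_power2_le) auto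
 also have "... = (LINT z|LL. dquot w z*dquot ?O z) + (LINT z|LL. ?F z)" using i f(1) s by simp
 also have "... <= (LINT z|LL. dquot w z*dquot ?O z) + C_energy*core_mass w" using f(2) by simp
 finally have "(LINT z|LL. (dquot ?E z)^2) <= (LINT z|LL. dquot w z*dquot ?O z) + C_energy*core_mass w" .
 moreover have "(LINT x|L. (?E x)^2) = (LINT x|L. w x*?O x)"
  by (simp add: power_mult_distrib rweight_power2) (simp add: power2_eq_square mult_ac)
 ultimately show ?thesis by (simp add: Hnorm_power2_eq Hinner_def)
qed

definition low_mass :: "real => 'n fn => real" where
 "low_mass r w = (LINT x|L. indicator {x. w x <= 1} x*(weight x*w x powr r))"

lemma low_mass_integrable:
 assumes "w \<in> borel_measurable borel" "!!x. w x > 0" "r >= 0"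
 shows "integrable L (%x. indicator {x. w x <= 1} x*(weight x*w x powr r))"
proof (rule integrable_boundI[OF weight_integrable])
 note [measurable] = assms(1)
 show "(%x. indicator {x. w x <= 1} x*(weight x*w x powr r)) \<in> borel_measurable L" by measurable
 show "abs (indicator {x. w x <= 1} x*(weight x*w x powr r)) <= weight x" for x
  using assms(2)[of x] assms(3) weight_nonneg[of x] by (auto simp: indicator_def abs_mult intro!: mult_right_le_one_le powr_le1)
qed

lemma low_mass_nonneg: "low_mass r w >= 0"
 by (simp add: low_mass_def weight_nonneg)

lemma low_mass_interpolation:
 assumes w: "w \<in> borel_measurable borel" "!!x. w x > 0" and r: "2 <= r" and l: "l > 0"
 shows "low_mass 2 w <= l^2*(LINT x|L. weight x) + l powr (2 - r)*low_mass r w"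
proof -
 let ?i = "%x. indicator {x. w x <= 1} x :: real"
 have ir: "integrable L (%x. ?i x*(weight x*w x powr r))" "integrable L (%x. ?i x*(weight x*w x powr 2))"
  using r by (auto intro!: low_mass_integrable w)
 have "low_mass 2 w <= (LINT x|L. l^2 * weight x + l powr (2 - r)*(?i x*(weight x*w x powr r)))"
  unfolding low_mass_def
 proof (rule integral_mono)
  fix x
  show "?i x*(weight x*w x powr 2) <= l^2 * weight x + l powr (2 - r)*(?i x*(weight x*w x powr r))"
  proof (cases "w x <= 1 & l < w x")
   case True
   have "w x powr 2 = w x powr (2 - r)*w x powr r" by (simp add: powr_add[symmetric])
   also have "... <= l powr (2 - r)*w x powr r" using True l r by (intro mult_right_mono powr_mono2') auto
   finally have "weight x*w x powr 2 <= weight x*(l powr (2 - r)*w x powr r)" using weight_nonneg by (intro mult_left_mono) auto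
   moreover have "0 <= l^2 * weight x" using weight_nonneg by simp
   ultimately show ?thesis using True by (simp add: mult_ac)
  next
   case False
   have "w x powr 2 <= l powr 2" if "w x <= l" using that w(2)[of x] by (intro powr_mono2) auto
   hence "?i x*(weight x*w x powr 2) <= l^2 * weight x"
    using False l weight_nonneg[of x] by (auto simp: indicator_def mult.commute powr_numeral intro!: mult_left_mono)
   moreover have "0 <= l powr (2 - r)*(?i x*(weight x*w x powr r))" using weight_nonneg by (auto simp: indicator_def)
   ultimately show ?thesis by linarith
  qed
 qed (use ir weight_integrable in auto)
 also have "... = l^2*(LINT x|L. weight x) + l powr (2 - r)*low_mass r w" using ir weight_integrable by (simp add: low_mass_def)
 finally show ?thesis .
qed

end

lemma powr_mult_power2_split:
 fixes w g k p :: real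
 assumes p: "p > 1" and w: "w >= 0" and k: "k > 0"
 shows "w powr (p - 1)*g^2 <= k powr (p - 1)*abs g powr (p + 1) + (1/k^2)*w powr (p + 1)"
proof (cases "w <= k*abs g")
 case True
 have "w powr (p - 1)*g^2 <= (k*abs g) powr (p - 1)*g^2" using True w p by (intro mult_right_mono powr_mono2) auto
 also have "... = k powr (p - 1)*abs g powr (p + 1)" using k by (simp add: powr_mult powr_Suc_eq_mult_power2)
 finally show ?thesis by (simp add: add_increasing2)
next
 case False
 have "abs g <= w/k" using False k by (simp add: field_simps)
 hence "(abs g)^2 <= (w/k)^2" by (intro power_mono) auto
 hence "w powr (p - 1)*g^2 <= w powr (p - 1)*(w/k)^2" by (intro mult_left_mono) auto
 also have "... = (1/k^2)*w powr (p + 1)" using w by (simp add: power_divide powr_Suc_eq_mult_power2)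
 finally show ?thesis by (simp add: add_increasing)
qed

lemma small_at_infinityE:
 fixes X :: "'a::real_normed_vector => real"
 assumes "!!y. filterlim (%n::nat. norm (y n)) at_top sequentially ==> (%n. X (y n)) ---> 0" "e > 0"
 obtains R where "!!y. norm y >= R ==> abs (X y) < e"
proof (rule ccontr)
 assume "~ thesis"
 hence "\<forall>n::nat. \<exists>y. norm y >= real n & ~ abs (X y) < e" using that by blast
 then obtain y where y: "!!n. norm (y n) >= real n" "!!n. ~ abs (X (y n)) < e" by metis
 have "escapes y"
  by (rule filterlim_at_top_mono[OF filterlim_real_sequentially]) (simp add: y)
 from tendstoD[OF assms(1)[OF this] assms(2)] y(2) show False by (auto simp: eventually_sequentially)
qed

context nonlinear
begin

lemma potential_term_small:
 assumes eta: "eta > 0"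
 obtains delta where "delta > 0" "!!w g S. w \<in> H ==> (!!x. w x >= 0) ==> g \<in> H ==> Hnorm g > 0 ==> S \<in> sets borel ==>
   (LINT x|L. indicator S x*w x powr (p + 1)) <= delta ==> (LINT x|L. indicator S x*(w x powr (p - 1)*(g x)^2)) <= eta*(Hnorm g)^2"
proof -
 define theta where "theta = (eta/(2*C_sob)) powr (1/(p - 1))"
 have theta: "theta > 0" "theta powr (p - 1)*C_sob = eta/2" using eta C_sob_pos p_gt_1 by (auto simp: theta_def powr_powr)
 have "(LINT x|L. indicator S x*(w x powr (p - 1)*(g x)^2)) <= eta*(Hnorm g)^2"
  if w: "w \<in> H" "!!x. w x >= 0" and g: "g \<in> H" "Hnorm g > 0" and S: "S \<in> sets borel" and d: "(LINT x|L. indicator S x*w x powr (p + 1)) <= eta*theta^2/2" for w g S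
 proof -
  note [measurable] = H_meas[OF w(1)] H_meas[OF g(1)] S
  define t where "t = Hnorm g"
  have t: "t > 0" using g by (simp add: t_def)
  define k where "k = theta/t"
  have k: "k > 0" using t theta by (simp add: k_def)
  let ?b = "%x. k powr (p - 1)*abs (g x) powr (p + 1) + (1/k^2)*(indicator S x*w x powr (p + 1))"
  have wi: "integrable L (%x. indicator S x*w x powr (p + 1))"
   by (rule integrable_boundI[OF powr_p1_integrable[OF w(1)]]) (auto simp: indicator_def w(2))
  have bi: "integrable L ?b" by (intro integrable_mult_right Bochner_Integration.integrable_add powr_p1_integrable g wi)
  have pt: "indicator S x*(w x powr (p - 1)*(g x)^2) <= ?b x" for x
   using powr_mult_power2_split[OF p_gt_1 w(2) k, of x "g x"] by (simp add: indicator_def)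
  have "(LINT x|L. indicator S x*(w x powr (p - 1)*(g x)^2)) <= (LINT x|L. ?b x)"
   by (rule integral_mono[OF integrable_boundI[OF bi] bi pt]) (use pt in \<open>auto simp: abs_mult\<close>)
  also have "... = k powr (p - 1)*(LINT x|L. abs (g x) powr (p + 1)) + (1/k^2)*(LINT x|L. indicator S x*w x powr (p + 1))"
   using powr_p1_integrable[OF g(1)] wi by (simp only: integral_mult_right_zero Bochner_Integration.integral_add integrable_mult_right)
  also have "... <= k powr (p - 1)*(C_sob*t powr (p + 1)) + (1/k^2)*(eta*theta^2/2)"
   using powr_p1_le[OF g(1)] d by (intro add_mono mult_left_mono) (auto simp: t_def)
  also have "... = (theta powr (p - 1)*C_sob)*t^2 + eta/2*t^2"
   using t theta(1) by (simp add: k_def powr_divide powr_Suc_eq_mult_power2 power_divide)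
  also have "... = eta*t^2" by (simp add: theta(2))
  finally show ?thesis by (simp add: t_def)
 qed
 thus thesis using eta theta by (intro that[of "eta*theta^2/2"]) auto
qed

lemma nonneg_pair_integrable:
 assumes "u \<in> H" "v \<in> H" "!!x. u x >= 0" "!!x. v x >= 0"
 shows "integrable L (%x. u x powr (p + 1))" "integrable L (%x. u x powr p * v x)" "integrable L (%x. excess p (u x) (v x))"
proof -
 have i: "integrable L (%x. g x powr (p + 1))" if "g \<in> H" "!!x. g x >= 0" for g using powr_p1_integrable[OF that(1)] that(2) by simp
 show "integrable L (%x. u x powr (p + 1))" using i assms by simp
 show m: "integrable L (%x. u x powr p * v x)"
  using product_le(1)[OF assms(1,2), of p 1] p_gt_1 assms(3,4) by simp
 show "integrable L (%x. excess p (u x) (v x))" unfolding excess_def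
  using i[OF H_add[OF assms(1,2)]] i[OF assms(1)] i[OF assms(2)] integrable_mult_right[OF m, of "p + 1"] assms
  by (auto simp: mult.assoc intro!: Bochner_Integration.integrable_diff)
qed

end

context setting
begin

definition gs_at :: "real^'n => 'n fn" where "gs_at y = (%x. gs (x - y))"

abbreviation add_gs :: "'n fn => real^'n => 'n fn" where "add_gs u y \<equiv> (%x. u x + gs_at y x)"

lemma gs_at_shift: "gs_at y = (%x. gs (x + (- y)))" by (simp add: gs_at_def)

lemma gs_at_pos: "gs_at y x > 0" by (simp add: gs_at_def gs_pos)

lemma gs_at_H: "gs_at y \<in> H" and Hnorm_gs_at: "Hnorm (gs_at y) = gs_norm"
 unfolding gs_at_shift using H_shift[OF gs_H, of "- y"] Hnorm_shift[OF gs_H, of "- y"] Hnorm_gs by (simp_all only:)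

lemma gs_at_meas[measurable]: "gs_at y \<in> borel_measurable borel" using H_meas gs_at_H by auto

lemma integral_gs_at:
 fixes F :: "real^'n => real => real"
 assumes "(%x. F x (gs_at y x)) \<in> borel_measurable borel"
 shows "(LINT x|L. F x (gs_at y x)) = (LINT x|L. F (x + y) (gs x))"
 using integral_lborel_shift(1)[OF assms, of y] by (simp add: gs_at_def)

lemma Hinner_gs_at: assumes "h \<in> H" shows "Hinner (gs_at y) h = Bform one (gs_at y) h"
proof -
 have k: "(%x. h (x + y)) \<in> H" using H_shift[OF assms] by auto
 have [measurable]: "h \<in> borel_measurable borel" using assms H_meas by auto
 have "Hinner (gs_at y) h = Hinner gs (%x. h (x + y))" using Hinner_shift[OF gs_H k, of "- y"] by (simp add: gs_at_def)
 also have "... = Bform one gs (%x. h (x + y))" using gs_crit[OF k] by (simp add: I_deriv_def)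
 also have "... = Bform one (gs_at y) h" unfolding Bform_def
  using integral_gs_at[of "%x t. 1*max t 0 powr p*h x" y] by simp
 finally show ?thesis .
qed

lemma Bint_one_gs_at: "Bint one (gs_at y) = gs_norm^2" using Hinner_gs_at[OF gs_at_H, of y y] by (simp add: Hnorm_power2[symmetric] Hnorm_gs_at Bform_self)

lemma gs_powr_integrable: "integrable L (%x. gs x powr (p + 1))" and gs_at_powr: "integrable L (%x. gs_at y x powr (p + 1))" "(LINT x|L. gs_at y x powr (p + 1)) = gs_norm^2"
 using powr_p1_integrable[OF gs_H] powr_p1_integrable[OF gs_at_H, of y] Bint_one_gs_at[of y] gs_pos gs_at_pos by (auto simp: less_imp_le Bint_def max_absorb1)

lemma gs_weighted_vanishes:
 fixes g :: "nat => 'n fn"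
 assumes [measurable]: "!!n. g n \<in> borel_measurable borel" and g: "!!n x. abs (g n x) <= 1" "!!x. (%n. g n x) ---> 0"
 shows "(%n. LINT x|L. g n x*gs x powr (p + 1)) ---> 0"
proof -
 note [measurable] = H_meas[OF gs_H]
 have "(%n. LINT x|L. g n x*gs x powr (p + 1)) ---> (LINT x|L. 0)"
 proof (rule integral_dominated_convergence[where w="%x. gs x powr (p + 1)"])
  show "AE x in L. (%n. g n x*gs x powr (p + 1)) ---> 0" using g(2) by (auto intro!: tendsto_mult_left_zero)
  show "AE x in L. norm (g n x*gs x powr (p + 1)) <= gs x powr (p + 1)" for n
   using g(1) by (auto simp: abs_mult intro!: mult_left_le_one_le)
 qed (auto simp: gs_powr_integrable)
 thus ?thesis by simp
qed

lemma weight_tendsto: assumes "escapes y" shows "(%n. weight (x + y n)) ---> 0"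
proof -
 have "filterlim (%n. - norm x + norm (y n)) at_top sequentially"
  using assms by (intro filterlim_tendsto_add_at_top[OF tendsto_const])
 hence "filterlim (%n. norm (x + y n)) at_top sequentially"
  by (rule filterlim_at_top_mono) (use norm_triangle_ineq4[of "x + y _" x] in \<open>auto simp: algebra_simps intro!: always_eventually\<close>)
 hence "filterlim (%n. 1 + norm (x + y n)) at_top sequentially" by (intro filterlim_tendsto_add_at_top[OF tendsto_const])
 thus ?thesis unfolding weight_def using N2s_pos by (intro tendsto_neg_powr) auto
qed

definition defect :: "real^'n => real" where "defect y = (LINT x|L. (1 - a x)*gs_at y x powr (p + 1))"
definition near_mass :: "real^'n => real" where "near_mass y = (LINT x|L. indicator {x. norm x < norm y/2} x*gs_at y x powr (p + 1))"

lemma a_meas[measurable]: "a \<in> borel_measurable borel" using a_coef by (simp add: coefficientD)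

lemma defect_vanishes: assumes "escapes y" shows "(%n. defect (y n)) ---> 0"
proof -
 obtain C where C: "!!x. 1 - a x <= C * weight x powr ((p + 1)/2)" using a_dec by blast
 have "(%n. LINT x|L. (1 - a (x + y n))*gs x powr (p + 1)) ---> 0"
 proof (rule gs_weighted_vanishes)
  show "abs (1 - a (x + y n)) <= 1" for n x using coefficientD(2,3)[OF a_coef, of "x + y n"] by simp
  show "(%n. 1 - a (x + y n)) ---> 0" for x
  proof (rule tendsto_sandwich[of "%_. 0" _ _ "%n. C * weight (x + y n) powr ((p + 1)/2)"])
   show "(%n. C * weight (x + y n) powr ((p + 1)/2)) ---> 0"
    using p_gt_1 weight_pos by (intro tendsto_mult_right_zero tendsto_zero_powrI[OF weight_tendsto[OF assms] tendsto_const]) (auto simp: less_imp_le)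
  qed (use C coefficientD(3)[OF a_coef] in auto)
 qed measurable
 moreover have "defect (y n) = (LINT x|L. (1 - a (x + y n))*gs x powr (p + 1))" for n
  unfolding defect_def using integral_gs_at[of "%x t. (1 - a x)*t powr (p + 1)" "y n"] by simp
 ultimately show ?thesis by simp
qed

lemma near_mass_vanishes: assumes "escapes y" shows "(%n. near_mass (y n)) ---> 0"
proof -
 have "(%n. LINT x|L. indicator {x. norm x < norm (y n)/2} (x + y n)*gs x powr (p + 1)) ---> 0"
 proof (rule gs_weighted_vanishes)
  show "(%n. indicator {x. norm x < norm (y n)/2} (x + y n) :: real) ---> 0" for x
  proof (rule tendsto_eventually)
   have "eventually (%n. norm (y n) >= 2*norm x) sequentially" using assms by (simp add: filterlim_at_top)
   thus "eventually (%n. indicator {x. norm x < norm (y n)/2} (x + y n) = (0::real)) sequentially"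
   proof eventually_elim
    case (elim n)
    thus ?case using norm_triangle_ineq4[of "x + y n" x] by (auto simp: indicator_def)
   qed
  qed
 qed (auto simp: indicator_def)
 moreover have "near_mass (y n) = (LINT x|L. indicator {x. norm x < norm (y n)/2} (x + y n)*gs x powr (p + 1))" for n
  unfolding near_mass_def using integral_gs_at[of "%x t. indicator {x. norm x < norm (y n)/2} x*t powr (p + 1)" "y n"] by simp
 ultimately show ?thesis by simp
qed

lemma gs_at_weighted_equation: "Hinner (gs_at y) (%x. weight x*gs_at y x) = (LINT x|L. weight x*gs_at y x powr (p + 1))"
 unfolding Hinner_gs_at[OF weight_mult_H[OF gs_at_H]] Bform_def
proof (intro Bochner_Integration.integral_cong refl)
 fix x show "1*max (gs_at y x) 0 powr p*(weight x*gs_at y x) = weight x*gs_at y x powr (p + 1)"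
  using gs_at_pos[of y x] powr_add[of "gs_at y x" p 1] by (simp add: max_def)
qed

abbreviation gs_weighted_norm :: "real^'n => real" where "gs_weighted_norm y \<equiv> Hnorm (%x. rweight x*gs_at y x)"

lemma Hnorm_rweight_gs_at_pos: "gs_weighted_norm y > 0"
proof (rule ccontr)
 assume "~ ?thesis"
 hence "AE x in L. rweight x*gs_at y x = 0" using Hnorm_eq_0_iff[OF rweight_mult_H[OF gs_at_H]] Hnorm_nonneg[of "%x. rweight x*gs_at y x"] by auto
 hence "AE x in L. False" by eventually_elim (use gs_at_pos rweight_pos in \<open>auto simp: less_le\<close>)
 thus False using L_not_null by simp
qed

text \<open>Near the origin the potential \<open>gs_at y x powr (p - 1)\<close> is small, since the translate has moved away;
  elsewhere the weight is comparable with \<open>weight y\<close>.\<close>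
lemma gs_at_weighted_powr_le:
 assumes eta: "eta > 0"
 obtains R where "!!y. norm y >= R ==>
  (LINT x|L. weight x*gs_at y x powr (p + 1)) <= eta*(gs_weighted_norm y)^2 + 2 powr N2s * weight y*gs_norm^2"
proof -
 obtain delta where delta: "delta > 0" "!!w g S. w \<in> H ==> (!!x. w x >= 0) ==> g \<in> H ==> Hnorm g > 0 ==> S \<in> sets borel ==>
   (LINT x|L. indicator S x*w x powr (p + 1)) <= delta ==> (LINT x|L. indicator S x*(w x powr (p - 1)*(g x)^2)) <= eta*(Hnorm g)^2"
  by (rule potential_term_small[OF eta]) blast
 obtain R where R: "!!y. norm y >= R ==> abs (near_mass y) < delta" using small_at_infinityE[of near_mass delta] near_mass_vanishes delta by blast
 show thesis
 proof (rule that)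
  fix y :: "real^'n" assume y: "norm y >= R"
  define w where "w = gs_at y"
  have w: "w \<in> H" "w x > 0" "integrable L (%x. w x powr (p + 1))" "(LINT x|L. w x powr (p + 1)) = gs_norm^2" for x
   using gs_at_H gs_at_pos gs_at_powr by (auto simp: w_def)
  note [measurable] = H_meas[OF w(1)]
  let ?i = "indicator {x. norm x < norm y/2} :: real^'n => real" and ?E = "(Hnorm (%x. rweight x*w x))^2"
  have Zi: "integrable L (%x. weight x*w x powr (p + 1))" by (rule weight_mult_integrable[OF w(3)])
  have Ai: "integrable L (%x. ?i x*(weight x*w x powr (p + 1)))" by (rule integrable_boundI[OF Zi]) (auto simp: indicator_def weight_nonneg)
  have "w x powr (p - 1)*(rweight x*w x)^2 = weight x*w x powr (p + 1)" for x
   using w(2)[of x] by (simp add: power_mult_distrib rweight_power2 powr_Suc_eq_mult_power2)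
  moreover have "(LINT x|L. ?i x*(w x powr (p - 1)*(rweight x*w x)^2)) <= eta*?E"
   using R[OF y] w(2) Hnorm_rweight_gs_at_pos[of y]
   by (intro delta(2) rweight_mult_H w(1)) (auto simp: near_mass_def w_def abs_less_iff less_imp_le)
  ultimately have near: "(LINT x|L. ?i x*(weight x*w x powr (p + 1))) <= eta*?E" by simp
  have "(LINT x|L. weight x*w x powr (p + 1)) <= (LINT x|L. ?i x*(weight x*w x powr (p + 1)) + (2 powr N2s * weight y)*w x powr (p + 1))"
  proof (intro integral_mono Zi)
   show "weight x*w x powr (p + 1) <= ?i x*(weight x*w x powr (p + 1)) + (2 powr N2s * weight y)*w x powr (p + 1)" for x
    using weight_comparable[of y 2 x] weight_nonneg[of y] by (cases "norm x < norm y/2") (auto simp: mult_right_mono)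
  qed (use Ai w in auto)
  also have "... = (LINT x|L. ?i x*(weight x*w x powr (p + 1))) + (2 powr N2s * weight y)*gs_norm^2" using Ai w by simp
  finally show "(LINT x|L. weight x*gs_at y x powr (p + 1)) <= eta*(gs_weighted_norm y)^2 + 2 powr N2s * weight y*gs_norm^2"
   using near by (simp add: w_def)
 qed
qed

lemma core_mass_gs_at_le: "core_mass (gs_at y) <= low_mass 2 (gs_at y) + (LINT x|L. weight x*gs_at y x powr (p + 1))"
proof -
 define w where "w = gs_at y"
 have w: "w \<in> H" "!!x. w x > 0" "integrable L (%x. weight x*w x powr (p + 1))"
  using gs_at_H gs_at_pos weight_mult_integrable[OF gs_at_powr(1)] by (auto simp: w_def)
 have i: "integrable L (%x. indicator {x. w x <= 1} x*(weight x*w x powr 2))" by (rule low_mass_integrable[OF H_meas[OF w(1)] w(2)]) simp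
 have "core_mass w <= (LINT x|L. indicator {x. w x <= 1} x*(weight x*w x powr 2) + weight x*w x powr (p + 1))"
  unfolding core_mass_def
 proof (intro integral_mono core_mass_integrable w(1) Bochner_Integration.integrable_add i w(3))
  fix x
  show "weight x*(w x)^2 <= indicator {x. w x <= 1} x*(weight x*w x powr 2) + weight x*w x powr (p + 1)"
  proof (cases "w x <= 1")
   case True
   thus ?thesis using weight_nonneg[of x] w(2)[of x] by (simp add: powr_numeral)
  next
   case False
   have "w x powr 2 <= w x powr (p + 1)" using False p_gt_1 by (intro powr_mono) auto
   thus ?thesis using False weight_nonneg[of x] w(2)[of x] by (simp add: powr_numeral mult_left_mono)
  qed
 qed
 also have "... = low_mass 2 w + (LINT x|L. weight x*w x powr (p + 1))" using i w(3) by (simp add: low_mass_def)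
 finally show ?thesis by (simp add: w_def)
qed

lemma weighted_energy_gs_at:
 obtains C R where "C > 0" "!!y. norm y >= R ==> (gs_weighted_norm y)^2 <= C*(weight y + low_mass 2 (gs_at y))"
proof -
 define c where "c = C_energy"
 define G where "G = 2 powr N2s*gs_norm^2"
 have c: "c >= 0" and G: "G >= 0" using C_energy_nonneg by (auto simp: c_def G_def)
 obtain R where R: "!!y. norm y >= R ==>
  (LINT x|L. weight x*gs_at y x powr (p + 1)) <= 1/(2*(1 + c))*(gs_weighted_norm y)^2 + 2 powr N2s * weight y*gs_norm^2"
  using gs_at_weighted_powr_le[of "1/(2*(1 + c))"] c by auto
 show thesis
 proof (rule that)
  show "2*((1 + c)*(G + 1)) > 0" using c G by simp
  fix y :: "real^'n" assume y: "norm y >= R"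
  define E where "E = (gs_weighted_norm y)^2"
  define Z where "Z = (LINT x|L. weight x*gs_at y x powr (p + 1))"
  define l where "l = low_mass 2 (gs_at y)"
  have l: "l >= 0" "weight y >= 0" by (auto simp: l_def low_mass_nonneg weight_nonneg)
  have "E <= Z + c*core_mass (gs_at y)" using caccioppoli[OF gs_at_H] by (simp add: E_def Z_def c_def gs_at_weighted_equation)
  also have "... <= Z + c*(l + Z)" using core_mass_gs_at_le[of y] c by (intro add_left_mono mult_left_mono) (auto simp: l_def Z_def)
  also have "... = (1 + c)*Z + c*l" by (simp add: algebra_simps)
  also have "... <= (1 + c)*(1/(2*(1 + c))*E + G * weight y) + c*l"
   using R[OF y] c by (intro add_right_mono mult_left_mono) (auto simp: Z_def E_def G_def mult_ac)
  also have "... = E/2 + ((1 + c)*(G * weight y) + c*l)"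
  proof -
   have "(1 + c)*(1/(2*(1 + c))) = 1/2" using c by (simp add: divide_simps)
   from arg_cong[OF this, of "%t. t*E"] have "(1 + c)*(1/(2*(1 + c))*E) = E/2" by (simp only: mult.assoc)
   thus ?thesis by (simp only: distrib_left add.assoc)
  qed
  finally have "E <= E/2 + ((1 + c)*(G * weight y) + c*l)" .
  hence "E <= 2*((1 + c)*(G * weight y) + c*l)" by argo
  also have "(1 + c)*(G * weight y) + c*l <= (1 + c)*((G + 1) * weight y) + (1 + c)*((G + 1)*l)"
  proof (intro add_mono mult_left_mono mult_right_mono)
   have "c*l <= (1 + c)*l" using l by (intro mult_right_mono) auto
   also have "... <= (1 + c)*((G + 1)*l)" using c G l by (intro mult_left_mono) (auto simp: distrib_right)
   finally show "c*l <= (1 + c)*((G + 1)*l)" .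
  qed (use c l in auto)
  finally show "(gs_weighted_norm y)^2 <= 2*((1 + c)*(G + 1))*(weight y + low_mass 2 (gs_at y))"
   by (simp add: E_def l_def algebra_simps)
 qed
qed

definition interaction :: "'n fn => real^'n => real" where "interaction u y = (LINT x|L. a x*excess p (u x) (gs_at y x))"

lemma a_integrable: "integrable L g ==> integrable L (%x. a x*g x)" for g :: "'n fn"
 by (rule integrable_boundI[where g="%x. abs (g x)"]) (auto simp: abs_mult coefficientD[OF a_coef] intro!: mult_left_le_one_le)

lemma defect_integrable: "integrable L (%x. (1 - a x)*gs_at y x powr (p + 1))"
 using a_integrable[OF gs_at_powr(1)] gs_at_powr(1) by (simp add: left_diff_distrib)

lemma interaction_integrable: assumes "u \<in> H" "!!x. u x >= 0" shows "integrable L (%x. a x*excess p (u x) (gs_at y x))"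
 using assms gs_at_H[of y] gs_at_pos[of y] by (intro a_integrable nonneg_pair_integrable) (auto simp: less_imp_le)

lemma interaction_ge:
 assumes u: "u \<in> H" "!!x. u x >= 0" "AE x in L. u x >= eps * weight x" and eps: "eps > 0"
  and ca: "ca > 0" "!!x. ca <= a x"
  and q: "q \<in> borel_measurable borel" "!!x. 0 <= q x" "!!x. q x <= excess p (eps * weight x) (gs_at y x)"
 shows "ca*(LINT x|L. q x) <= interaction u y"
proof -
 have i: "AE x in L. ca*q x <= a x*excess p (u x) (gs_at y x)" using u(3)
 proof eventually_elim
  case (elim x)
  have "q x <= excess p (u x) (gs_at y x)"
   using q(3)[of x] excess_mono[OF p_gt_1, of "eps * weight x" "u x" "gs_at y x"] elim eps weight_pos[of x] gs_at_pos[of y x] by (simp add: less_imp_le)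
  thus ?case using ca q(2)[of x] coefficientD(2)[OF a_coef, of x] by (intro mult_mono) auto
 qed
 have qi: "integrable L (%x. ca*q x)"
  using i ca q(1,2) by (intro Bochner_Integration.integrable_bound[OF interaction_integrable[OF u(1,2), of y]]) (auto elim!: eventually_mono)
 have "(LINT x|L. ca*q x) <= interaction u y" unfolding interaction_def by (intro integral_mono_AE qi interaction_integrable u i)
 thus ?thesis by simp
qed

lemma integral_pos_of_pos:
 fixes g :: "'n fn"
 assumes "integrable L g" "!!x. g x > 0" shows "(LINT z|L. g z) > 0"
proof -
 have "(LINT z|L. g z) ~= 0"
 proof
  assume "(LINT z|L. g z) = 0"
  hence "AE z in L. g z = 0" using assms by (subst (asm) integral_nonneg_eq_0_iff_AE) (auto simp: less_imp_le)
  hence "AE z in L. False" by eventually_elim (use assms(2) in \<open>auto simp: less_le\<close>)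
  thus False using L_not_null by simp
 qed
 moreover have "(LINT z|L. g z) >= 0" using assms(2) by (simp add: less_imp_le)
 ultimately show ?thesis by simp
qed

lemma interaction_ge_weight:
 assumes u: "u \<in> H" "!!x. u x >= 0" "AE x in L. u x >= eps * weight x" and eps: "eps > 0"
 obtains c where "c > 0" "!!y. c * weight y <= interaction u y"
proof -
 obtain ca where ca: "ca > 0" "!!x. ca <= a x" using a_low by blast
 note [measurable] = H_meas[OF gs_H]
 define g where "g = (%z. min (eps * weight z*gs z powr p) (gs z powr (p + 1)))"
 have gm[measurable]: "g \<in> borel_measurable borel" unfolding g_def by measurable
 have gp: "g z > 0" for z using eps weight_pos[of z] gs_pos[of z] by (simp add: g_def)
 have "abs (g x) <= gs x powr (p + 1)" for x using gp[of x] by (simp add: g_def)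
 hence gI: "(LINT z|L. g z) > 0" by (intro integral_pos_of_pos gp integrable_boundI[OF gs_powr_integrable]) auto
 have "ca*excess_const p*(LINT z|L. g z) * weight y <= interaction u y" for y
 proof -
  have "ca*(LINT x|L. excess_const p*(weight y*g (x - y))) <= interaction u y"
  proof (rule interaction_ge[OF u eps ca])
   fix x
   have "weight (x - y) <= (1 + norm y) powr N2s * weight (x - y + y)" by (rule weight_shift)
   moreover have "(1 + norm y) powr N2s > 0" using norm_ge_zero[of y] by (simp add: add_nonneg_eq_0_iff)
   ultimately have os: "weight y * weight (x - y) <= weight x" by (simp add: weight_def[of y] powr_minus_divide divide_le_eq mult.commute)
   have "excess_const p*(weight y*g (x - y)) <= excess p (weight y*(eps * weight (x - y))) (gs_at y x)"
    using excess_ge_scaled_min[OF p_gt_1 weight_pos weight_le_1, of "eps * weight (x - y)" "gs_at y x" y] eps weight_pos[of "x - y"] gs_at_pos[of y x]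
    by (simp add: g_def gs_at_def)
   also have "... <= excess p (eps * weight x) (gs_at y x)"
    using os eps weight_pos gs_at_pos[of y x] by (intro excess_mono p_gt_1) (auto simp: less_imp_le mult.left_commute[of "weight y"])
   finally show "excess_const p*(weight y*g (x - y)) <= excess p (eps * weight x) (gs_at y x)" .
   show "0 <= excess_const p*(weight y*g (x - y))" using excess_const_pos[OF p_gt_1] weight_nonneg[of y] gp[of "x - y"] by simp
  qed measurable
  also have "(LINT x|L. excess_const p*(weight y*g (x - y))) = excess_const p*(weight y*(LINT z|L. g z))"
   using integral_lborel_shift(1)[of g "- y"] gm by simp
  finally show ?thesis by (simp add: mult_ac)
 qed
 thus thesis using ca excess_const_pos[OF p_gt_1] gI by (intro that[of "ca*excess_const p*(LINT z|L. g z)"]) auto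
qed

lemma interaction_ge_low_mass:
 assumes u: "u \<in> H" "!!x. u x >= 0" "AE x in L. u x >= eps * weight x" and eps: "eps > 0"
 obtains c where "c > 0" "!!y. c*low_mass (max 2 p) (gs_at y) <= interaction u y"
proof -
 obtain ca where ca: "ca > 0" "!!x. ca <= a x" using a_low by blast
 define k where "k = excess_const p*min eps (eps powr (p - 1))"
 have k: "k > 0" using excess_const_pos[OF p_gt_1] eps by (simp add: k_def)
 have "ca*k*low_mass (max 2 p) (gs_at y) <= interaction u y" for y
 proof -
  have "ca*(LINT x|L. k*(indicator {x. gs_at y x <= 1} x*(weight x*gs_at y x powr (max 2 p)))) <= interaction u y"
  proof (rule interaction_ge[OF u eps ca])
   show "k*(indicator {x. gs_at y x <= 1} x*(weight x*gs_at y x powr (max 2 p))) <= excess p (eps * weight x) (gs_at y x)" for x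
    using excess_ge_low[OF p_gt_1 eps weight_pos weight_le_1 gs_at_pos, of y x x] excess_nonneg[OF p_gt_1, of "eps * weight x" "gs_at y x"]
     eps weight_nonneg[of x] gs_at_pos[of y x] by (simp add: indicator_def k_def mult.assoc)
   show "0 <= k*(indicator {x. gs_at y x <= 1} x*(weight x*gs_at y x powr (max 2 p)))" for x using k weight_nonneg[of x] by simp
  qed measurable
  thus ?thesis by (simp add: low_mass_def mult_ac)
 qed
 thus thesis using ca k by (intro that[of "ca*k"]) auto
qed

lemma low_mass_2_le:
 assumes r: "r >= 2" and c: "c > 0" "c*low_mass r (gs_at y) <= X" and X: "X > 0"
 shows "low_mass 2 (gs_at y) <= ((LINT x|L. weight x) + 1/c)*X powr (2/r)"
proof -
 define l where "l = X powr (1/r)"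
 have l: "l > 0" using X by (simp add: l_def)
 have "l powr 2 = X powr (2/r)" by (simp add: l_def powr_powr)
 hence l2: "l^2 = X powr (2/r)" using l by (simp add: powr_numeral)
 have "l powr (2 - r)*X powr 1 = X powr (2/r)" unfolding l_def powr_powr powr_add[symmetric] using r by (simp add: field_simps)
 hence lX: "l powr (2 - r)*X = X powr (2/r)" using X by simp
 have "low_mass 2 (gs_at y) <= l^2*(LINT x|L. weight x) + l powr (2 - r)*low_mass r (gs_at y)"
  by (rule low_mass_interpolation[OF gs_at_meas gs_at_pos r l])
 also have "... <= l^2*(LINT x|L. weight x) + l powr (2 - r)*(X/c)" using c by (intro add_left_mono mult_left_mono) (auto simp: field_simps)
 also have "... = ((LINT x|L. weight x) + 1/c)*X powr (2/r)" using l2 lX by (simp add: field_simps)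
 finally show ?thesis .
qed

lemma weighted_energy_le_interaction:
 assumes u: "u \<in> H" "!!x. u x >= 0" "AE x in L. u x >= eps * weight x" and eps: "eps > 0"
 obtains K R where "K > 0" "!!y. interaction u y > 0"
  "!!y. norm y >= R ==> interaction u y <= 1 ==> (gs_weighted_norm y)^2 <= K*interaction u y powr (2/max 2 p)"
proof -
 define r where "r = max 2 p"
 have r: "r >= 2" by (simp add: r_def)
 obtain c1 where c1: "c1 > 0" "!!y. c1 * weight y <= interaction u y" by (rule interaction_ge_weight[OF u eps]) blast
 obtain c2 where c2: "c2 > 0" "!!y. c2*low_mass r (gs_at y) <= interaction u y"
  by (rule interaction_ge_low_mass[OF u eps, folded r_def]) blast
 obtain C R where C: "C > 0" "!!y. norm y >= R ==> (gs_weighted_norm y)^2 <= C*(weight y + low_mass 2 (gs_at y))"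
  by (rule weighted_energy_gs_at) blast
 define M where "M = (LINT x|L. weight x)"
 have M: "M >= 0" by (simp add: M_def weight_nonneg)
 show thesis
 proof (rule that)
  show "C*(1/c1 + (M + 1/c2)) > 0" using C c1 c2 M by (simp add: add_pos_nonneg)
  fix y
  define X where "X = interaction u y"
  have "c1 * weight y > 0" using c1(1) weight_pos by simp
  hence X: "X > 0" using c1(2)[of y] by (simp add: X_def)
  thus "interaction u y > 0" by (simp add: X_def)
  assume y: "norm y >= R" and "interaction u y <= 1"
  hence X1: "X <= 1" by (simp add: X_def)
  have low: "low_mass 2 (gs_at y) <= (M + 1/c2)*X powr (2/r)"
   unfolding M_def using c2(1) c2(2)[of y] X by (intro low_mass_2_le[OF r]) (auto simp: X_def)
  have "X powr 1 <= X powr (2/r)" using X X1 r by (intro powr_mono') auto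
  hence "weight y <= (1/c1)*X powr (2/r)" using c1(1) c1(2)[of y] X by (simp add: X_def field_simps)
  hence "C*(weight y + low_mass 2 (gs_at y)) <= C*((1/c1)*X powr (2/r) + (M + 1/c2)*X powr (2/r))"
   using low C(1) by (intro mult_left_mono add_mono) auto
  also have "... = C*(1/c1 + (M + 1/c2))*X powr (2/r)" by (simp add: algebra_simps)
  finally show "(gs_weighted_norm y)^2 <= C*(1/c1 + (M + 1/c2))*interaction u y powr (2/max 2 p)"
   using C(2)[OF y] by (simp add: X_def r_def)
 qed
qed

lemma defect_le_weighted_energy:
 obtains G where "G >= 0" "!!y. defect y <= G*((gs_weighted_norm y)^2) powr ((p + 1)/2)"
proof -
 obtain D0 where D0: "!!x. 1 - a x <= D0 * weight x powr ((p + 1)/2)" using a_dec by blast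
 define D where "D = max D0 0"
 have D: "D >= 0" by (simp add: D_def)
 have "defect y <= (D*C_sob)*((gs_weighted_norm y)^2) powr ((p + 1)/2)" for y
 proof -
  note rH = rweight_mult_H[OF gs_at_H, of y]
  have pw: "weight x powr ((p + 1)/2)*gs_at y x powr (p + 1) = abs (rweight x*gs_at y x) powr (p + 1)" for x
   using gs_at_pos[of y x] rweight_pos[of x] by (simp add: rweight_power2[symmetric] powr_eq_power2_powr[of "rweight x" "p + 1"] powr_mult abs_mult)
  have "defect y <= (LINT x|L. D*abs (rweight x*gs_at y x) powr (p + 1))"
   unfolding defect_def
  proof (rule integral_mono)
   fix x
   have "1 - a x <= D * weight x powr ((p + 1)/2)" using D0[of x] by (rule order_trans) (auto simp: D_def intro!: mult_right_mono)
   hence "(1 - a x)*gs_at y x powr (p + 1) <= D * weight x powr ((p + 1)/2)*gs_at y x powr (p + 1)" by (intro mult_right_mono) auto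
   thus "(1 - a x)*gs_at y x powr (p + 1) <= D*abs (rweight x*gs_at y x) powr (p + 1)" unfolding pw[symmetric] by (simp add: mult.assoc)
   show "integrable L (%x. (1 - a x)*gs_at y x powr (p + 1))" by (rule defect_integrable)
  qed (use powr_p1_integrable[OF rH] in auto)
  also have "... = D*(LINT x|L. abs (rweight x*gs_at y x) powr (p + 1))" by simp
  also have "... <= D*(C_sob*gs_weighted_norm y powr (p + 1))" using powr_p1_le[OF rH] D by (intro mult_left_mono)
  finally show ?thesis using powr_eq_power2_powr[OF Hnorm_nonneg, of "%x. rweight x*gs_at y x" "p + 1"] by simp
 qed
 thus thesis using D C_sob_pos by (intro that[of "D*C_sob"]) auto
qed

lemma interaction_dominates:
 assumes u: "u \<in> H" "!!x. u x >= 0" "AE x in L. u x >= eps * weight x" and eps: "eps > 0"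
 obtains R where "!!y. norm y >= R ==> interaction u y > 0 & defect y <= interaction u y/2"
proof -
 define r where "r = max 2 p"
 define q where "q = (p + 1)/r - 1"
 have r: "r >= 2" "r < p + 1" using p_gt_1 by (auto simp: r_def)
 have q: "q > 0" using r by (simp add: q_def)
 obtain K R where K: "K > 0" "!!y. interaction u y > 0"
  "!!y. norm y >= R ==> interaction u y <= 1 ==> (gs_weighted_norm y)^2 <= K*interaction u y powr (2/r)"
  by (rule weighted_energy_le_interaction[OF u eps, folded r_def]) blast
 obtain G0 where G0: "G0 >= 0" "!!y. defect y <= G0*((gs_weighted_norm y)^2) powr ((p + 1)/2)" by (rule defect_le_weighted_energy) blast
 define G where "G = G0*K powr ((p + 1)/2)"
 have G: "G >= 0" using G0 by (simp add: G_def)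
 define delta where "delta = min 1 ((1/(2*(G + 1))) powr (1/q))"
 have delta: "delta > 0" "delta <= 1" using G by (auto simp: delta_def)
 obtain R2 where R2: "!!y. norm y >= R2 ==> abs (defect y) < delta/2"
  by (rule small_at_infinityE[of defect "delta/2", OF defect_vanishes]) (use delta in auto)
 have "defect y <= interaction u y/2" if y: "norm y >= max R R2" for y
 proof (cases "interaction u y <= delta")
  case False
  thus ?thesis using R2[of y] y by (simp add: abs_less_iff)
 next
  case True
  define X where "X = interaction u y"
  have X: "X > 0" "X <= delta" "X <= 1" using K(2)[of y] True delta by (auto simp: X_def)
  have "defect y <= G0*(K*X powr (2/r)) powr ((p + 1)/2)"
   using K(3)[of y] y X(3) G0 p_gt_1 by (intro order_trans[OF G0(2) mult_left_mono] powr_mono2) (auto simp: X_def)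
  also have "... = G0*(K powr ((p + 1)/2)*X powr (q + 1))"
  proof -
   have "2/r*((p + 1)/2) = q + 1" using r by (simp add: q_def field_simps)
   thus ?thesis using K(1) X by (simp only: powr_mult powr_powr)
  qed
  also have "... = G*X powr (q + 1)" by (simp add: G_def)
  also have "... <= X/2" using X by (intro mult_powr_Suc_le_half[OF G q]) (auto simp: delta_def)
  finally show ?thesis by (simp add: X_def)
 qed
 thus thesis using that[of "max R R2"] K(2) by blast
qed

end

lemma powr_mult_le_swap:
 fixes x y p :: real assumes "p > 1" "0 <= x" "x <= y" shows "x powr p*y <= y powr p*x"
proof -
 have s: "r powr p*q = r powr (p - 1)*(r*q)" if "r >= 0" for r q :: real using powr_mult_base[OF that, of "p - 1"] by (simp add: mult_ac)
 have "x powr (p - 1)*(x*y) <= y powr (p - 1)*(x*y)" using assms by (intro mult_right_mono powr_mono2) auto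
 thus ?thesis using assms by (simp add: s mult.commute[of y x])
qed

definition split_bound :: "real => real => real => real => real" where
 "split_bound p l A B = 1/excess_const p*(1 + l)*excess p A B + A powr (p + 1)/l"

lemma excess_split:
 assumes p: "p > 1" and A: "A >= 0" and B: "B >= 0" and l: "l > 0"
 shows "A powr p*B <= split_bound p l A B" "B powr p*A <= split_bound p l A B"
proof -
 define c where "c = excess_const p"
 have c: "c > 0" using excess_const_pos[OF p] by (simp add: c_def)
 have G: "excess p A B >= 0" by (rule excess_nonneg[OF p A B])
 have sb: "split_bound p l A B = 1/c*(1 + l)*excess p A B + A powr (p + 1)/l" by (simp add: split_bound_def c_def)
 have "A powr p*B <= split_bound p l A B & B powr p*A <= split_bound p l A B"
 proof (cases "A <= B")
  case True
  have "B powr p*A <= (1/c)*excess p A B" using c excess_lower(1)[OF p A True] by (simp add: c_def field_simps)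
  also have "... <= 1/c*(1 + l)*excess p A B" using G c l by (intro mult_right_mono) (auto simp: divide_right_mono)
  also have "... <= 1/c*(1 + l)*excess p A B + A powr (p + 1)/l" using l by simp
  finally show ?thesis using powr_mult_le_swap[OF p A True] sb by linarith
 next
  case False
  have "0 <= (l*B - A)^2/l" using l by simp
  also have "... = l*B^2 - 2*(A*B) + A^2/l" using l by (simp add: power2_eq_square field_simps)
  finally have "A*B <= l*B^2 + A^2/l" using mult_nonneg_nonneg[OF A B] by linarith
  hence "A powr (p - 1)*(A*B) <= A powr (p - 1)*(l*B^2 + A^2/l)" by (rule mult_left_mono) simp
  also have "A powr (p - 1)*(A*B) = A powr p*B" using powr_mult_base[OF A, of "p - 1"] by (simp add: mult_ac)
  also have "A powr (p - 1)*(l*B^2 + A^2/l) = l*(A powr (p - 1)*B^2) + A powr (p + 1)/l" using A by (simp add: powr_Suc_eq_mult_power2 distrib_left)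
  also have "l*(A powr (p - 1)*B^2) <= l*((1/c)*excess p A B)"
   using c excess_lower(2)[OF p B] False l by (intro mult_left_mono) (auto simp: c_def field_simps)
  also have "... <= 1/c*(1 + l)*excess p A B" using G c by (simp add: field_simps)
  finally have "A powr p*B <= 1/c*(1 + l)*excess p A B + A powr (p + 1)/l" by simp
  thus ?thesis using powr_mult_le_swap[OF p B, of A] False sb by linarith
 qed
 thus "A powr p*B <= split_bound p l A B" "B powr p*A <= split_bound p l A B" by auto
qed

context setting
begin

lemma critical_nonneg:
 assumes "f \<in> Hdual" "nonneg_dual s f" "u \<in> H" "stationary f u"
 shows "AE x in L. u x = max (u x) 0"
proof -
 let ?h = "pos_part (%x. - u x)"
 have h: "?h \<in> H" using H_pos_part[OF H_minus[OF assms(3)]] .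
 have "Bform a u ?h = (LINT x|L. 0)" unfolding Bform_def by (intro Bochner_Integration.integral_cong refl) (auto simp: max_def)
 hence "Hinner u ?h = f ?h" using assms(4)[rule_format, OF h] by (simp add: I_deriv_def)
 moreover have "f ?h >= 0" using assms(2) h by (simp add: nonneg_dual_def)
 moreover have "- Hinner u ?h >= (Hnorm ?h)^2" using Hinner_pos_part_ge[OF H_minus[OF assms(3)]] Hinner_scale_left[of "-1" u ?h] by simp
 ultimately have "(Hnorm ?h)^2 <= 0" by linarith
 hence "AE x in L. ?h x = 0" using Hnorm_eq_0_iff[OF h] by simp
 thus ?thesis by eventually_elim (auto simp: max_def split: if_splits)
qed

lemma critical_pos_part:
 assumes "f \<in> Hdual" "u \<in> H" "AE x in L. u x = max (u x) 0"
 shows "h \<in> H ==> I_deriv a f (pos_part u) h = I_deriv a f u h" "I f (pos_part u) = I f u" "Hnorm (pos_part u) = Hnorm u"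
proof -
 have m: "pos_part u \<in> borel_measurable borel" using H_meas H_pos_part assms by auto
 show h: "Hnorm (pos_part u) = Hnorm u" using Hnorm_AE_cong[OF assms(2) m assms(3)] by simp
 show "h \<in> H ==> I_deriv a f (pos_part u) h = I_deriv a f u h" using Hinner_AE_cong[OF assms(2) m assms(3)] by (simp add: I_deriv_def Bform_def)
 have "f (pos_part u) = f u" using dual_AE_cong[OF assms(1,2) H_pos_part[OF assms(2)] assms(3)] by simp
 thus "I f (pos_part u) = I f u" by (simp add: Ifun_eq h Bint_def)
qed

lemma critical_energy:
 assumes "f \<in> Hdual" "u \<in> H" "stationary f u"
 shows "Bint a u = (Hnorm u)^2 - f u" "I f u = kappa*(Hnorm u)^2 - p/(p + 1)*f u"
proof -
 show B: "Bint a u = (Hnorm u)^2 - f u" using assms(3)[rule_format, OF assms(2)] by (simp add: I_deriv_def Bform_self Hnorm_power2)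
 show "I f u = kappa*(Hnorm u)^2 - p/(p + 1)*f u" unfolding Ifun_eq B kappa_def using p_gt_1 by (simp add: divide_simps) (simp add: algebra_simps)
qed

lemma I_AE_cong:
 assumes "f \<in> Hdual" "u \<in> H" "v \<in> H" "AE x in L. u x = v x" shows "I f u = I f v"
 using Hnorm_AE_cong[OF assms(2) H_meas[OF assms(3)] assms(4)] Bint_AE_cong[OF H_meas[OF assms(2)] H_meas[OF assms(3)] a_coef assms(4)] dual_AE_cong[OF assms]
 by (simp add: Ifun_eq)

text \<open>Compare \<open>I f\<close> at \<open>u\<close> and \<open>(1 - t)*u\<close>: the difference is \<open>o(t)\<close> by criticality and at least \<open>t*I f u\<close> by convexity.\<close>
lemma locmin_energy:
 assumes f: "f \<in> Hdual" and u: "u \<in> Hball s r" "crit_Hs s (I f) u" and r: "r > 0"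
  and conv: "strictly_convex_on_Hs s (Hball s r) (I f)"
 shows "I f u <= 0"
proof -
 have uH: "u \<in> H" and z: "(%x::real^'n. 0) \<in> Hball s r" using u(1) r by (auto simp: Hball_def H_zero Hnorm_zero)
 have I0: "I f (%x. 0) = 0" using dual_scale[OF f H_zero, of 0] by (simp add: Ifun_eq Hnorm_zero Bint_def)
 show ?thesis
 proof (cases "AE x in L. 0 = u x")
  case True
  show ?thesis using I_AE_cong[OF f H_zero uH True] I0 by simp
 next
  case ne: False
  show ?thesis
  proof (rule field_le_epsilon)
   fix e :: real assume e: "e > 0"
   define k where "k = Hnorm u + 1"
   have k: "k > 0" "Hnorm u <= k" using Hnorm_nonneg[of u] by (auto simp: k_def)
   obtain d where d: "d > 0" "!!h. h \<in> H ==> Hnorm h < d ==> abs (I f (%x. u x + h x) - I f u) <= e/k*Hnorm h"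
    using u(2) divide_pos_pos[OF e k(1)] unfolding crit_Hs_def by metis
   define t where "t = min (1/2) (d/(2*k))"
   have t: "0 < t" "t < 1" "t*k < d" using d(1) k(1) by (auto simp: t_def min_def field_simps)
   have h: "(%x. (- t)*u x) \<in> H" "Hnorm (%x. (- t)*u x) = t*Hnorm u" using H_scale[OF uH] t by (simp_all only: Hnorm_scale)
   have "t*Hnorm u <= t*k" using k t by (intro mult_left_mono) auto
   hence "Hnorm (%x. (- t)*u x) < d" using h(2) t by linarith
   hence "abs (I f (%x. (1 - t)*u x) - I f u) <= e/k*(t*Hnorm u)" using d(2)[OF h(1)] unfolding h(2) by (simp add: algebra_simps)
   moreover have "I f (%x. (1 - t)*u x) < (1 - t)*I f u"
    using conv[unfolded strictly_convex_on_Hs_def, rule_format, OF z u(1) ne, of t] t by (simp add: I0)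
   ultimately have "t*I f u <= t*(e*(Hnorm u/k))" by (simp add: algebra_simps abs_le_iff)
   hence "I f u <= e*(Hnorm u/k)" using t(1) by (rule mult_left_le_imp_le)
   also have "... <= e*1" using e k by (intro mult_left_mono) auto
   finally show "I f u <= 0 + e" by simp
  qed
 qed
qed

lemma fibre_upper:
 fixes P Q R e tau g :: real
 assumes P: "P = Q + R + e" and tau: "tau > 0" and g: "g > 0" "Q * kappa - R/2 - e/2 >= g" and Q: "Q >= 0"
 shows "fibre p Q R tau + tau^2*(P - 1)/2 <= P/2 - Q/(p + 1) - R + e^2/(4*g)"
proof -
 have "tau*(tau powr p - p*tau + p - 1)/(p + 1) >= 0" using bernoulli_powr[of p tau] tau p_gt_1 by (intro divide_nonneg_nonneg mult_nonneg_nonneg) (auto simp: algebra_simps)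
 moreover have "(tau powr (p + 1) - 1)/(p + 1) - (tau^2 - 1)/2 = kappa*(tau - 1)^2 + tau*(tau powr p - p*tau + p - 1)/(p + 1)"
  unfolding kappa_def using p_gt_1 tau powr_add[of tau p 1] by (simp add: divide_simps power2_eq_square) (simp add: algebra_simps)
 ultimately have "kappa*(tau - 1)^2 <= (tau powr (p + 1) - 1)/(p + 1) - (tau^2 - 1)/2" by linarith
 hence convex: "Q*(kappa*(tau - 1)^2) <= Q*((tau powr (p + 1) - 1)/(p + 1) - (tau^2 - 1)/2)" using Q by (rule mult_left_mono)
 have gap: "g*(tau - 1)^2 <= (Q * kappa - R/2 - e/2)*(tau - 1)^2" using g(2) by (intro mult_right_mono) auto
 have "0 <= (2*g*(tau - 1) - e)^2/(4*g)" using g(1) by simp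
 also have "... = g*(tau - 1)^2 - e*(tau - 1) + e^2/(4*g)" using g(1) by (simp add: divide_simps power2_eq_square) (simp add: algebra_simps)
 finally have square: "e*(tau - 1) - g*(tau - 1)^2 <= e^2/(4*g)" by linarith
 have "fibre p Q R tau + tau^2*(P - 1)/2 - (P/2 - Q/(p + 1) - R)
  = - (Q*((tau powr (p + 1) - 1)/(p + 1) - (tau^2 - 1)/2)) + R/2*(tau - 1)^2 + e*(tau - 1) + e/2*(tau - 1)^2"
  unfolding P fibre_def using p_gt_1 by (simp add: divide_simps power2_eq_square) (simp add: algebra_simps)
 also have "... <= - (Q * kappa - R/2 - e/2)*(tau - 1)^2 + e*(tau - 1)" using convex by (simp add: algebra_simps)
 also have "... <= e^2/(4*g)" using gap square by linarith
 finally show ?thesis by linarith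
qed

lemma interaction_expand:
 assumes u: "u \<in> H" "!!x. u x >= 0"
 shows "Bint a (add_gs u y) = Bint a u + (gs_norm^2 - defect y) + (p + 1)*Bform a u (gs_at y) + interaction u y"
  "0 <= defect y" "0 <= Bform a u (gs_at y)" "Bint a (gs_at y) = gs_norm^2 - defect y"
proof -
 have w0: "gs_at y x >= 0" for x using gs_at_pos[of y x] by simp
 note [measurable] = H_meas[OF u(1)]
 note i = a_integrable[OF nonneg_pair_integrable(1)[OF u(1) gs_at_H[of y] u(2) w0]] a_integrable[OF nonneg_pair_integrable(1)[OF gs_at_H[of y] u(1) w0 u(2)]]
  a_integrable[OF nonneg_pair_integrable(2)[OF u(1) gs_at_H[of y] u(2) w0]] interaction_integrable[OF u, of y]
 have wa: "(LINT x|L. a x*gs_at y x powr (p + 1)) = gs_norm^2 - defect y"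
  unfolding defect_def gs_at_powr(2)[of y, symmetric]
 proof (subst Bochner_Integration.integral_diff[symmetric])
  show "integrable L (%x. (1 - a x)*gs_at y x powr (p + 1))" by (rule defect_integrable)
 qed (auto simp: gs_at_powr left_diff_distrib)
 thus "Bint a (gs_at y) = gs_norm^2 - defect y" using w0 by (simp add: Bint_def max_absorb1)
 have "Bint a (add_gs u y) = (LINT x|L. a x*u x powr (p + 1) + a x*gs_at y x powr (p + 1) + (p + 1)*(a x*(u x powr p*gs_at y x)) + a x*excess p (u x) (gs_at y x))"
  unfolding Bint_def using u(2) w0 by (intro Bochner_Integration.integral_cong refl) (simp add: excess_def max_absorb1 add_nonneg_nonneg algebra_simps)
 also have "... = (LINT x|L. a x*u x powr (p + 1)) + (LINT x|L. a x*gs_at y x powr (p + 1)) + (p + 1)*(LINT x|L. a x*(u x powr p*gs_at y x)) + interaction u y"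
  unfolding interaction_def using i by simp
 finally show "Bint a (add_gs u y) = Bint a u + (gs_norm^2 - defect y) + (p + 1)*Bform a u (gs_at y) + interaction u y"
  unfolding wa Bint_def Bform_def using u(2) by (simp add: max_absorb1 mult.assoc)
 show "0 <= defect y" unfolding defect_def using coefficientD(3)[OF a_coef] by simp
 show "0 <= Bform a u (gs_at y)" unfolding Bform_def using coefficientD(2)[OF a_coef] w0 by simp
qed

definition C_interaction :: real where "C_interaction = (p + 1)*(3*C_sob*gs_norm powr p) + C_taylor*(gs_norm + 1) powr (p - 1)"

lemma C_interaction_pos: "C_interaction > 0"
 using C_sob_pos C_taylor_pos p_gt_1 gs_norm_pos by (simp add: C_interaction_def add_pos_pos)

lemma interaction_le:
 assumes u: "u \<in> H" "!!x. u x >= 0" "Hnorm u <= 1"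
 shows "interaction u y <= C_interaction*Hnorm u"
proof -
 define w where "w = gs_at y"
 define t where "t = Hnorm u"
 have t: "0 <= t" "t <= 1" using u Hnorm_nonneg by (auto simp: t_def)
 have w: "w \<in> H" "Hnorm w = gs_norm" using gs_at_H Hnorm_gs_at by (auto simp: w_def)
 note E = interaction_expand[OF u(1,2), of y, folded w_def]
 have "abs (Bint a (%x. w x + u x) - Bint a w - (p + 1)*Bform a w u) <= C_taylor*(gs_norm + t) powr (p - 1)*t^2"
  using Bint_taylor[OF a_coef w(1) u(1)] by (simp add: w t_def)
 also have "... <= C_taylor*(gs_norm + 1) powr (p - 1)*t"
  using C_taylor_pos t gs_norm_pos p_gt_1 by (intro mult_mono powr_mono2) (auto simp: power2_eq_square mult_left_le_one_le)
 finally have "Bint a (%x. u x + w x) <= Bint a w + (p + 1)*Bform a w u + C_taylor*(gs_norm + 1) powr (p - 1)*t" by (simp add: add.commute abs_le_iff)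
 moreover have "(p + 1)*Bform a w u <= (p + 1)*(3*C_sob*(gs_norm powr p*t))"
  using Bform_bound[OF a_coef w(1) u(1)] p_gt_1 by (intro mult_left_mono) (auto simp: w t_def abs_le_iff)
 moreover have "Bint a u >= 0" "(p + 1)*Bform a u w >= 0" using Bint_nonneg[OF a_coef] E(3) p_gt_1 by auto
 ultimately have "interaction u y <= (p + 1)*(3*C_sob*(gs_norm powr p*t)) + C_taylor*(gs_norm + 1) powr (p - 1)*t"
  using E(1,4) by linarith
 thus ?thesis by (simp add: C_interaction_def t_def algebra_simps)
qed

lemma sqrt_optimal_split:
 fixes z k X c :: real
 assumes X: "X > 0" and c: "c > 0" and z: "!!l. l > 0 ==> z <= k*(1 + l)*X + c/l"
 shows "z <= k*X + (k + 1) * sqrt (c*X)"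
proof -
 define l where "l = sqrt (c/X)"
 have l: "l > 0" using X c by (simp add: l_def)
 have "l*X = sqrt (c/X) * sqrt (X^2)" using X by (simp add: l_def)
 also have "... = sqrt (c*X)" unfolding real_sqrt_mult[symmetric] using X by (simp add: power2_eq_square)
 finally have lX: "l*X = sqrt (c*X)" .
 have "c = l^2*X" using X c by (simp add: l_def)
 hence cl: "c/l = sqrt (c*X)" using l lX by (simp add: power2_eq_square)
 have "k*(1 + l)*X + c/l = k*X + k*(l*X) + c/l" by (simp add: algebra_simps)
 also have "... = k*X + (k + 1) * sqrt (c*X)" unfolding lX cl by (simp add: algebra_simps)
 finally show ?thesis using z[OF l] by simp
qed

lemma integral_le_split_bound:
 assumes k: "k > 0" "!!x. 1/excess_const p <= k*a x" and u: "u \<in> H" "!!x. u x >= 0" "Hnorm u <= 1" and l: "l > 0"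
  and h: "integrable L h" "!!x. h x <= split_bound p l (u x) (gs_at y x)"
 shows "(LINT x|L. h x) <= k*(1 + l)*interaction u y + C_sob*Hnorm u/l"
proof -
 have Ui: "integrable L (%x. u x powr (p + 1))" using powr_p1_integrable[OF u(1)] u(2) by simp
 note Xi = interaction_integrable[OF u(1,2), of y]
 have "(LINT x|L. h x) <= (LINT x|L. k*(1 + l)*(a x*excess p (u x) (gs_at y x)) + (1/l)*u x powr (p + 1))"
 proof (rule integral_mono[OF h(1)])
  fix x
  have "(1/excess_const p)*((1 + l)*excess p (u x) (gs_at y x)) <= (k*a x)*((1 + l)*excess p (u x) (gs_at y x))"
   using k l excess_nonneg[OF p_gt_1 u(2) less_imp_le[OF gs_at_pos]] by (intro mult_right_mono) auto
  thus "h x <= k*(1 + l)*(a x*excess p (u x) (gs_at y x)) + (1/l)*u x powr (p + 1)" using h(2)[of x] by (simp add: split_bound_def mult_ac)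
 qed (use Ui Xi in auto)
 also have "... = k*(1 + l)*interaction u y + (1/l)*(LINT x|L. u x powr (p + 1))" unfolding interaction_def using Ui Xi by simp
 also have "(1/l)*(LINT x|L. u x powr (p + 1)) <= (1/l)*(C_sob*Hnorm u)"
 proof (rule mult_left_mono)
  have "(LINT x|L. u x powr (p + 1)) <= C_sob*Hnorm u powr (p + 1)" using powr_p1_le[OF u(1)] u(2) by simp
  also have "... <= C_sob*Hnorm u powr 1" using C_sob_pos Hnorm_nonneg u(3) p_gt_1 by (intro mult_left_mono powr_mono') auto
  finally show "(LINT x|L. u x powr (p + 1)) <= C_sob*Hnorm u" using Hnorm_nonneg by simp
 qed (use l in simp)
 finally show ?thesis by simp
qed

text \<open>Optimizing in \<open>l\<close> makes the integral of \<open>h\<close> a geometric mean of \<open>Hnorm u\<close> and the interaction.\<close>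
lemma integral_power2_le_interaction:
 assumes k: "k > 0" "!!x. 1/excess_const p <= k*a x" and u: "u \<in> H" "!!x. u x >= 0" "Hnorm u <= 1" and X: "interaction u y > 0"
  and h: "integrable L h" "!!x. 0 <= h x" "!!x l. l > 0 ==> h x <= split_bound p l (u x) (gs_at y x)"
 shows "(LINT x|L. h x)^2 <= 2*(k^2*C_interaction + (k + 1)^2*C_sob)*(Hnorm u*interaction u y)"
proof -
 define X where "X = interaction u y"
 define t where "t = Hnorm u"
 have X0: "X > 0" using X by (simp add: X_def)
 have XC: "X <= C_interaction*t" using interaction_le[OF u] by (simp add: X_def t_def)
 have t: "0 < t"
 proof (rule ccontr)
  assume "~ 0 < t"
  hence "C_interaction*t <= 0" using C_interaction_pos by (simp add: mult_le_0_iff)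
  thus False using XC X0 by linarith
 qed
 have "(LINT x|L. h x) <= k*(1 + l)*X + C_sob*t/l" if "l > 0" for l
  unfolding X_def t_def by (rule integral_le_split_bound[OF k u that h(1) h(3)[OF that]])
 hence "(LINT x|L. h x) <= k*X + (k + 1) * sqrt (C_sob*t*X)" using X0 t C_sob_pos by (intro sqrt_optimal_split) auto
 hence "(LINT x|L. h x)^2 <= (k*X + (k + 1) * sqrt (C_sob*t*X))^2" using h(2) by (intro power_mono) auto
 also have "... <= 2*((k*X)^2 + ((k + 1) * sqrt (C_sob*t*X))^2)"
  using zero_le_power2[of "k*X - (k + 1) * sqrt (C_sob*t*X)"] by (simp add: power2_sum power2_diff)
 also have "((k + 1) * sqrt (C_sob*t*X))^2 = (k + 1)^2*(C_sob*t*X)"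
  using X0 t C_sob_pos unfolding power_mult_distrib by (subst real_sqrt_pow2) auto
 also have "(k*X)^2 = k^2*X*X" by (simp add: power2_eq_square)
 also have "2*(k^2*X*X + (k + 1)^2*(C_sob*t*X)) <= 2*(k^2*(C_interaction*t)*X + (k + 1)^2*(C_sob*t*X))" using XC X0 by (intro mult_left_mono add_right_mono mult_right_mono) auto
 finally show ?thesis by (simp add: X_def t_def algebra_simps)
qed

definition interaction_bound :: "real => 'n fn => real^'n => bool" where
 "interaction_bound C u y \<longleftrightarrow> interaction u y <= C*Hnorm u & Hinner u (gs_at y) <= C*Hnorm u
  & (Hinner u (gs_at y))^2 <= C*Hnorm u*interaction u y & (Bform a u (gs_at y))^2 <= C*Hnorm u*interaction u y"

lemma interaction_bounds:
 obtains C where "C > 0" "!!u y. u \<in> H ==> (!!x. u x >= 0) ==> Hnorm u <= 1 ==> interaction u y > 0 ==> interaction_bound C u y"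
proof -
 obtain ca where ca: "ca > 0" "!!x. ca <= a x" using a_low by blast
 define k where "k = 1/excess_const p/ca"
 have k: "k > 0" "1/excess_const p <= k*a x" for x
  using excess_const_pos[OF p_gt_1] ca(1) mult_left_mono[OF ca(2)[of x], of k] by (auto simp: k_def)
 define M where "M = 2*(k^2*C_interaction + (k + 1)^2*C_sob)"
 define C where "C = C_interaction + gs_norm + M"
 have M: "M >= 0" using C_interaction_pos C_sob_pos by (simp add: M_def)
 have C: "C > 0" "C_interaction <= C" "gs_norm <= C" "M <= C" using M C_interaction_pos gs_norm_pos by (auto simp: C_def)
 show thesis
 proof (rule that[OF C(1)])
  fix u y assume u: "u \<in> H" "!!x. u x >= 0" "Hnorm u <= 1" and X: "interaction u y > 0"
  have w: "gs_at y x >= 0" for x by (rule less_imp_le[OF gs_at_pos])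
  have sq: "(LINT x|L. h x)^2 <= C*Hnorm u*interaction u y"
   if "integrable L h" "!!x. 0 <= h x" "!!x l. l > 0 ==> h x <= split_bound p l (u x) (gs_at y x)" for h
   using integral_power2_le_interaction[OF k u X that, folded M_def]
    mult_right_mono[OF C(4), of "Hnorm u*interaction u y"] X Hnorm_nonneg[of u] by (simp add: mult.assoc)
  have "Hinner u (gs_at y) = (LINT x|L. gs_at y x powr p*u x)"
   unfolding Hinner_commute[of u] Hinner_gs_at[OF u(1)] Bform_def using w by (simp add: max_absorb1)
  moreover have "(LINT x|L. gs_at y x powr p*u x)^2 <= C*Hnorm u*interaction u y"
   using nonneg_pair_integrable(2)[OF gs_at_H u(1) w u(2)] u(2) w excess_split(2)[OF p_gt_1 u(2) w] by (intro sq) auto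
  ultimately have H2: "(Hinner u (gs_at y))^2 <= C*Hnorm u*interaction u y" by simp
  have "Bform a u (gs_at y) = (LINT x|L. a x*(u x powr p*gs_at y x))" unfolding Bform_def using u(2) by (simp add: max_absorb1 mult.assoc)
  moreover have "(LINT x|L. a x*(u x powr p*gs_at y x))^2 <= C*Hnorm u*interaction u y"
  proof (rule sq)
   show "integrable L (%x. a x*(u x powr p*gs_at y x))" by (intro a_integrable nonneg_pair_integrable u gs_at_H w)
   fix x :: "real^'n" and l :: real assume l: "l > 0"
   have "a x*(u x powr p*gs_at y x) <= u x powr p*gs_at y x" using coefficientD(2,3)[OF a_coef, of x] u(2) w by (intro mult_left_le_one_le) auto
   also have "... <= split_bound p l (u x) (gs_at y x)" by (rule excess_split(1)[OF p_gt_1 u(2) w l])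
   finally show "a x*(u x powr p*gs_at y x) <= split_bound p l (u x) (gs_at y x)" .
  qed (use coefficientD(2)[OF a_coef] w in auto)
  ultimately have B2: "(Bform a u (gs_at y))^2 <= C*Hnorm u*interaction u y" by simp
  have "Hinner u (gs_at y) <= gs_norm*Hnorm u" using Hinner_Cauchy_Schwarz[OF u(1) gs_at_H, of y] by (simp add: Hnorm_gs_at mult.commute abs_le_iff)
  moreover have "gs_norm*Hnorm u <= C*Hnorm u" "C_interaction*Hnorm u <= C*Hnorm u" using C Hnorm_nonneg by (auto intro: mult_right_mono)
  ultimately show "interaction_bound C u y" using H2 B2 interaction_le[OF u, of y] by (auto simp: interaction_bound_def)
 qed
qed

lemma fibre_sum_gap:
 fixes t F A W m alpha beta X C Q R e :: real
 assumes A: "0 <= A" "A = t^2 - F" and al: "0 <= alpha" and be: "0 <= beta" "beta <= C*t" and X: "0 < X" "X <= C*t"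
  and m: "0 <= m" "m <= X/2" and t: "0 <= t" "t <= 1" and C: "C > 0" and W: "W > 0"
  and small: "(kappa*C + (1 + C)/2 + C/2)*t <= kappa*W/2"
  and Q: "Q = A + (W - m) + (p + 1)*alpha + X" and R: "R = F + (beta - alpha)" and e: "e = beta - p*alpha - X + m"
 shows "Q > 0" "kappa*W/2 <= Q * kappa - R/2 - e/2"
proof -
 have "(p + 1)*alpha >= 0" "p*alpha >= 0" using al p_gt_1 by auto
 hence Ql: "Q >= W - C*t" and el: "e <= C*t" using A X m be unfolding Q e by linarith+
 have s: "(kappa*C + (1 + C)/2 + C/2)*t = kappa*(C*t) + t/2 + C*t" by (simp add: algebra_simps add_divide_distrib)
 have "0 <= t/2 + C*t" using C t by simp
 hence "kappa*(C*t) <= kappa*(W/2)" using small unfolding s by simp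
 hence "C*t <= W/2" using kappa_pos by simp
 thus "Q > 0" using Ql W by linarith
 have "t^2 <= t" using t by (simp add: power2_eq_square mult_left_le_one_le)
 hence "R <= t + C*t" using A al be unfolding R by (simp add: algebra_simps)
 moreover have "kappa*(W - C*t) <= kappa*Q" using Ql kappa_pos by (intro mult_left_mono) auto
 hence "kappa*W - kappa*(C*t) <= Q * kappa" by (simp add: algebra_simps)
 ultimately show "kappa*W/2 <= Q * kappa - R/2 - e/2" using el small unfolding s by linarith
qed

lemma power2_sum3_le:
 fixes alpha beta m X B :: real
 assumes "beta^2 <= B" "alpha^2 <= B" "X^2 <= B" "0 <= m" "m <= X"
 shows "(beta - p*alpha - X + m)^2 <= 3*(2 + p^2)*B"
proof -
 have "(r1 + r2 + r3)^2 <= 3*(r1^2 + r2^2 + r3^2)" for r1 r2 r3 :: real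
  using zero_le_power2[of "r1 - r2"] zero_le_power2[of "r1 - r3"] zero_le_power2[of "r2 - r3"] by (simp add: power2_eq_square algebra_simps)
 from this[of beta "- p*alpha" "m - X"] have "(beta - p*alpha - X + m)^2 <= 3*(beta^2 + p^2*alpha^2 + (m - X)^2)"
  by (simp add: power_mult_distrib algebra_simps)
 moreover have "(m - X)^2 <= X^2" using assms by (intro abs_le_square_iff[THEN iffD1]) auto
 moreover have "p^2*alpha^2 <= p^2*B" using assms(2) by (intro mult_left_mono) auto
 ultimately show ?thesis using assms by (simp add: algebra_simps)
qed

definition energy_radius :: "real => real" where
 "energy_radius C = min 1 (min (kappa*gs_norm^2/(2*(kappa*C + (1 + C)/2 + C/2))) (kappa*gs_norm^2/(2*(p + 1)*(3*(2 + p^2)*C))))"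

lemma energy_radius:
 assumes C: "C > 0"
 shows "energy_radius C > 0" "t <= energy_radius C ==> t <= 1"
  "t <= energy_radius C ==> (kappa*C + (1 + C)/2 + C/2)*t <= kappa*gs_norm^2/2"
  "t <= energy_radius C ==> 3*(2 + p^2)*C*t <= kappa*gs_norm^2/(2*(p + 1))"
proof -
 define G where "G = kappa*C + (1 + C)/2 + C/2"
 define E where "E = 3*(2 + p^2)*C"
 have EG: "E > 0" "G > 0" using C kappa_pos by (auto simp: E_def G_def add_pos_pos add_pos_nonneg)
 have d: "energy_radius C = min 1 (min (kappa*gs_norm^2/(2*G)) (kappa*gs_norm^2/(2*(p + 1)*E)))" by (simp add: energy_radius_def G_def E_def)
 show "energy_radius C > 0" unfolding d using EG kappa_pos gs_norm_pos p_gt_1 by simp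
 assume t: "t <= energy_radius C"
 thus "t <= 1" by (simp add: d)
 have "G*t <= G*(kappa*gs_norm^2/(2*G))" using t EG by (intro mult_left_mono) (auto simp: d)
 thus "(kappa*C + (1 + C)/2 + C/2)*t <= kappa*gs_norm^2/2" using EG by (simp add: G_def[symmetric])
 have "E*t <= E*(kappa*gs_norm^2/(2*(p + 1)*E))" using t EG by (intro mult_left_mono) (auto simp: d)
 also have "... = kappa*gs_norm^2/(2*(p + 1))" using EG by simp
 finally show "3*(2 + p^2)*C*t <= kappa*gs_norm^2/(2*(p + 1))" unfolding E_def .
qed

text \<open>The energy of the sum is that of its summands minus \<open>(interaction - defect)/(p + 1)\<close>, up to the square of
  the Nehari error \<open>e\<close>, which is of smaller order.\<close>
lemma fibre_sum_less:
 fixes t F A m alpha beta X C Q R P tau :: real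
 assumes A: "0 <= A" "A = t^2 - F" and al: "0 <= alpha" "alpha^2 <= C*t*X" and be: "0 <= beta" "beta <= C*t" "beta^2 <= C*t*X"
  and X: "0 < X" "X <= C*t" and m: "0 <= m" "m <= X/2" and t: "0 <= t" "t <= energy_radius C" and C: "C > 0" and tau: "tau > 0"
  and Q: "Q = A + (gs_norm^2 - m) + (p + 1)*alpha + X" and R: "R = F + (beta - alpha)" and P: "P = t^2 + 2*beta + gs_norm^2"
 shows "Q > 0" "fibre p Q R tau + tau^2*(P - 1)/2 < kappa*t^2 - p/(p + 1)*F + gs_energy"
proof -
 define W where "W = gs_norm^2"
 define e where "e = beta - p*alpha - X + m"
 have W: "W > 0" using gs_norm_pos by (simp add: W_def)
 note r = energy_radius(2-4)[OF C t(2), folded W_def]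
 note gap = fibre_sum_gap[OF A al(1) be(1,2) X m t(1) r(1) C W r(2) Q[folded W_def] R e_def]
 show "Q > 0" by (rule gap(1))
 have PQR: "P = Q + R + e" unfolding P Q R A(2) e_def by (simp add: algebra_simps)
 have "X^2 <= C*t*X" using X by (simp add: power2_eq_square mult_right_mono)
 hence "e^2 <= 3*(2 + p^2)*(C*t*X)" unfolding e_def using be al m X by (intro power2_sum3_le) auto
 also have "... = 3*(2 + p^2)*C*t*X" by simp
 also have "... <= kappa*W/(2*(p + 1))*X" using r(3) X by (intro mult_right_mono) auto
 finally have "e^2/(4*(kappa*W/2)) <= (kappa*W/(2*(p + 1))*X)/(4*(kappa*W/2))" using kappa_pos W by (intro divide_right_mono) auto
 also have "... = (X/4)/(p + 1)" using kappa_pos W p_gt_1 by (simp add: divide_simps)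
 also have "... < (X - m)/(p + 1)" using m X p_gt_1 by (intro divide_strict_right_mono) auto
 finally have e2: "e^2/(4*(kappa*W/2)) < (X - m)/(p + 1)" .
 have "fibre p Q R tau + tau^2*(P - 1)/2 <= P/2 - Q/(p + 1) - R + e^2/(4*(kappa*W/2))"
  using PQR tau kappa_pos W gap by (intro fibre_upper) auto
 also have "P/2 - Q/(p + 1) - R = kappa*t^2 - p/(p + 1)*F + gs_energy - (X - m)/(p + 1)"
  unfolding gs_energy_eq P Q R A(2) kappa_def using p_gt_1 by (simp add: divide_simps) (simp add: algebra_simps)
 finally show "fibre p Q R tau + tau^2*(P - 1)/2 < kappa*t^2 - p/(p + 1)*F + gs_energy" using e2 by linarith
qed

lemma I_scale: assumes "f \<in> Hdual" "g \<in> H" "tau >= 0" shows "I f (%x. tau*g x) = fibre p (Bint a g) (f g) tau + tau^2*((Hnorm g)^2 - 1)/2"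
 unfolding Ifun_eq Hnorm_scale fibre_def using assms by (simp add: Bint_scale dual_scale power_mult_distrib algebra_simps diff_divide_distrib)

lemma normalized_Sigma: assumes "g \<in> H" "Bint a g > 0" shows "Hnorm g > 0" "normalized g \<in> Sigma"
proof -
 show h: "Hnorm g > 0"
 proof (rule ccontr)
  assume "~ ?thesis"
  hence "Hnorm g = 0" using Hnorm_nonneg[of g] by linarith
  thus False using Bint_le[OF a_coef assms(1)] assms(2) p_gt_1 by simp
 qed
 have "Bint a (normalized g) > 0" unfolding normalized_def using h assms(2) by (subst Bint_scale) auto
 thus "normalized g \<in> Sigma" using H_normalized[OF assms(1)] Hnorm_normalized[OF h] by (simp add: Sigma_plus_iff)
qed

abbreviation low_sum :: "('n fn => real) => 'n fn => real^'n => bool" where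
 "low_sum f u y \<equiv> normalized (add_gs u y) \<in> Sigma & Hnorm (add_gs u y) > 0 & J f (normalized (add_gs u y)) < I f u + gs_energy"

lemma energy_estimate:
 obtains d where "d > 0" "!!f u y. small_dual f ==> nonneg_dual s f ==> u \<in> H ==> (!!x. u x >= 0) ==> stationary f u ==> Hnorm u <= d ==>
   interaction u y > 0 ==> defect y <= interaction u y/2 ==> low_sum f u y"
proof -
 obtain C where C: "C > 0" "!!u y. u \<in> H ==> (!!x. u x >= 0) ==> Hnorm u <= 1 ==> interaction u y > 0 ==> interaction_bound C u y"
  by (rule interaction_bounds) blast
 show thesis
 proof (rule that[OF energy_radius(1)[OF C(1)]])
  fix f u y assume f: "small_dual f" "nonneg_dual s f" and u: "u \<in> H" "!!x. u x >= 0" and cr: "stationary f u"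
   and ud: "Hnorm u <= energy_radius C" and X: "interaction u y > 0" and m: "defect y <= interaction u y/2"
  define w where "w = gs_at y"
  define g where "g = (%x. u x + w x)"
  note fH = small_dualD(1)[OF f(1)]
  have w: "w \<in> H" "Hnorm w = gs_norm" "!!x. w x >= 0" using gs_at_H Hnorm_gs_at gs_at_pos by (auto simp: w_def less_imp_le)
  have g: "g \<in> H" using H_add[OF u(1) w(1)] by (simp add: g_def)
  note b = C(2)[OF u energy_radius(2)[OF C(1) ud] X, unfolded interaction_bound_def, folded w_def]
  note ex = interaction_expand[OF u, of y, folded w_def]
  note ce = critical_energy[OF fH u(1) cr]
  have fw: "f w = Hinner u w - Bform a u w" using cr[rule_format, OF w(1)] by (simp add: I_deriv_def)
  have "f w >= 0" using f(2) w by (simp add: nonneg_dual_def)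
  hence be: "0 <= Hinner u w" using fw ex(3) by linarith
  have P: "(Hnorm g)^2 = (Hnorm u)^2 + 2*Hinner u w + gs_norm^2" unfolding g_def Hnorm_power2_add[OF u(1) w(1)] by (simp add: w)
  have R: "f g = f u + (Hinner u w - Bform a u w)" using dual_add[OF fH u(1) w(1)] fw by (simp add: g_def)
  note low = fibre_sum_less[OF Bint_nonneg[OF a_coef] ce(1) ex(3) _ be _ _ X _ ex(2) m Hnorm_nonneg ud C(1) _ ex(1)[folded g_def] R P]
  have Q0: "Bint a g > 0" using low(1)[of 1] b by simp
  note vS = normalized_Sigma[OF g Q0]
  define tau where "tau = tmax f (normalized g)/Hnorm g"
  have tau: "tau > 0" using tmax_max(1)[OF f(1) vS(2)] vS(1) by (simp add: tau_def)
  have "J f (normalized g) = I f (%x. tau*g x)" using J_eq(1)[OF f(1) vS(2)] by (simp add: normalized_def tau_def)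
  also have "... = fibre p (Bint a g) (f g) tau + tau^2*((Hnorm g)^2 - 1)/2" using I_scale[OF fH g] tau by simp
  also have "... < I f u + gs_energy" using low(2)[OF _ _ _ _ tau] b ce(2) by simp
  finally show "low_sum f u y"
   using vS by (simp add: g_def w_def)
 qed
qed

lemma J_ge_natural:
 assumes f: "small_dual f" and v: "v \<in> Sigma"
 shows "kappa*(Bint a v powr (- 1/(p - 1)))^2 - Bint a v powr (- 1/(p - 1))*dual_norm f <= J f v"
proof -
 define t where "t = Bint a v powr (- 1/(p - 1))"
 have t: "t > 0" using Bint_Sigma_plus(1)[OF v] by (simp add: t_def)
 have "f v <= dual_norm f" using dual_bound[OF small_dualD(1)[OF f] Sigma_plusD(1)[OF v]] by (simp add: Sigma_plusD(2)[OF v] abs_le_iff)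
 hence "t*f v <= t*dual_norm f" using t by (intro mult_left_mono) auto
 moreover have "fibre p (Bint a v) (f v) t = kappa*t^2 - t*f v" unfolding t_def by (rule fibre_at_natural[OF Bint_Sigma_plus(1)[OF v]])
 moreover have "fibre p (Bint a v) (f v) t <= J f v" using J_eq(2)[OF f v] tmax_max(2)[OF f v t] by simp
 ultimately show ?thesis unfolding t_def[symmetric] by linarith
qed

lemma low_energy_barycentre:
 obtains d where "d > 0" "!!f v. small_dual f ==> dual_norm f <= d ==> v \<in> Sigma ==> J f v < gs_energy ==> barycentre v ~= 0"
proof -
 obtain nu where nu: "nu > 0" "!!v. v \<in> Sigma ==> Bint a v > Bmax - nu ==> barycentre v ~= 0" by (rule barycentre_nonzero) blast
 define k where "k = max (Bmax - nu) (Bmax/2)"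
 have k: "0 < k" "k < Bmax" "Bmax - nu <= k" using Bmax_pos nu by (auto simp: k_def)
 define r where "r = k powr (- 1/(p - 1))"
 have r: "r > gs_norm" unfolding r_def gs_norm_def using k p_gt_1 by (intro powr_less_mono2_neg) auto
 have r0: "r > 0" using r gs_norm_pos by linarith
 define d where "d = kappa*(r^2 - gs_norm^2)/r"
 have "gs_norm^2 < r^2" using r gs_norm_pos by (intro power_strict_mono) auto
 hence d: "d > 0" "r*d = kappa*(r^2 - gs_norm^2)" using r0 kappa_pos by (auto simp: d_def)
 hence rd: "r*(kappa*r - d) = kappa*gs_norm^2" by (simp add: algebra_simps power2_eq_square)
 hence kd: "kappa*r - d >= 0" using r0 kappa_pos by (metis less_imp_le mult_nonneg_nonneg zero_le_mult_iff zero_le_power2 not_le)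
 show thesis
 proof (rule that[OF d(1)])
  fix f v assume f: "small_dual f" "dual_norm f <= d" and v: "v \<in> Sigma" and J: "J f v < gs_energy"
  have "Bint a v > Bmax - nu"
  proof (rule ccontr)
   assume "~ ?thesis"
   hence B: "0 < Bint a v" "Bint a v <= k" using Bint_Sigma_plus[OF v] k by auto
   define t where "t = Bint a v powr (- 1/(p - 1))"
   have t: "t >= r" unfolding t_def r_def using B p_gt_1 by (intro powr_mono2') auto
   have "gs_energy = r*(kappa*r - d)" by (simp only: gs_energy_eq rd)
   also have "... <= t*(kappa*t - dual_norm f)" using t r0 kd f(2) kappa_pos by (intro mult_mono diff_mono mult_left_mono) auto
   also have "... = kappa*t^2 - t*dual_norm f" by (simp add: power2_eq_square algebra_simps)
   also have "... <= J f v" unfolding t_def by (rule J_ge_natural[OF f(1) v])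
   finally show False using J by simp
  qed
  thus "barycentre v ~= 0" using nu v by blast
 qed
qed

lemma barycentre_scale: "barycentre (%x. c * v x) = c^2 *\<^sub>R barycentre v"
 by (simp add: barycentre_def power_mult_distrib integral_scaleR_right[symmetric] del: integral_scaleR_right)

lemma barycentre_direction:
 obtains d R where "d > 0" "!!u y. u \<in> H ==> Hnorm u <= d ==> norm y >= R ==> y ~= 0 ==> Hnorm (add_gs u y) > 0 ==> barycentre (normalized (add_gs u y)) \<bullet> y > 0"
proof -
 define l where "l = (LINT x|L. (gs x)^2)"
 have l: "l > 0" unfolding l_def by (rule L2_pos[OF gs_H Hnorm_gs_pos])
 have "(%n. barycentre (gs_at (y n)) \<bullet> (y n /\<^sub>R norm (y n)) - l) ---> 0" if "escapes y" for y
  using barycentre_shift_tendsto[OF gs_H that] by (simp add: l_def gs_at_def LIM_zero_iff)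
 then obtain R where R: "!!y. norm y >= R ==> abs (barycentre (gs_at y) \<bullet> (y /\<^sub>R norm y) - l) < l/2"
  by (rule small_at_infinityE[where X="%y. barycentre (gs_at y) \<bullet> (y /\<^sub>R norm y) - l" and e="l/2"]) (use l in auto)
 define D where "D = 1 + 2*gs_norm"
 define d where "d = min 1 (l/(4*D))"
 have D: "D > 0" using gs_norm_pos by (simp add: D_def)
 have d: "d > 0" "d <= 1" using l D by (auto simp: d_def)
 have "d*D <= l/(4*D)*D" using D by (intro mult_right_mono) (auto simp: d_def)
 hence dD: "d*D <= l/4" using D by simp
 show thesis
 proof (rule that[OF d(1)])
  fix u y assume u: "u \<in> H" "Hnorm u <= d" and y: "norm y >= R" "y ~= 0" and h: "Hnorm (add_gs u y) > 0"
  let ?g = "%x. u x + gs_at y x" and ?e = "y /\<^sub>R norm y"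
  have g: "?g \<in> H" using H_add[OF u(1) gs_at_H] .
  have "norm (barycentre ?g - barycentre (gs_at y)) <= Hdist ?g (gs_at y)*(Hnorm ?g + Hnorm (gs_at y))" by (rule barycentre_lipschitz[OF g gs_at_H])
  also have "... = Hnorm u*(Hnorm ?g + gs_norm)" by (simp add: Hnorm_gs_at)
  also have "... <= d*D" unfolding D_def
   using u Hnorm_triangle[OF u(1) gs_at_H[of y]] d gs_norm_pos Hnorm_nonneg by (intro mult_mono) (auto simp: Hnorm_gs_at intro: add_nonneg_nonneg)
  finally have "norm (barycentre ?g - barycentre (gs_at y)) <= l/4" using dD by linarith
  moreover have "abs ((barycentre ?g - barycentre (gs_at y)) \<bullet> ?e) <= norm (barycentre ?g - barycentre (gs_at y))*norm ?e" by (rule Cauchy_Schwarz_ineq2)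
  moreover have "norm ?e = 1" using y by simp
  ultimately have "abs (barycentre ?g \<bullet> ?e - barycentre (gs_at y) \<bullet> ?e) <= l/4" by (simp only: inner_diff_left mult_1_right)
  hence "barycentre ?g \<bullet> ?e > 0" using R[OF y(1)] l by linarith
  hence "barycentre ?g \<bullet> y > 0" using y by (simp add: zero_less_mult_iff)
  thus "barycentre (normalized ?g) \<bullet> y > 0" unfolding normalized_def barycentre_scale using h by simp
 qed
qed

end

lemma not_tendsto_subseq:
 fixes X :: "nat => 'a::metric_space"
 assumes "~ X ---> l"
 obtains e sigma where "e > 0" "strict_mono (sigma :: nat => nat)" "!!n. e <= dist (X (sigma n)) l"
proof -
 obtain e where e: "e > 0" "\<exists>\<^sub>F n in sequentially. e <= dist (X n) l"
  using assms unfolding tendsto_iff by (auto simp: not_eventually not_less)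
 hence "infinite {n. e <= dist (X n) l}" by (auto simp: frequently_sequentially infinite_nat_iff_unbounded_le)
 then obtain sigma :: "nat => nat" where "strict_mono sigma" "\<forall>n. sigma n \<in> {n. e <= dist (X n) l}" using infinite_enumerate by blast
 thus ?thesis using that e by blast
qed

lemma decreasing_continuous_less_uniformly:
 fixes F :: "nat => 'a::heine_borel => real"
 assumes K: "compact K" and F: "!!n. continuous_on K (F n)" "!!n x. x \<in> K ==> F (Suc n) x <= F n x" and c: "!!x. x \<in> K ==> \<exists>n. F n x < c"
 shows "\<exists>n. \<forall>x\<in>K. F n x < c"
proof (rule ccontr)
 assume no: "~ ?thesis"
 define C where "C n = K \<inter> F n -` {c..}" for n
 have "compact (C n)" for n
  using K continuous_on_closed_vimage[OF compact_imp_closed[OF K], of "F n"] F(1) compact_Int_closed[OF K, of "F n -` {c..} \<inter> K"]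
  by (auto simp: C_def Int_commute)
 moreover have "C n ~= {}" for n using no by (auto simp: C_def not_less)
 moreover have "C n \<subseteq> C m" if "m <= n" for m n
  using lift_Suc_antimono_le[of "%n. F n _", OF F(2) that] by (auto simp: C_def intro: order_trans)
 ultimately have "\<Inter>(range C) ~= {}" by (rule compact_nest)
 then obtain x where x: "x \<in> C n" for n by blast
 hence "x \<in> K" and ge: "c <= F n x" for n by (auto simp: C_def)
 then obtain n where "F n x < c" using c by blast
 thus False using ge[of n] by simp
qed

context frac_sobolev
begin

lemma Hdist_scale_tendsto:
 assumes g: "!!n. g n \<in> H" "G \<in> H" "(%n. Hdist (g n) G) ---> 0" and c: "c ---> l"
 shows "(%n. Hdist (%x. c n*g n x) (%x. l*G x)) ---> 0"
proof (rule tendsto_sandwich[OF _ _ tendsto_const])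
 show "(%n. abs (c n)*Hdist (g n) G + abs (c n - l)*Hnorm G) ---> 0"
  using tendsto_add[OF tendsto_mult[OF tendsto_rabs[OF c] g(3)] tendsto_mult_right[OF tendsto_rabs_zero[OF LIM_zero[OF c]], of "Hnorm G"]] by simp
 have "Hdist (%x. c n*g n x) (%x. l*G x) <= abs (c n)*Hdist (g n) G + abs (c n - l)*Hnorm G" for n
 proof -
  have "(%x. c n*(g n x - G x) + (c n - l)*G x) = (%x. c n*g n x - l*G x)" by (auto simp: algebra_simps)
  thus ?thesis using Hnorm_triangle[OF H_scale[OF H_diff[OF g(1)[of n] g(2)], of "c n"] H_scale[OF g(2), of "c n - l"], unfolded Hnorm_scale] by simp
 qed
 thus "\<forall>\<^sub>F n in sequentially. Hdist (%x. c n*g n x) (%x. l*G x) <= abs (c n)*Hdist (g n) G + abs (c n - l)*Hnorm G" by simp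
qed (simp add: Hnorm_nonneg)

lemma Hdist_add_tendsto:
 assumes "!!n. g n \<in> H" "G \<in> H" "(%n. Hdist (g n) G) ---> 0" "!!n. k n \<in> H" "K \<in> H" "(%n. Hdist (k n) K) ---> 0"
 shows "(%n. Hdist (%x. g n x + k n x) (%x. G x + K x)) ---> 0"
proof (rule tendsto_sandwich[OF _ _ tendsto_const])
 show "(%n. Hdist (g n) G + Hdist (k n) K) ---> 0" using tendsto_add[OF assms(3,6)] by simp
 have "Hdist (%x. g n x + k n x) (%x. G x + K x) <= Hdist (g n) G + Hdist (k n) K" for n
  using Hnorm_triangle[OF H_diff[OF assms(1)[of n] assms(2)] H_diff[OF assms(4)[of n] assms(5)]] by (simp add: algebra_simps)
 thus "\<forall>\<^sub>F n in sequentially. Hdist (%x. g n x + k n x) (%x. G x + K x) <= Hdist (g n) G + Hdist (k n) K" by simp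
qed (simp add: Hnorm_nonneg)

lemma Hdist_normalized_tendsto:
 assumes "!!n. g n \<in> H" "G \<in> H" "(%n. Hdist (g n) G) ---> 0" "Hnorm G > 0"
 shows "(%n. Hdist (normalized (g n)) (normalized G)) ---> 0"
proof -
 have "(%n. Hnorm (g n) - Hnorm G) ---> 0"
  by (rule Lim_null_comparison[OF _ assms(3)]) (use Hnorm_reverse_triangle[OF assms(1,2)] in simp)
 hence "(%n. Hnorm (g n)) ---> Hnorm G" by (rule LIM_zero_cancel)
 thus ?thesis unfolding normalized_def using assms by (intro Hdist_scale_tendsto tendsto_intros) auto
qed

lemma weak_limit_Hdist:
 assumes "!!n. v n \<in> H" "w \<in> H" "(%n. Hinner (v n) w) ---> Hinner w w"
 shows "(%n. (Hdist (v n) w)^2 - (Hnorm (v n))^2) ---> - (Hnorm w)\<^sup>2"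
proof -
 have "(%n. (Hnorm w)^2 - 2*Hinner (v n) w) ---> (Hnorm w)^2 - 2*Hinner w w" by (intro tendsto_intros assms)
 thus ?thesis unfolding Hnorm_power2_diff[OF assms(1,2)] by (simp add: Hnorm_power2)
qed

lemma tendsto_0_of_power2: "(%n. (Hnorm (v n))^2) ---> 0 ==> (%n. Hnorm (v n)) ---> 0"
 using tendsto_real_sqrt[of "%n. (Hnorm (v n))^2" 0] Hnorm_nonneg by simp

lemma Hnorm_le_of_Hinner_self: assumes "Hinner k k <= C*Hnorm k" "C >= 0" shows "Hnorm k <= C"
 using assms Hnorm_nonneg[of k] by (cases "Hnorm k = 0") (auto simp: Hnorm_power2[symmetric] power2_eq_square)

subsection \<open>Continuity of translations\<close>

lemma cube_indicator_tendsto: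
 assumes "y ---> l"
 shows "AE x in L. (%n. indicator (cube k z) (x + y n) :: real) ---> indicator (cube k z) (x + l)"
proof -
 have "AE x in L. \<forall>i. \<forall>j::int. x $ i ~= of_int j/2 ^ k - l $ i"
 proof (subst AE_all_countable, intro allI, subst AE_all_countable, intro allI)
  fix i :: 'n and j :: int
  have "{x :: real^'n. x $ i = of_int j/2 ^ k - l $ i} \<in> null_sets lebesgue"
   using negligible_hyperplane[of "axis i (1::real)" "of_int j/2 ^ k - l $ i"] by (simp add: negligible_iff_null_sets inner_axis' axis_eq_0_iff)
  hence "AE x in lebesgue. x $ i ~= of_int j/2 ^ k - l $ i" by (auto intro: AE_I')
  thus "AE x in L. x $ i ~= of_int j/2 ^ k - l $ i" by (simp add: AE_completion_iff)
 qed
 thus ?thesis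
 proof eventually_elim
  case (elim x)
  have "eventually (%n. cube_index k (x + y n) = cube_index k (x + l)) sequentially"
   unfolding cube_index_def vec_eq_iff vec_lambda_beta
  proof (rule eventually_all_finite)
   fix i
   have lim: "(%n. 2 ^ k*(x + y n) $ i) ---> 2 ^ k*(x + l) $ i" by (intro tendsto_intros assms)
   have ni: "2 ^ k*(x + l) $ i ~= of_int j" for j using elim[rule_format, of i j] by (auto simp: field_simps)
   let ?j = "\<lfloor>2 ^ k*(x + l) $ i\<rfloor>"
   have "of_int ?j < 2 ^ k*(x + l) $ i" "2 ^ k*(x + l) $ i < of_int ?j + 1" using ni[of ?j]
    by (metis less_eq_real_def of_int_floor_le) (rule real_of_int_floor_add_one_gt)
   from order_tendstoD(1)[OF lim this(1)] order_tendstoD(2)[OF lim this(2)]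
   show "eventually (%n. \<lfloor>2 ^ k*(x + y n) $ i\<rfloor> = ?j) sequentially" by eventually_elim (auto simp: floor_eq_iff)
  qed
  thus ?case by (intro tendsto_eventually) (auto elim!: eventually_mono simp: cube_def indicator_def)
 qed
qed

lemma H_zero_of_averages: assumes "h \<in> H" "!!k z. cube_avg k h z = 0" shows "AE x in L. h x = 0"
proof -
 have "(LINT x|L. (h x)^2) <= avg_rate k*(Hnorm h)^2" for k
  using dyadic_avg_L2(2)[OF assms(1), of k] by (simp add: dyadic_avg_def assms(2))
 moreover have "(%k. avg_rate k*(Hnorm h)^2) ---> 0" by (rule tendsto_mult_left_zero[OF avg_rate_tendsto])
 ultimately have "(LINT x|L. (h x)^2) <= 0" by (intro LIMSEQ_le_const) auto
 hence "(LINT x|L. (h x)^2) = 0" by (intro antisym) auto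
 thus ?thesis using L2D(2)[OF H_L2[OF assms(1)]] by (subst (asm) integral_nonneg_eq_0_iff_AE) auto
qed

lemma AE_limit_of_shifts:
 assumes u: "u \<in> H" and y: "y ---> l" and v: "v \<in> H" "AE x in L. (%n. u (x + y n)) ---> v x"
 shows "AE x in L. v x = u (x + l)"
proof -
 note [measurable] = H_meas[OF u]
 have "cube_avg k (%x. v x - u (x + l)) z = 0" for k z
 proof -
  let ?Q = "indicator (cube k z) :: 'n fn"
  have Q2: "L2 L (%x. ?Q (x + c))" "(LINT x|L. (?Q (x + c))^2) = cube_vol k" for c
   using integral_lborel_shift[of ?Q c] cube_integral by (auto simp: L2_def indicator_power2)
  have shift: "(LINT x|L. u (x + c)*?Q x) = (LINT x|L. ?Q (x + - c)*u x)" for c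
   using integral_lborel_shift(1)[of "%x. ?Q (x + - c)*u x" c] by (simp add: mult.commute)
  have "(LINT x|L. (u (x + c))^2) <= (Hnorm u)^2" for c using L2_le_Hnorm[of "%x. u (x + c)"] by (simp only: Hnorm_shift[OF u])
  hence "(%n. LINT x|L. u (x + y n)*?Q x) ---> (LINT x|L. v x*?Q x)"
   by (rule L2_weak_limit[OF H_L2[OF H_shift[OF u]] v(2) H_L2[OF v(1)] L2_cube])
  moreover have "(%n. LINT x|L. ?Q (x + - y n)*u x) ---> (LINT x|L. ?Q (x + - l)*u x)"
   by (rule L2_weak_limit[where C="cube_vol k", OF Q2(1) cube_indicator_tendsto[OF tendsto_minus[OF y]] Q2(1) H_L2[OF u]]) (simp only: Q2(2) order_refl)
  ultimately have "(LINT x|L. v x*?Q x) = (LINT x|L. u (x + l)*?Q x)" unfolding shift by (rule LIMSEQ_unique)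
  thus ?thesis using cube_avg_diff[OF H_L2[OF v(1)] H_L2[OF H_shift[OF u]], of k l z] by (simp add: cube_avg_def mult.commute)
 qed
 from H_zero_of_averages[OF H_diff[OF v(1) H_shift[OF u]] this] show ?thesis by eventually_elim simp
qed

lemma shift_tendsto:
 assumes u: "u \<in> H" and y: "y ---> l"
 shows "(%n. Hdist (%x. u (x + y n)) (%x. u (x + l))) ---> 0"
proof (rule ccontr)
 assume "~ ?thesis"
 then obtain e sigma where e: "e > 0" "strict_mono (sigma :: nat => nat)"
  "!!n. e <= dist (Hdist (%x. u (x + y (sigma n))) (%x. u (x + l))) 0" by (rule not_tendsto_subseq) blast
 obtain phi v where phi: "strict_mono (phi :: nat => nat)" "v \<in> H" "AE x in L. (%n. u (x + y (sigma (phi n)))) ---> v x"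
  "!!g. g \<in> H ==> (%n. Hinner (%x. u (x + y (sigma (phi n)))) g) ---> Hinner v g"
  by (rule rellich[of "%n x. u (x + y (sigma n))" "Hnorm u"]) (use u H_shift Hnorm_shift in auto)
 define t where "t n = y (sigma (phi n))" for n
 note phi' = phi(3,4)[folded t_def]
 have t: "t ---> l" unfolding t_def using LIMSEQ_subseq_LIMSEQ[OF y strict_mono_o[OF e(2) phi(1)]] by (simp add: o_def)
 have "Hinner v (%x. u (x + l)) = Hinner (%x. u (x + l)) (%x. u (x + l))"
  using H_meas[OF H_shift[OF u]] by (intro Hinner_AE_cong phi AE_limit_of_shifts[OF u t] phi' H_shift u)
 hence "(%n. (Hdist (%x. u (x + t n)) (%x. u (x + l)))^2 - (Hnorm u)^2) ---> - (Hnorm u)\<^sup>2"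
  using weak_limit_Hdist[OF H_shift[OF u] H_shift[OF u], of t l] phi'(2)[OF H_shift[OF u], of l] by (simp add: Hnorm_shift[OF u])
 from tendsto_add[OF this tendsto_const[of "(Hnorm u)^2"]]
 have "(%n. Hdist (%x. u (x + t n)) (%x. u (x + l))) ---> 0" by (intro tendsto_0_of_power2) simp
 from order_tendstoD(2)[OF this e(1)] obtain n where "Hdist (%x. u (x + t n)) (%x. u (x + l)) < e"
  by (auto simp: eventually_sequentially)
 thus False using e(3)[of "phi n"] Hnorm_nonneg by (simp add: t_def)
qed

end
context nonlinear
begin

subsection \<open>Palais--Smale sequences\<close>

definition dual_energy :: "('n fn => real) => 'n fn => real" where "dual_energy f h = (Hnorm h)^2/2 - f h"

lemma dual_energy_ge: assumes "f \<in> Hdual" "h \<in> H" shows "- ((dual_norm f)^2/2) <= dual_energy f h"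
 using dual_bound[OF assms] zero_le_power2[of "Hnorm h - dual_norm f"] by (simp add: dual_energy_def power2_diff abs_le_iff algebra_simps)

lemma dual_energy_add:
 assumes "f \<in> Hdual" "g \<in> H" "h \<in> H"
 shows "dual_energy f (%x. g x + h x) = dual_energy f g + (Hinner g h - f h) + (Hnorm h)^2/2"
 by (simp add: dual_energy_def Hnorm_power2_add dual_add assms add_divide_distrib)

lemma Hdist_le_dual_energy:
 assumes f: "f \<in> Hdual" and v: "v \<in> H" and w: "w \<in> H" and m: "!!h. h \<in> H ==> m <= dual_energy f h"
 shows "(Hdist v w)^2 <= 4*(dual_energy f v - m) + 4*(dual_energy f w - m)"
proof -
 let ?k = "%x. (1/2)*(v x + w x)"
 have "m <= dual_energy f ?k" by (intro m H_scale H_add v w)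
 moreover have "dual_energy f ?k = (Hnorm (%x. v x + w x))^2/8 - (f v + f w)/2"
  unfolding dual_energy_def dual_scale[OF f H_add[OF v w]] Hnorm_scale dual_add[OF f v w] by (simp add: power_divide)
 ultimately show ?thesis unfolding Hnorm_power2_diff[OF v w] dual_energy_def using Hnorm_power2_add[OF v w] by (simp add: field_simps)
qed

lemma dual_energy_minimizing_Cauchy:
 assumes f: "f \<in> Hdual" and m: "!!h. h \<in> H ==> m <= dual_energy f h"
  and g: "!!n. g n \<in> H" "!!n. dual_energy f (g n) < m + inverse (real (Suc n))" and e: "e > 0"
 shows "tail_le (%n k. Hdist (g n) (g k)) e"
proof -
 obtain n0 where n0: "inverse (real (Suc n0)) < e^2/8" using reals_Archimedean[of "e^2/8"] e by auto
 have close: "dual_energy f (g j) - m <= e^2/8" if "j >= n0" for j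
 proof -
  have "inverse (real (Suc j)) <= inverse (real (Suc n0))" using that by (intro le_imp_inverse_le) auto
  thus ?thesis using g(2)[of j] n0 by linarith
 qed
 have "Hdist (g n) (g k) <= e" if "n >= n0" "k >= n0" for n k
 proof (rule power2_le_imp_le)
  show "(Hdist (g n) (g k))^2 <= e^2" using Hdist_le_dual_energy[OF f g(1) g(1) m, of n k] close[OF that(1)] close[OF that(2)] by simp
 qed (use e in simp)
 thus ?thesis by blast
qed

lemma dual_energy_minimizer:
 assumes f: "f \<in> Hdual"
 obtains g where "g \<in> H" "!!h. h \<in> H ==> dual_energy f g <= dual_energy f h"
proof -
 define m where "m = Inf (dual_energy f ` H)"
 have bdd: "bdd_below (dual_energy f ` H)" using dual_energy_ge[OF f] by (intro bdd_belowI2) auto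
 have m: "m <= dual_energy f h" if "h \<in> H" for h unfolding m_def using bdd that by (intro cINF_lower) auto
 have "\<exists>h\<in>H. dual_energy f h < m + inverse (real (Suc n))" for n
  using cINF_less_iff[of H "dual_energy f" "m + inverse (real (Suc n))"] bdd H_zero by (auto simp: m_def)
 then obtain g where g: "!!n. g n \<in> H" "!!n. dual_energy f (g n) < m + inverse (real (Suc n))" by metis
 obtain G where G: "G \<in> H" "(%n. Hdist (g n) G) ---> 0"
  by (rule H_complete[OF g(1) dual_energy_minimizing_Cauchy[OF f m g]]) auto
 let ?b = "Hnorm G + dual_norm f"
 have "dual_energy f G <= m + inverse (real (Suc n)) + ?b*Hdist (g n) G" for n
 proof -
  let ?k = "%x. g n x - G x"
  have k: "?k \<in> H" by (intro H_diff g G)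
  have "dual_energy f (g n) = dual_energy f G + (Hinner G ?k - f ?k) + (Hnorm ?k)^2/2" using dual_energy_add[OF f G(1) k] by simp
  moreover have "- (Hnorm G*Hnorm ?k) <= Hinner G ?k" "f ?k <= dual_norm f*Hnorm ?k"
   using Hinner_Cauchy_Schwarz[OF G(1) k] dual_bound[OF f k] by (auto simp: abs_le_iff)
  moreover have "0 <= (Hnorm ?k)^2/2" by simp
  ultimately have "dual_energy f G <= dual_energy f (g n) + (Hnorm G*Hnorm ?k + dual_norm f*Hnorm ?k)" by linarith
  thus ?thesis using g(2)[of n] by (simp add: distrib_right)
 qed
 moreover have "(%n. m + inverse (real (Suc n)) + ?b*Hdist (g n) G) ---> m + 0 + ?b*0"
  by (intro tendsto_intros LIMSEQ_inverse_real_of_nat G(2))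
 ultimately have "dual_energy f G <= m" by (intro LIMSEQ_le_const) auto
 thus thesis using that[OF G(1)] m order_trans by blast
qed

lemma riesz:
 assumes f: "f \<in> Hdual"
 obtains g where "g \<in> H" "!!h. h \<in> H ==> Hinner g h = f h"
proof -
 obtain g where g: "g \<in> H" "!!h. h \<in> H ==> dual_energy f g <= dual_energy f h" using dual_energy_minimizer[OF f] by blast
 show thesis
 proof (rule that[OF g(1)])
  fix h assume h: "h \<in> H"
  have "0 <= 0 + 2*t*((Hinner g h - f h)/2) + t^2*((Hnorm h)^2/2)" for t
   using g(2)[OF H_add[OF g(1) H_scale[OF h, of t]]] dual_energy_add[OF f g(1) H_scale[OF h, of t]]
   by (simp add: Hinner_scale_right dual_scale[OF f h] Hnorm_scale power_mult_distrib right_diff_distrib diff_divide_distrib)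
  hence "((Hinner g h - f h)/2)^2 <= 0*((Hnorm h)^2/2)" by (rule discriminant_le_0) simp
  thus "Hinner g h = f h" by simp
 qed
qed

lemma dual_weak_tendsto:
 assumes f: "f \<in> Hdual" and z: "!!n. z n \<in> H" "w \<in> H" and lim: "!!g. g \<in> H ==> (%n. Hinner (z n) g) ---> Hinner w g"
 shows "(%n. f (z n)) ---> f w"
proof -
 obtain g where g: "g \<in> H" "!!h. h \<in> H ==> Hinner g h = f h" using riesz[OF f] by blast
 show ?thesis using lim[OF g(1)] g(2)[OF z(1)] g(2)[OF z(2)] by (simp add: Hinner_commute[of _ g])
qed

lemma I_deriv_dual: assumes "coefficient b" "f \<in> Hdual" "u \<in> H" shows "I_deriv b f u \<in> Hdual"
 using I_deriv_add[OF assms] I_deriv_scale[OF assms(2)] I_deriv_bound[OF assms order_refl] unfolding Hneg_def by blast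

lemma weak_limit_critical:
 assumes f: "coefficient b" "f \<in> Hdual" and Y: "!!n. Y n \<in> H" "!!n. Hnorm (Y n) <= T" and w: "w \<in> H" "AE x in L. (%n. Y n x) ---> w x"
  and lim: "!!g. g \<in> H ==> (%n. Hinner (Y n) g) ---> Hinner w g"
  and e: "e ---> 0" "!!n h. h \<in> H ==> abs (I_deriv b f (Y n) h) <= e n*Hnorm h"
 shows "\<forall>h\<in>H. I_deriv b f w h = 0"
proof
 fix h assume h: "h \<in> H"
 have "(%n. I_deriv b f (Y n) h) ---> I_deriv b f w h"
  unfolding I_deriv_def by (intro tendsto_intros lim h Bform_weak_limit[OF f(1) Y w h])
 moreover have "(%n. I_deriv b f (Y n) h) ---> 0"
  by (rule Lim_null_comparison[OF _ tendsto_mult_left_zero[OF e(1), of "Hnorm h"]]) (use e(2)[OF h] in simp)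
 ultimately show "I_deriv b f w h = 0" by (rule LIMSEQ_unique)
qed

end

context setting
begin

lemma Bint_nehari: assumes "small_dual f" "v \<in> Sigma" shows "Bint a (nehari f v) = (tmax f v)^2 - f (nehari f v)"
proof -
 have "I_deriv a f (nehari f v) (nehari f v) = 0"
  using I_deriv_scale[OF small_dualD(1)[OF assms(1)] Sigma_plusD(1)[OF assms(2)]] I_deriv_nehari_self[OF assms] by simp
 thus ?thesis by (simp add: I_deriv_def Bform_self Hnorm_power2[symmetric] Hnorm_nehari[OF assms])
qed

lemma palais_smale_splitting:
 assumes f: "small_dual f" and v: "!!n. v n \<in> Sigma" "!!n. tmax f (v n) <= T" and J: "(%n. J f (v n)) ---> c"
  and w: "w \<in> H" "stationary f w" "AE x in L. (%n. nehari f (v n) x) ---> w x"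
  and lim: "!!g. g \<in> H ==> (%n. Hinner (nehari f (v n)) g) ---> Hinner w g"
 shows "(%n. (Hdist (nehari f (v n)) w)^2) ---> (c - I f w)/kappa"
  "(%n. (Hdist (nehari f (v n)) w)^2 - Bint one (%x. nehari f (v n) x - w x)) ---> 0"
proof -
 define Y where "Y n = nehari f (v n)" for n
 define Z where "Z n = (%x. Y n x - w x)" for n
 note fH = small_dualD(1)[OF f] and crit = critical_energy[OF small_dualD(1)[OF f] w(1,2)]
 have Y: "Y n \<in> H" "Hnorm (Y n) = tmax f (v n)" "Hnorm (Y n) <= T" for n
  using H_nehari[OF v(1)] Hnorm_nehari[OF f v(1)] v(2) by (auto simp: Y_def)
 have Z: "Z n \<in> H" "Hnorm (Z n) <= T + Hnorm w" for n
  using H_diff[OF Y(1) w(1)] Hnorm_diff_le[OF Y(1) w(1), of n] Y(3)[of n] by (auto simp: Z_def)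
 have aeY: "AE x in L. (%n. Y n x) ---> w x" and limY: "!!g. g \<in> H ==> (%n. Hinner (Y n) g) ---> Hinner w g" using w(3) lim by (simp_all add: Y_def)
 have aeZ: "AE x in L. (%n. Z n x) ---> 0" using aeY by eventually_elim (simp add: Z_def LIM_zero)
 have norm: "(%n. (Hnorm (Z n))^2 - (tmax f (v n))^2) ---> - (Hnorm w)\<^sup>2"
  using weak_limit_Hdist[OF Y(1) w(1) limY[OF w(1)]] by (simp add: Z_def Y(2))
 have dual: "(%n. f (Y n)) ---> f w" by (rule dual_weak_tendsto[OF fH Y(1) w(1) limY])
 have split: "(%n. Bint a (Y n) - Bint a (Z n)) ---> Bint a w" unfolding Z_def by (rule brezis_lieb[OF a_coef Y(1,3) w(1) aeY])
 have vanish: "(%n. Bint one (Z n) - Bint a (Z n)) ---> 0" by (rule coefficient_defect_vanishes[OF a_coef one_minus_a_integrable Z aeZ])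
 have "(%n. ((Hnorm (Z n))^2 - (tmax f (v n))^2) + (Bint a (Y n) - Bint a (Z n)) + f (Y n) - (Bint one (Z n) - Bint a (Z n)))
  ---> - (Hnorm w)\<^sup>2 + Bint a w + f w - 0" by (intro tendsto_intros norm split dual vanish)
 thus "(%n. (Hdist (nehari f (v n)) w)^2 - Bint one (%x. nehari f (v n) x - w x)) ---> 0"
  unfolding crit(1) by (simp add: Y_def Z_def Bint_nehari[OF f v(1)])
 have "(%n. (J f (v n) + p/(p + 1)*f (Y n))/kappa + ((Hnorm (Z n))^2 - (tmax f (v n))^2)) ---> (c + p/(p + 1)*f w)/kappa + - (Hnorm w)\<^sup>2"
  using kappa_pos by (intro tendsto_intros J dual norm) auto
 moreover have "(J f (v n) + p/(p + 1)*f (Y n))/kappa = (tmax f (v n))^2" for n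
  unfolding J_eq(5)[OF f v(1)] Y_def dual_scale[OF fH Sigma_plusD(1)[OF v(1)]] using kappa_pos by simp
 moreover have "(c + p/(p + 1)*f w)/kappa + - (Hnorm w)\<^sup>2 = (c - I f w)/kappa" unfolding crit(2) using kappa_pos by (simp add: field_simps)
 ultimately show "(%n. (Hdist (nehari f (v n)) w)^2) ---> (c - I f w)/kappa" by (simp add: Y_def Z_def)
qed

lemma remainder_vanishes:
 assumes Z: "!!n. Z n \<in> H" and l: "(%n. (Hnorm (Z n))^2) ---> l" "l < gs_norm^2" and bal: "(%n. (Hnorm (Z n))^2 - Bint one (Z n)) ---> 0"
 shows "(%n. Hnorm (Z n)) ---> 0"
proof -
 have l0: "l >= 0" using l(1) by (rule LIMSEQ_le_const) auto
 have "l = 0"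
 proof (rule ccontr)
  assume "l ~= 0"
  hence pos: "l > 0" using l0 by simp
  have "(%n. Bint one (Z n)) ---> l" using tendsto_diff[OF l(1) bal] by simp
  moreover have "(%n. Bmax*((Hnorm (Z n))^2) powr ((p + 1)/2)) ---> Bmax*l powr ((p + 1)/2)" using pos by (intro tendsto_intros l(1)) auto
  ultimately have "l <= Bmax*l powr ((p + 1)/2)" using Bint_one_le_Bmax_power2[OF Z] by (intro LIMSEQ_le) auto
  also have "... = l*(Bmax*l powr ((p - 1)/2))" using powr_add[of l "(p - 1)/2" 1] pos by (simp add: field_simps)
  also have "l powr ((p - 1)/2) < (gs_norm^2) powr ((p - 1)/2)" using pos l(2) p_gt_1 by (intro powr_less_mono2) auto
  also have "(gs_norm^2) powr ((p - 1)/2) = gs_norm powr (p - 1)" using gs_norm_pos by (simp add: powr_powr diff_divide_distrib flip: powr_numeral)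
  finally show False using pos Bmax_pos gs_norm_powr by (simp add: mult.commute)
 qed
 thus ?thesis using l(1) by (intro tendsto_0_of_power2) simp
qed

lemma nehari_limit:
 assumes f: "small_dual f" and v: "!!n. v n \<in> Sigma" and w: "w \<in> H" and lim: "(%n. Hdist (nehari f (v n)) w) ---> 0"
 shows "normalized w \<in> Sigma" "(%n. Hdist (v n) (normalized w)) ---> 0" "nehari f (normalized w) = w"
proof -
 note Y = H_nehari[OF v] Hnorm_nehari[OF f v]
 have lower: "tmax_min^2/2 <= Bint a (nehari f (v n))" for n
 proof -
  have t: "0 < tmax f (v n)" "tmax_min <= tmax f (v n)" using tmax_max(1)[OF f v] tmax_ge[OF f v] by auto
  have "tmax_min^2/2 <= (tmax f (v n))^2*(1/2)" using t(2) tmax_min_pos by (simp add: power_mono)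
  also have "... <= (tmax f (v n))^2*(Bint a (v n)*tmax f (v n) powr (p - 1))" using Bint_tmax_powr(1)[OF f v] by (intro mult_left_mono) auto
  also have "... = Bint a (nehari f (v n))" unfolding Bint_scale[OF less_imp_le[OF t(1)]] using t(1) by (simp add: powr_Suc_eq_mult_power2)
  finally show ?thesis .
 qed
 have "(%n. Bint a (nehari f (v n))) ---> Bint a w" by (rule Hdist_tendsto(2)[OF Y(1) w lim a_coef])
 hence "tmax_min^2/2 <= Bint a w" using lower by (intro LIMSEQ_le_const) auto
 hence "Bint a w > 0" using zero_less_power[OF tmax_min_pos, of 2] by linarith
 note S = normalized_Sigma[OF w this]
 show "normalized w \<in> Sigma" by (rule S(2))
 have "normalized (nehari f (v n)) = v n" for n using tmax_max(1)[OF f v, of n] by (simp add: normalized_def Y(2))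
 thus vw: "(%n. Hdist (v n) (normalized w)) ---> 0" using Hdist_normalized_tendsto[OF Y(1) w lim S(1)] by simp
 have "tmax f (normalized w) = Hnorm w"
  using LIMSEQ_unique[OF tmax_tendsto(1)[OF f v S(2) vw]] Hdist_tendsto(1)[OF Y(1) w lim] by (simp add: Y(2))
 thus "nehari f (normalized w) = w" using S(1) by (simp add: normalized_def)
qed

lemma palais_smale:
 assumes f: "small_dual f" and v: "!!n. v n \<in> Sigma" and J: "(%n. J f (v n)) ---> c"
  and low: "!!u. u \<in> H ==> stationary f u ==> c < I f u + gs_energy"
  and e: "e ---> 0" "!!n h. h \<in> H ==> abs (I_deriv a f (nehari f (v n)) h) <= e n*Hnorm h"
 obtains phi w where "strict_mono (phi :: nat => nat)" "w \<in> Sigma" "(%n. Hdist (v (phi n)) w) ---> 0"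
  "stationary f (nehari f w)" "J f w = c"
proof -
 obtain M where M: "!!n. J f (v n) <= M" using convergent_imp_Bseq[of "%n. J f (v n)"] J by (auto simp: convergent_def Bseq_def abs_le_iff)
 note T = tmax_le[OF f v M]
 obtain phi u where phi: "strict_mono (phi :: nat => nat)" and u: "u \<in> H" "AE x in L. (%n. nehari f (v (phi n)) x) ---> u x"
  and lim: "!!g. g \<in> H ==> (%n. Hinner (nehari f (v (phi n))) g) ---> Hinner u g"
  by (rule rellich[of "%n. nehari f (v n)" "tmax_bound M"]) (use H_nehari Hnorm_nehari f v T in auto)
 have Y: "nehari f (v (phi n)) \<in> H" "Hnorm (nehari f (v (phi n))) <= tmax_bound M" for n using H_nehari[OF v] Hnorm_nehari[OF f v] T by auto
 have "(%n. e (phi n)) ---> 0" using LIMSEQ_subseq_LIMSEQ[OF e(1) phi] by (simp add: o_def)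
 note crit = weak_limit_critical[OF a_coef small_dualD(1)[OF f] Y u lim this e(2)]
 have Jphi: "(%n. J f (v (phi n))) ---> c" using LIMSEQ_subseq_LIMSEQ[OF J phi] by (simp add: o_def)
 note split = palais_smale_splitting[OF f v T Jphi u(1) crit u(2) lim]
 have "(c - I f u)/kappa < gs_norm^2" using low[OF u(1) crit] kappa_pos by (simp add: gs_energy_eq field_simps)
 hence "(%n. Hdist (nehari f (v (phi n))) u) ---> 0" by (intro remainder_vanishes[OF H_diff[OF Y(1) u(1)] split(1) _ split(2)])
 note lim = nehari_limit[OF f v u(1) this]
 show thesis using that[OF phi lim(1,2)] crit LIMSEQ_unique[OF tmax_tendsto(2)[OF f v lim(1,2)] Jphi] by (simp add: lim(3))
qed

end

context frac_sobolev
begin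

subsection \<open>A descent step on the unit sphere\<close>

definition sphere_step :: "real => 'n fn => 'n fn => 'n fn" where "sphere_step t g v = normalized (%x. v x + (- t)*g x)"

lemma tangent_step:
 assumes v: "v \<in> H" "Hnorm v = 1" and g: "g \<in> H" "Hinner g v = 0"
 shows "(Hnorm (%x. v x + (- t)*g x))^2 = 1 + (t*Hnorm g)^2" "1 <= Hnorm (%x. v x + (- t)*g x)"
proof -
 show q: "(Hnorm (%x. v x + (- t)*g x))^2 = 1 + (t*Hnorm g)^2"
  unfolding Hnorm_power2_add[OF v(1) H_scale[OF g(1)]] Hnorm_scale Hinner_scale_right using g(2) by (simp add: v Hinner_commute[of v] power_mult_distrib)
 show "1 <= Hnorm (%x. v x + (- t)*g x)"
 proof (rule power2_le_imp_le[OF _ Hnorm_nonneg])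
  show "1^2 <= (Hnorm (%x. v x + (- t)*g x))^2" unfolding q by simp
 qed
qed

lemma sphere_step:
 assumes v: "v \<in> H" "Hnorm v = 1" and g: "g \<in> H" "Hinner g v = 0"
 shows "sphere_step t g v \<in> H" "Hnorm (sphere_step t g v) = 1" "Hdist (sphere_step t g v) v <= abs t*Hnorm g"
  "0 <= t ==> t*Hnorm g <= 1 ==> Hinner g (%x. sphere_step t g v x - v x) <= - (t*(Hnorm g)^2/2)"
proof -
 define X where "X = (%x. v x + (- t)*g x)"
 define q where "q = Hnorm X"
 have X: "X \<in> H" unfolding X_def by (rule H_add[OF v(1) H_scale[OF g(1)]])
 note norm = tangent_step[OF v g, of t, folded X_def, folded q_def]
 have step: "sphere_step t g v = (%x. (1/q)*X x)" by (simp add: sphere_step_def normalized_def X_def q_def)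
 show w: "sphere_step t g v \<in> H" "Hnorm (sphere_step t g v) = 1"
  using H_normalized[OF X] Hnorm_normalized[of X] norm(2) by (auto simp: sphere_step_def X_def q_def)
 have inner: "Hinner h (sphere_step t g v) = (1/q)*(Hinner h v - t*Hinner h g)" if "h \<in> H" for h
  unfolding step Hinner_scale_right X_def Hinner_add_right[OF v(1) H_scale[OF g(1)] that] by simp
 have "(Hdist (sphere_step t g v) v)^2 = 2 - 2*Hinner v (sphere_step t g v)"
  unfolding Hnorm_power2_diff[OF w(1) v(1)] by (simp add: w v Hinner_commute[of v])
 also have "... = 2*((q - 1)/q)"
  unfolding inner[OF v(1)] using g(2) v(2) norm(2) Hinner_commute[of v g] by (simp add: Hnorm_power2[symmetric] diff_divide_distrib)
 also have "... <= 2*((q - 1)/1)" using norm(2) by (intro mult_left_mono divide_left_mono) auto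
 also have "... <= (q + 1)*(q - 1)" unfolding div_by_1 using norm(2) by (intro mult_right_mono) auto
 also have "... = (abs t*Hnorm g)^2" using norm(1) by (simp add: power_mult_distrib) (simp add: power2_eq_square algebra_simps)
 finally show "Hdist (sphere_step t g v) v <= abs t*Hnorm g" by (rule power2_le_imp_le) (simp add: Hnorm_nonneg)
 assume t: "0 <= t" "t*Hnorm g <= 1"
 have "(t*Hnorm g)^2 <= 1" using t Hnorm_nonneg by (intro power_le_one) auto
 hence "q^2 <= 2^2" unfolding norm(1) by simp
 hence "q <= 2" by (rule power2_le_imp_le) simp
 hence "t*(Hnorm g)^2/2 <= t*(Hnorm g)^2/q" using norm(2) t by (intro divide_left_mono) auto
 thus "Hinner g (%x. sphere_step t g v x - v x) <= - (t*(Hnorm g)^2/2)"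
  unfolding Hinner_diff_right[OF w(1) v(1) g(1)] inner[OF g(1)] g(2) by (simp add: Hnorm_power2)
qed

lemma sphere_step_0: "Hnorm v = 1 ==> sphere_step 0 g v = v" by (simp add: sphere_step_def normalized_def)

lemma sphere_step_tendsto:
 assumes v: "!!n. v n \<in> H" "w \<in> H" "Hnorm w = 1" "(%n. Hdist (v n) w) ---> 0"
  and g: "!!n. g n \<in> H" "h \<in> H" "Hinner h w = 0" "(%n. Hdist (g n) h) ---> 0" and t: "t ---> r"
 shows "(%n. Hdist (sphere_step (t n) (g n) (v n)) (sphere_step r h w)) ---> 0"
 unfolding sphere_step_def
proof (intro Hdist_normalized_tendsto Hdist_add_tendsto Hdist_scale_tendsto v g tendsto_minus t H_add H_scale)
 show "Hnorm (%x. w x + - r*h x) > 0" using tangent_step(2)[OF v(2,3) g(2,3), of r] by linarith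
qed

end

context setting
begin

definition grad :: "('n fn => real) => 'n fn => 'n fn" where
 "grad f v = (SOME g. g \<in> H & (\<forall>h\<in>H. Hinner g h = I_deriv a f (nehari f v) h))"

definition descent_step :: "('n fn => real) => real => 'n fn => 'n fn" where "descent_step f t v = sphere_step t (grad f v) v"

lemma grad:
 assumes "f \<in> Hdual" "v \<in> Sigma"
 shows "grad f v \<in> H" "h \<in> H ==> Hinner (grad f v) h = I_deriv a f (nehari f v) h"
proof -
 have "\<exists>g. g \<in> H & (\<forall>h\<in>H. Hinner g h = I_deriv a f (nehari f v) h)"
  by (rule riesz[OF I_deriv_dual[OF a_coef assms(1) H_nehari[OF assms(2)]]]) blast
 from someI_ex[OF this] show "grad f v \<in> H" "h \<in> H ==> Hinner (grad f v) h = I_deriv a f (nehari f v) h" by (auto simp: grad_def)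
qed

lemma Hinner_grad_self: assumes "small_dual f" "v \<in> Sigma" shows "Hinner (grad f v) v = 0"
 using grad(2)[OF small_dualD(1)[OF assms(1)] assms(2) Sigma_plusD(1)[OF assms(2)]] I_deriv_nehari_self[OF assms] by simp

definition grad_bound :: "real => real" where "grad_bound T = T + 3*C_sob*T powr p + dual_max"

lemma grad_bound_pos: "T > 0 ==> grad_bound T > 0" using C_sob_pos dual_max_pos by (simp add: grad_bound_def add_pos_nonneg)

lemma Hnorm_grad_le: assumes f: "small_dual f" and v: "v \<in> Sigma" "tmax f v <= T" shows "Hnorm (grad f v) <= grad_bound T"
proof (rule Hnorm_le_of_Hinner_self)
 note fH = small_dualD(1)[OF f] and T = less_le_trans[OF tmax_max(1)[OF f v(1)] v(2)]
 note g = grad(1)[OF fH v(1)]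
 have "Hinner (grad f v) (grad f v) <= (T + 3*C_sob*T powr p + dual_norm f)*Hnorm (grad f v)"
  using I_deriv_bound[OF a_coef fH H_nehari[OF v(1)] _ g] Hnorm_nehari[OF f v(1)] v(2) by (simp add: grad(2)[OF fH v(1) g] abs_le_iff)
 also have "... <= grad_bound T*Hnorm (grad f v)" unfolding grad_bound_def using small_dualD(2)[OF f] Hnorm_nonneg by (intro mult_right_mono) auto
 finally show "Hinner (grad f v) (grad f v) <= grad_bound T*Hnorm (grad f v)" .
 show "grad_bound T >= 0" using grad_bound_pos[OF T] by simp
qed

lemma grad_tendsto:
 assumes f: "small_dual f" and v: "!!n. v n \<in> Sigma" and w: "w \<in> Sigma" and lim: "(%n. Hdist (v n) w) ---> 0"
 shows "(%n. Hdist (grad f (v n)) (grad f w)) ---> 0"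
proof -
 note fH = small_dualD(1)[OF f] and tlim = tmax_tendsto(1)[OF f v w lim]
 obtain M where M: "!!n. tmax f (v n) <= M" using convergent_imp_Bseq[of "%n. tmax f (v n)"] tlim by (auto simp: convergent_def Bseq_def abs_le_iff)
 define D where "D = deriv_lip (M + tmax f w)"
 have bound: "Hdist (grad f (v n)) (grad f w) <= D*Hdist (nehari f (v n)) (nehari f w)" for n
 proof (rule Hnorm_le_of_Hinner_self)
  let ?k = "%x. grad f (v n) x - grad f w x"
  have k: "?k \<in> H" by (intro H_diff grad fH v w)
  have "Hinner ?k ?k = I_deriv a f (nehari f (v n)) ?k - I_deriv a f (nehari f w) ?k"
   by (simp add: Hinner_diff_left[OF grad(1)[OF fH v] grad(1)[OF fH w] k] grad(2)[OF fH v k] grad(2)[OF fH w k])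
  also have "... <= deriv_lip (tmax f (v n) + tmax f w)*Hdist (nehari f (v n)) (nehari f w)*Hnorm ?k"
   using I_deriv_lipschitz[OF a_coef fH H_nehari[OF v[of n], of f] H_nehari[OF w, of f] k] by (simp add: Hnorm_nehari[OF f v] Hnorm_nehari[OF f w] abs_le_iff)
  also have "... <= D*Hdist (nehari f (v n)) (nehari f w)*Hnorm ?k" unfolding D_def
   using M[of n] tmax_max(1)[OF f v[of n]] tmax_max(1)[OF f w] Hnorm_nonneg by (intro mult_right_mono deriv_lip_mono) auto
  finally show "Hinner ?k ?k <= D*Hdist (nehari f (v n)) (nehari f w)*Hnorm ?k" .
  show "D*Hdist (nehari f (v n)) (nehari f w) >= 0" using deriv_lip_pos[of "M + tmax f w"] Hnorm_nonneg by (simp add: D_def)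
 qed
 have "(%n. D*Hdist (nehari f (v n)) (nehari f w)) ---> 0"
  using v w Sigma_plusD(1) by (intro tendsto_mult_right_zero Hdist_scale_tendsto tlim lim) auto
 thus ?thesis by (rule Lim_null_comparison[rotated]) (use bound Hnorm_nonneg in simp)
qed

lemma descent_step_tendsto:
 assumes f: "small_dual f" and v: "!!n. v n \<in> Sigma" and w: "w \<in> Sigma" and lim: "(%n. Hdist (v n) w) ---> 0" "t ---> r"
 shows "(%n. Hdist (descent_step f (t n) (v n)) (descent_step f r w)) ---> 0"
 unfolding descent_step_def using Sigma_plusD v w small_dualD(1)[OF f]
 by (intro sphere_step_tendsto grad_tendsto Hinner_grad_self grad f lim) auto

lemma descent_step_0: "v \<in> Sigma ==> descent_step f 0 v = v" by (simp add: descent_step_def sphere_step_0 Sigma_plusD)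

definition descent_const :: "real => real" where "descent_const T = J_taylor_const (6 powr (1/(p - 1))*T)"

definition descent_time :: "real => real" where
 "descent_time T = min (min (Sigma_radius T) 1/grad_bound T) (tmax_min/(4*descent_const T))"

lemma descent_const_pos: "T > 0 ==> descent_const T > 0" unfolding descent_const_def by (intro J_taylor_const_pos mult_pos_pos) auto

lemma descent_time:
 assumes T: "T > 0"
 shows "descent_time T > 0" "descent_time T*grad_bound T <= min (Sigma_radius T) 1" "descent_const T*descent_time T <= tmax_min/4"
proof -
 note pos = grad_bound_pos[OF T] descent_const_pos[OF T] Sigma_radius_pos[OF T]
 show "descent_time T > 0" using pos tmax_min_pos by (simp add: descent_time_def)
 have "descent_time T*grad_bound T <= (min (Sigma_radius T) 1/grad_bound T)*grad_bound T"
  using pos by (intro mult_right_mono) (auto simp: descent_time_def)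
 thus "descent_time T*grad_bound T <= min (Sigma_radius T) 1" using pos by simp
 have "descent_const T*descent_time T <= descent_const T*(tmax_min/(4*descent_const T))"
  using pos by (intro mult_left_mono) (auto simp: descent_time_def)
 thus "descent_const T*descent_time T <= tmax_min/4" using pos by simp
qed

lemma descent:
 assumes f: "small_dual f" and v: "v \<in> Sigma" "tmax f v <= T" and t: "0 <= t" "t <= descent_time T"
 shows "descent_step f t v \<in> Sigma" "J f (descent_step f t v) <= J f v - tmax_min/4*t*(Hnorm (grad f v))^2"
proof -
 define g where "g = grad f v"
 define w where "w = descent_step f t v"
 have T: "T > 0" using tmax_max(1)[OF f v(1)] v(2) by linarith
 have gH: "g \<in> H" "Hinner g v = 0" using grad(1)[OF small_dualD(1)[OF f] v(1)] Hinner_grad_self[OF f v(1)] by (auto simp: g_def)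
 note step = sphere_step[OF Sigma_plusD[OF v(1)] gH, of t, folded descent_step_def[of f t v, folded g_def], folded w_def]
 have "t*Hnorm g <= descent_time T*grad_bound T"
  using t Hnorm_grad_le[OF f v] Hnorm_nonneg descent_time(1)[OF T] by (intro mult_mono) (auto simp: g_def)
 hence tg: "t*Hnorm g <= Sigma_radius T" "t*Hnorm g <= 1" using descent_time(2)[OF T] by auto
 have dist: "Hdist w v <= t*Hnorm g" using step(3) t by simp
 note near = J_taylor_near[OF f v step(1,2) order_trans[OF dist tg(1)], folded descent_const_def]
 show "descent_step f t v \<in> Sigma" using near(1) by (simp add: w_def)
 have "(Hdist w v)^2 <= (t*Hnorm g)^2" by (rule power_mono[OF dist Hnorm_nonneg])
 hence "descent_const T*(Hdist w v)^2 <= descent_const T*(t*Hnorm g)^2" using descent_const_pos[OF T] by (intro mult_left_mono) auto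
 also have "... = (descent_const T*t)*(t*(Hnorm g)^2)" by (simp add: power2_eq_square mult_ac)
 also have "... <= tmax_min/4*(t*(Hnorm g)^2)"
 proof (rule mult_right_mono)
  show "descent_const T*t <= tmax_min/4" using descent_time(3)[OF T] mult_left_mono[OF t(2), of "descent_const T"] descent_const_pos[OF T] by linarith
 qed (use t in simp)
 finally have second: "descent_const T*(Hdist w v)^2 <= tmax_min/4*(t*(Hnorm g)^2)" .
 have "J_deriv f v (%x. w x - v x) = tmax f v * Hinner g (%x. w x - v x)"
  using grad(2)[OF small_dualD(1)[OF f] v(1) H_diff[OF step(1) Sigma_plusD(1)[OF v(1)]]] by (simp add: J_deriv_def g_def)
 also have "... <= tmax f v * (- (t*(Hnorm g)^2/2))" using step(4)[OF t(1) tg(2)] tmax_max(1)[OF f v(1)] by (intro mult_left_mono) auto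
 also have "... <= tmax_min*(- (t*(Hnorm g)^2/2))" using tmax_ge[OF f v(1)] t(1) by (intro mult_right_mono_neg) auto
 finally have "J_deriv f v (%x. w x - v x) <= - (tmax_min*(t*(Hnorm g)^2)/2)" by simp
 hence "J f w <= J f v - tmax_min/4*(t*(Hnorm g)^2)" using near(2) second by linarith
 thus "J f (descent_step f t v) <= J f v - tmax_min/4*t*(Hnorm (grad f v))^2" by (simp add: w_def g_def mult.assoc)
qed

text \<open>The energy drop along one descent step bounds the gradient from above.\<close>
lemma palais_smale_of_descent:
 assumes f: "small_dual f" and v: "!!n. v n \<in> Sigma" "!!n. tmax f (v n) <= T" and t: "0 < t" "t <= descent_time T"
  and J: "(%n. J f (v n)) ---> c" "(%n. J f (descent_step f t (v n))) ---> c"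
  and low: "!!u. u \<in> H ==> stationary f u ==> c < I f u + gs_energy"
 obtains phi w where "strict_mono (phi :: nat => nat)" "w \<in> Sigma" "(%n. Hdist (v (phi n)) w) ---> 0"
  "stationary f (nehari f w)" "J f w = c"
proof -
 define r where "r = tmax_min/4*t"
 have r: "r > 0" using t tmax_min_pos by (simp add: r_def)
 have "(%n. (J f (v n) - J f (descent_step f t (v n)))/r) ---> (c - c)/r" using r by (intro tendsto_intros J) auto
 moreover have "(Hnorm (grad f (v n)))^2 <= (J f (v n) - J f (descent_step f t (v n)))/r" for n
  using descent(2)[OF f v(1)[of n] v(2) _ t(2), folded r_def] t(1) r by (simp add: field_simps)
 ultimately have "(%n. (Hnorm (grad f (v n)))^2) ---> 0" by (intro Lim_null_comparison[of "%n. (Hnorm (grad f (v n)))^2"]) auto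
 hence e: "(%n. Hnorm (grad f (v n))) ---> 0" by (rule tendsto_0_of_power2)
 have "abs (I_deriv a f (nehari f (v n)) h) <= Hnorm (grad f (v n))*Hnorm h" if "h \<in> H" for n h
  using Hinner_Cauchy_Schwarz[OF grad(1)[OF small_dualD(1)[OF f] v(1)] that] grad(2)[OF small_dualD(1)[OF f] v(1) that] by simp
 from palais_smale[OF f v(1) J(1) low e this] show thesis using that by blast
qed

end

subsection \<open>Linking the spheres of low energy\<close>

lemma sphere_map_not_nullhomotopic:
 fixes c :: "'a::euclidean_space" assumes R: "R > 0"
 shows "~ homotopic_with_canon (%_. True) (sphere 0 R) (- {0}) id (%_. c)"
proof
 let ?K = "sphere (0 :: 'a) R" and ?r = "%x :: 'a. (R/norm x) *\<^sub>R x"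
 assume "homotopic_with_canon (%_. True) ?K (- {0}) id (%_. c)"
 hence "homotopic_with_canon (%_. True) ?K ?K (?r \<circ> id) (?r \<circ> (%_. c))"
  by (rule homotopic_with_compose_continuous_left) (use R in \<open>auto intro!: continuous_intros\<close>)
 hence "homotopic_with_canon (%_. True) ?K ?K id (%_. ?r c)" by (rule homotopic_with_eq) (use R in auto)
 hence "contractible ?K" unfolding contractible_def by blast
 thus False using R by (simp add: contractible_sphere)
qed

lemma homotopic_nonzero:
 fixes g h :: "'a::topological_space => 'b::real_inner"
 assumes gh: "continuous_on S g" "continuous_on S h" and pos: "!!y. y \<in> S ==> g y \<bullet> g y > 0" "!!y. y \<in> S ==> h y \<bullet> g y > 0"
 shows "homotopic_with_canon (%_. True) S (- {0}) g h"
proof (rule homotopic_with_linear[OF gh])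
 fix y assume y: "y \<in> S"
 show "closed_segment (g y) (h y) \<subseteq> - {0}"
 proof
  fix z assume "z \<in> closed_segment (g y) (h y)"
  then obtain t where t: "0 <= t" "t <= 1" "z = (1 - t) *\<^sub>R g y + t *\<^sub>R h y" by (auto simp: closed_segment_def)
  hence "z \<bullet> g y > 0" unfolding t(3) inner_add_left inner_scaleR_left using pos[OF y]
   by (cases "t = 0") (auto intro!: add_nonneg_pos)
  thus "z \<in> - {0}" by auto
 qed
qed

lemma homotopic_near_constant:
 fixes g :: "'a::topological_space => 'b::real_normed_vector"
 assumes g: "continuous_on S g" and near: "!!y. y \<in> S ==> norm (g y - c) < norm c"
 shows "homotopic_with_canon (%_. True) S (- {0}) g (%_. c)"
proof (rule homotopic_with_linear[OF g continuous_on_const])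
 fix y assume y: "y \<in> S"
 show "closed_segment (g y) c \<subseteq> - {0}"
 proof
  fix z assume "z \<in> closed_segment (g y) c"
  hence "norm (z - c) <= norm (g y - c)" using segment_bound(2)[of z "g y" c] by (simp add: norm_minus_commute)
  thus "z \<in> - {0}" using near[OF y] by auto
 qed
qed

locale perturbed = setting s N2s n_type p a gs for s N2s and n_type :: "'n::finite itself" and p a gs +
 fixes f :: "'n fn => real" and u :: "'n fn" and R :: real
 assumes f_small: "small_dual f" and u_H: "u \<in> H"
  and lowest: "!!u'. u' \<in> H ==> stationary f u' ==> I f u <= I f u'"
  and low_barycentre: "!!v. v \<in> Sigma ==> J f v < I f u + gs_energy ==> barycentre v ~= 0"
  and R_pos: "R > 0"
  and family: "!!y. norm y = R ==> low_sum f u y & barycentre (normalized (add_gs u y)) \<bullet> y > 0"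
begin

definition low_path :: "real^'n => 'n fn" where "low_path y = normalized (add_gs u y)"

definition path_level :: real where "path_level = (SUP y\<in>sphere 0 R. J f (low_path y))"

definition low_set :: "'n fn set" where "low_set = {v \<in> Sigma. J f v <= path_level}"

lemma low_path:
 assumes "y \<in> sphere 0 R"
 shows "low_path y \<in> Sigma" "J f (low_path y) < I f u + gs_energy" "barycentre (low_path y) \<bullet> y > 0"
 using family[of y] assms by (auto simp: low_path_def)

lemma low_path_tendsto: assumes "y ---> l" "l \<in> sphere 0 R" shows "(%n. Hdist (low_path (y n)) (low_path l)) ---> 0"
 unfolding low_path_def
proof (intro Hdist_normalized_tendsto Hdist_add_tendsto u_H gs_at_H H_add)
 show "(%n. Hdist (gs_at (y n)) (gs_at l)) ---> 0" unfolding gs_at_shift by (rule shift_tendsto[OF gs_H tendsto_minus[OF assms(1)]])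
qed (use family assms(2) in \<open>auto simp: Hnorm_zero\<close>)

lemma J_low_path_continuous: "continuous_on (sphere 0 R) (%y. J f (low_path y))"
 unfolding continuous_on_sequentially o_def
 by (auto intro!: tmax_tendsto(2)[OF f_small] low_path(1) low_path_tendsto)

lemma path_level: "y \<in> sphere 0 R ==> J f (low_path y) <= path_level" and path_level_less: "path_level < I f u + gs_energy"
proof -
 have "sphere (0 :: real^'n) R ~= {}" using R_pos by simp
 then obtain ym where ym: "ym \<in> sphere 0 R" "!!y. y \<in> sphere 0 R ==> J f (low_path y) <= J f (low_path ym)"
  using continuous_attains_sup[OF compact_sphere _ J_low_path_continuous] by blast
 have eq: "path_level = J f (low_path ym)" unfolding path_level_def using ym by (intro cSup_eq_maximum) auto
 show "y \<in> sphere 0 R ==> J f (low_path y) <= path_level" unfolding eq by (rule ym(2))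
 show "path_level < I f u + gs_energy" unfolding eq by (rule low_path(2)[OF ym(1)])
qed

lemma low_path_low_set: "y \<in> sphere 0 R ==> low_path y \<in> low_set" using low_path(1) path_level by (simp add: low_set_def)

lemma low_setD: "v \<in> low_set ==> v \<in> Sigma" "v \<in> low_set ==> J f v <= path_level" "v \<in> low_set ==> barycentre v ~= 0"
 using low_barycentre[of v] path_level_less by (auto simp: low_set_def)

lemma tmax_low_set: "v \<in> low_set ==> tmax f v <= tmax_bound path_level" using tmax_le[OF f_small] low_setD by blast

definition flow_time :: real where "flow_time = descent_time (tmax_bound path_level)"

definition flow :: "nat => 'n fn => 'n fn" where "flow n = (descent_step f flow_time ^^ n)"

lemma flow_Suc: "flow (Suc n) v = descent_step f flow_time (flow n v)" by (simp add: flow_def)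

lemma flow_time_pos: "flow_time > 0" unfolding flow_time_def by (intro descent_time) (simp add: tmax_bound_def)

lemma descent_low_set:
 assumes "v \<in> low_set" "0 <= t" "t <= flow_time"
 shows "descent_step f t v \<in> low_set" "J f (descent_step f t v) <= J f v"
proof -
 note D = descent[OF f_small low_setD(1)[OF assms(1)] tmax_low_set[OF assms(1)] assms(2,3)[unfolded flow_time_def]]
 have "tmax_min/4*t*(Hnorm (grad f v))^2 >= 0" using tmax_min_pos assms(2) by simp
 thus "J f (descent_step f t v) <= J f v" using D(2) by linarith
 thus "descent_step f t v \<in> low_set" using D(1) low_setD(2)[OF assms(1)] by (simp add: low_set_def)
qed

lemma flow_low_set: "v \<in> low_set ==> flow n v \<in> low_set"
 by (induction n) (simp_all add: flow_Suc descent_low_set flow_time_pos less_imp_le, simp add: flow_def)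

lemma J_flow_Suc: "v \<in> low_set ==> J f (flow (Suc n) v) <= J f (flow n v)"
 using descent_low_set(2)[OF flow_low_set] flow_time_pos by (simp add: flow_Suc)

lemma flow_tendsto:
 assumes "!!k. v k \<in> low_set" "w \<in> low_set" "(%k. Hdist (v k) w) ---> 0"
 shows "(%k. Hdist (flow n (v k)) (flow n w)) ---> 0"
proof (induction n)
 case (Suc n)
 show ?case unfolding flow_Suc by (intro descent_step_tendsto f_small low_setD flow_low_set assms Suc tendsto_const)
qed (simp add: flow_def assms)

definition low_critical :: "'n fn => bool" where
 "low_critical v \<longleftrightarrow> v \<in> Sigma & stationary f (nehari f v) & J f v < I f u + gs_energy"

lemma low_set_palais_smale:
 assumes v: "!!n. v n \<in> low_set" and J: "(%n. J f (v n)) ---> c" "(%n. J f (descent_step f flow_time (v n))) ---> c"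
 obtains phi w where "strict_mono (phi :: nat => nat)" "low_critical w" "(%n. Hdist (v (phi n)) w) ---> 0" "J f w = c"
proof -
 have "c <= path_level" using J(1) by (rule LIMSEQ_le_const2) (use low_setD(2)[OF v] in blast)
 hence c: "c < I f u + gs_energy" using path_level_less by simp
 have low: "c < I f u' + gs_energy" if "u' \<in> H" "stationary f u'" for u' using lowest[OF that] c by simp
 obtain phi w where w: "strict_mono (phi :: nat => nat)" "w \<in> Sigma" "(%n. Hdist (v (phi n)) w) ---> 0" "stationary f (nehari f w)" "J f w = c"
  by (rule palais_smale_of_descent[OF f_small low_setD(1)[OF v] tmax_low_set[OF v] flow_time_pos _ J low])
   (auto simp: flow_time_def)
 show thesis by (rule that[OF w(1) _ w(3,5)]) (use w c in \<open>simp add: low_critical_def\<close>)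
qed

lemma flow_limit:
 assumes v: "v \<in> low_set"
 obtains w where "low_critical w" "(%n. J f (flow n v)) ---> J f w"
proof -
 have "decseq (%n. J f (flow n v))" using J_flow_Suc[OF v] by (simp add: decseq_Suc_iff)
 moreover have "0 <= J f (flow n v)" for n using J_eq(4)[OF f_small low_setD(1)[OF flow_low_set[OF v]]] by (simp add: less_imp_le)
 ultimately obtain c where c: "(%n. J f (flow n v)) ---> c" using decseq_convergent[of "%n. J f (flow n v)" 0] by blast
 obtain w where "low_critical w" "J f w = c"
  by (rule low_set_palais_smale[OF flow_low_set[OF v] c LIMSEQ_Suc[OF c, unfolded flow_Suc]]) blast
 thus thesis using that c by blast
qed

lemma low_critical_AE_cong:
 assumes "low_critical v" "low_critical w" "AE x in L. v x = w x"
 shows "Hdist v w = 0" "J f v = J f w"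
proof -
 have vw: "v \<in> Sigma" "w \<in> Sigma" using assms by (auto simp: low_critical_def)
 have "AE x in L. v x - w x = 0" using assms(3) by eventually_elim simp
 thus d: "Hdist v w = 0" using Hnorm_eq_0_iff[OF H_diff[OF Sigma_plusD(1)[OF vw(1)] Sigma_plusD(1)[OF vw(2)]]] by blast
 have "(%n::nat. J f v) ---> J f w" by (rule tmax_tendsto(2)[OF f_small vw]) (simp add: d)
 thus "J f v = J f w" by (simp add: LIMSEQ_const_iff)
qed

lemma near_unique_minimizer:
 assumes w: "low_critical w" "!!v. v \<in> low_set ==> J f w <= J f v" and eta: "eta > 0"
  and unique: "!!w'. low_critical w' ==> J f w' = J f w ==> AE x in L. w' x = w x"
 obtains eps where "eps > 0" "!!v. v \<in> low_set ==> J f v < J f w + eps ==> Hdist v w < eta"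
proof (rule ccontr)
 assume no: "~ thesis"
 have "\<exists>v. v \<in> low_set & J f v < J f w + inverse (real (Suc n)) & eta <= Hdist v w" for n
  by (rule ccontr, rule notE[OF no], rule that[of "inverse (real (Suc n))"]) (auto simp: not_le)
 then obtain v where v: "!!n. v n \<in> low_set" "!!n. J f (v n) < J f w + inverse (real (Suc n))" "!!n. eta <= Hdist (v n) w" by metis
 have upper: "(%n. J f w + inverse (real (Suc n))) ---> J f w" using tendsto_add[OF tendsto_const LIMSEQ_inverse_real_of_nat, of "J f w"] by simp
 have J: "(%n. J f (v n)) ---> J f w" by (rule tendsto_sandwich[OF _ _ tendsto_const upper]) (use w(2)[OF v(1)] less_imp_le[OF v(2)] in simp_all)
 have J': "(%n. J f (descent_step f flow_time (v n))) ---> J f w"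
  by (rule tendsto_sandwich[OF _ _ tendsto_const J]) (use w(2) descent_low_set v(1) flow_time_pos in \<open>simp_all add: less_imp_le\<close>)
 obtain phi w' where w': "low_critical w'" "(%n. Hdist (v (phi n)) w') ---> 0" "J f w' = J f w" by (rule low_set_palais_smale[OF v(1) J J']) blast
 note eq = low_critical_AE_cong(1)[OF w'(1) w(1) unique[OF w'(1,3)]]
 have "eta <= Hdist (v (phi n)) w'" for n
  using v(3)[of "phi n"] Hnorm_diff_triangle[OF Sigma_plusD(1) Sigma_plusD(1) Sigma_plusD(1), of "v (phi n)" w' w] eq low_setD(1)[OF v(1)] w(1) w'(1)
  by (simp add: low_critical_def)
 hence "eta <= 0" by (intro LIMSEQ_le_const[OF w'(2)]) blast
 thus False using eta by simp
qed

lemma flow_uniformly_low: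
 assumes lim: "!!y. y \<in> sphere 0 R ==> (%n. J f (flow n (low_path y))) ---> m" and eps: "eps > 0"
 shows "\<exists>n. \<forall>y\<in>sphere 0 R. J f (flow n (low_path y)) < m + eps"
proof (rule decreasing_continuous_less_uniformly[OF compact_sphere])
 show "continuous_on (sphere 0 R) (%y. J f (flow n (low_path y)))" for n
  unfolding continuous_on_sequentially o_def
  by (auto intro!: tmax_tendsto(2)[OF f_small] low_setD flow_low_set low_path_low_set flow_tendsto low_path_tendsto)
 show "J f (flow (Suc n) (low_path y)) <= J f (flow n (low_path y))" if "y \<in> sphere 0 R" for n y
  by (rule J_flow_Suc[OF low_path_low_set[OF that]])
 show "\<exists>n. J f (flow n (low_path y)) < m + eps" if "y \<in> sphere 0 R" for y
  using order_tendstoD(2)[OF lim[OF that], of "m + eps"] eps by (auto simp: eventually_sequentially)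
qed

lemma barycentre_tendsto:
 assumes v: "!!n. v n \<in> Sigma" "w \<in> Sigma" and lim: "(%n. Hdist (v n) w) ---> 0" shows "(%n. barycentre (v n)) ---> barycentre w"
proof (rule LIM_zero_cancel[OF Lim_null_comparison])
 show "\<forall>\<^sub>F n in sequentially. norm (barycentre (v n) - barycentre w) <= Hdist (v n) w*2"
  using barycentre_lipschitz[OF Sigma_plusD(1)[OF v(1)] Sigma_plusD(1)[OF v(2)]] by (simp add: Sigma_plusD(2)[OF v(1)] Sigma_plusD(2)[OF v(2)])
 show "(%n. Hdist (v n) w*2) ---> 0" by (rule tendsto_mult_left_zero[OF lim])
qed

abbreviation flow_step :: "nat => real \<times> (real^'n) => 'n fn" where
 "flow_step n z \<equiv> descent_step f (fst z*flow_time) (flow n (low_path (snd z)))"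

lemma barycentre_step_continuous:
 "continuous_on ({0..1} \<times> sphere 0 R) (%z. barycentre (flow_step n z))"
 unfolding continuous_on_sequentially o_def
proof (intro allI ballI impI, elim conjE)
 fix z and l :: "real \<times> (real^'n)" assume z: "\<forall>k. z k \<in> {0..1} \<times> sphere 0 R" "z ---> l" and l: "l \<in> {0..1} \<times> sphere 0 R"
 have K: "snd (z k) \<in> sphere 0 R" "snd l \<in> sphere 0 R" for k using z(1) l by (auto simp: mem_Times_iff)
 have A: "flow_step n y \<in> low_set" if "y \<in> {0..1} \<times> sphere 0 R" for y
  using that flow_time_pos by (intro descent_low_set flow_low_set low_path_low_set) (auto simp: mult_left_le_one_le)
 show "(%k. barycentre (flow_step n (z k))) ---> barycentre (flow_step n l)"
 proof (rule barycentre_tendsto)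
  show "(%k. Hdist (flow_step n (z k)) (flow_step n l)) ---> 0"
   by (intro descent_step_tendsto f_small low_setD flow_low_set low_path_low_set K flow_tendsto low_path_tendsto tendsto_snd tendsto_mult tendsto_fst tendsto_const z(2))
 qed (use A z(1) l low_setD in auto)
qed

lemma barycentre_flow_homotopic_Suc:
 "homotopic_with_canon (%_. True) (sphere 0 R) (- {0}) (%y. barycentre (flow n (low_path y))) (%y. barycentre (flow (Suc n) (low_path y)))"
proof -
 let ?F = "%z :: real \<times> (real^'n). barycentre (flow_step n z)"
 have "?F z ~= 0" if "z \<in> {0..1} \<times> sphere 0 R" for z
  using that flow_time_pos by (intro low_setD descent_low_set flow_low_set low_path_low_set) (auto simp: mult_left_le_one_le)
 hence "continuous_map (prod_topology (top_of_set {0..1}) (top_of_set (sphere 0 R))) (top_of_set (- {0})) ?F"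
  unfolding prod_topology_subtopology_eu continuous_map_subtopology_eu using barycentre_step_continuous[of n] by (auto simp: mem_Times_iff)
 hence "homotopic_with_canon (%_. True) (sphere 0 R) (- {0}) (%y. ?F (0, y)) (%y. ?F (1, y))"
  unfolding homotopic_with_def by (intro exI[of _ ?F] conjI allI ballI refl TrueI)
 thus ?thesis by (rule homotopic_with_eq) (auto simp: flow_Suc descent_step_0 low_setD flow_low_set low_path_low_set)
qed

lemma barycentre_flow_homotopic_id:
 "homotopic_with_canon (%_. True) (sphere 0 R) (- {0}) id (%y. barycentre (flow n (low_path y)))"
proof (induction n)
 case 0
 show ?case
 proof (rule homotopic_nonzero[OF continuous_on_id'])
  show "continuous_on (sphere 0 R) (%y. barycentre (flow 0 (low_path y)))"
   using homotopic_with_imp_continuous[OF barycentre_flow_homotopic_Suc] by blast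
 qed (use R_pos low_path(3) in \<open>auto simp: flow_def\<close>)
next
 case (Suc n)
 show ?case by (rule homotopic_with_trans[OF Suc barycentre_flow_homotopic_Suc])
qed

lemma barycentre_flow_far: "\<exists>y\<in>sphere 0 R. norm c <= norm (barycentre (flow n (low_path y)) - c)"
proof (rule ccontr)
 let ?h = "homotopic_with_canon (%_. True) (sphere (0 :: real^'n) R) (- {0})" and ?b = "%y. barycentre (flow n (low_path y))"
 assume "~ ?thesis"
 hence "?h ?b (%_. c)"
  using homotopic_with_imp_continuous[OF barycentre_flow_homotopic_id, of n] by (intro homotopic_near_constant) (auto simp: not_le)
 hence "?h id (%_. c)" by (rule homotopic_with_trans[OF barycentre_flow_homotopic_id])
 thus False using sphere_map_not_nullhomotopic[OF R_pos] by blast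
qed

text \<open>If the critical point \<open>w\<close> were unique, the flow would contract the sphere of low paths to \<open>w\<close>, and the
  barycentres to a nonzero constant.\<close>
lemma two_critical_points: "\<exists>v1 v2. low_critical v1 & low_critical v2 & ~ (AE x in L. v1 x = v2 x)"
proof (rule ccontr)
 assume no: "~ ?thesis"
 obtain y0 :: "real^'n" where y0: "y0 \<in> sphere 0 R" using R_pos sphere_eq_empty[of "0 :: real^'n" R] by fastforce
 obtain w where w: "low_critical w" by (rule flow_limit[OF low_path_low_set[OF y0]])
 have level: "J f w' = J f w" if "low_critical w'" for w' using low_critical_AE_cong(2)[OF that w] no that w by blast
 have lim: "(%n. J f (flow n v)) ---> J f w" if v: "v \<in> low_set" for v
 proof -
  obtain w' where "low_critical w'" "(%n. J f (flow n v)) ---> J f w'" by (rule flow_limit[OF v])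
  thus ?thesis by (simp add: level)
 qed
 have minimal: "J f w <= J f v" if v: "v \<in> low_set" for v
  using decseq_ge[OF _ lim[OF v], of 0] J_flow_Suc[OF v] by (simp add: decseq_Suc_iff) (simp add: flow_def)
 have wS: "w \<in> Sigma" "barycentre w ~= 0" using w low_barycentre by (auto simp: low_critical_def)
 obtain eps where eps: "eps > 0" "!!v. v \<in> low_set ==> J f v < J f w + eps ==> Hdist v w < norm (barycentre w)/2"
  by (rule near_unique_minimizer[OF w minimal, of "norm (barycentre w)/2"]) (use no w wS(2) in auto)
 obtain n where n: "!!y. y \<in> sphere 0 R ==> J f (flow n (low_path y)) < J f w + eps"
  using flow_uniformly_low[OF lim[OF low_path_low_set] eps(1)] by blast
 obtain y where y: "y \<in> sphere 0 R" "norm (barycentre w) <= norm (barycentre (flow n (low_path y)) - barycentre w)"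
  using barycentre_flow_far by blast
 define v where "v = flow n (low_path y)"
 have v: "v \<in> low_set" using flow_low_set[OF low_path_low_set[OF y(1)]] by (simp add: v_def)
 have "norm (barycentre v - barycentre w) <= Hdist v w*2"
  using barycentre_lipschitz[of v w] Sigma_plusD[OF low_setD(1)[OF v]] Sigma_plusD[OF wS(1)] by simp
 also have "... < norm (barycentre w)" using eps(2)[OF v] n[OF y(1)] by (simp add: v_def)
 finally show False using y(2) by (simp add: v_def)
qed

end

context setting
begin

lemma critical_energy_ge:
 assumes f: "f \<in> Hdual" and u: "u \<in> H" "stationary f u"
 shows "(kappa*Hnorm u - p/(p + 1)*dual_norm f)*Hnorm u <= I f u"
proof -
 have "p/(p + 1)*f u <= p/(p + 1)*(dual_norm f*Hnorm u)" using dual_bound[OF f u(1)] p_gt_1 by (intro mult_left_mono) (auto simp: abs_le_iff)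
 thus ?thesis unfolding critical_energy(2)[OF f u] by (simp add: power2_eq_square left_diff_distrib mult.assoc)
qed

lemma critical_Hnorm_le:
 assumes f: "f \<in> Hdual" and u: "u \<in> H" "stationary f u" "I f u <= 0"
 shows "kappa*Hnorm u <= dual_norm f"
proof (cases "Hnorm u = 0")
 case False
 have "(kappa*Hnorm u - p/(p + 1)*dual_norm f)*Hnorm u <= 0" using critical_energy_ge[OF f u(1,2)] u(3) by linarith
 hence "kappa*Hnorm u <= p/(p + 1)*dual_norm f" using False Hnorm_nonneg[of u] by (simp add: mult_le_0_iff)
 also have "... <= 1*dual_norm f" using p_gt_1 dual_norm_nonneg[OF f] by (intro mult_right_mono) auto
 finally show ?thesis by simp
qed (simp add: dual_norm_nonneg[OF f])

lemma critical_energy_nonneg: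
 assumes f: "f \<in> Hdual" "dual_norm f <= kappa*Hnorm u" and u: "u \<in> H" "stationary f u"
 shows "0 <= I f u"
proof -
 have "p/(p + 1)*dual_norm f <= 1*dual_norm f" using p_gt_1 dual_norm_nonneg[OF f(1)] by (intro mult_right_mono) auto
 hence "0 <= (kappa*Hnorm u - p/(p + 1)*dual_norm f)*Hnorm u" using f(2) Hnorm_nonneg[of u] by (intro mult_nonneg_nonneg) auto
 thus ?thesis using critical_energy_ge[OF f(1) u] by linarith
qed

lemma critical_nonzero:
 assumes f: "f \<in> Hdual" "nonzero_dual s f" and u: "u \<in> H" "stationary f u"
 shows "Hnorm u > 0"
proof (rule ccontr)
 assume "~ ?thesis"
 hence z: "Hnorm u = 0" using Hnorm_nonneg[of u] by simp
 have "f h = 0" if "h \<in> H" for h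
  using u(2)[rule_format, OF that] Hinner_Cauchy_Schwarz[OF u(1) that] Bform_bound[OF a_coef u(1) that] p_gt_1 by (simp add: I_deriv_def z)
 thus False using f(2) by (auto simp: nonzero_dual_def)
qed

lemma critical_supersolution:
 assumes f: "nonneg_dual s f" and u: "stationary f u" and phi: "phi \<in> H" "!!x. phi x >= 0"
 shows "Hinner u phi >= 0"
proof -
 have "f phi >= 0" using f phi by (auto simp: nonneg_dual_def)
 moreover have "Bform a u phi >= 0" unfolding Bform_def using phi coefficientD(2)[OF a_coef] by simp
 ultimately show ?thesis using u[rule_format, OF phi(1)] by (simp add: I_deriv_def)
qed

lemma locmin_lowest:
 assumes f: "f \<in> Hdual" "dual_norm f <= kappa*r" and u: "u \<in> H" "I f u <= 0"
  and unique: "!!v. v \<in> H ==> Hnorm v < r ==> stationary f v ==> AE x in L. v x = u x"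
  and v: "v \<in> H" "stationary f v"
 shows "I f u <= I f v"
proof (cases "Hnorm v < r")
 case True
 show ?thesis using I_AE_cong[OF f(1) v(1) u(1) unique[OF v(1) True v(2)]] by simp
next
 case False
 hence "kappa*r <= kappa*Hnorm v" using kappa_pos by (intro mult_left_mono) auto
 hence "dual_norm f <= kappa*Hnorm v" using f(2) by linarith
 thus ?thesis using critical_energy_nonneg[OF f(1) _ v] u(2) by simp
qed

definition lowest_solution :: "real => ('n fn => real) => 'n fn => bool" where
 "lowest_solution d f u \<longleftrightarrow> small_dual f & nonneg_dual s f & dual_norm f <= d & u \<in> H & (\<forall>x. u x >= 0) & 0 < Hnorm u & Hnorm u <= d
  & stationary f u & I f u <= 0 & (\<forall>v\<in>H. stationary f v --> I f u <= I f v)"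

lemma perturbed_exists:
 obtains d where "d > 0" "!!f u. lowest_solution d f u ==> \<exists>R. perturbed s N2s p a gs f u R"
proof -
 obtain d1 where d1: "d1 > 0" "!!f u y. small_dual f ==> nonneg_dual s f ==> u \<in> H ==> (!!x. u x >= 0) ==> stationary f u ==> Hnorm u <= d1 ==>
   interaction u y > 0 ==> defect y <= interaction u y/2 ==> low_sum f u y"
  by (rule energy_estimate) blast
 obtain d2 where d2: "d2 > 0" "!!f v. small_dual f ==> dual_norm f <= d2 ==> v \<in> Sigma ==> J f v < gs_energy ==> barycentre v ~= 0"
  by (rule low_energy_barycentre) blast
 obtain d3 R3 where d3: "d3 > 0" "!!u y. u \<in> H ==> Hnorm u <= d3 ==> norm y >= R3 ==> y ~= 0 ==> Hnorm (add_gs u y) > 0 ==> barycentre (normalized (add_gs u y)) \<bullet> y > 0"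
  by (rule barycentre_direction) blast
 show thesis
 proof (rule that[of "min d1 (min d2 d3)"])
  fix f u assume sol: "lowest_solution (min d1 (min d2 d3)) f u"
  hence f: "small_dual f" "nonneg_dual s f" "dual_norm f <= min d1 (min d2 d3)" and u: "u \<in> H" "!!x. u x >= 0" "0 < Hnorm u" "Hnorm u <= min d1 (min d2 d3)"
   and crit: "stationary f u" "I f u <= 0" by (auto simp: lowest_solution_def)
  obtain eps where eps: "eps > 0" "AE x in L. u x >= eps * weight x"
   by (rule supersolution_lower_bound[OF u(1-3) critical_supersolution[OF f(2) crit(1)]])
  obtain R1 where R1: "!!y. norm y >= R1 ==> interaction u y > 0 & defect y <= interaction u y/2"
   by (rule interaction_dominates[OF u(1,2) eps(2,1)]) blast
  have "perturbed s N2s p a gs f u (max (max R1 R3) 1)"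
  proof unfold_locales
   show "barycentre v ~= 0" if "v \<in> Sigma" "J f v < I f u + gs_energy" for v using d2(2)[OF f(1) _ that(1)] that(2) f(3) crit(2) by simp
   fix y :: "real^'n" assume y: "norm y = max (max R1 R3) 1"
   hence R: "norm y >= R1" "norm y >= R3" "y ~= 0" by auto
   have "low_sum f u y"
    using R1[OF R(1)] u(4) by (intro d1(2) f u(1,2) crit) auto
   thus "low_sum f u y
     & barycentre (normalized (add_gs u y)) \<bullet> y > 0" using d3(2)[OF u(1) _ R(2,3)] u(4) by simp
  qed (use f u sol in \<open>auto simp: lowest_solution_def\<close>)
  thus "\<exists>R. perturbed s N2s p a gs f u R" by blast
 qed (use d1(1) d2(1) d3(1) in simp)
qed

abbreviation two_low_critical_points :: "('n fn => real) => 'n fn => bool" where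
 "two_low_critical_points f u \<equiv> \<exists>v1 v2. crit_Sigma s (J f) v1 & crit_Sigma s (J f) v2 & ~ (AE x in L. v1 x = v2 x) & J f v1 < I f u + gs_energy & J f v2 < I f u + gs_energy"

lemma perturbed_critical_points:
 assumes "perturbed s N2s p a gs f u R"
 shows "two_low_critical_points f u"
proof -
 interpret P: perturbed s N2s n_type p a gs f u R by (rule assms)
 obtain v1 v2 where "P.low_critical v1" "P.low_critical v2" "~ (AE x in L. v1 x = v2 x)" using P.two_critical_points by blast
 thus ?thesis using crit_SigmaI[OF P.f_small] by (intro exI[of _ v1] exI[of _ v2]) (simp add: P.low_critical_def)
qed

definition locmin :: "real => ('n fn => real) => 'n fn => bool" where
 "locmin r f u \<longleftrightarrow> u \<in> Hball s r & crit_Hs s (I f) u & (\<forall>v\<in>Hball s r. crit_Hs s (I f) v --> (AE x in L. v x = u x))"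

lemma two_critical_points_of_locmin:
 assumes r: "r > 0"
 obtains d where "d > 0" "!!f u. f \<in> Hdual ==> nonneg_dual s f ==> nonzero_dual s f ==> dual_norm f <= d ==> strictly_convex_on_Hs s (Hball s r) (I f) ==> locmin r f u ==>
   two_low_critical_points f u"
proof -
 obtain d0 where d0: "d0 > 0" "!!f u. lowest_solution d0 f u ==> \<exists>R. perturbed s N2s p a gs f u R"
  by (rule perturbed_exists) blast
 define d where "d = min (min dual_max d0) (min (kappa*r) (kappa*d0))"
 show thesis
 proof (rule that[of d])
  show "d > 0" using dual_max_pos kappa_pos r d0(1) by (simp add: d_def)
  fix f u assume f: "f \<in> Hdual" "nonneg_dual s f" "nonzero_dual s f" "dual_norm f <= d" and conv: "strictly_convex_on_Hs s (Hball s r) (I f)"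
   and u: "locmin r f u"
  note crit_iff = crit_Hs_iff[OF a_coef f(1)]
  have small: "small_dual f" "dual_norm f <= d0" "dual_norm f <= kappa*r" "dual_norm f <= kappa*d0" using f(1,4) by (auto simp: small_dual_def d_def)
  have crit: "u \<in> H" "stationary f u" using u crit_iff by (auto simp: locmin_def)
  have I0: "I f u <= 0" using u by (intro locmin_energy[OF f(1) _ _ r conv]) (auto simp: locmin_def)
  note pos = critical_pos_part[OF f(1) crit(1) critical_nonneg[OF f(1,2) crit]]
  have "kappa*Hnorm u <= kappa*d0" using critical_Hnorm_le[OF f(1) crit I0] small(4) by linarith
  hence le: "Hnorm u <= d0" using kappa_pos by simp
  have "I f u <= I f v" if "v \<in> H" "stationary f v" for v
   using u crit_iff by (intro locmin_lowest[OF f(1) small(3) crit(1) I0 _ that]) (auto simp: Hball_def locmin_def)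
  hence "lowest_solution d0 f (pos_part u)"
   using pos crit(2) le I0 critical_nonzero[OF f(1,3) crit] f(2) small H_pos_part[OF crit(1)] by (simp add: lowest_solution_def)
  from d0(2)[OF this] show "two_low_critical_points f u"
   using perturbed_critical_points unfolding pos(2)[symmetric] by blast
 qed
qed

lemma multiplicity:
 assumes r: "r > 0" and d: "d > 0"
  and ex: "\<forall>f\<in>Hdual. nonneg_dual s f & nonzero_dual s f & dual_norm f <= d -->
    strictly_convex_on_Hs s (Hball s r) (I f) & (\<exists>u\<in>Hball s r. crit_Hs s (I f) u & (\<forall>v\<in>Hball s r. crit_Hs s (I f) v --> (AE x in L. v x = u x)))"
 shows "\<exists>d'. 0 < d' & d' <= d & (\<forall>f\<in>Hdual. nonneg_dual s f & nonzero_dual s f & dual_norm f <= d' -->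
    (\<forall>u\<in>Hball s r. crit_Hs s (I f) u --> two_low_critical_points f u))"
proof -
 obtain e where e: "e > 0" "!!f u. f \<in> Hdual ==> nonneg_dual s f ==> nonzero_dual s f ==> dual_norm f <= e ==> strictly_convex_on_Hs s (Hball s r) (I f) ==> locmin r f u ==>
   two_low_critical_points f u"
  by (rule two_critical_points_of_locmin[OF r]) blast
 show ?thesis
 proof (intro exI[of _ "min d e"] conjI ballI impI)
  fix f u assume f: "f \<in> Hdual" "nonneg_dual s f & nonzero_dual s f & dual_norm f <= min d e" and u: "u \<in> Hball s r" "crit_Hs s (I f) u"
  obtain u0 where conv: "strictly_convex_on_Hs s (Hball s r) (I f)"
   and u0: "!!v. v \<in> Hball s r ==> crit_Hs s (I f) v ==> AE x in L. v x = u0 x" using ex[rule_format, OF f(1)] f(2) by auto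
  have "AE x in L. v x = u x" if "v \<in> Hball s r" "crit_Hs s (I f) v" for v using u0[OF that] u0[OF u] by eventually_elim simp
  hence "locmin r f u" using u by (simp add: locmin_def)
  thus "two_low_critical_points f u"
   using f by (intro e(2) conv) auto
 qed (use d e(1) in auto)
qed

end

lemma (in frac_sobolev) decay_le_weight_powr:
 assumes mu: "0 <= q" "q <= mu" and C: "C >= 0" and x: "t <= C/(1 + norm x powr (mu*N2s))"
 shows "t <= C*2 powr (mu*N2s)*weight x powr q"
proof -
 define M where "M = mu*N2s"
 have M: "N2s*q <= M" "0 <= M" using mult_left_mono[OF mu(2), of N2s] mu N2s_pos by (auto simp: M_def mult.commute)
 have "(1 + norm x) powr M <= 2 powr M*(1 + norm x powr M)" using powr_add_le[of 1 "norm x" M] M by simp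
 hence "1/(1 + norm x powr M) <= 2 powr M*(1 + norm x) powr - M"
  by (simp add: powr_minus divide_simps add_pos_nonneg add_nonneg_eq_0_iff mult.commute)
 also have "... <= 2 powr M*weight x powr q" unfolding weight_def powr_powr using M by (intro mult_left_mono powr_mono) auto
 finally have "C*(1/(1 + norm x powr M)) <= C*(2 powr M*weight x powr q)" using C by (intro mult_left_mono) auto
 thus ?thesis using x by (simp add: M_def mult.assoc)
qed

lemma not_AE_of_emeasure_pos:
 assumes "{x \<in> space M. ~ P x} \<in> sets M" "emeasure M {x \<in> space M. ~ P x} > 0" shows "~ (AE x in M. P x)"
 using assms AE_iff_measurable[OF assms(1) refl] by simp

theorem theorem4p17:
  fixes s p C \<mu> r1 d1 :: real and a :: "real ^ 'n::finite \<Rightarrow> real" and wstar :: "real ^ 'n \<Rightarrow> real"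
  assumes s: "0 < s" "s < 1"
    and N: "real CARD('n) > 2 * s"
    and p: "1 < p" "p < (real CARD('n) + 2 * s) / (real CARD('n) - 2 * s)"
    and a_meas: "a \<in> borel_measurable lborel"
    and a_range: "\<forall>x. 0 < a x \<and> a x \<le> 1"
    and a_inf: "\<exists>c>0. \<forall>x. c \<le> a x"
    and a_ne1: "emeasure lborel {x. a x \<noteq> 1} > 0"
    and a_lim: "(a \<longlongrightarrow> 1) at_infinity"
    and C: "C > 0"
    and mu: "\<mu> > p + 1 + real CARD('n) / (real CARD('n) + 2 * s)"
    and decay: "\<forall>x. 1 - a x \<le> C / (1 + norm x powr (\<mu> * (real CARD('n) + 2 * s)))"
    and r1: "r1 > 0" and d1: "d1 > 0"
    and locmin: "\<forall>f\<in>Hneg s. nonneg_dual s f \<and> nonzero_dual s f \<and> Hneg_norm s f \<le> d1 \<longrightarrow>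
        strictly_convex_on_Hs s (Hball s r1) (Ifun s p a f) \<and>
        (\<exists>u\<in>Hball s r1. crit_Hs s (Ifun s p a f) u \<and>
           (\<forall>v\<in>Hball s r1. crit_Hs s (Ifun s p a f) v \<longrightarrow> (AE x in lborel. v x = u x)))"
    and w: "ground_state s p wstar"
  shows "\<exists>d5. 0 < d5 \<and> d5 \<le> d1 \<and>
     (\<forall>f\<in>Hneg s. nonneg_dual s f \<and> nonzero_dual s f \<and> Hneg_norm s f \<le> d5 \<longrightarrow>
        (\<forall>u\<in>Hball s r1. crit_Hs s (Ifun s p a f) u \<longrightarrow>
           (\<exists>v1 v2. crit_Sigma s (Jfun s p a f) v1 \<and> crit_Sigma s (Jfun s p a f) v2 \<and>
              \<not> (AE x in lborel. v1 x = v2 x) \<and>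
              Jfun s p a f v1 < Ifun s p a f u + Ifun s p (\<lambda>_. 1) (\<lambda>_. 0) wstar \<and>
              Jfun s p a f v2 < Ifun s p a f u + Ifun s p (\<lambda>_. 1) (\<lambda>_. 0) wstar)))"
proof -
  define N2s where "N2s = real CARD('n) + 2 * s"
  interpret nonlinear s N2s "TYPE('n)" p using s N p by unfold_locales (auto simp: N2s_def)
  have "coefficient a" using a_meas a_range by (auto simp: coefficient_def measurable_lborel1 less_imp_le)
  moreover have "p + 1 + 0 < \<mu>" by (rule order.strict_trans1[OF add_left_mono mu]) (use s in simp)
  then have "(p + 1) / 2 \<le> \<mu>" using p(1) by (simp add: field_simps)
  then have "1 - a x \<le> C * 2 powr (\<mu> * N2s) * weight x powr ((p + 1)/2)" for x
    using decay p C by (intro decay_le_weight_powr) (auto simp: N2s_def)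
  moreover have "\<not> (AE x in lborel. a x = 1)" using a_meas a_ne1 by (intro not_AE_of_emeasure_pos) auto
  ultimately interpret setting s N2s "TYPE('n)" p a wstar using a_inf w by unfold_locales auto
  show ?thesis by (rule multiplicity[OF r1 d1 locmin])
qed

end
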